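(* Let $M$ be a (super)manifold endowed with an affine flat structure $\mathcal{T}^f_M\subset\mathcal{T}_M$, with associated flat connection $\nabla_0$. Let $A$ be a solution to the oriented associativity equations on $M$ with flat identity $e$. Define $B:=j(\nabla_0A)$ and put $h=e$. Then $B$ is a solution to the commutativity equations for $(M,\mathcal{T}^f_M)$ with primitive vector $h$. The map $t\mapsto B(t)e$ establishes a local embedding of $M$ into a fiber of the local system $\mathcal{T}^f_M$ such that the tautological flat affine structure on the fiber induces the initial affine structure on $M$.
   Context: $M$ is a (super)manifold in one of the standard categories ($C^\infty$, analytic, formal). **Affine flat structure.** A subsheaf $\mathcal{T}^f_M\subset\mathcal{T}_M$ of flat vector fields which is a local system of linear spaces and of abelian Lie superalgebras (for the supercommutator) with $\mathcal{T}_M=\mathcal{O}_M\otimes\mathcal{T}_M^f$ (tensor product over constants). $\nabla_0:\mathcal{T}_M\to\Omega^1_M\otimes_{\mathcal{O}_M}\mathcal{T}_M$ is the connection with $\nabla_0(g\otimes s)=dg\otimes s$ for $g\in\mathcal{O}_M$, $s\in\mathcal{T}_M^f$. Equivalently, $M$ has an atlas with affine linear transition functions; its local coordinates $(t^i)$ are called flat, and $\mathcal{T}_M^f$ is locally spanned by $\partial_i=\partial/\partial t^i$. **Oriented associativity equations.** A solution is an even vector field $A$ on $M$ such that, writing $A=\sum_cA^c\partial_c$ in local flat coordinates and $A_{ab}{}^c:=\partial_a\partial_bA^c$, the law $\partial_a\circ\partial_b=\sum_cA_{ab}{}^c\partial_c$ extends to an associative (super)commutative $\mathcal{O}_M$-bilinear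 multiplication on $\mathcal{T}_M$. An even flat vector field $e=\partial_0$ (contained among the $\partial_i$) is a flat identity for $A$ if $A_{a0}{}^c=\delta_a^c$, i.e. $e\circ X=X$ for every vector field $X$. **The map $j$.** $j:\Omega^1_M\otimes_{\mathcal{O}_M}\mathcal{T}_M\to End_{\mathcal{O}_M}(\mathcal{T}_M)$ is the standard isomorphism: $j(dt^b\otimes\partial_c)$ maps $\partial_a$ to $\delta_a^b\partial_c$. Thus $B=j(\nabla_0A)$ has matrix $B_b{}^c=(-1)^{(|t^b|+1)(|t^b|+|t^c|)}\partial_bA^c$, with $B(\partial_b)=\sum_cB_b{}^c\partial_c$, where $|t^b|$ is the parity of $t^b$. **Commutativity equations.** For a local system $F$ of finite-dimensional vector (super)spaces on $M$, extend the flat connection $\nabla_0$ (with $\operatorname{Ker}\nabla_0=F$ on $\mathcal{O}_M\otimes F$) to $\mathcal{O}_M\otimes End\,F$. An even section $B$ of $\mathcal{O}_M\otimes End\,F$ is a solution to the commutativity equations for $(M,F)$ if $\nabla_0B\wedge\nabla_0B=0$; in a basis of flat sections this says that all $\partial B/\partial t^i$ pairwise supercommute. **Primitive vector.** An even (flat) section $h\in\Gamma(M,F)$ is primitive for $B$ if, over open $U\subset M$ where $F|_U=F_0\times U$ is trivialized ($F_0$ a fiber, viewed as a (super)manifold with linear structure), the map $U\to F_0$, $t\mapsto B(t)h$, is a local isomorphism everywhere.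
   Formalization: B=j(∇_0A) is taken as the contraction B(∂_b)=Σ_c(∂_bA^c)∂_c, i.e. the signed entries B_b^c stand to the right of ∂_c; with them as left coefficients the commutativity equations can fail on supermanifolds. For purely even M nothing changes. *)

theory Defs
  imports "HOL-Analysis.Analysis" "HOL-Algebra.AbelCoset" "HOL-Algebra.RingHom" "HOL-Algebra.Module"
begin

section \<open>Superspaces\<close>

text \<open>
  A superspace is a topological space with a sheaf of supercommutative algebras over the ground
  field.  Parities are booleans (\<open>True\<close> is odd), so the sum of two parities is \<open>a \<noteq> b\<close> and the
  Koszul sign of \<open>a\<close> and \<open>b\<close> is \<open>-1\<close> iff \<open>a \<and> b\<close>.  The algebra structure is given by the maps
  \<open>scalar X U\<close> from the ground field to the even sections; \<open>restr X U V\<close> restricts from \<open>U\<close> to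
  \<open>V \<subseteq> U\<close>.  Only the values of the fields at open sets are relevant.
\<close>

record ('p, 's, 'k) superspace =
  points :: "'p topology"
  sections :: "'p set \<Rightarrow> 's ring"
  part :: "'p set \<Rightarrow> bool \<Rightarrow> 's set"
  scalar :: "'p set \<Rightarrow> 'k \<Rightarrow> 's"
  restr :: "'p set \<Rightarrow> 'p set \<Rightarrow> 's \<Rightarrow> 's"

definition ksign :: "('a, 'b) ring_scheme \<Rightarrow> bool \<Rightarrow> 'a \<Rightarrow> 'a" where
  "ksign R b x = (if b then \<ominus>\<^bsub>R\<^esub> x else x)"

definition opens :: "('p, 's, 'k) superspace \<Rightarrow> 'p set \<Rightarrow> 'p set set" where
  "opens X U = {V. openin (points X) V \<and> V \<subseteq> U}"

abbreviation whole :: "('p, 's, 'k) superspace \<Rightarrow> 'p set" where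
  "whole X \<equiv> topspace (points X)"

definition supercommutative_algebra ::
    "'s ring \<Rightarrow> (bool \<Rightarrow> 's set) \<Rightarrow> ('k::field \<Rightarrow> 's) \<Rightarrow> bool" where
  "supercommutative_algebra R P c \<longleftrightarrow>
     ring R \<and>
     (\<forall>a. additive_subgroup (P a) R) \<and>
     (\<forall>f\<in>carrier R. \<exists>!q. q \<in> P False \<times> P True \<and> f = fst q \<oplus>\<^bsub>R\<^esub> snd q) \<and>
     (\<forall>a b. \<forall>f\<in>P a. \<forall>g\<in>P b. f \<otimes>\<^bsub>R\<^esub> g \<in> P (a \<noteq> b) \<and> f \<otimes>\<^bsub>R\<^esub> g = ksign R (a \<and> b) (g \<otimes>\<^bsub>R\<^esub> f)) \<and>
     (\<forall>x. c x \<in> P False) \<and> c 1 = \<one>\<^bsub>R\<^esub> \<and>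
     (\<forall>x y. c (x + y) = c x \<oplus>\<^bsub>R\<^esub> c y \<and> c (x * y) = c x \<otimes>\<^bsub>R\<^esub> c y)"

definition ringed_superspace :: "('p, 's, 'k::field) superspace \<Rightarrow> bool" where
  "ringed_superspace X \<longleftrightarrow>
     (\<forall>U\<in>opens X (whole X). supercommutative_algebra (sections X U) (part X U) (scalar X U)) \<and>
     (\<forall>U\<in>opens X (whole X). \<forall>f\<in>carrier (sections X U). restr X U U f = f) \<and>
     (\<forall>U\<in>opens X (whole X). \<forall>V\<in>opens X U.
        restr X U V \<in> ring_hom (sections X U) (sections X V) \<and>
        (\<forall>a. restr X U V ` part X U a \<subseteq> part X V a) \<and>
        (\<forall>x. restr X U V (scalar X U x) = scalar X V x) \<and>
        (\<forall>W\<in>opens X V. \<forall>f\<in>carrier (sections X U). restr X V W (restr X U V f) = restr X U W f)) \<and>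
     (\<forall>\<U> s. \<U> \<subseteq> opens X (whole X) \<and>
        (\<forall>V\<in>\<U>. s V \<in> carrier (sections X V)) \<and>
        (\<forall>V\<in>\<U>. \<forall>W\<in>\<U>. restr X V (V \<inter> W) (s V) = restr X W (V \<inter> W) (s W)) \<longrightarrow>
        (\<exists>!f. f \<in> carrier (sections X (\<Union>\<U>)) \<and> (\<forall>V\<in>\<U>. restr X (\<Union>\<U>) V f = s V)))"

definition open_sub :: "('p, 's, 'k) superspace \<Rightarrow> 'p set \<Rightarrow> ('p, 's, 'k) superspace" where
  "open_sub X U = X\<lparr>points := subtopology (points X) U\<rparr>"

text \<open>
  A morphism \<open>\<phi>\<close> consists of the map of points \<open>fst \<phi>\<close> and the pullbacks
  \<open>snd \<phi> W\<close> of functions on the open sets \<open>W\<close> of the target.  Since every stalk of a supermanifold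
  has the ground field as its residue field, pullbacks are automatically local on stalks.
\<close>

type_synonym ('p, 's, 'q, 'u) smorph = "('p \<Rightarrow> 'q) \<times> ('q set \<Rightarrow> 'u \<Rightarrow> 's)"

definition preim ::
    "('p, 's, 'k) superspace \<Rightarrow> ('p, 's, 'q, 'u) smorph \<Rightarrow> 'q set \<Rightarrow> 'p set" where
  "preim X \<phi> W = {p \<in> whole X. fst \<phi> p \<in> W}"

definition is_morphism ::
    "('p, 's, 'k) superspace \<Rightarrow> ('q, 'u, 'k) superspace \<Rightarrow> ('p, 's, 'q, 'u) smorph \<Rightarrow> bool" where
  "is_morphism X Y \<phi> \<longleftrightarrow>
     continuous_map (points X) (points Y) (fst \<phi>) \<and>
     (\<forall>W\<in>opens Y (whole Y).
        snd \<phi> W \<in> ring_hom (sections Y W) (sections X (preim X \<phi> W)) \<and>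
        (\<forall>a. snd \<phi> W ` part Y W a \<subseteq> part X (preim X \<phi> W) a) \<and>
        (\<forall>x. snd \<phi> W (scalar Y W x) = scalar X (preim X \<phi> W) x) \<and>
        (\<forall>W'\<in>opens Y W. \<forall>g\<in>carrier (sections Y W).
           snd \<phi> W' (restr Y W W' g) = restr X (preim X \<phi> W) (preim X \<phi> W') (snd \<phi> W g)))"

definition is_iso ::
    "('p, 's, 'k) superspace \<Rightarrow> ('q, 'u, 'k) superspace \<Rightarrow> ('p, 's, 'q, 'u) smorph \<Rightarrow> bool" where
  "is_iso X Y \<phi> \<longleftrightarrow>
     is_morphism X Y \<phi> \<and> homeomorphic_map (points X) (points Y) (fst \<phi>) \<and>
     (\<forall>W\<in>opens Y (whole Y).
        bij_betw (snd \<phi> W) (carrier (sections Y W)) (carrier (sections X (preim X \<phi> W))))"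

definition restrict_mor ::
    "('p, 's, 'k) superspace \<Rightarrow> 'p set \<Rightarrow> ('p, 's, 'q, 'u) smorph \<Rightarrow> ('p, 's, 'q, 'u) smorph" where
  "restrict_mor X V \<phi> =
     (fst \<phi>, \<lambda>W g. restr X (preim X \<phi> W) (preim (open_sub X V) \<phi> W) (snd \<phi> W g))"

definition local_iso ::
    "('p, 's, 'k) superspace \<Rightarrow> ('q, 'u, 'k) superspace \<Rightarrow> ('p, 's, 'q, 'u) smorph \<Rightarrow> bool" where
  "local_iso X Y \<phi> \<longleftrightarrow> is_morphism X Y \<phi> \<and>
     (\<forall>p\<in>whole X. \<exists>V\<in>opens X (whole X). p \<in> V \<and>
        (\<exists>W\<in>opens Y (whole Y). is_iso (open_sub X V) (open_sub Y W) (restrict_mor X V \<phi>)))"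

text \<open>A chart on \<open>U\<close> identifies \<open>U\<close> with an open subspace of the model \<open>L\<close>.\<close>

definition is_chart ::
    "('q, 'u, 'k) superspace \<Rightarrow> ('p, 's, 'k) superspace \<Rightarrow> 'p set \<Rightarrow> 'q set
      \<Rightarrow> ('p, 's, 'q, 'u) smorph \<Rightarrow> bool" where
  "is_chart L X U W \<phi> \<longleftrightarrow> U \<in> opens X (whole X) \<and> W \<in> opens L (whole L) \<and>
     is_iso (open_sub X U) (open_sub L W) \<phi>"

definition supermanifold ::
    "('q, 'u, 'k::field) superspace \<Rightarrow> ('p, 's, 'k) superspace \<Rightarrow> bool" where
  "supermanifold L X \<longleftrightarrow>
     ringed_superspace X \<and> Hausdorff_space (points X) \<and> second_countable (points X) \<and>
     (\<forall>p\<in>whole X. \<exists>U W \<phi>. p \<in> U \<and> is_chart L X U W \<phi>)"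


section \<open>The affine superspaces of the standard categories\<close>

text \<open>
  The three categories share one type of functions on the affine superspace of dimension \<open>m|n\<close>
  (\<open>m = CARD('m)\<close>): a function \<open>F\<close> is recorded through its Taylor coefficients, \<open>F p \<alpha> I\<close> being the
  coefficient of \<open>(x - p)\<^sup>\<alpha> \<theta>\<^sub>I\<close> in the expansion of \<open>F\<close> at \<open>p\<close>, where
  \<open>\<theta>\<^sub>I = \<theta>\<^bsub>i1\<^esub> \<dots> \<theta>\<^bsub>ir\<^esub>\<close> for \<open>i1 < \<dots> < ir\<close>.  In the smooth and analytic categories the
  expansions at the various points are those of one function; in particular \<open>F\<close> is determined by
  its values \<open>F p 0\<close>.  In the formal category the point set is discrete and a function is an
  arbitrary formal power series at each point, so that a one-point open set is a formal polydisc.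
  Functions on \<open>V\<close> are extended by zero outside \<open>V\<close>.

  Up to isomorphism, the ground field \<open>'k\<close> is the real or the complex field: by the Gelfand-Mazur
  theorem there are no other complete normed fields over the reals.  Over the complex numbers,
  \<open>Smooth\<close> and \<open>Analytic\<close> both give holomorphic functions.
\<close>

datatype category = Smooth | Analytic | Formal

type_synonym ('k, 'm) sfun = "'k^'m \<Rightarrow> ('m \<Rightarrow> nat) \<Rightarrow> nat set \<Rightarrow> 'k"

definition taylor_smooth ::
    "('k::{real_normed_field,banach}^'m::finite) set \<Rightarrow> ('k^'m \<Rightarrow> ('m \<Rightarrow> nat) \<Rightarrow> 'k) \<Rightarrow> bool" where
  "taylor_smooth V f \<longleftrightarrow>
     (\<forall>\<alpha>. continuous_on V (\<lambda>p. f p \<alpha>)) \<and>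
     (\<forall>\<alpha>. \<forall>p\<in>V. \<forall>i. ((\<lambda>z. f (p + axis i z) \<alpha>) has_field_derivative
        of_nat (Suc (\<alpha> i)) * f p (\<alpha>(i := Suc (\<alpha> i)))) (at 0))"

definition taylor_convergent ::
    "('k::{real_normed_field,banach}^'m::finite) set \<Rightarrow> ('k^'m \<Rightarrow> ('m \<Rightarrow> nat) \<Rightarrow> 'k) \<Rightarrow> bool" where
  "taylor_convergent V f \<longleftrightarrow>
     (\<forall>p\<in>V. \<exists>r>0. \<forall>q\<in>ball p r.
        ((\<lambda>\<alpha>. f p \<alpha> * (\<Prod>i\<in>UNIV. (q $ i - p $ i) ^ \<alpha> i)) has_sum f q (\<lambda>_. 0)) UNIV)"

fun regular ::
    "category \<Rightarrow> ('k::{real_normed_field,banach}^'m::finite) set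
      \<Rightarrow> ('k^'m \<Rightarrow> ('m \<Rightarrow> nat) \<Rightarrow> 'k) \<Rightarrow> bool" where
  "regular Smooth V f = taylor_smooth V f"
| "regular Analytic V f = (taylor_smooth V f \<and> taylor_convergent V f)"
| "regular Formal V f = True"

definition sfuns ::
    "category \<Rightarrow> nat \<Rightarrow> ('k::{real_normed_field,banach}^'m::finite) set \<Rightarrow> ('k, 'm) sfun set" where
  "sfuns C n V = {F.
     (\<forall>p \<alpha> I. p \<notin> V \<or> \<not> I \<subseteq> {..<n} \<longrightarrow> F p \<alpha> I = 0) \<and>
     (\<forall>I. regular C V (\<lambda>p \<alpha>. F p \<alpha> I))}"

text \<open>\<open>\<theta>\<^sub>J \<theta>\<^sub>K = inversion_sign J K \<theta>\<^bsub>J \<union> K\<^esub>\<close> for disjoint \<open>J\<close> and \<open>K\<close>.\<close>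

definition inversion_sign :: "nat set \<Rightarrow> nat set \<Rightarrow> 'k::comm_ring_1" where
  "inversion_sign J K = (-1) ^ card {(j, k). j \<in> J \<and> k \<in> K \<and> k < j}"

definition sfun_mult :: "('k::comm_ring_1, 'm::finite) sfun \<Rightarrow> ('k, 'm) sfun \<Rightarrow> ('k, 'm) sfun" where
  "sfun_mult F G p \<alpha> I =
     (\<Sum>\<beta> | \<forall>i. \<beta> i \<le> \<alpha> i. \<Sum>J\<in>Pow I.
        inversion_sign J (I - J) * F p \<beta> J * G p (\<lambda>i. \<alpha> i - \<beta> i) (I - J))"

definition sfun_scalar :: "('k::zero^'m) set \<Rightarrow> 'k \<Rightarrow> ('k, 'm) sfun" where
  "sfun_scalar V x p \<alpha> I = (if p \<in> V \<and> \<alpha> = (\<lambda>_. 0) \<and> I = {} then x else 0)"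

definition affine_superspace ::
    "category \<Rightarrow> nat
      \<Rightarrow> ('k::{real_normed_field,banach}^'m::finite, ('k, 'm) sfun, 'k) superspace" where
  "affine_superspace C n =
     \<lparr> points = (if C = Formal then discrete_topology UNIV else euclidean),
       sections = (\<lambda>V. \<lparr> carrier = sfuns C n V, mult = sfun_mult, one = sfun_scalar V 1,
                          zero = (\<lambda>p \<alpha> I. 0), add = (\<lambda>F G p \<alpha> I. F p \<alpha> I + G p \<alpha> I) \<rparr>),
       part = (\<lambda>V a. {F \<in> sfuns C n V. \<forall>p \<alpha> I. F p \<alpha> I \<noteq> 0 \<longrightarrow> odd (card I) = a}),
       scalar = sfun_scalar,
       restr = (\<lambda>U V F p. if p \<in> V then F p else (\<lambda>\<alpha> I. 0)) \<rparr>"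

text \<open>
  The coordinates are indexed by \<open>Inl i\<close> (even, \<open>i :: 'm\<close>) and \<open>Inr j\<close> (odd, \<open>j < n\<close>).
\<close>

definition coords :: "nat \<Rightarrow> ('m + nat) set" where
  "coords n = UNIV <+> {..<n}"

definition odd_index :: "'m + nat \<Rightarrow> bool" where
  "odd_index i \<longleftrightarrow> \<not> isl i"

fun coord :: "'m + nat \<Rightarrow> ('k::comm_ring_1, 'm::finite) sfun" where
  "coord (Inl i) p \<alpha> I =
     (if I \<noteq> {} then 0 else if \<alpha> = (\<lambda>_. 0) then p $ i else if \<alpha> = (\<lambda>_. 0)(i := 1) then 1 else 0)"
| "coord (Inr j) p \<alpha> I = (if I = {j} \<and> \<alpha> = (\<lambda>_. 0) then 1 else 0)"

fun coord_deriv :: "'m + nat \<Rightarrow> ('k::comm_ring_1, 'm) sfun \<Rightarrow> ('k, 'm) sfun" where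
  "coord_deriv (Inl i) F p \<alpha> I = of_nat (Suc (\<alpha> i)) * F p (\<alpha>(i := Suc (\<alpha> i))) I"
| "coord_deriv (Inr j) F p \<alpha> I =
     (if j \<in> I then 0 else inversion_sign {j} I * F p \<alpha> (insert j I))"


section \<open>Vector fields\<close>

text \<open>
  A vector field on \<open>U\<close> is a derivation of the sheaf of functions on \<open>U\<close>, that is, a family of maps
  indexed by the open subsets of \<open>U\<close>; the family and its members are extensional, so that equality
  of vector fields is equality in the logic.
\<close>

type_synonym ('p, 's) vfield = "'p set \<Rightarrow> 's \<Rightarrow> 's"

definition derivation ::
    "('p, 's, 'k) superspace \<Rightarrow> 'p set \<Rightarrow> bool \<Rightarrow> ('p, 's) vfield set" where
  "derivation X U a = {D.
     D \<in> (\<Pi>\<^sub>E V\<in>opens X U. carrier (sections X V) \<rightarrow>\<^sub>E carrier (sections X V)) \<and>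
     (\<forall>V\<in>opens X U.
        (\<forall>f\<in>carrier (sections X V). \<forall>g\<in>carrier (sections X V).
           D V (f \<oplus>\<^bsub>sections X V\<^esub> g) = D V f \<oplus>\<^bsub>sections X V\<^esub> D V g) \<and>
        (\<forall>x. \<forall>f\<in>carrier (sections X V).
           D V (scalar X V x \<otimes>\<^bsub>sections X V\<^esub> f) = scalar X V x \<otimes>\<^bsub>sections X V\<^esub> D V f) \<and>
        (\<forall>b. \<forall>f\<in>part X V b. D V f \<in> part X V (a \<noteq> b) \<and>
           (\<forall>g\<in>carrier (sections X V).
              D V (f \<otimes>\<^bsub>sections X V\<^esub> g) =
                (D V f \<otimes>\<^bsub>sections X V\<^esub> g) \<oplus>\<^bsub>sections X V\<^esub>
                ksign (sections X V) (a \<and> b) (f \<otimes>\<^bsub>sections X V\<^esub> D V g))) \<and>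
        (\<forall>W\<in>opens X V. \<forall>f\<in>carrier (sections X V).
           D W (restr X V W f) = restr X V W (D V f)))}"

definition vadd ::
    "('p, 's, 'k) superspace \<Rightarrow> 'p set \<Rightarrow> ('p, 's) vfield \<Rightarrow> ('p, 's) vfield \<Rightarrow> ('p, 's) vfield" where
  "vadd X U D E =
     (\<lambda>V\<in>opens X U. \<lambda>f\<in>carrier (sections X V). D V f \<oplus>\<^bsub>sections X V\<^esub> E V f)"

text \<open>
  The module of all vector fields on \<open>U\<close> over the functions on \<open>U\<close>; the ring multiplication
  of the record is not used.
\<close>

definition tangent ::
    "('p, 's, 'k) superspace \<Rightarrow> 'p set \<Rightarrow> ('s, ('p, 's) vfield) module" where
  "tangent X U =
     \<lparr> carrier = {vadd X U D E | D E. D \<in> derivation X U False \<and> E \<in> derivation X U True},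
       mult = undefined, one = undefined,
       zero = (\<lambda>V\<in>opens X U. \<lambda>f\<in>carrier (sections X V). \<zero>\<^bsub>sections X V\<^esub>),
       add = vadd X U,
       smult = (\<lambda>g D. \<lambda>V\<in>opens X U. \<lambda>f\<in>carrier (sections X V).
                  restr X U V g \<otimes>\<^bsub>sections X V\<^esub> D V f) \<rparr>"

definition vrestr ::
    "('p, 's, 'k) superspace \<Rightarrow> 'p set \<Rightarrow> ('p, 's) vfield \<Rightarrow> ('p, 's) vfield" where
  "vrestr X V D = restrict D (opens X V)"

text \<open>The coefficients of linear combinations stand to the left: \<open>\<Sum>\<^sub>i f\<^sub>i d\<^sub>i\<close>.\<close>

definition lin_comb ::
    "('p, 's, 'k) superspace \<Rightarrow> nat \<Rightarrow> 'p set \<Rightarrow> ('m::finite + nat \<Rightarrow> 's)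
      \<Rightarrow> ('m + nat \<Rightarrow> ('p, 's) vfield) \<Rightarrow> ('p, 's) vfield" where
  "lin_comb X n V f d =
     (\<Oplus>\<^bsub>tangent X V\<^esub>i\<in>coords n. f i \<odot>\<^bsub>tangent X V\<^esub> vrestr X V (d i))"

definition locally_constant :: "('p, 's, 'k) superspace \<Rightarrow> 'p set \<Rightarrow> 's \<Rightarrow> bool" where
  "locally_constant X V f \<longleftrightarrow> f \<in> carrier (sections X V) \<and>
     (\<forall>p\<in>V. \<exists>W\<in>opens X V. p \<in> W \<and> (\<exists>x. restr X V W f = scalar X W x))"

text \<open>Vector fields that correspond to each other under a morphism.\<close>

definition related ::
    "('p, 's, 'k) superspace \<Rightarrow> ('q, 'u, 'k) superspace \<Rightarrow> ('p, 's, 'q, 'u) smorph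
      \<Rightarrow> ('p, 's) vfield \<Rightarrow> ('q, 'u) vfield \<Rightarrow> bool" where
  "related X Y \<phi> D E \<longleftrightarrow> (\<forall>W\<in>opens Y (whole Y). \<forall>g\<in>carrier (sections Y W).
     D (preim X \<phi> W) (snd \<phi> W g) = snd \<phi> W (E W g))"

definition coord_field ::
    "('k^'m, ('k, 'm) sfun, 'k) superspace \<Rightarrow> ('k::comm_ring_1^'m::finite) set \<Rightarrow> 'm + nat
      \<Rightarrow> ('k^'m, ('k, 'm) sfun) vfield" where
  "coord_field L W i = (\<lambda>W'\<in>opens L W. \<lambda>F\<in>carrier (sections L W'). coord_deriv i F)"


section \<open>Affine flat structures\<close>

text \<open>
  Throughout, \<open>L\<close> is the model superspace \<open>affine_superspace C n\<close>, \<open>X\<close> is a supermanifold modelled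
  on \<open>L\<close>, and \<open>T U\<close> is the set of flat vector fields on the open set \<open>U\<close>.

  A flat frame on \<open>U\<close> is a homogeneous basis \<open>d\<close> of the flat fields which is also a basis of all
  vector fields over the functions; equivalently, it is a trivialization of the local system over
  \<open>U\<close>.  Sections of the constant sheaf are the locally constant functions.
\<close>

definition flat_frame ::
    "nat \<Rightarrow> ('p, 's, 'k) superspace \<Rightarrow> ('p set \<Rightarrow> ('p, 's) vfield set) \<Rightarrow> 'p set
      \<Rightarrow> ('m::finite + nat \<Rightarrow> ('p, 's) vfield) \<Rightarrow> bool" where
  "flat_frame n X T U d \<longleftrightarrow>
     U \<in> opens X (whole X) \<and>
     (\<forall>i\<in>coords n. d i \<in> T U \<and> d i \<in> derivation X U (odd_index i)) \<and>
     (\<forall>V\<in>opens X U.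
        (\<forall>D\<in>carrier (tangent X V).
           \<exists>!f. f \<in> coords n \<rightarrow>\<^sub>E carrier (sections X V) \<and> D = lin_comb X n V f d) \<and>
        (\<forall>f\<in>coords n \<rightarrow> carrier (sections X V).
           lin_comb X n V f d \<in> T V \<longleftrightarrow> (\<forall>i\<in>coords n. locally_constant X V (f i))))"

text \<open>
  Local flat coordinates on \<open>U\<close>: a chart \<open>\<phi>\<close> whose coordinate vector fields \<open>d i = \<partial>/\<partial>t\<^sup>i\<close>
  form a flat frame, where \<open>t\<^sup>i\<close> is the pullback of the \<open>i\<close>-th coordinate of \<open>L\<close>.
\<close>

definition flat_coordinates ::
    "('k^'m, ('k, 'm) sfun, 'k::comm_ring_1) superspace \<Rightarrow> nat \<Rightarrow> ('p, 's, 'k) superspace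
      \<Rightarrow> ('p set \<Rightarrow> ('p, 's) vfield set) \<Rightarrow> 'p set
      \<Rightarrow> ('m::finite + nat \<Rightarrow> ('p, 's) vfield) \<Rightarrow> bool" where
  "flat_coordinates L n X T U d \<longleftrightarrow>
     flat_frame n X T U d \<and>
     (\<exists>W \<phi>. is_chart L X U W \<phi> \<and>
        (\<forall>i\<in>coords n. related (open_sub X U) (open_sub L W) \<phi> (d i) (coord_field L W i)))"

text \<open>
  The first clauses say that \<open>T\<close> is a subsheaf of graded linear subspaces and that it is abelian
  for the supercommutator.  The last clause says that \<open>X\<close> has an atlas of flat coordinates whose
  coordinate vector fields locally span \<open>T\<close>.  It contains the requirements that \<open>T\<close> be a local
  system and that the tangent sheaf be the tensor product of \<open>T\<close> with the functions over the
  constants.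
\<close>

definition affine_flat_structure ::
    "('k^'m::finite, ('k, 'm) sfun, 'k::comm_ring_1) superspace \<Rightarrow> nat \<Rightarrow> ('p, 's, 'k) superspace
      \<Rightarrow> ('p set \<Rightarrow> ('p, 's) vfield set) \<Rightarrow> bool" where
  "affine_flat_structure L n X T \<longleftrightarrow>
     (\<forall>U\<in>opens X (whole X).
        T U \<subseteq> carrier (tangent X U) \<and>
        \<zero>\<^bsub>tangent X U\<^esub> \<in> T U \<and>
        (\<forall>D\<in>T U. \<forall>E\<in>T U. D \<oplus>\<^bsub>tangent X U\<^esub> E \<in> T U) \<and>
        (\<forall>x. \<forall>D\<in>T U. scalar X U x \<odot>\<^bsub>tangent X U\<^esub> D \<in> T U) \<and>
        (\<forall>D\<in>T U. \<exists>D0\<in>T U \<inter> derivation X U False. \<exists>D1\<in>T U \<inter> derivation X U True.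
           D = D0 \<oplus>\<^bsub>tangent X U\<^esub> D1) \<and>
        (\<forall>D\<in>T U. \<forall>V\<in>opens X U. vrestr X V D \<in> T V) \<and>
        (\<forall>D\<in>carrier (tangent X U).
           (\<forall>p\<in>U. \<exists>V\<in>opens X U. p \<in> V \<and> vrestr X V D \<in> T V) \<longrightarrow> D \<in> T U) \<and>
        (\<forall>a b. \<forall>D\<in>T U \<inter> derivation X U a. \<forall>E\<in>T U \<inter> derivation X U b.
           \<forall>V\<in>opens X U. \<forall>f\<in>carrier (sections X V).
             D V (E V f) = ksign (sections X V) (a \<and> b) (E V (D V f)))) \<and>
     (\<forall>p\<in>whole X. \<exists>U d. p \<in> U \<and> flat_coordinates L n X T U d)"

text \<open>
  The connection \<open>\<nabla>\<^sub>0\<close> is given by the covariant derivatives \<open>nabla U D E\<close> of \<open>E\<close> along \<open>D\<close> over \<open>U\<close>,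
  the contraction of \<open>\<nabla>\<^sub>0 E\<close> with \<open>D\<close>.  It is determined by \<open>\<nabla>\<^sub>0 (g s) = dg \<otimes> s\<close> for flat \<open>s\<close>.
\<close>

type_synonym ('p, 's) connection =
  "'p set \<Rightarrow> ('p, 's) vfield \<Rightarrow> ('p, 's) vfield \<Rightarrow> ('p, 's) vfield"

definition flat_connection ::
    "('p, 's, 'k) superspace \<Rightarrow> ('p set \<Rightarrow> ('p, 's) vfield set) \<Rightarrow> ('p, 's) connection \<Rightarrow> bool" where
  "flat_connection X T nabla \<longleftrightarrow>
     (\<forall>U\<in>opens X (whole X). \<forall>D\<in>carrier (tangent X U).
        (\<forall>E\<in>carrier (tangent X U).
           nabla U D E \<in> carrier (tangent X U) \<and>
           (\<forall>E'\<in>carrier (tangent X U).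
              nabla U D (E \<oplus>\<^bsub>tangent X U\<^esub> E') = nabla U D E \<oplus>\<^bsub>tangent X U\<^esub> nabla U D E') \<and>
           (\<forall>V\<in>opens X U. vrestr X V (nabla U D E) = nabla V (vrestr X V D) (vrestr X V E))) \<and>
        (\<forall>g\<in>carrier (sections X U). \<forall>s\<in>T U.
           nabla U D (g \<odot>\<^bsub>tangent X U\<^esub> s) = D U g \<odot>\<^bsub>tangent X U\<^esub> s))"


section \<open>Oriented associativity equations\<close>

text \<open>
  \<open>circ\<close> is a bilinear multiplication on the tangent sheaf extending the law
  \<open>\<partial>\<^sub>a \<circ> \<partial>\<^sub>b = \<Sum>\<^sub>c (\<partial>\<^sub>a \<partial>\<^sub>b A\<^sup>c) \<partial>\<^sub>c\<close> in flat coordinates.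
\<close>

type_synonym ('p, 's) vmult =
  "'p set \<Rightarrow> ('p, 's) vfield \<Rightarrow> ('p, 's) vfield \<Rightarrow> ('p, 's) vfield"

definition bilinear_multiplication ::
    "('p, 's, 'k) superspace \<Rightarrow> ('p, 's) vmult \<Rightarrow> bool" where
  "bilinear_multiplication X circ \<longleftrightarrow>
     (\<forall>U\<in>opens X (whole X). \<forall>D\<in>carrier (tangent X U). \<forall>E\<in>carrier (tangent X U).
        circ U D E \<in> carrier (tangent X U) \<and>
        (\<forall>E'\<in>carrier (tangent X U).
           circ U (E \<oplus>\<^bsub>tangent X U\<^esub> E') D = circ U E D \<oplus>\<^bsub>tangent X U\<^esub> circ U E' D \<and>
           circ U D (E \<oplus>\<^bsub>tangent X U\<^esub> E') = circ U D E \<oplus>\<^bsub>tangent X U\<^esub> circ U D E') \<and>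
        (\<forall>f\<in>carrier (sections X U).
           circ U (f \<odot>\<^bsub>tangent X U\<^esub> D) E = f \<odot>\<^bsub>tangent X U\<^esub> circ U D E) \<and>
        (\<forall>a b. \<forall>f\<in>part X U b. D \<in> derivation X U a \<longrightarrow>
           circ U D (f \<odot>\<^bsub>tangent X U\<^esub> E) =
             ksign (tangent X U) (a \<and> b) (f \<odot>\<^bsub>tangent X U\<^esub> circ U D E)) \<and>
        (\<forall>V\<in>opens X U. vrestr X V (circ U D E) = circ V (vrestr X V D) (vrestr X V E)))"

definition potential_multiplication ::
    "('k^'m::finite, ('k, 'm) sfun, 'k::comm_ring_1) superspace \<Rightarrow> nat \<Rightarrow> ('p, 's, 'k) superspace
      \<Rightarrow> ('p set \<Rightarrow> ('p, 's) vfield set) \<Rightarrow> ('p, 's) vfield \<Rightarrow> ('p, 's) vmult \<Rightarrow> bool" where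
  "potential_multiplication L n X T A circ \<longleftrightarrow>
     bilinear_multiplication X circ \<and>
     (\<forall>U d f. flat_coordinates L n X T U d \<and>
        f \<in> coords n \<rightarrow> carrier (sections X U) \<and> vrestr X U A = lin_comb X n U f d \<longrightarrow>
        (\<forall>a\<in>coords n. \<forall>b\<in>coords n.
           circ U (d a) (d b) = lin_comb X n U (\<lambda>c. d a U (d b U (f c))) d))"

definition oriented_associativity ::
    "('k^'m::finite, ('k, 'm) sfun, 'k::comm_ring_1) superspace \<Rightarrow> nat \<Rightarrow> ('p, 's, 'k) superspace
      \<Rightarrow> ('p set \<Rightarrow> ('p, 's) vfield set) \<Rightarrow> ('p, 's) vfield \<Rightarrow> bool" where
  "oriented_associativity L n X T A \<longleftrightarrow>
     A \<in> derivation X (whole X) False \<and>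
     (\<exists>circ. potential_multiplication L n X T A circ \<and>
        (\<forall>U\<in>opens X (whole X). \<forall>D\<in>carrier (tangent X U). \<forall>E\<in>carrier (tangent X U).
           (\<forall>F\<in>carrier (tangent X U). circ U (circ U D E) F = circ U D (circ U E F)) \<and>
           (\<forall>a b. D \<in> derivation X U a \<and> E \<in> derivation X U b \<longrightarrow>
              circ U D E = ksign (tangent X U) (a \<and> b) (circ U E D))))"

definition flat_identity ::
    "('k^'m::finite, ('k, 'm) sfun, 'k::comm_ring_1) superspace \<Rightarrow> nat \<Rightarrow> ('p, 's, 'k) superspace
      \<Rightarrow> ('p set \<Rightarrow> ('p, 's) vfield set) \<Rightarrow> ('p, 's) vfield \<Rightarrow> ('p, 's) vfield \<Rightarrow> bool" where
  "flat_identity L n X T A e \<longleftrightarrow>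
     e \<in> T (whole X) \<and> e \<in> derivation X (whole X) False \<and>
     (\<exists>circ. potential_multiplication L n X T A circ \<and>
        (\<forall>U\<in>opens X (whole X). \<forall>D\<in>carrier (tangent X U). circ U (vrestr X U e) D = D))"


section \<open>Commutativity equations and primitive vectors\<close>

type_synonym ('p, 's) endo = "'p set \<Rightarrow> ('p, 's) vfield \<Rightarrow> ('p, 's) vfield"

text \<open>
  \<open>B = j (\<nabla>\<^sub>0 A)\<close> maps a vector field \<open>D\<close> to the contraction of \<open>\<nabla>\<^sub>0 A\<close> with \<open>D\<close>.  In flat
  coordinates, \<open>B \<partial>\<^sub>b = \<Sum>\<^sub>c (\<partial>\<^sub>b A\<^sup>c) \<partial>\<^sub>c = \<Sum>\<^sub>c \<partial>\<^sub>c B\<^sub>b\<^sup>c\<close> with the matrix entry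
  \<open>B\<^sub>b\<^sup>c = (-1)\<^bsup>(|b| + 1)(|b| + |c|)\<^esup> \<partial>\<^sub>b A\<^sup>c\<close> multiplying on the right: moving \<open>\<partial>\<^sub>b A\<^sup>c\<close>, of parity
  \<open>|b| + |c|\<close>, past \<open>\<partial>\<^sub>c\<close> gives the sign with exponent \<open>|c|(|b| + |c|) = (|b| + 1)(|b| + |c|)\<close>
  modulo 2.  The entries must not be used as left coefficients: with
  \<open>B \<partial>\<^sub>b = \<Sum>\<^sub>c B\<^sub>b\<^sup>c \<partial>\<^sub>c\<close> the derivatives of \<open>B\<close> need not supercommute once some odd
  function \<open>\<partial>\<^sub>a \<partial>\<^sub>b A\<^sup>c\<close> is nonzero.
\<close>

definition j_nabla :: "('p, 's, 'k) superspace \<Rightarrow> ('p, 's) connection \<Rightarrow> ('p, 's) vfield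
      \<Rightarrow> ('p, 's) endo" where
  "j_nabla X nabla A = (\<lambda>U D. nabla U D (vrestr X U A))"

text \<open>Even global sections of the sheaf of endomorphisms of the tangent sheaf.\<close>

definition even_endomorphism :: "('p, 's, 'k) superspace \<Rightarrow> ('p, 's) endo \<Rightarrow> bool" where
  "even_endomorphism X B \<longleftrightarrow>
     (\<forall>U\<in>opens X (whole X). \<forall>D\<in>carrier (tangent X U).
        B U D \<in> carrier (tangent X U) \<and>
        (\<forall>a. D \<in> derivation X U a \<longrightarrow> B U D \<in> derivation X U a) \<and>
        (\<forall>E\<in>carrier (tangent X U). B U (D \<oplus>\<^bsub>tangent X U\<^esub> E) = B U D \<oplus>\<^bsub>tangent X U\<^esub> B U E) \<and>
        (\<forall>f\<in>carrier (sections X U). B U (f \<odot>\<^bsub>tangent X U\<^esub> D) = f \<odot>\<^bsub>tangent X U\<^esub> B U D) \<and>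
        (\<forall>V\<in>opens X U. vrestr X V (B U D) = B V (vrestr X V D)))"

text \<open>
  The covariant derivative \<open>[\<nabla>\<^sub>D, B]\<close> of an even endomorphism; on a flat field \<open>E\<close> it is
  \<open>\<nabla>\<^sub>D (B E)\<close>, i.e. the coefficients of \<open>B\<close> in a flat basis are differentiated along \<open>D\<close>.
\<close>

definition endo_deriv ::
    "('p, 's, 'k) superspace \<Rightarrow> ('p, 's) connection \<Rightarrow> ('p, 's) endo \<Rightarrow> 'p set
      \<Rightarrow> ('p, 's) vfield \<Rightarrow> ('p, 's) vfield \<Rightarrow> ('p, 's) vfield" where
  "endo_deriv X nabla B U D E = nabla U D (B U E) \<ominus>\<^bsub>tangent X U\<^esub> B U (nabla U D E)"

text \<open>
  The equation \<open>\<nabla>\<^sub>0 B \<and> \<nabla>\<^sub>0 B = 0\<close>, evaluated on all pairs of homogeneous vector fields.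
\<close>

definition commutativity_solution ::
    "('p, 's, 'k) superspace \<Rightarrow> ('p, 's) connection \<Rightarrow> ('p, 's) endo \<Rightarrow> bool" where
  "commutativity_solution X nabla B \<longleftrightarrow>
     even_endomorphism X B \<and>
     (\<forall>U\<in>opens X (whole X). \<forall>a b. \<forall>D\<in>derivation X U a. \<forall>D'\<in>derivation X U b.
        \<forall>E\<in>carrier (tangent X U).
          endo_deriv X nabla B U D (endo_deriv X nabla B U D' E) =
          ksign (tangent X U) (a \<and> b) (endo_deriv X nabla B U D' (endo_deriv X nabla B U D E)))"

text \<open>
  A flat frame \<open>s\<close> on \<open>U\<close> identifies the fiber of \<open>T\<close> with the affine superspace \<open>L\<close>, the point
  with coordinates \<open>x\<^sup>c\<close> being \<open>\<Sum>\<^sub>c x\<^sup>c s\<^sub>c\<close>.  A section \<open>Z = \<Sum>\<^sub>c f\<^sup>c s\<^sub>c\<close> is then the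
  map from \<open>U\<close> to the fiber for which the pullback of \<open>x\<^sup>c\<close> is \<open>f\<^sup>c\<close>.
\<close>

definition section_map ::
    "('k^'m::finite, ('k, 'm) sfun, 'k::comm_ring_1) superspace \<Rightarrow> nat \<Rightarrow> ('p, 's, 'k) superspace
      \<Rightarrow> 'p set \<Rightarrow> ('m + nat \<Rightarrow> ('p, 's) vfield) \<Rightarrow> ('p, 's) vfield
      \<Rightarrow> ('p, 's, 'k^'m, ('k, 'm) sfun) smorph \<Rightarrow> bool" where
  "section_map L n X U s Z \<phi> \<longleftrightarrow>
     is_morphism (open_sub X U) L \<phi> \<and>
     Z = lin_comb X n U (\<lambda>c. snd \<phi> (whole L) (coord c)) s"

definition primitive_vector ::
    "('k^'m::finite, ('k, 'm) sfun, 'k::comm_ring_1) superspace \<Rightarrow> nat \<Rightarrow> ('p, 's, 'k) superspace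
      \<Rightarrow> ('p set \<Rightarrow> ('p, 's) vfield set) \<Rightarrow> ('p, 's) endo \<Rightarrow> ('p, 's) vfield \<Rightarrow> bool" where
  "primitive_vector L n X T B h \<longleftrightarrow>
     h \<in> T (whole X) \<and> h \<in> derivation X (whole X) False \<and>
     (\<forall>U s. flat_frame n X T U s \<longrightarrow>
        (\<exists>\<phi>. section_map L n X U s (B U (vrestr X U h)) \<phi> \<and> local_iso (open_sub X U) L \<phi>))"

text \<open>
  The tautological flat affine structure of the fiber: the locally constant vector fields.
\<close>

definition tautological_flat ::
    "('k^'m::finite, ('k, 'm) sfun, 'k::comm_ring_1) superspace \<Rightarrow> nat \<Rightarrow> ('k^'m) set
      \<Rightarrow> ('k^'m, ('k, 'm) sfun) vfield set" where
  "tautological_flat L n W =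
     {lin_comb L n W f (coord_field L W) | f. \<forall>i\<in>coords n. locally_constant L W (f i)}"

text \<open>The flat fields induced by a flat structure on \<open>Y\<close> through a local isomorphism \<open>\<phi>\<close>.\<close>

definition induced_flat ::
    "('p, 's, 'k) superspace \<Rightarrow> ('q, 'u, 'k) superspace \<Rightarrow> ('p, 's, 'q, 'u) smorph
      \<Rightarrow> ('q set \<Rightarrow> ('q, 'u) vfield set) \<Rightarrow> 'p set \<Rightarrow> ('p, 's) vfield set" where
  "induced_flat X Y \<phi> T V = {D \<in> carrier (tangent X V).
     \<forall>p\<in>V. \<exists>V'\<in>opens X V. p \<in> V' \<and> (\<exists>W\<in>opens Y (whole Y).
       is_iso (open_sub X V') (open_sub Y W) (restrict_mor X V' \<phi>) \<and>
       (\<exists>E\<in>T W. related (open_sub X V') (open_sub Y W) (restrict_mor X V' \<phi>) (vrestr X V' D) E))}"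

end

theory Submission
 imports Defs
begin

text \<open>
 Contracting with the multiplication gives \<open>[\<nabla>\<^sub>D, B] E = D \<circ> E\<close>, so the commutativity equations are the
 associativity and commutativity of \<open>\<circ>\<close>.  As \<open>e\<close> is flat, \<open>\<nabla>\<^sub>D (B e) = D\<close>: the coefficients \<open>y\<^sup>c\<close> of
 \<open>B e\<close> in a flat frame \<open>s\<close> satisfy \<open>s\<^sub>a y\<^sup>c = \<delta>\<^sub>a\<^sup>c\<close>.

 Therefore no inverse function theorem is needed: in flat coordinates the \<open>s\<^sub>a\<close> are constant combinations
 of the coordinate fields, so \<open>y\<close> is locally an affine isomorphism, and pulling back along it is a linear
 substitution in Taylor series.  A section \<open>G\<close> is determined by the values at all points of its
 iterated derivatives along the \<open>s\<^sub>a\<close>, which form a Taylor series of \<open>G\<close> at each point.  The pullback of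
 \<open>F\<close> is the section whose series at \<open>p\<close> is that of \<open>F\<close> at \<open>y(p)\<close>; it exists locally, by uniqueness the
 local solutions glue, and the properties of the morphism are read off from the series.
\<close>

section \<open>Formal superseries\<close>

text \<open>A morphism consists of a map of points and ring homomorphisms whose compatibility with
  values is not assumed, and a flat frame on \<open>U\<close> need not come from a chart. Values of
  sections are therefore read in a chosen chart, and the link to pullbacks is that a local character
  of the functions on the model space is an evaluation. This is why reciprocals of power series
  occur: a function that is nonzero at the point is locally invertible in each category, so a
  character that killed it would send 1 to 0. The geometric bounds on coefficients serve the
  analytic category, where derivatives, products, reciprocals and affine substitutions of convergent
  series have to be shown convergent again. Expanding along the fields \<open>s\<^sub>a\<close>
  instead of chart coordinates makes the series depend on the frame alone, so that gluing and
  multiplicativity need no comparison of charts. The price is a sign rule: the Leibniz formula needs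
  a homogeneous left factor, and general products are split by parity.\<close>

lemma inversion_sign_Un_left:
 assumes "finite J" "finite J'" "finite K" "J \<inter> J' = {}"
 shows "(inversion_sign (J \<union> J') K :: 'k::comm_ring_1) = inversion_sign J K * inversion_sign J' K"
proof -
 let ?A = "%J. {(j, k). j \<in> J \<and> k \<in> K \<and> k < j}"
 have fin: "finite (?A J)" if "finite J" for J
  by (rule finite_subset[of _ "J \<times> K"]) (use that assms in auto)
 have "?A (J \<union> J') = ?A J \<union> ?A J'" "?A J \<inter> ?A J' = {}" using assms(4) by auto
 then have "card (?A (J \<union> J')) = card (?A J) + card (?A J')"
  using fin assms by (simp add: card_Un_disjoint)
 then show ?thesis unfolding inversion_sign_def by (simp add: power_add)
qed

lemma inversion_sign_Un_right:
 assumes "finite K" "finite K'" "finite J" "K \<inter> K' = {}"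
 shows "(inversion_sign J (K \<union> K') :: 'k::comm_ring_1) = inversion_sign J K * inversion_sign J K'"
proof -
 let ?A = "%K. {(j, k). j \<in> J \<and> k \<in> K \<and> k < j}"
 have fin: "finite (?A K)" if "finite K" for K
  by (rule finite_subset[of _ "J \<times> K"]) (use that assms in auto)
 have "?A (K \<union> K') = ?A K \<union> ?A K'" "?A K \<inter> ?A K' = {}" using assms(4) by auto
 then have "card (?A (K \<union> K')) = card (?A K) + card (?A K')"
  using fin assms by (simp add: card_Un_disjoint)
 then show ?thesis unfolding inversion_sign_def by (simp add: power_add)
qed

lemma inversion_sign_square: "(inversion_sign J K :: 'k::comm_ring_1) * inversion_sign J K = 1"
 unfolding inversion_sign_def by (simp flip: power_add add: mult_2[symmetric] power_mult)

lemma inversion_sign_empty [simp]: "inversion_sign {} K = 1" "inversion_sign J {} = 1"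
 unfolding inversion_sign_def by simp_all

text \<open>Each element of \<open>J\<close> lies either below or above \<open>j\<close> and so
  contributes an inversion to exactly one of the two signs.\<close>

lemma inversion_sign_swap:
 assumes "finite J" "j \<notin> J"
 shows "(inversion_sign {j} J :: 'k::comm_ring_1) * inversion_sign J {j} = (-1) ^ card J"
proof -
 have "{(a, k). a \<in> {j} \<and> k \<in> J \<and> k < a} = Pair j ` {k\<in>J. k < j}"
  "{(a, k). a \<in> J \<and> k \<in> {j} \<and> k < a} = (%a. (a, j)) ` {k\<in>J. j < k}" by auto
 then have c: "card {(a, k). a \<in> {j} \<and> k \<in> J \<and> k < a} = card {k\<in>J. k < j}"
  "card {(a, k). a \<in> J \<and> k \<in> {j} \<and> k < a} = card {k\<in>J. j < k}"
  by (simp_all add: card_image inj_on_def)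
 have "J = {k\<in>J. k < j} \<union> {k\<in>J. j < k}" "{k\<in>J. k < j} \<inter> {k\<in>J. j < k} = {}"
  using assms(2) by (auto simp: not_less_iff_gr_or_eq)
 then have "card J = card {k\<in>J. k < j} + card {k\<in>J. j < k}"
  using card_Un_disjoint[of "{k\<in>J. k < j}" "{k\<in>J. j < k}"] assms(1) by simp
 then show ?thesis unfolding inversion_sign_def c by (simp add: power_add)
qed

text \<open>Derivatives and products of superfunctions act on the expansion at each point
  separately. \<open>sder\<close> and \<open>smul\<close> are these operations on a single
  expansion, so that the algebra can be done without points and regularity.\<close>

fun sder :: "'m + nat => (('m => nat) => nat set => 'k::comm_ring_1) => ('m => nat) => nat set => 'k" where
 "sder (Inl i) H al I = of_nat (Suc (al i)) * H (al(i := Suc (al i))) I"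
| "sder (Inr j) H al I = (if j \<in> I then 0 else inversion_sign {j} I * H al (insert j I))"

definition smul :: "(('m::finite => nat) => nat set => 'k::comm_ring_1) => (('m => nat) => nat set => 'k)
  => ('m => nat) => nat set => 'k" where
 "smul H K al I = (\<Sum>be | \<forall>i. be i \<le> al i. \<Sum>J\<in>Pow I.
  inversion_sign J (I - J) * H be J * K (%i. al i - be i) (I - J))"

lemma coord_deriv_sder: "coord_deriv a F p = sder a (F p)"
 by (cases a) (auto simp: fun_eq_iff)

lemma sfun_mult_smul: "sfun_mult F G p = smul (F p) (G p)"
 by (simp add: fun_eq_iff sfun_mult_def smul_def)

lemma finite_below: "finite {be::'m::finite => nat. \<forall>i. be i \<le> al i}"
proof -
 have "{be. \<forall>i. be i \<le> al i} = (\<Pi>\<^sub>E i\<in>UNIV. {..al i})" by (auto simp: PiE_def Pi_def)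
 then show ?thesis by (simp add: finite_PiE)
qed

text \<open>The weight \<open>al i + 1\<close> is distributed as
  \<open>be i + (al i + 1 - be i)\<close> over the two factors, and each half is reindexed. The
  summand is an arbitrary \<open>t\<close>, so the same computation gives the product rule for
  \<open>conv\<close> and for \<open>smul\<close>.\<close>

lemma convolution_derivative:
 fixes t :: "('m::finite => nat) => ('m => nat) => 'k::comm_ring_1"
 defines "up \<equiv> %i (al::'m => nat). al(i := Suc (al i))"
 shows "of_nat (Suc (al i)) * (\<Sum>be | \<forall>l. be l \<le> up i al l. t be (%l. up i al l - be l)) =
  (\<Sum>be | \<forall>l. be l \<le> al l. of_nat (Suc (be i)) * t (up i be) (%l. al l - be l)) +
  (\<Sum>be | \<forall>l. be l \<le> al l. of_nat (Suc (al i - be i)) * t be (up i (%l. al l - be l)))"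
proof -
 let ?B = "{be. \<forall>l. be l \<le> up i al l}" and ?A = "{be. \<forall>l. be l \<le> al l}"
 let ?c = "%be l. up i al l - be l"
 have fin: "finite ?A" "finite ?B" using finite_below by auto
 have "of_nat (Suc (al i)) * (\<Sum>be\<in>?B. t be (?c be)) =
   (\<Sum>be\<in>?B. of_nat (be i) * t be (?c be) + of_nat (Suc (al i) - be i) * t be (?c be))"
  unfolding sum_distrib_left
 proof (rule sum.cong[OF refl])
  fix be assume "be \<in> ?B"
  then have "be i \<le> Suc (al i)" unfolding up_def by (metis (mono_tags, lifting) fun_upd_same mem_Collect_eq)
  then have "(of_nat (Suc (al i)) :: 'k) = of_nat (be i) + of_nat (Suc (al i) - be i)"
   by (metis le_add_diff_inverse of_nat_add)
  then show "of_nat (Suc (al i)) * t be (?c be) =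
    of_nat (be i) * t be (?c be) + of_nat (Suc (al i) - be i) * t be (?c be)"
   by (metis distrib_right)
 qed
 also have "... = (\<Sum>be\<in>?B. of_nat (be i) * t be (?c be)) + (\<Sum>be\<in>?B. of_nat (Suc (al i) - be i) * t be (?c be))"
  by (rule sum.distrib)
 also have "(\<Sum>be\<in>?B. of_nat (be i) * t be (?c be)) =
   (\<Sum>be\<in>{be\<in>?B. 0 < be i}. of_nat (be i) * t be (?c be))"
 proof (rule sum.mono_neutral_right)
  show "\<forall>be\<in>?B - {be\<in>?B. 0 < be i}. of_nat (be i) * t be (?c be) = 0"
  proof
   fix be assume "be \<in> ?B - {be\<in>?B. 0 < be i}"
   then have "be i = 0" by auto
   then show "of_nat (be i) * t be (?c be) = 0" by simp
  qed
 qed (use fin in auto)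
 also have "... = (\<Sum>be\<in>?A. of_nat (Suc (be i)) * t (up i be) (%l. al l - be l))"
 proof (rule sum.reindex_bij_witness[of _ "up i" "%be. be(i := be i - 1)"])
  fix be assume b: "be \<in> {be\<in>?B. 0 < be i}"
  then have bl: "!!l. be l \<le> up i al l" by auto
  show "up i (be(i := be i - 1)) = be" using b by (auto simp: up_def)
  show "be(i := be i - 1) \<in> ?A"
  proof (rule CollectI, rule allI)
   fix l show "(be(i := be i - 1)) l \<le> al l" using bl[of l] by (auto simp: up_def)
  qed
  have "(%l. al l - (be(i := be i - 1)) l) = ?c be" using b by (auto simp: up_def)
  then show "of_nat (Suc ((be(i := be i - 1)) i)) * t (up i (be(i := be i - 1)))
    (%l. al l - (be(i := be i - 1)) l) = of_nat (be i) * t be (?c be)"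
   using b \<open>up i (be(i := be i - 1)) = be\<close> by simp
 next
  fix be assume b: "be \<in> ?A"
  show "(up i be)(i := up i be i - 1) = be" by (auto simp: up_def)
  show "up i be \<in> {be\<in>?B. 0 < be i}" using b by (auto simp: up_def)
 qed
 \<comment> \<open>The indices of \<open>?B\<close> outside \<open>?A\<close> have
   \<open>be i = Suc (al i)\<close>, where the weight is zero.\<close>
 also have "(\<Sum>be\<in>?B. of_nat (Suc (al i) - be i) * t be (?c be)) =
   (\<Sum>be\<in>?A. of_nat (Suc (al i) - be i) * t be (?c be))"
 proof (rule sum.mono_neutral_right)
  show "?A <= ?B" by (auto simp: up_def le_SucI)
  show "\<forall>be\<in>?B - ?A. of_nat (Suc (al i) - be i) * t be (?c be) = 0"
  proof
   fix be assume b: "be \<in> ?B - ?A"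
   then have bl: "!!l. be l \<le> up i al l" by auto
   obtain l where l: "\<not> be l \<le> al l" using b by auto
   then have "l = i" using bl[of l] by (auto simp: up_def split: if_splits)
   then have "Suc (al i) - be i = 0" using l by simp
   then show "of_nat (Suc (al i) - be i) * t be (?c be) = 0" by (simp only: of_nat_0 mult_zero_left)
  qed
 qed (rule fin)
 also have "... = (\<Sum>be\<in>?A. of_nat (Suc (al i - be i)) * t be (up i (%l. al l - be l)))"
 proof (rule sum.cong[OF refl])
  fix be assume "be \<in> ?A"
  then have b: "be i \<le> al i" by auto
  have "?c be = up i (%l. al l - be l)" using b by (auto simp: up_def Suc_diff_le)
  then show "of_nat (Suc (al i) - be i) * t be (?c be) =
    of_nat (Suc (al i - be i)) * t be (up i (%l. al l - be l))"
   using b by (simp only: Suc_diff_le)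
 qed
 finally show ?thesis .
qed

lemma sder_even_smul:
 "sder (Inl i) (smul H K) al I = smul (sder (Inl i) H) K al I + smul H (sder (Inl i) K) al I"
proof -
 let ?t = "%be \<gamma>. \<Sum>J\<in>Pow I. inversion_sign J (I - J) * H be J * K \<gamma> (I - J)"
 show ?thesis
  using convolution_derivative[of al i ?t]
  by (simp add: smul_def sum_distrib_left mult_ac)
qed

text \<open>Here \<open>d\<close> is the left derivative by the odd variable of index
  \<open>j\<close> and \<open>m\<close> the product of the odd parts. If \<open>j\<close> is not in
  \<open>I\<close>, the subsets of \<open>insert j I\<close> are sorted by the factor that receives
  \<open>j\<close>, and moving the derivative past the first factor costs
  \<open>(-1) ^ card J\<close>. If \<open>j\<close> is in \<open>I\<close>, the left side vanishes
  and the terms on the right cancel under the pairing of \<open>J\<close> with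
  \<open>insert j J\<close>.\<close>

lemma odd_leibniz:
 fixes F G :: "nat set => 'k::comm_ring_1" and j :: nat
 defines "d \<equiv> %F I. if j \<in> I then 0 else inversion_sign {j} I * F (insert j I)"
  and "m \<equiv> %F G I. \<Sum>J\<in>Pow I. inversion_sign J (I - J) * F J * G (I - J)"
 assumes fin: "finite I"
 shows "d (m F G) I = m (d F) G I + m (%J. (-1) ^ card J * F J) (d G) I"
proof (cases "j \<in> I")
 case False
 have fJ: "finite J" "finite (I - J)" if "J <= I" for J using that fin finite_subset by auto
 have inj: "inj_on (insert j) (Pow I)" using False by (auto simp: inj_on_def)
 have disj: "Pow I \<inter> insert j ` Pow I = {}" using False by auto
 let ?s = "inversion_sign :: nat set => nat set => 'k"
 have "m F G (insert j I) = (\<Sum>J\<in>Pow I. ?s J (insert j I - J) * F J * G (insert j I - J)) +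
   (\<Sum>J\<in>Pow I. ?s (insert j J) (insert j I - insert j J) * F (insert j J) * G (insert j I - insert j J))"
  unfolding m_def Pow_insert using fin disj
  by (subst sum.union_disjoint) (simp_all add: sum.reindex[OF inj])
 also have "... = (\<Sum>J\<in>Pow I. ?s J (insert j (I - J)) * F J * G (insert j (I - J))) +
   (\<Sum>J\<in>Pow I. ?s (insert j J) (I - J) * F (insert j J) * G (I - J))"
  using False by (intro arg_cong2[of _ _ _ _ "(+)"] sum.cong) (auto simp: insert_Diff_if)
 finally have e: "d (m F G) I = (\<Sum>J\<in>Pow I. ?s {j} I * ?s J (insert j (I - J)) * F J * G (insert j (I - J))) +
   (\<Sum>J\<in>Pow I. ?s {j} I * ?s (insert j J) (I - J) * F (insert j J) * G (I - J))"
  unfolding d_def using False by (simp add: distrib_left sum_distrib_left mult.assoc)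
 have "m (d F) G I = (\<Sum>J\<in>Pow I. ?s {j} I * ?s (insert j J) (I - J) * F (insert j J) * G (I - J))"
  unfolding m_def
 proof (rule sum.cong[OF refl])
  fix J assume J: "J \<in> Pow I"
  have 1: "?s {j} I = ?s {j} J * ?s {j} (I - J)"
   using inversion_sign_Un_right[of J "I - J" "{j}"] J fJ[of J] by (simp add: Un_absorb1)
  have 2: "?s (insert j J) (I - J) = ?s {j} (I - J) * ?s J (I - J)"
   using inversion_sign_Un_left[of "{j}" J "I - J"] J fJ[of J] False by auto
  have 3: "?s {j} I * ?s (insert j J) (I - J) = ?s J (I - J) * ?s {j} J"
   unfolding 1 2 using inversion_sign_square[of "{j}" "I - J", where 'k='k] by (simp add: algebra_simps)
  show "?s J (I - J) * d F J * G (I - J) =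
    ?s {j} I * ?s (insert j J) (I - J) * F (insert j J) * G (I - J)"
   unfolding 3 d_def using J False by (auto simp: mult.assoc)
 qed
 moreover have "m (%J. (-1) ^ card J * F J) (d G) I =
   (\<Sum>J\<in>Pow I. ?s {j} I * ?s J (insert j (I - J)) * F J * G (insert j (I - J)))"
  unfolding m_def
 proof (rule sum.cong[OF refl])
  fix J assume J: "J \<in> Pow I"
  have jJ: "j \<notin> J" using J False by auto
  have 1: "?s {j} I = ?s {j} J * ?s {j} (I - J)"
   using inversion_sign_Un_right[of J "I - J" "{j}"] J fJ[of J] by (simp add: Un_absorb1)
  have 2: "?s J (insert j (I - J)) = ?s J {j} * ?s J (I - J)"
   using inversion_sign_Un_right[of "{j}" "I - J" J] J fJ[of J] False by auto
  have 4: "?s {j} J * ?s J {j} = (-1) ^ card J" using J fJ jJ by (simp add: inversion_sign_swap)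
  have 3: "?s {j} I * ?s J (insert j (I - J)) = (-1) ^ card J * (?s J (I - J) * ?s {j} (I - J))"
   unfolding 1 2 4[symmetric] by (simp add: algebra_simps)
  show "?s J (I - J) * ((-1) ^ card J * F J) * d G (I - J) =
    ?s {j} I * ?s J (insert j (I - J)) * F J * G (insert j (I - J))"
   unfolding 3 d_def using J False by (simp add: algebra_simps)
 qed
 ultimately show ?thesis unfolding e by simp
next
 case True
 define I' where "I' = I - {j}"
 have I: "I = insert j I'" "j \<notin> I'" "finite I'" using True fin by (auto simp: I'_def)
 let ?s = "inversion_sign :: nat set => nat set => 'k"
 have fJ: "finite J" "finite (I' - J)" if "J <= I'" for J using that I(3) finite_subset by auto
 have inj: "inj_on (insert j) (Pow I')" using I by (auto simp: inj_on_def)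
 have disj: "Pow I' \<inter> insert j ` Pow I' = {}" using I by auto
 have split: "(\<Sum>J\<in>Pow I. f J) = (\<Sum>J\<in>Pow I'. f J) + (\<Sum>J\<in>Pow I'. f (insert j J))" for f :: "nat set => 'k"
  unfolding I(1) Pow_insert using I(3) disj
  by (subst sum.union_disjoint) (simp_all add: sum.reindex[OF inj])
 have a: "m (d F) G I = (\<Sum>J\<in>Pow I'. ?s J (I - J) * (?s {j} J * F (insert j J)) * G (I - J))"
  unfolding m_def split d_def using I by (auto intro!: sum.cong)
 have b0: "(\<Sum>J\<in>Pow I'. ?s J (I - J) * ((-1) ^ card J * F J) * d G (I - J)) = 0"
  by (rule sum.neutral) (use I in \<open>auto simp: d_def\<close>)
 have b: "m (%J. (-1) ^ card J * F J) (d G) I =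
   (\<Sum>J\<in>Pow I'. ?s (insert j J) (I - insert j J) * ((-1) ^ card (insert j J) * F (insert j J)) *
    (?s {j} (I - insert j J) * G (insert j (I - insert j J))))"
  unfolding m_def split b0 by (simp add: d_def)
 have "m (d F) G I + m (%J. (-1) ^ card J * F J) (d G) I = 0"
  unfolding a b sum.distrib[symmetric]
 proof (rule sum.neutral, rule ballI)
  fix J assume "J \<in> Pow I'"
  then have J: "J <= I'" "j \<notin> J" "finite J" "finite (I' - J)" using I fJ by auto
  have e: "I - J = insert j (I' - J)" "I - insert j J = I' - J" "insert j (I' - J) = I - J"
   using J I by auto
  have 2: "?s J (insert j (I' - J)) = ?s J {j} * ?s J (I' - J)"
   using inversion_sign_Un_right[of "{j}" "I' - J" J] J I by auto
  have 3: "?s (insert j J) (I' - J) = ?s {j} (I' - J) * ?s J (I' - J)"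
   using inversion_sign_Un_left[of "{j}" J "I' - J"] J by auto
  have 4: "?s {j} J * ?s J {j} = (-1) ^ card J" using J by (simp add: inversion_sign_swap)
  have 5: "?s J (insert j (I' - J)) * ?s {j} J = (-1) ^ card J * ?s J (I' - J)"
   unfolding 2 4[symmetric] by (simp add: algebra_simps)
  have 6: "?s (insert j J) (I' - J) * ?s {j} (I' - J) = ?s J (I' - J)"
   unfolding 3 using inversion_sign_square[of "{j}" "I' - J", where 'k='k] by (simp add: algebra_simps)
  have "?s J (I - J) * (?s {j} J * F (insert j J)) * G (I - J) =
    (?s J (insert j (I' - J)) * ?s {j} J) * F (insert j J) * G (I - J)" unfolding e(1) by (simp add: mult_ac)
  moreover have "?s (insert j J) (I - insert j J) * ((-1) ^ card (insert j J) * F (insert j J)) *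
    (?s {j} (I - insert j J) * G (insert j (I - insert j J))) =
    - ((?s (insert j J) (I' - J) * ?s {j} (I' - J)) * (-1) ^ card J * F (insert j J) * G (I - J))"
   unfolding e(2,3) using J by (simp add: mult_ac)
  ultimately show "?s J (I - J) * (?s {j} J * F (insert j J)) * G (I - J) +
   ?s (insert j J) (I - insert j J) * ((-1) ^ card (insert j J) * F (insert j J)) *
    (?s {j} (I - insert j J) * G (insert j (I - insert j J))) = 0"
   unfolding 5 6 by (simp add: mult_ac)
 qed
 then show ?thesis using True by (simp add: d_def)
qed

lemma sder_odd_smul:
 "sder (Inr j) (smul H K) al I =
  smul (sder (Inr j) H) K al I + smul (%be J. (-1) ^ card J * H be J) (sder (Inr j) K) al I"
proof (cases "finite I")
 case True
 have "sder (Inr j) (smul H K) al I = (\<Sum>be | \<forall>i. be i \<le> al i. if j \<in> I then 0 else inversion_sign {j} I *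
   (\<Sum>J\<in>Pow (insert j I). inversion_sign J (insert j I - J) * H be J * K (%i. al i - be i) (insert j I - J)))"
  by (auto simp: smul_def sum_distrib_left)
 then show ?thesis
  unfolding odd_leibniz[OF True] by (simp add: smul_def sum.distrib)
next
 case False
 \<comment> \<open>Expansions are indexed by arbitrary sets of naturals; sums over an infinite power
   set are zero by convention, so every term vanishes.\<close>
 then have "infinite (Pow I)" "infinite (Pow (insert j I))" by auto
 then show ?thesis by (simp add: smul_def)
qed

lemma smul_0_0:
 fixes H K :: "('m::finite => nat) => nat set => 'k::comm_ring_1"
 shows "smul H K (%_. 0) {} = H (%_. 0) {} * K (%_. 0) {}"
proof -
 have "{be::'m => nat. \<forall>i. be i = 0} = {%_. 0}" by auto
 then show ?thesis unfolding smul_def le_zero_eq by simp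
qed

section \<open>Power series in several variables\<close>

definition multi_level :: "nat => ('m::finite => nat) set" where
 "multi_level r = {al. sum al UNIV = r}"

definition multi_power :: "('m::finite => 'k::comm_ring_1) => ('m => nat) => 'k" where
 "multi_power h al = (\<Prod>i\<in>UNIV. h i ^ al i)"

text \<open>The part of degree \<open>r\<close> of the series at \<open>h\<close>. Linear
  substitutions preserve the degree, so identities for them can be proved on these finite sums
  before any convergence is known.\<close>

definition level_sum :: "(('m::finite => nat) => 'k::comm_ring_1) => ('m => 'k) => nat => 'k" where
 "level_sum c h r = (\<Sum>al\<in>multi_level r. c al * multi_power h al)"

definition dser :: "'m => (('m => nat) => 'k::comm_ring_1) => ('m => nat) => 'k" where
 "dser i H al = of_nat (Suc (al i)) * H (al(i := Suc (al i)))"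

definition dlin :: "('m::finite => 'k) => (('m => nat) => 'k::comm_ring_1) => ('m => nat) => 'k" where
 "dlin v H al = (\<Sum>a\<in>UNIV. v a * dser a H al)"

lemma degree_upd: "sum ((be::'m::finite => nat)(i := Suc (be i))) UNIV = Suc (sum be UNIV)"
proof -
 have "sum (be(i := Suc (be i))) UNIV = Suc (be i) + sum (be(i := Suc (be i))) (UNIV - {i})"
  by (subst sum.remove[of UNIV i]) auto
 also have "sum (be(i := Suc (be i))) (UNIV - {i}) = sum be (UNIV - {i})" by (rule sum.cong) auto
 finally show ?thesis using sum.remove[of UNIV i be] by simp
qed

lemma multi_power_upd: "multi_power h (be(i := Suc (be i))) = h i * multi_power h be"
proof -
 have "(\<Prod>j\<in>UNIV - {i}. h j ^ (be(i := Suc (be i))) j) = (\<Prod>j\<in>UNIV - {i}. h j ^ be j)"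
  by (rule prod.cong) auto
 then show ?thesis
  unfolding multi_power_def by (simp add: prod.remove[of UNIV i] mult_ac)
qed

lemma multi_power_const: "multi_power (%_. x) al = x ^ sum al UNIV"
 by (simp add: multi_power_def power_sum)

lemma multi_power_0 [simp]: "multi_power h (%_. 0) = 1"
 by (simp add: multi_power_def)

lemma degree_le:
 fixes al :: "'m::finite => nat"
 shows "al i \<le> sum al UNIV"
 by (rule member_le_sum) auto

lemma finite_multi_level [simp]: "finite (multi_level r :: ('m::finite => nat) set)"
 by (rule finite_subset[OF _ finite_below[of "%_. r"]]) (auto simp: multi_level_def degree_le)

lemma multi_level_0: "multi_level 0 = {%_::'m::finite. 0}"
 by (auto simp: multi_level_def)

lemma level_sum_0: "level_sum c h 0 = c (%_. 0)"
 by (simp add: level_sum_def multi_level_0)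

lemma level_shift:
 fixes g :: "('m::finite => nat) => 'k::comm_ring_1"
 shows "(\<Sum>al\<in>multi_level (Suc r). of_nat (al i) * g al) =
  (\<Sum>be\<in>multi_level r. of_nat (Suc (be i)) * g (be(i := Suc (be i))))"
proof -
 have "(\<Sum>al\<in>multi_level (Suc r). of_nat (al i) * g al) =
   (\<Sum>al\<in>{al\<in>multi_level (Suc r). al i ~= 0}. of_nat (al i) * g al)"
  by (rule sum.mono_neutral_right) auto
 also have "... = (\<Sum>be\<in>multi_level r. of_nat (Suc (be i)) * g (be(i := Suc (be i))))"
 proof (rule sum.reindex_bij_witness[of _ "%be. be(i := Suc (be i))" "%be. be(i := be i - 1)"])
  fix al assume a: "al \<in> {al\<in>multi_level (Suc r). al i ~= 0}"
  show e: "(al(i := al i - 1))(i := Suc ((al(i := al i - 1)) i)) = al" using a by auto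
  show "al(i := al i - 1) \<in> multi_level r"
   using a degree_upd[of "al(i := al i - 1)" i] unfolding e by (simp add: multi_level_def)
  show "of_nat (Suc ((al(i := al i - 1)) i)) * g ((al(i := al i - 1))(i := Suc ((al(i := al i - 1)) i))) =
    of_nat (al i) * g al" unfolding e using a by auto
 next
  fix be :: "'m => nat" assume b: "be \<in> multi_level r"
  show "(be(i := Suc (be i)))(i := (be(i := Suc (be i))) i - 1) = be" by auto
  show "be(i := Suc (be i)) \<in> {al\<in>multi_level (Suc r). al i ~= 0}"
   using b by (simp add: multi_level_def degree_upd fun_upd_same del: fun_upd_apply)
 qed
 finally show ?thesis .
qed

text \<open>This is Euler's identity for homogeneous polynomials. In characteristic zero it
  determines the homogeneous parts recursively from the derivatives.\<close>

lemma level_sum_Suc: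
 fixes c :: "('m::finite => nat) => 'k::comm_ring_1"
 shows "of_nat (Suc r) * level_sum c h (Suc r) = (\<Sum>i\<in>UNIV. h i * level_sum (dser i c) h r)"
proof -
 have "of_nat (Suc r) * level_sum c h (Suc r) =
   (\<Sum>al\<in>multi_level (Suc r). \<Sum>i\<in>UNIV. of_nat (al i) * (c al * multi_power h al))"
  unfolding level_sum_def sum_distrib_left
 proof (rule sum.cong[OF refl])
  fix al :: "'m => nat" assume "al \<in> multi_level (Suc r)"
  then have "Suc r = sum al UNIV" by (simp add: multi_level_def)
  then show "of_nat (Suc r) * (c al * multi_power h al) = (\<Sum>i\<in>UNIV. of_nat (al i) * (c al * multi_power h al))"
   by (simp only: of_nat_sum sum_distrib_right)
 qed
 also have "... = (\<Sum>i\<in>UNIV. \<Sum>be\<in>multi_level r.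
   of_nat (Suc (be i)) * (c (be(i := Suc (be i))) * multi_power h (be(i := Suc (be i)))))"
  by (subst sum.swap) (simp only: level_shift)
 also have "... = (\<Sum>i\<in>UNIV. h i * level_sum (dser i c) h r)"
  unfolding level_sum_def sum_distrib_left dser_def multi_power_upd
  by (intro sum.cong refl) (simp add: mult_ac)
 finally show ?thesis .
qed

lemma dser_commute: "dser i (dser j H) = dser j (dser i H)"
proof (cases "i = j")
 case False
 show ?thesis
 proof
  fix al
  have "al(i := Suc (al i), j := Suc (al j)) = al(j := Suc (al j), i := Suc (al i))"
   using False by (rule fun_upd_twist)
  then show "dser i (dser j H) al = dser j (dser i H) al"
   using False by (simp add: dser_def mult_ac)
 qed
qed simp

lemma dser_dlin: "dser i (dlin v H) = dlin v (dser i H)"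
proof
 fix al
 have "dser i (dlin v H) al = (\<Sum>a\<in>UNIV. v a * dser i (dser a H) al)"
  unfolding dser_def[of i] dlin_def by (simp add: sum_distrib_left mult_ac)
 then show "dser i (dlin v H) al = dlin v (dser i H) al"
  by (simp add: dlin_def dser_commute)
qed

lemma dlin_commute: "dlin v (dlin w H) = dlin w (dlin v H)"
proof
 fix al
 have e: "dlin v (dlin w H) al = (\<Sum>a\<in>UNIV. \<Sum>b\<in>UNIV. v a * w b * dser b (dser a H) al)" for v w
  by (simp add: dlin_def[of v] dser_dlin) (simp add: dlin_def sum_distrib_left mult_ac)
 show "dlin v (dlin w H) al = dlin w (dlin v H) al"
  unfolding e by (subst sum.swap) (simp add: dser_commute mult_ac)
qed

subsection \<open>Linear substitutions\<close>

text \<open>An arbitrary order of the variables, over which products of the operators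
  \<open>dlin (g i)\<close> are written as a fold. These operators commute, so the order is
  immaterial.\<close>

definition enum_list :: "'m::finite list" where
 "enum_list = (SOME us. distinct us \<and> set us = UNIV)"

lemma enum_list: "distinct (enum_list :: 'm::finite list)" "set (enum_list :: 'm::finite list) = UNIV"
proof -
 have "\<exists>us::'m list. distinct us \<and> set us = UNIV"
  using finite_distinct_list[of "UNIV :: 'm set"] by auto
 from someI_ex[OF this] show "distinct (enum_list :: 'm list)" "set (enum_list :: 'm list) = UNIV"
  unfolding enum_list_def by auto
qed

definition dpow :: "('m::finite => 'm => 'k) => ('m => nat) => 'm list
  => (('m => nat) => 'k::comm_ring_1) => ('m => nat) => 'k" where
 "dpow g be us H = foldr (%i. dlin (g i) ^^ be i) us H"

text \<open>
 The expansion in \<open>h\<close> of the series \<open>H\<close> at \<open>\<Sum>\<^sub>b h\<^sub>b g\<^sub>b\<close>, written as a Taylor series.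
\<close>

definition esub :: "('m::finite => 'm => 'k) => (('m => nat) => 'k::field_char_0) => ('m => nat) => 'k" where
 "esub g H be = dpow g be enum_list H (%_. 0) / of_nat (\<Prod>i\<in>UNIV. fact (be i))"

lemma dlin_funpow_commute: "dlin v ((dlin w ^^ k) H) = (dlin w ^^ k) (dlin v H)"
proof (induction k)
 case (Suc k)
 have "dlin v (dlin w ((dlin w ^^ k) H)) = dlin w (dlin v ((dlin w ^^ k) H))" by (rule dlin_commute)
 then show ?case using Suc by simp
qed simp

lemma dlin_dpow: "dlin v (dpow g be us H) = dpow g be us (dlin v H)"
 by (induction us) (simp_all add: dpow_def dlin_funpow_commute)

lemma dpow_upd:
 assumes "distinct us" "i \<in> set us"
 shows "dpow g (be(i := Suc (be i))) us H = dpow g be us (dlin (g i) H)"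
 using assms
proof (induction us)
 case (Cons x us)
 show ?case
 proof (cases "x = i")
  case True
  then have "i \<notin> set us" using Cons.prems by auto
  then have "dpow g (be(i := Suc (be i))) us H = dpow g be us H"
   unfolding dpow_def by (intro foldr_cong) auto
  then have "dpow g (be(i := Suc (be i))) (x # us) H = dlin (g i) ((dlin (g i) ^^ be i) (dpow g be us H))"
   using True by (simp add: dpow_def)
  also have "... = (dlin (g i) ^^ be i) (dpow g be us (dlin (g i) H))"
   by (simp add: dlin_funpow_commute dlin_dpow)
  finally show ?thesis using True by (simp add: dpow_def)
 next
  case False
  then show ?thesis using Cons by (simp add: dpow_def)
 qed
qed simp

lemma dpow_0: "dpow g (%_. 0) us H = H"
 by (induction us) (simp_all add: dpow_def)

lemma esub_0 [simp]: "esub g H (%_. 0) = H (%_. 0)"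
 by (simp add: esub_def dpow_0)

lemma fact_upd:
 fixes be :: "'m::finite => nat"
 shows "(\<Prod>j\<in>UNIV. fact ((be(i := Suc (be i))) j) :: nat) = Suc (be i) * (\<Prod>j\<in>UNIV. fact (be j))"
proof -
 have "(\<Prod>j\<in>UNIV - {i}. fact ((be(i := Suc (be i))) j) :: nat) = (\<Prod>j\<in>UNIV - {i}. fact (be j))"
  by (rule prod.cong) auto
 moreover have "(\<Prod>j\<in>UNIV. fact ((be(i := Suc (be i))) j) :: nat) =
   fact (Suc (be i)) * (\<Prod>j\<in>UNIV - {i}. fact ((be(i := Suc (be i))) j))"
  by (subst prod.remove[of UNIV i]) auto
 moreover have "(\<Prod>j\<in>UNIV. fact (be j) :: nat) = fact (be i) * (\<Prod>j\<in>UNIV - {i}. fact (be j))"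
  by (rule prod.remove) auto
 ultimately show ?thesis unfolding fact_Suc by (simp only: mult.assoc of_nat_id)
qed

text \<open>Chain rule: raising the exponent of variable \<open>i\<close> applies one more
  \<open>dlin (g i)\<close>, and the factor of the derivative cancels against the factorial.\<close>

lemma dser_esub:
 fixes H :: "('m::finite => nat) => 'k::field_char_0"
 shows "dser i (esub g H) = esub g (dlin (g i) H)"
proof
 fix be
 have "(of_nat (Suc (be i)) :: 'k) ~= 0" by (rule of_nat_neq_0)
 then show "dser i (esub g H) be = esub g (dlin (g i) H) be"
  unfolding dser_def esub_def fact_upd of_nat_mult
  unfolding dpow_upd[OF enum_list(1), of i, unfolded enum_list(2), OF UNIV_I] times_divide_eq_right
  by (rule nonzero_mult_divide_mult_cancel_left)
qed

text \<open>
 Both sides satisfy the recursion of \<open>level_sum_Suc\<close> with the same operator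
 \<open>\<Sum>\<^sub>b h\<^sub>b (\<Sum>\<^sub>a g\<^bsub>ba\<^esub> \<partial>\<^sub>a) = \<Sum>\<^sub>a (\<Sum>\<^sub>b h\<^sub>b g\<^bsub>ba\<^esub>) \<partial>\<^sub>a\<close>.
\<close>

lemma level_sum_esub:
 fixes H :: "('m::finite => nat) => 'k::field_char_0"
 shows "level_sum (esub g H) h r = level_sum H (%a. \<Sum>b\<in>UNIV. h b * g b a) r"
proof (induction r arbitrary: H)
 case 0
 show ?case by (simp add: level_sum_0)
next
 case (Suc r)
 let ?v = "%a. \<Sum>b\<in>UNIV. h b * g b a"
 have lin: "level_sum (dlin w H) h' r = (\<Sum>a\<in>UNIV. w a * level_sum (dser a H) h' r)" for w h'
  unfolding level_sum_def dlin_def sum_distrib_left sum_distrib_right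
  by (subst sum.swap) (simp add: mult_ac)
 have "of_nat (Suc r) * level_sum (esub g H) h (Suc r) =
   (\<Sum>b\<in>UNIV. h b * level_sum (dlin (g b) H) ?v r)"
  unfolding level_sum_Suc dser_esub Suc.IH ..
 also have "... = (\<Sum>a\<in>UNIV. ?v a * level_sum (dser a H) ?v r)"
  unfolding lin sum_distrib_left sum_distrib_right by (subst sum.swap) (simp add: mult_ac)
 also have "... = of_nat (Suc r) * level_sum H ?v (Suc r)"
  unfolding level_sum_Suc ..
 finally show ?case
  using mult_left_cancel[OF of_nat_neq_0[of r, where 'a='k]] by blast
qed

text \<open>\<open>dser\<close> only multiplies coefficients by natural numbers, so the triangle
  inequality passes through every step. This is the method of majorants: convergence of a
  substituted series reduces to nonnegative coefficients.\<close>

lemma dpow_majorant: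
 fixes H :: "('m::finite => nat) => 'k::real_normed_field"
 assumes "!!al. norm (H al) \<le> M al"
 shows "norm (dpow g be us H al) \<le> dpow (%b a. norm (g b a)) be us M al"
proof -
 have 1: "norm (dlin v K al) \<le> dlin (%a. norm (v a)) L al"
  if "!!al. norm (K al) \<le> L al" for v al and K :: "('m => nat) => 'k" and L
  unfolding dlin_def dser_def
  by (rule order_trans[OF norm_sum]) (auto intro!: sum_mono mult_mono that simp: norm_mult simp del: of_nat_Suc)
 have 2: "norm ((dlin v ^^ k) K al) \<le> (dlin (%a. norm (v a)) ^^ k) L al"
  if "!!al. norm (K al) \<le> L al" for v k al and K :: "('m => nat) => 'k" and L
  using that by (induction k arbitrary: al) (simp_all add: 1)
 show ?thesis
  using assms by (induction us arbitrary: al) (simp_all add: dpow_def 2)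
qed

lemma esub_majorant:
 fixes H :: "('m::finite => nat) => 'k::real_normed_field"
 shows "norm (esub g H be) \<le> esub (%b a. norm (g b a)) (%al. norm (H al)) be"
 unfolding esub_def norm_divide norm_of_nat
 by (intro divide_right_mono dpow_majorant) (auto intro: prod_nonneg)

subsection \<open>Convergence\<close>

lemma multi_degree_Union: "(\<Union>r<n. multi_level r) = {al::'m::finite => nat. sum al UNIV < n}"
 by (auto simp: multi_level_def)

lemma sum_multi_level:
 fixes c :: "('m::finite => nat) => 'k::comm_monoid_add"
 shows "(\<Sum>r<n. sum c (multi_level r)) = sum c {al. sum al UNIV < n}"
 unfolding multi_degree_Union[symmetric]
 by (rule sum.UNION_disjoint[symmetric]) (simp_all, auto simp: multi_level_def)

lemma finite_degree_less: "finite {al::'m::finite => nat. sum al UNIV < n}"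
 unfolding multi_degree_Union[symmetric] by auto

text \<open>Every finite set of multi-indices has bounded degree, so the truncations by degree
  eventually contain it.\<close>

lemma has_sum_levels:
 fixes c :: "('m::finite => nat) => 'k::{comm_monoid_add,topological_space}"
 assumes "(c has_sum L) UNIV"
 shows "(%r. sum c (multi_level r)) sums L"
proof -
 have "filterlim (%n. {al::'m => nat. sum al UNIV < n}) (finite_subsets_at_top UNIV) sequentially"
  unfolding filterlim_finite_subsets_at_top
 proof (intro allI impI)
  fix X :: "('m => nat) set" assume X: "finite X \<and> X <= UNIV"
  have "al \<in> X ==> sum al UNIV \<le> Max ((%al. sum al UNIV) ` X)" for al using X by auto
  then have "X <= {al. sum al UNIV < n}" if "Max ((%al. sum al UNIV) ` X) < n" for n
   using that by fastforce
  then show "\<forall>\<^sub>F n in sequentially. finite {al::'m => nat. sum al UNIV < n} \<and>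
    X <= {al. sum al UNIV < n} \<and> {al. sum al UNIV < n} <= UNIV"
   using eventually_gt_at_top[of "Max ((%al. sum al UNIV) ` X)"]
   by (elim eventually_mono) (auto simp: finite_degree_less)
 qed
 then have "(%n. sum c {al. sum al UNIV < n}) \<longlonglongrightarrow> L"
  using assms unfolding has_sum_def by (rule filterlim_compose[rotated])
 then show ?thesis unfolding sums_def sum_multi_level .
qed

text \<open>\<open>has_sum\<close> sums the multi-indices in no particular order, while the
  computations with products and substitutions go by degree. Absolute summability makes the two sums
  agree.\<close>

lemma abs_summable_has_sum:
 fixes c :: "('m::finite => nat) => 'k::banach"
 assumes "(%al. norm (c al)) summable_on UNIV" "(%r. sum c (multi_level r)) sums L"
 shows "(c has_sum L) UNIV"
proof -
 have "(c has_sum infsum c UNIV) UNIV" using assms(1) abs_summable_summable has_sum_infsum by blast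
 then show ?thesis using has_sum_levels[of c] assms(2) sums_unique2 by blast
qed

lemma nonneg_levels_summable:
 fixes c :: "('m::finite => nat) => real"
 assumes "!!al. 0 \<le> c al" "summable (%r. sum c (multi_level r))"
 shows "c summable_on UNIV"
proof (rule nonneg_bdd_above_summable_on)
 show "bdd_above (sum c ` {F. F <= UNIV \<and> finite F})"
 proof (rule bdd_aboveI2)
  fix F :: "('m => nat) set" assume "F \<in> {F. F <= UNIV \<and> finite F}"
  then have F: "finite F" by auto
  let ?n = "Suc (Max ((%al. sum al UNIV) ` F))"
  have "sum al UNIV < ?n" if "al \<in> F" for al using F that by (simp add: less_Suc_eq_le)
  then have "sum c F \<le> sum c {al. sum al UNIV < ?n}"
   by (intro sum_mono2 finite_degree_less) (auto simp: assms(1))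
  also have "... \<le> (\<Sum>r. sum c (multi_level r))"
   unfolding sum_multi_level[symmetric]
   by (rule sum_le_suminf[OF assms(2)]) (auto intro: sum_nonneg assms(1))
  finally show "sum c F \<le> (\<Sum>r. sum c (multi_level r))" .
 qed
qed (rule assms(1))

text \<open>A finite set of multi-indices lies in a box, over which the sum is a product of finite
  geometric sums; hence the bound \<open>1 / (1 - x)\<close> for each variable.\<close>

lemma summable_multi_geometric:
 assumes "0 \<le> x" "x < (1::real)"
 shows "(%al::'m::finite => nat. x ^ sum al UNIV) summable_on UNIV"
proof (rule nonneg_bdd_above_summable_on)
 show "bdd_above (sum (%al::'m => nat. x ^ sum al UNIV) ` {F. F <= UNIV \<and> finite F})"
 proof (rule bdd_aboveI2)
  fix F :: "('m => nat) set" assume "F \<in> {F. F <= UNIV \<and> finite F}"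
  then have F: "finite F" by auto
  let ?n = "Suc (Max ((%al. sum al UNIV) ` F))"
  have "al i < ?n" if "al \<in> F" for al i
  proof -
   have "sum al UNIV \<le> Max ((%al. sum al UNIV) ` F)" using F that by simp
   then show ?thesis using degree_le[of al i] by simp
  qed
  then have sub: "F <= (\<Pi>\<^sub>E i\<in>UNIV. {..<?n})" by (auto simp: PiE_def Pi_def)
  have "(\<Sum>al\<in>F. x ^ sum al UNIV) \<le> (\<Sum>al\<in>(\<Pi>\<^sub>E i\<in>UNIV. {..<?n}). \<Prod>i\<in>(UNIV::'m set). x ^ al i)"
   unfolding power_sum by (intro sum_mono2 sub finite_PiE) (use assms in \<open>auto intro!: prod_nonneg\<close>)
  also have "... = (\<Prod>i\<in>(UNIV::'m set). \<Sum>k<?n. x ^ k)"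
   by (rule prod_sum_PiE[symmetric]) auto
  also have "... \<le> (\<Prod>i\<in>(UNIV::'m set). 1 / (1 - x))"
  proof (rule prod_mono)
   fix i :: 'm
   have "(\<Sum>k<?n. x ^ k) \<le> (\<Sum>k. x ^ k)"
    by (rule sum_le_suminf) (use assms in \<open>auto intro: summable_geometric\<close>)
   moreover have "0 \<le> (\<Sum>k<?n. x ^ k)" by (rule sum_nonneg) (use assms in auto)
   ultimately show "0 \<le> (\<Sum>k<?n. x ^ k) \<and> (\<Sum>k<?n. x ^ k) \<le> 1 / (1 - x)"
    using suminf_geometric[of x] assms by simp
  qed
  finally show "(\<Sum>al\<in>F. x ^ sum al UNIV) \<le> (\<Prod>i\<in>(UNIV::'m set). 1 / (1 - x))" .
 qed
qed (use assms in auto)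

text \<open>Beyond a finite set the partial sums stay within distance 1 of the limit, so a further
  term, being a difference of two of them, has norm at most 2.\<close>

lemma has_sum_bounded:
 fixes c :: "'i => 'k::real_normed_vector"
 assumes "(c has_sum L) UNIV"
 obtains B where "!!x. norm (c x) \<le> B" "0 \<le> B"
proof -
 have "\<forall>\<^sub>F X in finite_subsets_at_top UNIV. dist (sum c X) L < 1"
  using assms unfolding has_sum_def by (rule tendstoD) simp
 then obtain F where F: "finite F" "!!G. finite G ==> F <= G ==> dist (sum c G) L < 1"
  unfolding eventually_finite_subsets_at_top by auto
 have 1: "norm (c x) \<le> 2" if "x \<notin> F" for x
 proof -
  have "c x = (sum c (insert x F) - L) - (sum c F - L)" using F that by simp
  then have "norm (c x) \<le> norm (sum c (insert x F) - L) + norm (sum c F - L)"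
   by (metis norm_triangle_ineq4)
  also have "... \<le> 1 + 1"
   using F(2)[of "insert x F"] F(2)[of F] F(1) by (intro add_mono) (simp_all add: dist_norm subset_insertI)
  finally show ?thesis by simp
 qed
 have 2: "norm (c x) \<le> (\<Sum>x\<in>F. norm (c x))" if "x \<in> F" for x
  using F that by (intro member_le_sum) auto
 have 3: "0 \<le> (\<Sum>x\<in>F. norm (c x))" by (rule sum_nonneg) simp
 have "norm (c x) \<le> 2 + (\<Sum>x\<in>F. norm (c x))" for x
  using 1[of x] 2[of x] 3 by (cases "x \<in> F") auto
 then show ?thesis using that 3 by fastforce
qed

text \<open>Cauchy's estimates, as a form of convergence near the base point that survives
  derivatives, products and reciprocals with explicit new constants.\<close>

definition geometric_bound :: "real => real => (('m::finite => nat) => 'k::real_normed_vector) => bool" where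
 "geometric_bound C K H \<longleftrightarrow> 0 \<le> C \<and> 0 < K \<and> (\<forall>al. norm (H al) \<le> C * K ^ sum al UNIV)"

lemma geometric_bound_term:
 fixes H :: "('m::finite => nat) => 'k::real_normed_field"
 assumes "geometric_bound C K H" "!!i. norm (h i) \<le> t" "0 \<le> t"
 shows "norm (H al * multi_power h al) \<le> C * (K * t) ^ sum al UNIV"
proof -
 have "norm (multi_power h al) \<le> (\<Prod>i\<in>UNIV. t ^ al i)"
  unfolding multi_power_def prod_norm[symmetric] norm_power
  by (intro prod_mono conjI power_mono assms) auto
 then have "norm (multi_power h al) \<le> t ^ sum al UNIV" by (simp add: power_sum)
 then have "norm (H al * multi_power h al) \<le> (C * K ^ sum al UNIV) * t ^ sum al UNIV"
  unfolding norm_mult using assms by (intro mult_mono) (auto simp: geometric_bound_def)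
 then show ?thesis by (simp add: power_mult_distrib mult_ac)
qed

lemma geometric_bound_summable:
 fixes H :: "('m::finite => nat) => 'k::real_normed_field"
 assumes "geometric_bound C K H" "!!i. norm (h i) \<le> t" "0 \<le> t" "K * t < 1"
 shows "(%al. norm (H al * multi_power h al)) summable_on UNIV"
proof (rule Infinite_Sum.abs_summable_on_comparison_test')
 show "(%al::'m => nat. C * (K * t) ^ sum al UNIV) summable_on UNIV"
  using assms by (intro summable_on_cmult_right summable_multi_geometric) (auto simp: geometric_bound_def)
qed (use geometric_bound_term[OF assms(1-3)] in auto)

text \<open>The factor \<open>al i + 1\<close> of the derivative is at most
  \<open>2 ^ sum al UNIV\<close>, which doubles the ratio; one further \<open>K\<close> comes from
  the raised index.\<close>

lemma geometric_bound_dser: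
 fixes H :: "('m::finite => nat) => 'k::real_normed_field"
 assumes "geometric_bound C K H"
 shows "geometric_bound (C * K) (2 * K) (dser i H)"
 unfolding geometric_bound_def
proof (intro conjI allI)
 fix al :: "'m => nat"
 have "Suc (al i) \<le> 2 ^ al i" by (metis Suc_leI less_exp)
 also have "... \<le> 2 ^ sum al UNIV" by (intro power_increasing degree_le) auto
 finally have s: "real (Suc (al i)) \<le> 2 ^ sum al UNIV"
  by (metis of_nat_le_iff of_nat_numeral of_nat_power)
 have "norm (dser i H al) = real (Suc (al i)) * norm (H (al(i := Suc (al i))))"
  unfolding dser_def norm_mult norm_of_nat ..
 also have "... \<le> 2 ^ sum al UNIV * (C * K ^ sum (al(i := Suc (al i))) UNIV)"
  using s by (intro mult_mono conjunct2[OF conjunct2[OF assms[unfolded geometric_bound_def]], rule_format]) auto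
 also have "... = C * K * (2 * K) ^ sum al UNIV"
  unfolding degree_upd by (simp add: power_mult_distrib mult_ac)
 finally show "norm (dser i H al) \<le> C * K * (2 * K) ^ sum al UNIV" .
qed (use assms in \<open>auto simp: geometric_bound_def\<close>)

lemma geometric_bound_level_summable:
 fixes H :: "('m::finite => nat) => 'k::real_normed_field"
 assumes "geometric_bound C K H" "0 \<le> t" "K * t < 1"
 shows "summable (%r. \<Sum>al\<in>multi_level r. norm (H al) * t ^ r)"
proof -
 have "((%al. norm (H al * multi_power (%_. of_real t) al)) has_sum
   infsum (%al. norm (H al * multi_power (%_. of_real t) al)) UNIV) UNIV"
  by (rule has_sum_infsum, rule geometric_bound_summable[OF assms(1) _ assms(2,3)]) (use assms in auto)
 from has_sum_levels[OF this]
 have "summable (%r. \<Sum>al\<in>multi_level r. norm (H al * multi_power (%_. of_real t) al))"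
  by (rule sums_summable)
 moreover have "(\<Sum>al\<in>multi_level r. norm (H al * multi_power (%_. of_real t :: 'k) al)) =
   (\<Sum>al\<in>multi_level r. norm (H al) * t ^ r)" for r
  by (rule sum.cong) (use assms(2) in \<open>auto simp: multi_power_const norm_mult norm_power multi_level_def\<close>)
 ultimately show ?thesis by simp
qed

lemma level_sum_norm_le:
 fixes H :: "('m::finite => nat) => 'k::real_normed_field"
 assumes "!!i. norm (h i) \<le> t" "0 \<le> t"
 shows "norm (level_sum H h r) \<le> (\<Sum>al\<in>multi_level r. norm (H al) * t ^ r)"
 unfolding level_sum_def
proof (rule order_trans[OF norm_sum sum_mono])
 fix al :: "'m => nat" assume a: "al \<in> multi_level r"
 have "norm (multi_power h al) \<le> (\<Prod>i\<in>UNIV. t ^ al i)"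
  unfolding multi_power_def prod_norm[symmetric] norm_power
  by (intro prod_mono conjI power_mono assms) auto
 then have "norm (multi_power h al) \<le> t ^ r" using a by (simp add: power_sum[symmetric] multi_level_def)
 then show "norm (H al * multi_power h al) \<le> norm (H al) * t ^ r"
  unfolding norm_mult by (intro mult_left_mono) auto
qed

text \<open>By majorants the coefficients may be taken nonnegative. Then the degree sums of the
  substituted series, with all variables equal to \<open>t\<close>, are those of the original one at
  a point whose coordinates \<open>t * (\<Sum>b\<in>UNIV. norm (g b a))\<close> are at most
  \<open>t * N\<close>.\<close>

lemma esub_summable:
 fixes H :: "('m::finite => nat) => 'k::{real_normed_field,banach}"
 assumes "geometric_bound C K H" "!!i. norm (h i) \<le> t" "0 \<le> t"
  and N: "!!a. (\<Sum>b\<in>UNIV. norm (g b a)) \<le> N" and "K * (t * N) < 1"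
 shows "(%be. norm (esub g H be * multi_power h be)) summable_on UNIV"
proof -
 let ?g = "%b a. norm (g b a)" and ?H = "%al. norm (H al)"
 have nn: "0 \<le> esub ?g ?H be" for be by (rule order_trans[OF norm_ge_zero esub_majorant])
 have N0: "0 \<le> N" using N[of undefined] by (meson norm_ge_zero order_trans sum_nonneg)
 have gb: "geometric_bound C K ?H" using assms(1) by (simp add: geometric_bound_def)
 have lev: "(\<Sum>be\<in>multi_level r. esub ?g ?H be * t ^ sum be UNIV) =
   level_sum ?H (%a. \<Sum>b\<in>UNIV. t * ?g b a) r" for r
  using level_sum_esub[of ?g ?H "%_. t" r] by (simp add: level_sum_def multi_power_const)
 have "summable (%r. \<Sum>be\<in>multi_level r. esub ?g ?H be * t ^ sum be UNIV)"
 proof (rule summable_comparison_test'[OF geometric_bound_level_summable[OF gb _ assms(5)]])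
  show "norm (\<Sum>be\<in>multi_level n. esub ?g ?H be * t ^ sum be UNIV) \<le>
    (\<Sum>al\<in>multi_level n. norm (norm (H al)) * (t * N) ^ n)" for n
   unfolding lev
   by (rule level_sum_norm_le)
    (use assms(3) N N0 in \<open>auto simp: sum_distrib_left[symmetric] sum_nonneg intro!: mult_left_mono\<close>)
 qed (use assms(3) N0 in auto)
 then have "(%be. esub ?g ?H be * t ^ sum be UNIV) summable_on UNIV"
  using nn assms(3) by (intro nonneg_levels_summable) auto
 then show ?thesis
 proof (rule Infinite_Sum.abs_summable_on_comparison_test')
  fix be :: "'m => nat"
  have "norm (multi_power h be) \<le> (\<Prod>i\<in>UNIV. t ^ be i)"
   unfolding multi_power_def prod_norm[symmetric] norm_power
   by (intro prod_mono conjI power_mono assms) auto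
  then show "norm (esub g H be * multi_power h be) \<le> esub ?g ?H be * t ^ sum be UNIV"
   unfolding norm_mult using esub_majorant nn by (intro mult_mono) (auto simp: power_sum)
 qed
qed

subsection \<open>Inverses of power series\<close>

definition conv :: "(('m::finite => nat) => 'k::comm_ring_1) => (('m => nat) => 'k) => ('m => nat) => 'k" where
 "conv H K al = (\<Sum>be | \<forall>i. be i \<le> al i. H be * K (%i. al i - be i))"

lemma dser_conv: "dser i (conv H K) al = conv (dser i H) K al + conv H (dser i K) al"
 using convolution_derivative[of al i "%be \<gamma>. H be * K \<gamma>"]
 by (simp add: conv_def dser_def mult_ac del: of_nat_Suc)

lemma degree_diff:
 fixes al :: "'m::finite => nat"
 assumes "\<forall>i. be i \<le> al i"
 shows "sum be UNIV + (\<Sum>i\<in>UNIV. al i - be i) = sum al UNIV"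
 unfolding sum.distrib[symmetric] using assms by simp

text \<open>Pairs of indices are regrouped by the degree of the first one, which gives the Cauchy
  product of the two series of degree sums.\<close>

lemma level_sum_conv: "level_sum (conv H G) h k = (\<Sum>i\<le>k. level_sum H h i * level_sum G h (k - i))"
proof -
 have split: "multi_power h al = multi_power h be * multi_power h (%i. al i - be i)"
  if "\<forall>i. be i \<le> al i" for al be
  unfolding multi_power_def prod.distrib[symmetric] power_add[symmetric] using that by simp
 have "level_sum (conv H G) h k = (\<Sum>al\<in>multi_level k. \<Sum>be | \<forall>i. be i \<le> al i.
   H be * multi_power h be * (G (%i. al i - be i) * multi_power h (%i. al i - be i)))"
  unfolding level_sum_def conv_def sum_distrib_right
  by (intro sum.cong refl) (use split in \<open>auto simp: mult_ac\<close>)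
 also have "... = (\<Sum>(al, be)\<in>Sigma (multi_level k) (%al. {be. \<forall>i. be i \<le> al i}).
   H be * multi_power h be * (G (%i. al i - be i) * multi_power h (%i. al i - be i)))"
  by (rule sum.Sigma) (auto simp: finite_below)
 also have "... = (\<Sum>(i, be, \<gamma>)\<in>Sigma {..k} (%i. multi_level i \<times> multi_level (k - i)).
   H be * multi_power h be * (G \<gamma> * multi_power h \<gamma>))"
  by (rule sum.reindex_bij_witness[of _ "%(i, be, \<gamma>). (%i. be i + \<gamma> i, be)"
     "%(al, be). (sum be UNIV, be, %i. al i - be i)"])
   (auto simp: multi_level_def sum.distrib fun_eq_iff dest: degree_diff)
 also have "... = (\<Sum>i\<le>k. \<Sum>(be, \<gamma>)\<in>multi_level i \<times> multi_level (k - i).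
   H be * multi_power h be * (G \<gamma> * multi_power h \<gamma>))"
  by (subst sum.Sigma) auto
 also have "... = (\<Sum>i\<le>k. level_sum H h i * level_sum G h (k - i))"
  unfolding level_sum_def sum_product sum.cartesian_product ..
 finally show ?thesis .
qed

text \<open>The reciprocal series, obtained by solving for its coefficients one at a time. The
  excluded index \<open>be = (%_. 0)\<close> belongs to the unknown coefficient itself; every other
  index lowers the degree.\<close>

function cinv :: "(('m::finite => nat) => 'k::field) => ('m => nat) => 'k" where
 "cinv H al = (if al = (%_. 0) then 1 / H (%_. 0)
  else - (\<Sum>be\<in>{be. (\<forall>i. be i \<le> al i) \<and> be ~= (%_. 0)}. H be * cinv H (%i. al i - be i)) / H (%_. 0))"
 by auto
termination
proof (relation "Wellfounded.measure (%(H, al). sum al UNIV)", simp)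
 fix H :: "('m::finite => nat) => 'k" and al be :: "'m => nat"
 assume b: "be \<in> {be. (\<forall>i. be i \<le> al i) \<and> be ~= (%_. 0)}"
 then obtain i where "be i ~= 0" by auto
 then have "0 < sum be UNIV" using degree_le[of be i] by simp
 then show "((H, %i. al i - be i), H, al) \<in> Wellfounded.measure (%(H, al). sum al UNIV)"
  using degree_diff[of be al] b by simp
qed

declare cinv.simps [simp del]

lemma cinv_0: "cinv H (%_. 0) = 1 / H (%_. 0)"
 by (subst cinv.simps) simp

lemma conv_split:
 fixes H :: "('m::finite => nat) => 'k::comm_ring_1"
 shows "conv H G al = H (%_. 0) * G al +
  (\<Sum>be\<in>{be. (\<forall>i. be i \<le> al i) \<and> be ~= (%_. 0)}. H be * G (%i. al i - be i))"
proof -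
 have "{be. \<forall>i. be i \<le> al i} = insert (%_. 0) {be. (\<forall>i. be i \<le> al i) \<and> be ~= (%_. 0)}" by auto
 moreover have "finite {be. (\<forall>i. be i \<le> al i) \<and> be ~= (%_. 0)}"
  by (rule finite_subset[OF _ finite_below[of al]]) auto
 ultimately show ?thesis unfolding conv_def by simp
qed

lemma conv_cinv:
 fixes H :: "('m::finite => nat) => 'k::field"
 assumes "H (%_. 0) ~= 0"
 shows "conv H (cinv H) al = (if al = (%_. 0) then 1 else 0)"
proof (cases "al = (%_. 0)")
 case True
 have e: "{be::'m => nat. (\<forall>i. be i = 0) \<and> be ~= (%_. 0)} = {}" by auto
 show ?thesis unfolding conv_split True cinv_0 le_zero_eq e using assms by simp
next
 case False
 then show ?thesis unfolding conv_split by (subst cinv.simps) (use assms in simp)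
qed

text \<open>Induction on the degree with the bound \<open>1 / c * K' ^ sum al UNIV\<close>. A term
  of the recursion with index \<open>be\<close> carries the factor
  \<open>(K / K') ^ sum be UNIV\<close>, which is at most \<open>t * (1/2) ^ sum be UNIV\<close>
  because \<open>be\<close> is not zero. \<open>M\<close> bounds the sum of the powers of
  \<open>1/2\<close>, and the smallness of \<open>t\<close> closes the induction.\<close>

lemma geometric_bound_cinv:
 fixes H :: "('m::finite => nat) => 'k::real_normed_field"
 assumes "geometric_bound C K H" and nz: "H (%_. 0) ~= 0"
 obtains C' K' where "geometric_bound C' K' (cinv H)"
proof -
 define M where "M = infsum (%al::'m => nat. (1/2::real) ^ sum al UNIV) UNIV"
 have M: "(\<Sum>al\<in>F. (1/2::real) ^ sum al UNIV) \<le> M" if "finite F" for F :: "('m => nat) set"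
  unfolding M_def by (rule finite_sum_le_infsum) (use that summable_multi_geometric[of "1/2"] in auto)
 have M0: "0 \<le> M" using M[of "{}"] by simp
 define c where "c = norm (H (%_. 0))"
 have c: "0 < c" using nz by (simp add: c_def)
 have CK: "0 \<le> C" "0 < K" "!!al. norm (H al) \<le> C * K ^ sum al UNIV"
  using assms(1) by (auto simp: geometric_bound_def)
 \<comment> \<open>This choice makes \<open>C / c * t * M\<close> at most 1; the summand 1 in the
   denominator also keeps \<open>t\<close> at most 1.\<close>
 define t where "t = 1 / (1 + C / c * M)"
 have CM: "0 \<le> C / c * M" using CK c M0 by simp
 have t: "0 < t" "t \<le> 1" "C / c * t * M \<le> 1"
 proof -
  have D: "0 < 1 + C / c * M" using CM by simp
  show "0 < t" unfolding t_def using D by simp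
  show "t \<le> 1" unfolding t_def using CM D by (simp only: divide_le_eq_1_pos)
  have "C / c * t * M = (C / c * M) / (1 + C / c * M)" by (simp add: t_def)
  also have "... \<le> 1" using D by (simp only: divide_le_eq_1_pos)
  finally show "C / c * t * M \<le> 1" .
 qed
 define K' where "K' = 2 * K / t"
 have K': "0 < K'" "K / K' = t / 2" using t CK by (simp_all add: K'_def)
 have "norm (cinv H al) \<le> 1 / c * K' ^ sum al UNIV" for al
 proof (induction al rule: measure_induct_rule[of "%al. sum al UNIV"])
  case (less al)
  show ?case
  proof (cases "al = (%_. 0)")
   case True
   then show ?thesis by (simp add: cinv_0 c_def norm_divide)
  next
   case False
   let ?S = "{be. (\<forall>i. be i \<le> al i) \<and> be ~= (%_. 0)}"
   have fS: "finite ?S" by (rule finite_subset[OF _ finite_below[of al]]) auto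
   have summand: "norm (H be * cinv H (%i. al i - be i)) \<le>
     C * t / c * K' ^ sum al UNIV * (1/2) ^ sum be UNIV" if b: "be \<in> ?S" for be
   proof -
    obtain i where "be i ~= 0" using b by auto
    then have pos: "0 < sum be UNIV" using degree_le[of be i] by simp
    have deg: "sum be UNIV + (\<Sum>i\<in>UNIV. al i - be i) = sum al UNIV" using b degree_diff by auto
    have "norm (H be * cinv H (%i. al i - be i)) \<le>
      (C * K ^ sum be UNIV) * (1 / c * K' ^ (\<Sum>i\<in>UNIV. al i - be i))"
     unfolding norm_mult using deg pos CK c
     by (intro mult_mono CK(3) less.IH) (auto simp: less_imp_le)
    also have "K ^ sum be UNIV = (t / 2) ^ sum be UNIV * K' ^ sum be UNIV"
     unfolding K'(2)[symmetric] power_divide using K' by simp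
    also have "C * ((t / 2) ^ sum be UNIV * K' ^ sum be UNIV) * (1 / c * K' ^ (\<Sum>i\<in>UNIV. al i - be i)) =
      t ^ sum be UNIV * (C / c * K' ^ sum al UNIV * (1/2) ^ sum be UNIV)"
     unfolding deg[symmetric] power_add by (simp add: power_divide field_simps)
    also have "... \<le> t * (C / c * K' ^ sum al UNIV * (1/2) ^ sum be UNIV)"
    proof (rule mult_right_mono)
     show "t ^ sum be UNIV \<le> t" using t pos power_decreasing[of 1 "sum be UNIV" t] by simp
    qed (use CK c K' in simp)
    finally show ?thesis by (simp add: field_simps)
   qed
   have "norm (cinv H al) = norm (\<Sum>be\<in>?S. H be * cinv H (%i. al i - be i)) / c"
    using False by (subst cinv.simps) (simp add: norm_divide c_def)
   also have "... \<le> (\<Sum>be\<in>?S. C * t / c * K' ^ sum al UNIV * (1/2) ^ sum be UNIV) / c"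
    using c summand by (intro divide_right_mono order_trans[OF norm_sum sum_mono]) auto
   also have "... = C * t / c * K' ^ sum al UNIV * (\<Sum>be\<in>?S. (1/2) ^ sum be UNIV) / c"
    by (simp add: sum_distrib_left)
   also have "... \<le> C * t / c * K' ^ sum al UNIV * M / c"
    using M[OF fS] CK t c K' by (intro divide_right_mono mult_left_mono) auto
   also have "... = (C / c * t * M) * (K' ^ sum al UNIV / c)" by simp
   also have "... \<le> 1 * (K' ^ sum al UNIV / c)"
    using t c K' by (intro mult_right_mono) auto
   finally show ?thesis by simp
  qed
 qed
 then show ?thesis using that[of "1 / c" K'] c K' by (simp add: geometric_bound_def)
qed

section \<open>Regular families of Taylor series\<close>

lemma taylor_smooth_iff:
 "taylor_smooth V f \<longleftrightarrow> (\<forall>al. continuous_on V (%p. f p al)) \<and>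
  (\<forall>al. \<forall>p\<in>V. \<forall>i. ((%z. f (p + axis i z) al) has_field_derivative dser i (f p) al) (at 0))"
 by (simp add: taylor_smooth_def dser_def)

lemma norm_axis [simp]: "norm (axis i (z::'k::real_normed_vector)) = norm z"
proof -
 have "norm (axis i z) = L2_set (%j. norm (axis i z $ j)) UNIV" by (simp add: norm_vec_def)
 also have "... = L2_set (%j. if j = i then norm z else 0) UNIV"
  by (rule L2_set_cong) (auto simp: axis_def)
 also have "... = norm z" by (simp add: L2_set_def sum.delta if_distrib[of "%x. x\<^sup>2"] cong: if_cong)
 finally show ?thesis .
qed

lemma axis_add: "axis i (z + w :: 'k::comm_monoid_add) = axis i z + axis i w"
 by (simp add: vec_eq_iff axis_def)

lemma axis_zero [simp]: "axis i (0 :: 'k::zero) = 0"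
 by (simp add: vec_eq_iff axis_def)

lemma norm_vec_le:
 fixes h :: "'k::real_normed_vector ^ 'm::finite"
 shows "norm h \<le> (\<Sum>i\<in>UNIV. norm (h $ i))"
 unfolding norm_vec_def by (rule L2_set_le_sum) auto

lemma eventually_axis_in:
 fixes p :: "'k::real_normed_vector ^ 'm::finite"
 assumes "open V" "p \<in> V"
 shows "\<forall>\<^sub>F z in nhds 0. p + axis i z \<in> V"
proof -
 obtain e where e: "e > 0" "ball p e <= V" using assms openE by blast
 have "\<forall>\<^sub>F z in nhds (0::'k). norm z < e"
  using e(1) eventually_nhds_metric[of "%z. norm z < e" 0] by auto
 then show ?thesis
  by (rule eventually_mono) (use e in \<open>auto simp: dist_norm\<close>)
qed

lemma taylor_smooth_cong:
 assumes "open V" "taylor_smooth V f" "!!p. p \<in> V ==> f p = g p"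
 shows "taylor_smooth V g"
 unfolding taylor_smooth_iff
proof (intro conjI allI ballI)
 fix al show "continuous_on V (%p. g p al)"
  using assms(2,3) unfolding taylor_smooth_iff by (metis (mono_tags, lifting) continuous_on_cong)
next
 fix al i p assume p: "p \<in> V"
 have "\<forall>\<^sub>F z in nhds 0. f (p + axis i z) al = g (p + axis i z) al"
  using eventually_axis_in[OF assms(1) p, of i] by (rule eventually_mono) (simp add: assms(3))
 moreover have "((%z. f (p + axis i z) al) has_field_derivative dser i (f p) al) (at 0)"
  using assms(2) p unfolding taylor_smooth_iff by blast
 ultimately show "((%z. g (p + axis i z) al) has_field_derivative dser i (g p) al) (at 0)"
  using assms(3)[OF p] DERIV_cong_ev[of 0 0 "%z. f (p + axis i z) al" "%z. g (p + axis i z) al"] by simp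
qed

lemma taylor_convergent_cong:
 assumes "open V" "taylor_convergent V f" "!!p. p \<in> V ==> f p = g p"
 shows "taylor_convergent V g"
 unfolding taylor_convergent_def
proof
 fix p assume p: "p \<in> V"
 obtain e where e: "e > 0" "ball p e <= V" using assms(1) p openE by blast
 obtain r where r: "r > 0" "\<forall>q\<in>ball p r.
   ((%al. f p al * (\<Prod>i\<in>UNIV. (q $ i - p $ i) ^ al i)) has_sum f q (%_. 0)) UNIV"
  using assms(2) p unfolding taylor_convergent_def by blast
 show "\<exists>r>0. \<forall>q\<in>ball p r.
   ((%al. g p al * (\<Prod>i\<in>UNIV. (q $ i - p $ i) ^ al i)) has_sum g q (%_. 0)) UNIV"
 proof (intro exI[of _ "min e r"] conjI ballI)
  fix q assume q: "q \<in> ball p (min e r)"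
  then have "f q = g q" using e assms(3) by auto
  moreover have "((%al. f p al * (\<Prod>i\<in>UNIV. (q $ i - p $ i) ^ al i)) has_sum f q (%_. 0)) UNIV"
   using q r(2) by simp
  ultimately show "((%al. g p al * (\<Prod>i\<in>UNIV. (q $ i - p $ i) ^ al i)) has_sum g q (%_. 0)) UNIV"
   using assms(3)[OF p] by simp
 qed (use e r in auto)
qed

text \<open>Derivatives look at neighbouring base points, whence the openness. The recurring
  condition \<open>C = Formal \<or> open V\<close> is openness in the model space, which is discrete
  in the formal category.\<close>

lemma regular_cong:
 assumes "C = Formal \<or> open V" "regular C V f" "!!p. p \<in> V ==> f p = g p"
 shows "regular C V g"
 using assms taylor_smooth_cong[of V f g] taylor_convergent_cong[of V f g] by (cases C) auto

lemma regular_mono: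
 assumes "regular C V f" "W <= V"
 shows "regular C W f"
proof -
 have "taylor_smooth V f ==> taylor_smooth W f" "taylor_convergent V f ==> taylor_convergent W f"
  using assms(2) unfolding taylor_smooth_def taylor_convergent_def
  by (meson continuous_on_subset in_mono)+
 then show ?thesis using assms(1) by (cases C) auto
qed

lemma regular_zero: "regular C V (%p al. 0)"
proof -
 have "taylor_smooth V (%p al. 0)" by (auto simp: taylor_smooth_def)
 moreover have "taylor_convergent V (%p al. 0)"
  unfolding taylor_convergent_def by (auto intro!: exI[of _ 1])
 ultimately show ?thesis by (cases C) auto
qed

lemma regular_const: "regular C V (%p al. if al = (%_. 0) then x else 0)"
proof -
 have ne: "al(i := Suc (al i)) ~= (%_. 0)" for al :: "'b => nat" and i
  by (metis fun_upd_same nat.distinct(1))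
 have "taylor_smooth V (%p al. if al = (%_. 0) then x else 0)"
  by (auto simp: taylor_smooth_def ne)
 moreover have "taylor_convergent V (%p al. if al = (%_. 0) then x else 0)"
  unfolding taylor_convergent_def
 proof (intro ballI exI[of _ 1] conjI)
  fix p q :: "'a ^ 'b"
  have "((%al. (if al = (%_. 0) then x else 0) * (\<Prod>i\<in>UNIV. (q $ i - p $ i) ^ al i)) has_sum x) {%_. 0}"
   using has_sum_finite[of "{%_. 0}" "%al. (if al = (%_. 0) then x else 0) * (\<Prod>i\<in>UNIV. (q $ i - p $ i) ^ al i)"]
   by simp
  then have "((%al. (if al = (%_. 0) then x else 0) * (\<Prod>i\<in>UNIV. (q $ i - p $ i) ^ al i)) has_sum x) UNIV"
   by (subst has_sum_cong_neutral[of _ _ _ "%al. (if al = (%_. 0) then x else 0) * (\<Prod>i\<in>UNIV. (q $ i - p $ i) ^ al i)"]) auto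
  then show "((%al. (if al = (%_. 0) then x else 0) * (\<Prod>i\<in>UNIV. (q $ i - p $ i) ^ al i)) has_sum
    (if (%_. 0) = (%_. 0) then x else 0)) UNIV" by simp
 qed auto
 ultimately show ?thesis by (cases C) auto
qed

lemma taylor_smooth_linear:
 assumes "taylor_smooth V f" "taylor_smooth V g"
 shows "taylor_smooth V (%p al. c * f p al + g p al)"
 unfolding taylor_smooth_iff
proof (intro conjI allI ballI)
 fix al show "continuous_on V (%p. c * f p al + g p al)"
  using assms unfolding taylor_smooth_iff by (intro continuous_intros) auto
next
 fix al i p assume p: "p \<in> V"
 have e: "dser i (%al. c * f p al + g p al) al = c * dser i (f p) al + dser i (g p) al"
  by (simp add: dser_def algebra_simps)
 show "((%z. c * f (p + axis i z) al + g (p + axis i z) al) has_field_derivative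
   dser i (%al. c * f p al + g p al) al) (at 0)"
  unfolding e using assms p unfolding taylor_smooth_iff
  by (intro DERIV_add DERIV_cmult) auto
qed

lemma taylor_convergent_linear:
 assumes "taylor_convergent V f" "taylor_convergent V g"
 shows "taylor_convergent V (%p al. c * f p al + g p al)"
 unfolding taylor_convergent_def
proof
 fix p assume p: "p \<in> V"
 let ?m = "%q al. \<Prod>i\<in>UNIV. (q $ i - p $ i) ^ al i"
 obtain r where r: "r > 0" "\<forall>q\<in>ball p r. ((%al. f p al * ?m q al) has_sum f q (%_. 0)) UNIV"
  using assms(1) p unfolding taylor_convergent_def by blast
 obtain s where s: "s > 0" "\<forall>q\<in>ball p s. ((%al. g p al * ?m q al) has_sum g q (%_. 0)) UNIV"
  using assms(2) p unfolding taylor_convergent_def by blast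
 show "\<exists>r>0. \<forall>q\<in>ball p r. ((%al. (c * f p al + g p al) * ?m q al) has_sum
   c * f q (%_. 0) + g q (%_. 0)) UNIV"
 proof (intro exI[of _ "min r s"] conjI ballI)
  fix q assume "q \<in> ball p (min r s)"
  then have "((%al. c * (f p al * ?m q al) + g p al * ?m q al) has_sum
    c * f q (%_. 0) + g q (%_. 0)) UNIV"
   using r s by (intro has_sum_add has_sum_cmult_right) auto
  then show "((%al. (c * f p al + g p al) * ?m q al) has_sum c * f q (%_. 0) + g q (%_. 0)) UNIV"
   by (simp add: algebra_simps)
 qed (use r s in auto)
qed

lemma regular_linear:
 assumes "regular C V f" "regular C V g"
 shows "regular C V (%p al. c * f p al + g p al)"
 using assms taylor_smooth_linear taylor_convergent_linear by (cases C) auto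

lemma regular_sum:
 assumes "finite S" "!!a. a \<in> S ==> regular C V (f a)"
 shows "regular C V (%p al. \<Sum>a\<in>S. c a * f a p al)"
 using assms
proof (induction S)
 case empty
 show ?case by (simp add: regular_zero)
next
 case (insert x S)
 then show ?case using regular_linear[of C V "f x" "%p al. \<Sum>a\<in>S. c a * f a p al" "c x"] by simp
qed

subsection \<open>Directional derivatives\<close>

text \<open>\<open>taylor_smooth\<close> provides only partial derivatives and their continuity. The
  increment along \<open>v\<close> is therefore built up one coordinate at a time, as in the proof
  that continuous partial derivatives imply differentiability.\<close>

lemma taylor_smooth_directional:
 fixes f :: "'k::{real_normed_field,banach}^'m::finite => ('m => nat) => 'k"
 assumes V: "open V" and f: "taylor_smooth V f" and p: "p \<in> V"
 shows "((%z. f (p + (\<chi> i. z * v i)) al) has_field_derivative dlin v (f p) al) (at 0)"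
proof -
 have "((%z. f (p + (\<chi> i. if i \<in> S then z * v i else 0)) al) has_field_derivative
   (\<Sum>a\<in>S. v a * dser a (f p) al)) (at 0)" if "finite S" for S :: "'m set"
  using that
 proof (induction S)
  case empty
  have "(%z. f (p + (\<chi> i. if i \<in> {} then z * v i else 0)) al) = (%z. f p al)"
   by (simp add: vec_eq_iff flip: zero_vec_def)
  then show ?case by simp
 next
  case (insert a S)
  let ?\<sigma> = "%z. (\<chi> i. if i \<in> S then z * v i else 0) :: 'k^'m"
  let ?E = "%z. f (p + ?\<sigma> z + axis a (z * v a)) al - f (p + ?\<sigma> z) al"
  let ?D = "dser a (f p) al"
  \<comment> \<open>When \<open>norm z * N < \<delta>\<close>, all points visited while coordinate
    \<open>a\<close> is moved lie within \<open>\<delta>\<close> of \<open>p\<close>; the summand 1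
    keeps \<open>N\<close> positive.\<close>
  define N where "N = 1 + (\<Sum>i\<in>UNIV. norm (v i)) + norm (v a)"
  have N: "N > 0" unfolding N_def by (intro add_pos_nonneg sum_nonneg) auto
  have \<sigma>: "norm (?\<sigma> z) \<le> norm z * (\<Sum>i\<in>UNIV. norm (v i))" for z
  proof -
   have "norm (?\<sigma> z) \<le> (\<Sum>i\<in>UNIV. norm z * norm (v i))"
    by (rule order_trans[OF norm_vec_le sum_mono]) (auto simp: norm_mult)
   then show ?thesis by (simp add: sum_distrib_left)
  qed
  have "(?E has_field_derivative v a * ?D) (at 0)"
   unfolding has_field_derivative_def has_derivative_at_alt
  proof (intro conjI allI impI)
   show "bounded_linear ((*) (v a * ?D))" by (rule bounded_linear_mult_right)
   fix e :: real assume e: "e > 0"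
   have va: "0 < 1 + norm (v a)" by (simp add: add_pos_nonneg)
   define e' where "e' = e / (1 + norm (v a))"
   have e': "e' > 0" "e' * norm (v a) \<le> e"
    using e va by (simp_all add: e'_def divide_le_eq mult_left_mono algebra_simps)
   have "continuous_on V (%q. dser a (f q) al)"
    using f unfolding taylor_smooth_iff dser_def by (intro continuous_intros) auto
   then have "isCont (%q. dser a (f q) al) p"
    using V p by (simp add: continuous_on_eq_continuous_at)
   then obtain \<delta>1 where \<delta>1: "\<delta>1 > 0" "!!q. dist q p < \<delta>1 ==> dist (dser a (f q) al) ?D < e'"
    using e' unfolding continuous_at_eps_delta by blast
   obtain \<delta>2 where \<delta>2: "\<delta>2 > 0" "ball p \<delta>2 <= V" using V p openE by blast
   define \<delta> where "\<delta> = min \<delta>1 \<delta>2"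
   show "\<exists>d>0. \<forall>z. norm (z - 0) < d -->
     norm (?E z - ?E 0 - v a * ?D * (z - 0)) \<le> e * norm (z - 0)"
   proof (intro exI[of _ "\<delta> / N"] conjI allI impI)
    show "\<delta> / N > 0" using \<delta>1 \<delta>2 N by (simp add: \<delta>_def)
    fix z :: 'k assume z: "norm (z - 0) < \<delta> / N"
    then have zN: "norm z * N < \<delta>" using N by (simp add: pos_less_divide_eq)
    let ?q = "p + ?\<sigma> z"
    have near: "dist (?q + axis a w) p < \<delta>" if w: "w \<in> cball 0 (norm (z * v a))" for w
    proof -
     have "dist (?q + axis a w) p = norm (?\<sigma> z + axis a w)" by (simp add: dist_norm add.assoc)
     also have "... \<le> norm z * (\<Sum>i\<in>UNIV. norm (v i)) + norm z * norm (v a)"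
      using w by (intro order_trans[OF norm_triangle_ineq] add_mono \<sigma>) (auto simp: norm_mult)
     also have "... \<le> norm z * N" by (simp add: N_def distrib_left)
     finally show ?thesis using zN by simp
    qed
    \<comment> \<open>Subtracting the linear term leaves a function of \<open>w\<close> whose
      derivative is small by continuity of the partial derivative, so the mean value inequality
      applies.\<close>
    let ?u = "%w. f (?q + axis a w) al - w * ?D"
    have "norm (?u (z * v a) - ?u 0) \<le> e' * norm (z * v a - 0)"
    proof (rule field_differentiable_bound)
     show "convex (cball (0::'k) (norm (z * v a)))" by simp
     fix w assume w: "w \<in> cball (0::'k) (norm (z * v a))"
     have q: "?q + axis a w \<in> V" using near[OF w] \<delta>2 by (auto simp: \<delta>_def dist_commute)
     have "((%x. f (?q + axis a w + axis a x) al) has_field_derivative dser a (f (?q + axis a w)) al) (at 0)"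
      using f q unfolding taylor_smooth_iff by blast
     then have "((%x. f (?q + axis a (x + w)) al) has_field_derivative dser a (f (?q + axis a w)) al) (at 0)"
      by (simp add: axis_add add_ac)
     then have "((%x. f (?q + axis a x) al) has_field_derivative dser a (f (?q + axis a w)) al) (at w)"
      using DERIV_shift[of "%x. f (?q + axis a x) al" _ 0 w] by simp
     then show "(?u has_field_derivative dser a (f (?q + axis a w)) al - 1 * ?D)
       (at w within cball 0 (norm (z * v a)))"
      by (intro DERIV_subset[OF DERIV_diff] DERIV_cmult_right DERIV_ident) auto
     show "norm (dser a (f (?q + axis a w)) al - 1 * ?D) \<le> e'"
      using \<delta>1(2)[of "?q + axis a w"] near[OF w] by (simp add: \<delta>_def dist_norm)
    qed auto
    also have "... \<le> e * norm z"
    proof -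
     show ?thesis using mult_right_mono[OF e'(2), of "norm z"] by (simp add: norm_mult mult_ac)
    qed
    finally show "norm (?E z - ?E 0 - v a * ?D * (z - 0)) \<le> e * norm (z - 0)"
     by (simp add: algebra_simps)
   qed
  qed
  then have "((%z. ?E z + f (p + ?\<sigma> z) al) has_field_derivative
    v a * ?D + (\<Sum>a\<in>S. v a * dser a (f p) al)) (at 0)"
   by (rule DERIV_add[OF _ insert.IH])
  moreover have "?E z + f (p + ?\<sigma> z) al = f (p + (\<chi> i. if i \<in> insert a S then z * v i else 0)) al" for z
  proof -
   have "?\<sigma> z + axis a (z * v a) = (\<chi> i. if i \<in> insert a S then z * v i else 0)"
    using insert.hyps by (auto simp: vec_eq_iff axis_def)
   then show ?thesis by (simp add: add.assoc)
  qed
  ultimately show ?case using insert.hyps by simp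
 qed
 from this[of UNIV] show ?thesis by (simp add: dlin_def)
qed

text \<open>Along the line through \<open>p\<close> and \<open>q\<close>, the difference between the
  function and its linear candidate has derivative zero. The parameters in the ground field for
  which the line stays in the ball form a convex set containing 0 and 1.\<close>

lemma taylor_smooth_affine:
 fixes f :: "'k::{real_normed_field,banach}^'m::finite => ('m => nat) => 'k"
 assumes f: "taylor_smooth (ball p r) f"
  and c: "!!q i. q \<in> ball p r ==> dser i (f q) (%_. 0) = c i" and q: "q \<in> ball p r"
 shows "f q (%_. 0) = f p (%_. 0) + (\<Sum>i\<in>UNIV. (q $ i - p $ i) * c i)"
proof -
 define v where "v = (%i. q $ i - p $ i)"
 define S where "S = (%z. p + (\<chi> i. z * v i)) -` ball p r"
 have nz: "norm ((\<chi> i. z * v i) :: 'k^'m) = norm z * norm (q - p)" for z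
  by (simp add: norm_vec_def norm_mult L2_set_right_distrib v_def)
 have S: "S = {z. norm z * norm (q - p) < r}" by (auto simp: S_def dist_norm nz)
 have conv: "convex S"
 proof (cases "q = p")
  case True
  then show ?thesis using q unfolding S by (cases "r > 0") auto
 next
  case False
  then have "S = ball 0 (r / norm (q - p))" unfolding S by (auto simp: pos_less_divide_eq)
  then show ?thesis by simp
 qed
 let ?u = "%z. f (p + (\<chi> i. z * v i)) (%_. 0) - z * (\<Sum>i\<in>UNIV. v i * c i)"
 have "\<exists>c. \<forall>x\<in>S. ?u x = c"
 proof (rule has_field_derivative_zero_constant[OF conv])
  fix z assume z: "z \<in> S"
  then have zq: "p + (\<chi> i. z * v i) \<in> ball p r" by (simp add: S_def)
  have "((%x. f (p + (\<chi> i. z * v i) + (\<chi> i. x * v i)) (%_. 0)) has_field_derivative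
    dlin v (f (p + (\<chi> i. z * v i))) (%_. 0)) (at 0)"
   by (rule taylor_smooth_directional[OF open_ball f zq])
  moreover have "p + (\<chi> i. z * v i) + (\<chi> i. x * v i) = p + (\<chi> i. (x + z) * v i)" for x
   by (simp add: vec_eq_iff algebra_simps)
  ultimately have "((%x. f (p + (\<chi> i. (x + z) * v i)) (%_. 0)) has_field_derivative
    (\<Sum>i\<in>UNIV. v i * c i)) (at 0)"
   using c[OF zq] by (simp add: dlin_def)
  then have "((%x. f (p + (\<chi> i. x * v i)) (%_. 0)) has_field_derivative (\<Sum>i\<in>UNIV. v i * c i)) (at z)"
   using DERIV_shift[of "%x. f (p + (\<chi> i. x * v i)) (%_. 0)" _ 0 z] by simp
  then have "(?u has_field_derivative (\<Sum>i\<in>UNIV. v i * c i) - 1 * (\<Sum>i\<in>UNIV. v i * c i)) (at z within S)"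
   by (intro DERIV_subset[OF DERIV_diff] DERIV_cmult_right DERIV_ident) auto
  then show "(?u has_field_derivative 0) (at z within S)" by simp
 qed
 moreover have "0 \<in> S" "1 \<in> S" using q unfolding S by (auto simp: dist_norm norm_minus_commute
   intro: le_less_trans[OF norm_ge_zero])
 ultimately have "?u 1 = ?u 0" by metis
 moreover have "p + (\<chi> i. 1 * v i) = q" "p + (\<chi> i. 0 * v i) = p" by (simp_all add: v_def vec_eq_iff)
 ultimately show ?thesis by (simp add: v_def algebra_simps)
qed

subsection \<open>Derivatives of regular families\<close>

lemma taylor_smooth_dser:
 assumes "taylor_smooth V f"
 shows "taylor_smooth V (%p. dser i (f p))"
 unfolding taylor_smooth_iff
proof (intro conjI allI ballI)
 fix al show "continuous_on V (%p. dser i (f p) al)"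
  using assms unfolding taylor_smooth_iff dser_def by (intro continuous_intros) auto
next
 fix al l p assume p: "p \<in> V"
 have "((%z. of_nat (Suc (al i)) * f (p + axis l z) (al(i := Suc (al i)))) has_field_derivative
   of_nat (Suc (al i)) * dser l (f p) (al(i := Suc (al i)))) (at 0)"
  using assms p unfolding taylor_smooth_iff by (intro DERIV_cmult) auto
 moreover have "dser l (dser i (f p)) al = of_nat (Suc (al i)) * dser l (f p) (al(i := Suc (al i)))"
  unfolding dser_commute[of l i] by (simp only: dser_def[of i])
 ultimately show "((%z. dser i (f (p + axis l z)) al) has_field_derivative dser l (dser i (f p)) al) (at 0)"
  by (simp only: dser_def[of i])
qed

text \<open>The terms of the sum at a point with all coordinates equal to \<open>\<rho>\<close> are
  bounded, which is Cauchy's estimate with ratio \<open>1 / \<rho>\<close>.\<close>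

lemma taylor_convergent_bound:
 fixes f :: "'k::{real_normed_field,banach}^'m::finite => ('m => nat) => 'k"
 assumes "taylor_convergent V f" "p \<in> V"
 obtains r C K where "r > 0" "geometric_bound C K (f p)"
  "!!h. norm h < r ==> ((%al. f p al * multi_power (%i. h $ i) al) has_sum f (p + h) (%_. 0)) UNIV"
proof -
 obtain r where r: "r > 0" "\<forall>q\<in>ball p r.
   ((%al. f p al * (\<Prod>i\<in>UNIV. (q $ i - p $ i) ^ al i)) has_sum f q (%_. 0)) UNIV"
  using assms unfolding taylor_convergent_def by blast
 have s: "((%al. f p al * multi_power (%i. h $ i) al) has_sum f (p + h) (%_. 0)) UNIV" if "norm h < r" for h
 proof -
  have "p + h \<in> ball p r" using that by (simp add: dist_norm)
  then show ?thesis using r(2) by (force simp: multi_power_def)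
 qed
 \<comment> \<open>The norm is at most the sum of the coordinate norms, so the point with all
   coordinates \<open>\<rho>\<close> has norm at most \<open>r / 2\<close>.\<close>
 define \<rho> where "\<rho> = r / (2 * real CARD('m))"
 have \<rho>: "\<rho> > 0" using r by (simp add: \<rho>_def)
 let ?h = "(\<chi> i. of_real \<rho>) :: 'k^'m"
 have "norm ?h \<le> real CARD('m) * \<rho>" using norm_vec_le[of ?h] \<rho> by simp
 also have "... < r" using r by (simp add: \<rho>_def)
 finally have "norm ?h < r" .
 from s[OF this] obtain B where B: "!!al. norm (f p al * multi_power (%i. ?h $ i) al) \<le> B" "0 \<le> B"
  using has_sum_bounded by blast
 have "geometric_bound B (1 / \<rho>) (f p)"
  unfolding geometric_bound_def
 proof (intro conjI allI)
  fix al :: "'m => nat"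
  have "norm (f p al) * \<rho> ^ sum al UNIV \<le> B"
   using B(1)[of al] \<rho> by (simp add: multi_power_const norm_mult norm_power)
  then show "norm (f p al) \<le> B * (1 / \<rho>) ^ sum al UNIV"
   using \<rho> by (simp add: power_one_over field_simps)
 qed (use B \<rho> in auto)
 then show ?thesis using that r(1) s by blast
qed

lemma taylor_convergentI:
 fixes f :: "'k::{real_normed_field,banach}^'m::finite => ('m => nat) => 'k"
 assumes "!!p. p \<in> V ==> \<exists>r>0. \<forall>h. norm h < r -->
  (%al. norm (f p al * multi_power (%i. h $ i) al)) summable_on UNIV \<and>
  level_sum (f p) (%i. h $ i) sums f (p + h) (%_. 0)"
 shows "taylor_convergent V f"
 unfolding taylor_convergent_def
proof
 fix p assume "p \<in> V"
 then obtain r where r: "r > 0" "!!h. norm h < r ==>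
  (%al. norm (f p al * multi_power (%i. h $ i) al)) summable_on UNIV \<and>
  level_sum (f p) (%i. h $ i) sums f (p + h) (%_. 0)"
  using assms by meson
 show "\<exists>r>0. \<forall>q\<in>ball p r.
   ((%al. f p al * (\<Prod>i\<in>UNIV. (q $ i - p $ i) ^ al i)) has_sum f q (%_. 0)) UNIV"
 proof (intro exI[of _ r] conjI ballI r(1))
  fix q assume "q \<in> ball p r"
  then have "norm (q - p) < r" by (simp add: dist_norm norm_minus_commute)
  from r(2)[OF this] show "((%al. f p al * (\<Prod>i\<in>UNIV. (q $ i - p $ i) ^ al i)) has_sum f q (%_. 0)) UNIV"
   using abs_summable_has_sum[of "%al. f p al * multi_power (%i. (q - p) $ i) al"]
   unfolding level_sum_def multi_power_def by simp
 qed
qed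

text \<open>The expansion at \<open>p\<close> is differentiated term by term in the coordinate
  \<open>i\<close>, by uniform convergence of the degree sums. By smoothness the derivative obtained
  is the first-order coefficient of the expansion at \<open>p + h\<close>.\<close>

lemma taylor_convergent_dser:
 fixes f :: "'k::{real_normed_field,banach}^'m::finite => ('m => nat) => 'k"
 assumes V: "open V" and smooth: "taylor_smooth V f" and f: "taylor_convergent V f"
 shows "taylor_convergent V (%p. dser i (f p))"
proof (rule taylor_convergentI)
 fix p assume p: "p \<in> V"
 obtain r C K where rCK: "r > 0" "geometric_bound C K (f p)"
  "!!h. norm h < r ==> ((%al. f p al * multi_power (%i. h $ i) al) has_sum f (p + h) (%_. 0)) UNIV"
  by (rule taylor_convergent_bound[OF f p]) (rule that)
 have K: "K > 0" using rCK(2) by (simp add: geometric_bound_def)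
 obtain e where e: "e > 0" "ball p e <= V" using V p openE by blast
 \<comment> \<open>\<open>h\<close> and the variation \<open>w\<close> each use up
   \<open>1 / (8 * K)\<close>, so together they stay within \<open>1 / (4 * K)\<close>, where the
   derived series with ratio \<open>2 * K\<close> converges; \<open>r / 2\<close> likewise leaves
   room for both in the original radius.\<close>
 define s where "s = min e (min (r / 2) (1 / (8 * K)))"
 have s: "s > 0" "s \<le> e" "s \<le> r / 2" "s \<le> 1 / (8 * K)" using e rCK K by (auto simp: s_def)
 have gb: "geometric_bound (C * K) (2 * K) (dser i (f p))" by (rule geometric_bound_dser[OF rCK(2)])
 have Kt: "2 * K * (1 / (4 * K)) < 1" "0 \<le> 1 / (4 * K)" using K by simp_all
 show "\<exists>r>0. \<forall>h. norm h < r -->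
   (%al. norm (dser i (f p) al * multi_power (%i. h $ i) al)) summable_on UNIV \<and>
   level_sum (dser i (f p)) (%i. h $ i) sums dser i (f (p + h)) (%_. 0)"
 proof (intro exI[of _ s] conjI allI impI s(1))
  fix h :: "'k^'m" assume h: "norm h < s"
  have hj: "norm (h $ j) \<le> 1 / (8 * K)" for j
   using h s(4) Finite_Cartesian_Product.norm_nth_le[of h j] by linarith
  have le: "1 / (8 * K) \<le> 1 / (4 * K)" using K by (simp add: frac_le)
  show "(%al. norm (dser i (f p) al * multi_power (%i. h $ i) al)) summable_on UNIV"
   by (rule geometric_bound_summable[OF gb _ Kt(2) Kt(1)]) (use hj le order_trans in blast)
  define hw where "hw = (%w j. if j = i then h $ j + w else h $ j)"
  have hw: "norm (hw w j) \<le> 1 / (4 * K)" if "w \<in> ball 0 s" for w j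
  proof -
   have "norm (hw w j) \<le> norm (h $ j) + norm w"
    unfolding hw_def by (simp add: norm_triangle_ineq)
   also have "... \<le> 1 / (8 * K) + 1 / (8 * K)" using hj that s(4) by (intro add_mono) auto
   finally show ?thesis by (simp add: field_simps)
  qed
  have hwv: "hw w = (%j. (h + axis i w) $ j)" for w by (auto simp: hw_def axis_def)
  let ?F = "%n w. level_sum (f p) (hw w) n"
  \<comment> \<open>The part of degree 0 is constant in \<open>w\<close>, and differentiation lowers
    the degree by one.\<close>
  let ?F' = "%n w. case n of 0 => 0 | Suc m => level_sum (dser i (f p)) (hw w) m"
  have deriv: "(?F n has_field_derivative ?F' n w) (at w within ball 0 s)" for n w
  proof (cases n)
   case 0
   then show ?thesis by (simp add: level_sum_0)
  next
   case (Suc m)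
   define P where "P = (%al::'m => nat. \<Prod>j\<in>UNIV - {i}. (h $ j) ^ al j)"
   have mp: "multi_power (hw w) al = (h $ i + w) ^ al i * P al" for w al
   proof -
    have "(\<Prod>j\<in>UNIV - {i}. hw w j ^ al j) = P al"
     unfolding P_def hw_def by (rule prod.cong) auto
    then show ?thesis unfolding multi_power_def by (simp add: prod.remove[of UNIV i] hw_def)
   qed
   have Pu: "P (be(i := Suc (be i))) = P be" for be unfolding P_def by (rule prod.cong) auto
   have "((%w. \<Sum>al\<in>multi_level n. f p al * ((h $ i + w) ^ al i * P al)) has_field_derivative
     (\<Sum>al\<in>multi_level n. f p al * (of_nat (al i) * (h $ i + w) ^ (al i - 1) * P al))) (at w within ball 0 s)"
    by (auto intro!: derivative_eq_intros simp: mult_ac)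
   also have "(\<Sum>al\<in>multi_level n. f p al * (of_nat (al i) * (h $ i + w) ^ (al i - 1) * P al)) =
     (\<Sum>al\<in>multi_level (Suc m). of_nat (al i) * (f p al * (h $ i + w) ^ (al i - 1) * P al))"
    unfolding Suc by (intro sum.cong) (auto simp: mult_ac)
   also have "... = level_sum (dser i (f p)) (hw w) m"
    unfolding level_shift Pu level_sum_def mp dser_def
    by (intro sum.cong refl) (simp add: mult_ac del: of_nat_Suc)
   finally show ?thesis unfolding level_sum_def[of "f p"] mp using Suc by simp
  qed
  have sumF: "(%n. ?F n w) sums f (p + (h + axis i w)) (%_. 0)" if w: "w \<in> ball 0 s" for w
  proof -
   have "norm (h + axis i w) < r"
    using norm_triangle_ineq[of h "axis i w"] h w s(3) by auto
   from has_sum_levels[OF rCK(3)[OF this]] show ?thesis unfolding level_sum_def hwv .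
  qed
  have M: "summable (%n. case n of 0 => 0 | Suc m => \<Sum>al\<in>multi_level m. norm (dser i (f p) al) * (1 / (4 * K)) ^ m)"
   (is "summable ?M")
   by (subst summable_Suc_iff[symmetric]) (use geometric_bound_level_summable[OF gb Kt(2) Kt(1)] in simp)
  have unif: "uniformly_convergent_on (ball 0 s) (%n w. \<Sum>m<n. ?F' m w)"
  proof (rule Weierstrass_m_test'[OF _ M])
   fix n w assume "w \<in> ball (0::'k) s"
   then show "norm (?F' n w) \<le> ?M n"
    using level_sum_norm_le[of "hw w" "1 / (4 * K)"] hw Kt(2) by (cases n) auto
  qed
  have zero: "(0::'k) \<in> ball 0 s" using s by simp
  have "((%w. \<Sum>n. ?F n w) has_field_derivative (\<Sum>n. ?F' n 0)) (at 0)"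
   by (rule has_field_derivative_series'(2)[OF convex_ball deriv unif zero sums_summable[OF sumF[OF zero]]])
    (use s in auto)
  then have "((%w. f (p + (h + axis i w)) (%_. 0)) has_field_derivative (\<Sum>n. ?F' n 0)) (at 0)"
   by (rule has_field_derivative_transform_within_open[OF _ open_ball zero])
    (use sumF in \<open>auto simp: sums_iff\<close>)
  moreover have "p + h \<in> V" using h s(2) e by (auto simp: dist_norm)
  then have "((%w. f (p + h + axis i w) (%_. 0)) has_field_derivative dser i (f (p + h)) (%_. 0)) (at 0)"
   using smooth unfolding taylor_smooth_iff by blast
  ultimately have eq: "(\<Sum>n. ?F' n 0) = dser i (f (p + h)) (%_. 0)"
   using DERIV_unique by (simp add: add.assoc) blast
  have "summable (%n. ?F' n 0)"
  proof (rule summable_comparison_test'[OF M])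
   show "norm (?F' n 0) \<le> ?M n" for n
    using level_sum_norm_le[of "hw 0" "1 / (4 * K)"] hw[OF zero] Kt(2) by (cases n) auto
  qed
  then have "(%n. ?F' n 0) sums dser i (f (p + h)) (%_. 0)" using eq by (simp add: sums_iff)
  then have "(%n. ?F' (Suc n) 0) sums (dser i (f (p + h)) (%_. 0) - ?F' 0 0)"
   by (simp only: sums_Suc_iff diff_add_cancel)
  then show "level_sum (dser i (f p)) (%i. h $ i) sums dser i (f (p + h)) (%_. 0)"
   by (simp add: hwv)
 qed
qed

lemma regular_dser:
 assumes "C = Formal \<or> open V" "regular C V f"
 shows "regular C V (%p. dser i (f p))"
 using assms taylor_smooth_dser taylor_convergent_dser by (cases C) auto

lemma regular_dlin:
 assumes "C = Formal \<or> open V" "regular C V f"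
 shows "regular C V (%p. dlin v (f p))"
 unfolding dlin_def[abs_def] by (intro regular_sum regular_dser assms) auto

lemma regular_dpow:
 assumes "C = Formal \<or> open V" "regular C V f"
 shows "regular C V (%p. dpow g be us (f p))"
proof -
 have 1: "regular C V (%p. (dlin v ^^ k) (f p))" if "regular C V f" for v k f
  using that by (induction k) (auto intro: regular_dlin[OF assms(1)])
 show ?thesis unfolding dpow_def
  by (induction us) (auto simp: assms(2) intro: 1)
qed

subsection \<open>Affine substitutions and inverses\<close>

text \<open>By \<open>dser_esub\<close> a partial derivative of the substituted series is the
  substitution of a directional derivative, so smoothness reduces to
  \<open>taylor_smooth_directional\<close>. Convergence follows from the majorant estimate and
  \<open>level_sum_esub\<close>.\<close>

lemma regular_esub:
 fixes f :: "'k::{real_normed_field,banach}^'m::finite => ('m => nat) => 'k"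
 assumes V: "C = Formal \<or> open V" and f: "regular C V f"
  and \<psi>: "!!q h. \<psi> (q + h) = \<psi> q + (\<chi> a. \<Sum>b\<in>UNIV. h $ b * g b a)"
 shows "regular C (\<psi> -` V) (%q. esub g (f (\<psi> q)))"
proof -
 have \<psi>0: "\<psi> = (%q. \<psi> 0 + (\<chi> a. \<Sum>b\<in>UNIV. q $ b * g b a))"
 proof
  fix q show "\<psi> q = \<psi> 0 + (\<chi> a. \<Sum>b\<in>UNIV. q $ b * g b a)"
   using \<psi>[of 0 q] by (simp only: add_0_left)
 qed
 have cont: "continuous_on S \<psi>" for S
  by (subst \<psi>0) (intro continuous_intros)
 have \<psi>axis: "\<psi> (q + axis b z) = \<psi> q + (\<chi> a. z * g b a)" for q b z
  unfolding \<psi> by (simp add: axis_def if_distrib[of "%x. x * _"] sum.delta cong: if_cong)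
 have s: "taylor_smooth (\<psi> -` V) (%q. esub g (f (\<psi> q)))" if o: "open V" and sf: "taylor_smooth V f"
  unfolding taylor_smooth_iff
 proof (intro conjI allI ballI)
  fix be
  have "taylor_smooth V (%p. dpow g be enum_list (f p))"
   using regular_dpow[of Smooth V f g be] o sf by simp
  then have c: "continuous_on V (%p. dpow g be enum_list (f p) (%_. 0))"
   unfolding taylor_smooth_iff by blast
  show "continuous_on (\<psi> -` V) (%q. esub g (f (\<psi> q)) be)"
   unfolding esub_def
   by (intro continuous_on_divide continuous_on_const continuous_on_compose2[OF c cont]) (auto simp: fact_prod)
 next
  fix be q b assume q: "q \<in> \<psi> -` V"
  let ?f = "%p. dpow g be enum_list (f p)" and ?c = "of_nat (\<Prod>i\<in>UNIV. fact (be i)) :: 'k"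
  have "taylor_smooth V ?f" using regular_dpow[of Smooth V f g be] o sf by simp
  then have "((%z. ?f (\<psi> q + (\<chi> a. z * g b a)) (%_. 0)) has_field_derivative dlin (g b) (?f (\<psi> q)) (%_. 0)) (at 0)"
   using taylor_smooth_directional[OF o, of ?f "\<psi> q" "g b"] q by simp
  then have "((%z. ?f (\<psi> (q + axis b z)) (%_. 0) / ?c) has_field_derivative
    dlin (g b) (?f (\<psi> q)) (%_. 0) / ?c) (at 0)"
   unfolding \<psi>axis by (rule DERIV_cdivide)
  then show "((%z. esub g (f (\<psi> (q + axis b z))) be) has_field_derivative dser b (esub g (f (\<psi> q))) be) (at 0)"
   unfolding dser_esub by (simp only: esub_def dlin_dpow)
 qed
 have c: "taylor_convergent (\<psi> -` V) (%q. esub g (f (\<psi> q)))" if cf: "taylor_convergent V f"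
 proof (rule taylor_convergentI)
  fix q assume "q \<in> \<psi> -` V"
  then have p: "\<psi> q \<in> V" by simp
  obtain r C K where rCK: "r > 0" "geometric_bound C K (f (\<psi> q))"
   "!!h. norm h < r ==> ((%al. f (\<psi> q) al * multi_power (%i. h $ i) al) has_sum f (\<psi> q + h) (%_. 0)) UNIV"
   by (rule taylor_convergent_bound[OF cf p]) (rule that)
  have K: "K > 0" using rCK(2) by (simp add: geometric_bound_def)
  define N where "N = 1 + (\<Sum>a\<in>UNIV. \<Sum>b\<in>UNIV. norm (g b a))"
  have N1: "N \<ge> 1" unfolding N_def by (simp add: sum_nonneg)
  have N: "(\<Sum>b\<in>UNIV. norm (g b a)) \<le> N" for a
  proof -
   have "(\<Sum>b\<in>UNIV. norm (g b a)) \<le> (\<Sum>a\<in>UNIV. \<Sum>b\<in>UNIV. norm (g b a))"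
    by (rule member_le_sum) (auto simp: sum_nonneg)
   then show ?thesis by (simp add: N_def)
  qed
  define t where "t = 1 / (2 * K * N)"
  have t: "t > 0" "K * (t * N) < 1" using K N1 by (simp_all add: t_def)
  define s where "s = min t (r / N)"
  have s: "s > 0" using t rCK N1 by (simp add: s_def)
  have v: "norm ((\<chi> a. \<Sum>b\<in>UNIV. h $ b * g b a) :: 'k^'m) \<le> norm h * N" for h
  proof -
   have "norm ((\<chi> a. \<Sum>b\<in>UNIV. h $ b * g b a) :: 'k^'m) \<le> (\<Sum>a\<in>UNIV. norm (\<Sum>b\<in>UNIV. h $ b * g b a))"
    using norm_vec_le[of "(\<chi> a. \<Sum>b\<in>UNIV. h $ b * g b a) :: 'k^'m"] by simp
   also have "... \<le> (\<Sum>a\<in>UNIV. \<Sum>b\<in>UNIV. norm h * norm (g b a))"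
    by (intro sum_mono order_trans[OF norm_sum])
     (auto simp: norm_mult intro!: mult_right_mono Finite_Cartesian_Product.norm_nth_le)
   also have "... = norm h * (\<Sum>a\<in>UNIV. \<Sum>b\<in>UNIV. norm (g b a))" by (simp add: sum_distrib_left)
   also have "... \<le> norm h * N" by (intro mult_left_mono) (auto simp: N_def)
   finally show ?thesis .
  qed
  show "\<exists>r>0. \<forall>h. norm h < r -->
    (%al. norm (esub g (f (\<psi> q)) al * multi_power (%i. h $ i) al)) summable_on UNIV \<and>
    level_sum (esub g (f (\<psi> q))) (%i. h $ i) sums esub g (f (\<psi> (q + h))) (%_. 0)"
  proof (intro exI[of _ s] conjI allI impI s)
   fix h :: "'k^'m" assume h: "norm h < s"
   have "norm (h $ i) \<le> t" for i
    using h Finite_Cartesian_Product.norm_nth_le[of h i] by (simp add: s_def)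
   then show "(%al. norm (esub g (f (\<psi> q)) al * multi_power (%i. h $ i) al)) summable_on UNIV"
    by (rule esub_summable[OF rCK(2) _ _ N t(2)]) (use t in auto)
   let ?v = "(\<chi> a. \<Sum>b\<in>UNIV. h $ b * g b a) :: 'k^'m"
   have "norm h * N < r" using h N1 by (simp add: s_def pos_less_divide_eq)
   then have "norm ?v < r" using v[of h] by simp
   from has_sum_levels[OF rCK(3)[OF this]]
   have "level_sum (f (\<psi> q)) (%i. ?v $ i) sums f (\<psi> q + ?v) (%_. 0)" unfolding level_sum_def .
   moreover have "level_sum (esub g (f (\<psi> q))) (%i. h $ i) = level_sum (f (\<psi> q)) (%i. ?v $ i)"
    by (rule ext) (simp add: level_sum_esub)
   ultimately show "level_sum (esub g (f (\<psi> q))) (%i. h $ i) sums esub g (f (\<psi> (q + h))) (%_. 0)"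
    by (simp add: \<psi>)
  qed
 qed
 show ?thesis using V f s c by (cases C) auto
qed

text \<open>The recursion expresses a coefficient as a quotient involving reciprocal coefficients of
  lower degree, so continuity and the quotient rule go by induction on the degree. That the
  derivative is again the right coefficient is the product rule applied to the constant product
  1.\<close>

lemma taylor_smooth_cinv:
 fixes f :: "'k::{real_normed_field,banach}^'m::finite => ('m => nat) => 'k"
 assumes f: "taylor_smooth V f" and nz: "!!p. p \<in> V ==> f p (%_. 0) ~= 0"
 shows "taylor_smooth V (%p. cinv (f p))"
proof -
 let ?S = "%al. {be::'m => nat. (\<forall>i. be i \<le> al i) \<and> be ~= (%_. 0)}"
 have deg_less: "(\<Sum>i\<in>UNIV. al i - be i) < sum al UNIV" if b: "be \<in> ?S al" for al be :: "'m => nat"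
 proof -
  obtain i where "be i ~= 0" using b by auto
  then have "0 < sum be UNIV" using degree_le[of be i] by simp
  then show ?thesis using degree_diff[of be al] b by simp
 qed
 have rec: "cinv H al = ((if al = (%_. 0) then 1 else 0) - (\<Sum>be\<in>?S al. H be * cinv H (%i. al i - be i))) / H (%_. 0)"
  if "H (%_. 0) ~= 0" for H :: "('m => nat) => 'k" and al
  using conv_cinv[of H al, OF that] that unfolding conv_split by (simp add: field_simps split: if_splits)
 have cont: "continuous_on V (%p. cinv (f p) al)" for al
 proof (induction al rule: measure_induct_rule[of "%al. sum al UNIV"])
  case (less al)
  have "continuous_on V (%p. ((if al = (%_. 0) then 1 else 0) -
    (\<Sum>be\<in>?S al. f p be * cinv (f p) (%i. al i - be i))) / f p (%_. 0))"
   using f nz deg_less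
   unfolding taylor_smooth_iff by (intro continuous_intros less.IH) auto
  then show ?case by (rule continuous_on_eq) (simp add: rec nz)
 qed
 have deriv: "((%z. cinv (f (p + axis i z)) al) has_field_derivative dser i (cinv (f p)) al) (at 0)"
  if p: "p \<in> V" for p i al
 proof (induction al rule: measure_induct_rule[of "%al. sum al UNIV"])
  case (less al)
  let ?H = "f p" and ?G = "cinv (f p)"
  define one where "one = (if al = (%_. 0) then 1 else (0::'k))"
  note rec' = rec[of _ al, folded one_def]
  let ?num = "%z. one - (\<Sum>be\<in>?S al. f (p + axis i z) be * cinv (f (p + axis i z)) (%i. al i - be i))"
  let ?D = "\<Sum>be\<in>?S al. dser i ?H be * ?G (%i. al i - be i) + dser i ?G (%i. al i - be i) * ?H be"
  have d: "((%z. f (p + axis i z) be) has_field_derivative dser i ?H be) (at 0)" for be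
   using f p unfolding taylor_smooth_iff by blast
  have "((%z. \<Sum>be\<in>?S al. f (p + axis i z) be * cinv (f (p + axis i z)) (%i. al i - be i)) has_field_derivative ?D) (at 0)"
  proof (rule DERIV_sum)
   fix be assume b: "be \<in> ?S al"
   from DERIV_mult[OF d less.IH[OF deg_less[OF b]], of be]
   show "((%z. f (p + axis i z) be * cinv (f (p + axis i z)) (%i. al i - be i)) has_field_derivative
    dser i ?H be * ?G (%i. al i - be i) + dser i ?G (%i. al i - be i) * ?H be) (at 0)" by simp
  qed
  then have num_d: "(?num has_field_derivative 0 - ?D) (at 0)" by (intro DERIV_diff DERIV_const)
  have nz0: "f (p + axis i 0) (%_. 0) ~= 0" using nz[OF p] by simp
  have "((%z. ?num z / f (p + axis i z) (%_. 0)) has_field_derivative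
    ((0 - ?D) * ?H (%_. 0) - ?num 0 * dser i ?H (%_. 0)) / (?H (%_. 0) * ?H (%_. 0))) (at 0)"
   using DERIV_divide[OF num_d d[of "%_. 0"] nz0] by (simp only: axis_zero add_0_right)
  moreover have "((0 - ?D) * ?H (%_. 0) - ?num 0 * dser i ?H (%_. 0)) / (?H (%_. 0) * ?H (%_. 0)) = dser i ?G al"
  proof -
   have num: "?num 0 = ?H (%_. 0) * ?G al" unfolding rec'[where H = "f p", OF nz[OF p]] using nz[OF p] by simp
   \<comment> \<open>The product is the constant 1, and a raised index is never the zero
     index.\<close>
   have "dser i (conv ?H ?G) al = 0"
   proof -
    have "al(i := Suc (al i)) ~= (%_. 0)" by (metis fun_upd_same nat.distinct(1))
    then show ?thesis unfolding dser_def conv_cinv[where H = "f p", OF nz[OF p]] by simp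
   qed
   then have "conv (dser i ?H) ?G al + conv ?H (dser i ?G) al = 0" unfolding dser_conv .
   then have "dser i ?H (%_. 0) * ?G al + ?H (%_. 0) * dser i ?G al + ?D = 0"
    unfolding conv_split sum.distrib by (simp add: mult_ac add_ac)
   have ring: "(0 - D) * h - (h * g) * d = G * (h * h)" if "d * g + h * G + D = 0" for D h g d G :: 'k
   proof -
    have "G * h = - D - d * g" using that by (simp add: algebra_simps eq_neg_iff_add_eq_0)
    then have "G * h * h = (- D - d * g) * h" by simp
    then show ?thesis by (simp add: algebra_simps)
   qed
   have "(0 - ?D) * ?H (%_. 0) - ?num 0 * dser i ?H (%_. 0) =
     dser i ?G al * (?H (%_. 0) * ?H (%_. 0))"
    unfolding num by (rule ring) fact
   then show ?thesis using nz[OF p] by simp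
  qed
  ultimately have r: "((%z. ?num z / f (p + axis i z) (%_. 0)) has_field_derivative dser i ?G al) (at 0)" by simp
  \<comment> \<open>The points \<open>p + axis i z\<close> may leave \<open>V\<close>, so that the
    denominator does not vanish for small \<open>z\<close> comes from continuity.\<close>
  have "isCont (%z. f (p + axis i z) (%_. 0)) 0" using d DERIV_isCont by blast
  then have "((%z. f (p + axis i z) (%_. 0)) \<longlongrightarrow> f (p + axis i 0) (%_. 0)) (nhds 0)"
   unfolding isCont_def by (rule tendsto_at_iff_tendsto_nhds[THEN iffD1])
  then have "\<forall>\<^sub>F z in nhds 0. f (p + axis i z) (%_. 0) ~= 0"
   by (rule tendsto_imp_eventually_ne) (use nz[OF p] in simp)
  then have ev: "\<forall>\<^sub>F z in nhds 0. ?num z / f (p + axis i z) (%_. 0) = cinv (f (p + axis i z)) al"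
   by (rule eventually_mono) (simp add: rec')
  show ?case using r unfolding DERIV_cong_ev[OF refl ev refl] .
 qed
 show ?thesis unfolding taylor_smooth_iff using cont deriv by blast
qed

text \<open>The Cauchy product of the two series of degree sums is 1 in degree 0 and 0 above, so the
  sum of the reciprocal series is the reciprocal value.\<close>

lemma taylor_convergent_cinv:
 fixes f :: "'k::{real_normed_field,banach}^'m::finite => ('m => nat) => 'k"
 assumes V: "open V" and f: "taylor_convergent V f" and nz: "!!p. p \<in> V ==> f p (%_. 0) ~= 0"
 shows "taylor_convergent V (%p. cinv (f p))"
proof (rule taylor_convergentI)
 fix p assume p: "p \<in> V"
 obtain r C K where rCK: "r > 0" "geometric_bound C K (f p)"
  "!!h. norm h < r ==> ((%al. f p al * multi_power (%i. h $ i) al) has_sum f (p + h) (%_. 0)) UNIV"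
  by (rule taylor_convergent_bound[OF f p]) (rule that)
 obtain C' K' where gb': "geometric_bound C' K' (cinv (f p))"
  using geometric_bound_cinv[OF rCK(2) nz[OF p]] .
 obtain e where e: "e > 0" "ball p e <= V" using V p openE by blast
 have K: "K > 0" "K' > 0" using rCK(2) gb' by (simp_all add: geometric_bound_def)
 define t where "t = min (1 / (2 * K)) (1 / (2 * K'))"
 have t: "0 < t" using K by (simp add: t_def)
 have "K * t \<le> K * (1 / (2 * K))" "K' * t \<le> K' * (1 / (2 * K'))"
  by (intro mult_left_mono; use K in \<open>simp add: t_def\<close>)+
 then have Kt: "K * t < 1" "K' * t < 1" using K by simp_all
 define s where "s = min t (min e r)"
 have s: "s > 0" using t e rCK by (simp add: s_def)
 show "\<exists>r>0. \<forall>h. norm h < r -->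
   (%al. norm (cinv (f p) al * multi_power (%i. h $ i) al)) summable_on UNIV \<and>
   level_sum (cinv (f p)) (%i. h $ i) sums cinv (f (p + h)) (%_. 0)"
 proof (intro exI[of _ s] conjI allI impI s)
  fix h :: "'k^'m" assume h: "norm h < s"
  have hi: "norm (h $ i) \<le> t" for i
   using h Finite_Cartesian_Product.norm_nth_le[of h i] by (simp add: s_def)
  show "(%al. norm (cinv (f p) al * multi_power (%i. h $ i) al)) summable_on UNIV"
   by (rule geometric_bound_summable[OF gb' hi _ Kt(2)]) (use t in auto)
  let ?h = "%i. h $ i"
  have lev: "summable (%r. norm (level_sum H ?h r))" if "geometric_bound C K H" "K * t < 1"
   for C K and H :: "('m => nat) => 'k"
   by (rule summable_comparison_test'[OF geometric_bound_level_summable[OF that(1) less_imp_le[OF t] that(2)]])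
    (use level_sum_norm_le[OF hi less_imp_le[OF t]] in simp)
  have A: "level_sum (f p) ?h sums f (p + h) (%_. 0)"
   using has_sum_levels[OF rCK(3)] h unfolding level_sum_def by (simp add: s_def)
  have ls: "level_sum (conv (f p) (cinv (f p))) ?h k = (if k = 0 then 1 else 0)" for k
  proof -
   have "level_sum (conv (f p) (cinv (f p))) ?h k =
     (\<Sum>al\<in>(multi_level k :: ('m => nat) set). if al = (%_. 0) then 1 else 0)"
    unfolding level_sum_def conv_cinv[where H = "f p", OF nz[OF p]] by (rule sum.cong) auto
   also have "... = (if (%_. 0) \<in> (multi_level k :: ('m => nat) set) then 1 else 0)"
    by (simp add: sum.delta)
   finally show ?thesis by (simp add: multi_level_def)
  qed
  have "(%k. \<Sum>i\<le>k. level_sum (f p) ?h i * level_sum (cinv (f p)) ?h (k - i)) sums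
    ((\<Sum>k. level_sum (f p) ?h k) * (\<Sum>k. level_sum (cinv (f p)) ?h k))"
   by (rule Cauchy_product_sums) (rule lev[OF rCK(2) Kt(1)], rule lev[OF gb' Kt(2)])
  then have "(%k. if k = 0 then 1 else 0) sums
    (f (p + h) (%_. 0) * (\<Sum>k. level_sum (cinv (f p)) ?h k))"
   unfolding level_sum_conv[symmetric] ls using A by (simp add: sums_iff)
  moreover have "(%k. if k = 0 then 1 else (0::'k)) sums 1"
   using sums_single[of 0 "%_. 1::'k"] by (simp add: eq_commute cong: if_cong)
  ultimately have "f (p + h) (%_. 0) * (\<Sum>k. level_sum (cinv (f p)) ?h k) = 1"
   using sums_unique2 by blast
  then have "(\<Sum>k. level_sum (cinv (f p)) ?h k) = cinv (f (p + h)) (%_. 0)"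
   unfolding cinv_0 by (metis mult_not_zero nonzero_mult_div_cancel_left zero_neq_one)
  moreover have "summable (level_sum (cinv (f p)) ?h)"
   using lev[OF gb' Kt(2)] by (rule summable_norm_cancel)
  ultimately show "level_sum (cinv (f p)) ?h sums cinv (f (p + h)) (%_. 0)" by (simp add: sums_iff)
 qed
qed

lemma regular_cinv:
 assumes "C = Formal \<or> open V" "regular C V f" "!!p. p \<in> V ==> f p (%_. 0) ~= 0"
 shows "regular C V (%p. cinv (f p))"
 using assms taylor_smooth_cinv[of V f] taylor_convergent_cinv[of V f] by (cases C) auto

section \<open>Superfunctions on the affine superspace\<close>

lemma affine_superspace_simps [simp]:
 "carrier (sections (affine_superspace C n) V) = sfuns C n V"
 "mult (sections (affine_superspace C n) V) = sfun_mult"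
 "add (sections (affine_superspace C n) V) = (%F G p al I. F p al I + G p al I)"
 "one (sections (affine_superspace C n) V) = sfun_scalar V 1"
 "zero (sections (affine_superspace C n) V) = (%p al I. 0)"
 "scalar (affine_superspace C n) = sfun_scalar"
 "restr (affine_superspace C n) U V F = (%p. if p \<in> V then F p else (%al I. 0))"
 "part (affine_superspace C n) V a = {F \<in> sfuns C n V. \<forall>p al I. F p al I ~= 0 --> odd (card I) = a}"
 by (simp_all add: affine_superspace_def)

lemma whole_affine [simp]: "whole (affine_superspace C n) = UNIV"
 by (simp add: affine_superspace_def)

lemma openin_affine: "openin (points (affine_superspace C n)) V \<longleftrightarrow> C = Formal \<or> open V"
 by (simp add: affine_superspace_def)

lemma opens_affine: "V \<in> opens (affine_superspace C n) W \<longleftrightarrow> (C = Formal \<or> open V) \<and> V <= W"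
 by (simp add: opens_def openin_affine)

definition odd_support :: "nat => (('m => nat) => nat set => 'k::zero) => bool" where
 "odd_support n H \<longleftrightarrow> (\<forall>al I. \<not> I <= {..<n} --> H al I = 0)"

lemma sfunsI:
 assumes "!!p. p \<notin> V ==> F p = (%al I. 0)" "!!p. odd_support n (F p)"
  "!!I. I <= {..<n} ==> regular C V (%p al. F p al I)"
 shows "F \<in> sfuns C n V"
 unfolding sfuns_def
proof (intro CollectI conjI allI impI)
 fix p al I assume "p \<notin> V \<or> \<not> I <= {..<n}"
 then show "F p al I = 0" using assms(1,2) unfolding odd_support_def by metis
next
 fix I
 show "regular C V (%p al. F p al I)"
 proof (cases "I <= {..<n}")
  case False
  then have "(%p al. F p al I) = (%p al. 0)" using assms(2) unfolding odd_support_def by blast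
  then show ?thesis by (simp add: regular_zero)
 qed (use assms(3) in auto)
qed

lemma sfuns_support: "F \<in> sfuns C n V ==> odd_support n (F p)"
 by (auto simp: sfuns_def odd_support_def)

lemma sfuns_outside: "F \<in> sfuns C n V ==> p \<notin> V ==> F p = (%al I. 0)"
 by (auto simp: sfuns_def fun_eq_iff)

lemma sfuns_regular: "F \<in> sfuns C n V ==> regular C V (%p al. F p al I)"
 by (auto simp: sfuns_def)

lemma sfuns_linear:
 assumes "F \<in> sfuns C n V" "G \<in> sfuns C n V"
 shows "(%p al I. c * F p al I + G p al I) \<in> sfuns C n V"
 using assms by (auto simp: sfuns_def intro: regular_linear)

lemma sfuns_zero: "(%p al I. 0) \<in> sfuns C n V"
 by (auto simp: sfuns_def intro: regular_zero)

lemma sfuns_add: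
 assumes "F \<in> sfuns C n V" "G \<in> sfuns C n V"
 shows "(%p al I. F p al I + G p al I) \<in> sfuns C n V"
 using sfuns_linear[OF assms, of 1] by simp

lemma sfuns_scale:
 assumes "F \<in> sfuns C n V"
 shows "(%p al I. c * F p al I) \<in> sfuns C n V"
 using sfuns_linear[OF assms sfuns_zero, of c] by simp

lemma sfuns_sum:
 assumes "finite S" "!!a. a \<in> S ==> F a \<in> sfuns C n V"
 shows "(%p al I. \<Sum>a\<in>S. c a * F a p al I) \<in> sfuns C n V"
 using assms
proof (induction S)
 case (insert x S)
 then show ?case using sfuns_linear[of "F x" C n V "%p al I. \<Sum>a\<in>S. c a * F a p al I" "c x"] by simp
qed (simp add: sfuns_zero)

lemma sfuns_restr:
 assumes "F \<in> sfuns C n V" "W <= V" "C = Formal \<or> open W"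
 shows "(%p. if p \<in> W then F p else (%al I. 0)) \<in> sfuns C n W"
proof (rule sfunsI)
 fix I
 have "regular C W (%p al. F p al I)" using assms sfuns_regular regular_mono by blast
 then show "regular C W (%p al. (if p \<in> W then F p else (%al I. 0)) al I)"
  by (rule regular_cong[OF assms(3)]) simp
qed (use sfuns_support[OF assms(1)] in \<open>auto simp: odd_support_def\<close>)

lemma sfun_scalar_in: "C = Formal \<or> open V ==> sfun_scalar V x \<in> sfuns C n V"
proof (rule sfunsI)
 fix I :: "nat set" assume V: "C = Formal \<or> open V"
 have "regular C V (%p al. if al = (%_. 0) then (if I = {} then x else 0) else 0)"
  by (rule regular_const)
 then show "regular C V (%p al. sfun_scalar V x p al I)"
  by (rule regular_cong[OF V]) (auto simp: sfun_scalar_def)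
qed (auto simp: sfun_scalar_def odd_support_def fun_eq_iff)

lemma sfuns_coord_deriv:
 assumes V: "C = Formal \<or> open V" and F: "F \<in> sfuns C n V"
 shows "coord_deriv a F \<in> sfuns C n V"
proof (cases a)
 case (Inl i)
 show ?thesis
 proof (rule sfunsI)
  fix I
  show "regular C V (%p al. coord_deriv a F p al I)"
   using regular_dser[OF V sfuns_regular[OF F, of I], of i] unfolding dser_def[abs_def] Inl by simp
 qed (use F in \<open>auto simp: sfuns_def odd_support_def Inl fun_eq_iff\<close>)
next
 case (Inr j)
 show ?thesis
 proof (rule sfunsI)
  fix I
  show "regular C V (%p al. coord_deriv a F p al I)"
   using regular_linear[OF sfuns_regular[OF F, of "insert j I"] regular_zero, of "inversion_sign {j} I"]
    regular_zero[of C V] unfolding Inr by (cases "j \<in> I") simp_all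
 next
  fix p show "odd_support n (coord_deriv a F p)"
   using sfuns_support[OF F, of p] unfolding Inr odd_support_def by auto
 qed (use F in \<open>auto simp: sfuns_def Inr fun_eq_iff\<close>)
qed

lemma finite_coords [simp]: "finite (coords n :: ('m::finite + nat) set)"
 by (simp add: coords_def)

lemma Inl_coords [simp]: "Inl i \<in> coords n" and Inr_coords [simp]: "Inr j \<in> coords n \<longleftrightarrow> j < n"
 by (auto simp: coords_def)

lemma odd_index_simps [simp]: "\<not> odd_index (Inl i)" "odd_index (Inr j)"
 by (simp_all add: odd_index_def)

subsection \<open>Expansions are determined by iterated derivatives at the base point\<close>

lemma inversion_sign_neq_0: "(inversion_sign J K :: 'k::field) ~= 0"
 unfolding inversion_sign_def by simp

lemma sder_support:
 "odd_support n H ==> odd_support n (sder a H)"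
 by (cases a) (auto simp: odd_support_def)

text \<open>A coefficient with a nonzero index is, up to a sign or a positive integer factor, a
  coefficient of smaller total degree of some derivative, and words of the derivative are words of
  the original series. Characteristic zero makes the integer invertible; the induction runs over all
  pairs of series at once.\<close>

lemma series_determined:
 fixes H H' :: "('m::finite => nat) => nat set => 'k::field_char_0"
 assumes "!!w. set w <= coords n ==> fold sder w H (%_. 0) {} = fold sder w H' (%_. 0) {}"
  and "odd_support n H" "odd_support n H'"
 shows "H = H'"
proof -
 have "H al I = H' al I" if "I <= {..<n}" for al I
  using that assms
 proof (induction "sum al UNIV + card I" arbitrary: al I H H' rule: less_induct)
  case less
  have words: "fold sder w (sder a H) (%_. 0) {} = fold sder w (sder a H') (%_. 0) {}"
   if "set w <= coords n" "a \<in> coords n" for w a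
   using less.prems(2)[of "a # w"] that by simp
  have supp: "odd_support n (sder a H)" "odd_support n (sder a H')" for a
   using less.prems(3,4) by (simp_all add: sder_support)
  have ih: "sder a H be J = sder a H' be J"
   if "sum be UNIV + card J < sum al UNIV + card I" "J <= {..<n}" "a \<in> coords n" for be J a
   by (rule less.hyps[OF that(1,2) words[OF _ that(3)] supp])
  consider (even) i where "al i ~= 0" | (odd) j where "j \<in> I" | (zero) "al = (%_. 0)" "I = {}"
   by auto
  then show ?case
  proof cases
   case even
   define be where "be = al(i := al i - 1)"
   have al: "al = be(i := Suc (be i))" using even by (auto simp: be_def)
   have "sum al UNIV = Suc (sum be UNIV)" unfolding al degree_upd ..
   then have "sder (Inl i) H be I = sder (Inl i) H' be I"
    using less.prems(1) by (intro ih) simp_all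
   then show ?thesis using of_nat_neq_0[of "be i", where 'a='k] by (simp add: al[symmetric] del: of_nat_Suc)
  next
   case odd
   have fI: "finite I" using less.prems(1) finite_subset by blast
   then have "card I = Suc (card (I - {j}))" using odd by (metis card.remove)
   then have "sder (Inr j) H al (I - {j}) = sder (Inr j) H' al (I - {j})"
    using less.prems(1) odd by (intro ih) auto
   then show ?thesis using odd inversion_sign_neq_0[of "{j}" "I - {j}", where 'k='k]
    by (simp add: insert_absorb)
  next
   case zero
   then show ?thesis using less.prems(2)[of "[]"] by simp
  qed
 qed
 then show ?thesis using assms(2,3) unfolding odd_support_def fun_eq_iff by metis
qed

subsection \<open>Local characters are evaluations\<close>

definition component :: "nat set => ('k::zero, 'm) sfun => ('k, 'm) sfun" where
 "component I F = (%p al J. if J = I then F p al J else 0)"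

lemma component_in:
 assumes "F \<in> sfuns C n V"
 shows "component I F \<in> sfuns C n V"
proof (rule sfunsI)
 fix J show "regular C V (%p al. component I F p al J)"
  using sfuns_regular[OF assms, of J] regular_zero[of C V] by (cases "J = I") (simp_all add: component_def)
qed (use assms in \<open>auto simp: sfuns_def component_def odd_support_def fun_eq_iff\<close>)

lemma sfun_eq_sum_components:
 assumes "F \<in> sfuns C n V"
 shows "F = (%p al J. \<Sum>I\<in>Pow {..<n}. component I F p al J)"
proof (intro ext)
 fix p al J
 have "(\<Sum>I\<in>Pow {..<n}. component I F p al J) = (if J <= {..<n} then F p al J else 0)"
  unfolding component_def by (simp add: sum.delta)
 then show "F p al J = (\<Sum>I\<in>Pow {..<n}. component I F p al J)"
  using sfuns_support[OF assms, of p] by (auto simp: odd_support_def)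
qed

lemma smul_odd_coord:
 fixes H :: "('m::finite => nat) => nat set => 'k::comm_ring_1"
 shows "smul (%al I. if I = {j} \<and> al = (%_. 0) then 1 else 0) H al I =
  (if j \<in> I \<and> finite I then inversion_sign {j} (I - {j}) * H al (I - {j}) else 0)"
proof -
 let ?t = "%al I. if I = {j} \<and> al = (%_. 0) then 1 else (0::'k)"
 have "smul ?t H al I = (\<Sum>be | \<forall>i. be i \<le> al i. if be = (%_. 0) then
   (\<Sum>J\<in>Pow I. if J = {j} then inversion_sign J (I - J) * H al (I - J) else 0) else 0)"
  unfolding smul_def by (intro sum.cong refl) (auto intro!: sum.cong sum.neutral)
 also have "... = (\<Sum>J\<in>Pow I. if J = {j} then inversion_sign J (I - J) * H al (I - J) else 0)"
  by (simp add: sum.delta finite_below)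
 also have "... = (if j \<in> I \<and> finite I then inversion_sign {j} (I - {j}) * H al (I - {j}) else 0)"
  by (cases "finite I") (simp_all add: sum.delta)
 finally show ?thesis .
qed

lemma smul_body:
 fixes a b :: "('m::finite => nat) => 'k::comm_ring_1"
 shows "smul (%al I. if I = {} then a al else 0) (%al I. if I = {} then b al else 0) al I =
  (if I = {} then conv a b al else 0)"
proof (cases "I = {}")
 case True
 then show ?thesis by (simp add: smul_def conv_def)
next
 case False
 have "(\<Sum>J\<in>Pow I. inversion_sign J (I - J) * (if J = {} then a be else 0) *
   (if I - J = {} then b (%i. al i - be i) else 0)) = 0" for be
  by (rule sum.neutral) (use False in auto)
 then show ?thesis using False by (simp add: smul_def)
qed

text \<open>A character of the ring of germs at \<open>q\<close>, encoded on neighbourhoods below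
  \<open>V0\<close> so that no germs have to be formed.\<close>

definition germ_character ::
  "category => nat => 'k::{real_normed_field,banach}^'m::finite
   => (('k^'m) set => ('k, 'm) sfun => 'k) => ('k^'m) set => bool" where
 "germ_character C n q v V0 \<longleftrightarrow>
  (\<forall>V. (C = Formal \<or> open V) \<and> q \<in> V \<and> V <= V0 -->
    (\<forall>F\<in>sfuns C n V. \<forall>G\<in>sfuns C n V.
     v V (%p al I. F p al I + G p al I) = v V F + v V G \<and> v V (sfun_mult F G) = v V F * v V G) \<and>
    (\<forall>x. v V (sfun_scalar V x) = x) \<and>
    (\<forall>W. (C = Formal \<or> open W) \<and> q \<in> W \<and> W <= V -->
     (\<forall>F\<in>sfuns C n V. v W (%p. if p \<in> W then F p else (%al I. 0)) = v V F)))"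

lemma germ_characterD:
 assumes "germ_character C n q v V0" "C = Formal \<or> open V" "q \<in> V" "V <= V0"
 shows "F \<in> sfuns C n V ==> G \<in> sfuns C n V ==> v V (%p al I. F p al I + G p al I) = v V F + v V G"
  and "F \<in> sfuns C n V ==> G \<in> sfuns C n V ==> v V (sfun_mult F G) = v V F * v V G"
  and "v V (sfun_scalar V x) = x"
  and "C = Formal \<or> open W ==> q \<in> W ==> W <= V ==> F \<in> sfuns C n V
   ==> v W (%p. if p \<in> W then F p else (%al I. 0)) = v V F"
 using assms(1)[unfolded germ_character_def, rule_format, of V] assms(2-) by simp_all

lemma sfun_scalar_0 [simp]: "sfun_scalar V 0 = (%p al I. 0)"
 by (auto simp: sfun_scalar_def fun_eq_iff)

text \<open>A component with nonempty \<open>I\<close> is a multiple of an odd coordinate, whose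
  square is zero, and so has value zero. For the even body, a character differing from the
  evaluation would kill the function \<open>G\<close> obtained by subtracting the character's value,
  although \<open>G\<close> is invertible near \<open>q\<close>.\<close>

lemma germ_character_eval:
 fixes q :: "'k::{real_normed_field,banach}^'m::finite"
 assumes v: "germ_character C n q v V" and V: "C = Formal \<or> open V" "q \<in> V" and F: "F \<in> sfuns C n V"
 shows "v V F = F q (%_. 0) {}"
proof -
 note char = germ_characterD[OF v]
 note add = char(1)[OF V order_refl] and mult = char(2)[OF V order_refl] and scal = char(3)[OF V order_refl]
 have zero: "v V (%p al I. 0) = 0" using scal[of 0] by simp
 have sum: "v V (%p al J. \<Sum>I\<in>S. G I p al J) = (\<Sum>I\<in>S. v V (G I))"
  if "finite S" "!!I. I \<in> S ==> G I \<in> sfuns C n V" for S and G :: "nat set => ('k, 'm) sfun"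
  using that
 proof (induction S)
  case (insert x S)
  have "(%p al J. \<Sum>I\<in>S. 1 * G I p al J) \<in> sfuns C n V" using insert by (intro sfuns_sum) auto
  then show ?case using insert add[of "G x" "%p al J. \<Sum>I\<in>S. G I p al J"] by simp
 qed (simp add: zero)
 have nilp: "v V (component I F) = 0" if I: "I <= {..<n}" "I ~= {}" for I
 proof -
  obtain j where j: "j \<in> I" using I by auto
  have fI: "finite I" using I finite_subset by blast
  define \<theta> :: "('k, 'm) sfun" where
   "\<theta> = (%p. if p \<in> V then (%al I. if I = {j} \<and> al = (%_. 0) then 1 else 0) else (%al I. 0))"
  \<comment> \<open>The sign is chosen so that the odd coordinate times \<open>F'\<close> is the
    \<open>I\<close>-component of \<open>F\<close>.\<close>
  define F' :: "('k, 'm) sfun" where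
   "F' = (%p al J. if J = I - {j} then inversion_sign {j} (I - {j}) * F p al I else 0)"
  have \<theta>in: "\<theta> \<in> sfuns C n V"
  proof (rule sfunsI)
   fix J :: "nat set"
   have "regular C V (%p al. if al = (%_. 0) then (if J = {j} then 1 else 0) else 0)"
    by (rule regular_const)
   then show "regular C V (%p al. \<theta> p al J)"
    by (rule regular_cong[OF V(1)]) (auto simp: \<theta>_def)
  qed (use j I in \<open>auto simp: \<theta>_def odd_support_def\<close>)
  have F'in: "F' \<in> sfuns C n V"
  proof (rule sfunsI)
   fix J :: "nat set"
   show "regular C V (%p al. F' p al J)"
    using regular_linear[OF sfuns_regular[OF F, of I] regular_zero, of "inversion_sign {j} (I - {j})"]
     regular_zero[of C V] by (cases "J = I - {j}") (simp_all add: F'_def)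
  qed (use F I in \<open>auto simp: F'_def odd_support_def sfuns_def fun_eq_iff\<close>)
  have "sfun_mult \<theta> F' = component I F"
  proof (intro ext)
   fix p al J
   show "sfun_mult \<theta> F' p al J = component I F p al J"
   proof (cases "p \<in> V")
    case True
    have "J - {j} = I - {j} \<longleftrightarrow> J = I" if "j \<in> J" using that j by blast
    then show ?thesis
     using True fI j inversion_sign_square[of "{j}" "I - {j}", where 'k='k]
     by (auto simp: sfun_mult_smul \<theta>_def smul_odd_coord F'_def component_def mult.assoc[symmetric])
   next
    case False
    then show ?thesis using sfuns_outside[OF F False]
     by (simp add: sfun_mult_smul \<theta>_def smul_def component_def)
   qed
  qed
  moreover have "sfun_mult \<theta> \<theta> = (%p al I. 0)"
  proof (intro ext)
   fix p al J
   show "sfun_mult \<theta> \<theta> p al J = 0"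
    by (cases "p \<in> V") (auto simp: sfun_mult_smul \<theta>_def smul_odd_coord, simp add: smul_def)
  qed
  then have "v V \<theta> * v V \<theta> = 0" using mult[OF \<theta>in \<theta>in] zero by simp
  ultimately show ?thesis using mult[OF \<theta>in F'in] by simp
 qed
 have body: "v V (component {} F) = F q (%_. 0) {}"
 proof (rule ccontr)
  assume ne: "v V (component {} F) ~= F q (%_. 0) {}"
  define c where "c = v V (component {} F)"
  define G where "G = (%p al I. component {} F p al I + sfun_scalar V (- c) p al I)"
  have Gin: "G \<in> sfuns C n V" unfolding G_def by (intro sfuns_add component_in F sfun_scalar_in V)
  have vG: "v V G = 0"
   unfolding G_def add[OF component_in[OF F] sfun_scalar_in[OF V(1)]] scal by (simp add: c_def)
  \<comment> \<open>The reciprocal of \<open>G\<close> exists only here; compatibility with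
    restriction carries the value of \<open>G\<close> to \<open>W\<close>.\<close>
  define W where "W = {p\<in>V. G p (%_. 0) {} ~= 0}"
  have qW: "q \<in> W" using V ne by (simp add: W_def G_def component_def sfun_scalar_def c_def)
  have oW: "C = Formal \<or> open W"
  proof (cases "C = Formal")
   case False
   then have "taylor_smooth V (%p al. G p al {})" using sfuns_regular[OF Gin, of "{}"] by (cases C) auto
   then have "continuous_on V (%p. G p (%_. 0) {})" unfolding taylor_smooth_iff by blast
   then have "open (V \<inter> (%p. G p (%_. 0) {}) -` (- {0}))"
    using V False by (intro continuous_open_preimage) auto
   moreover have "V \<inter> (%p. G p (%_. 0) {}) -` (- {0}) = W" by (auto simp: W_def)
   ultimately show ?thesis by simp
  qed simp
  have WV: "W <= V" by (auto simp: W_def)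
  let ?G = "%p. if p \<in> W then G p else (%al I. 0)"
  define H :: "('k, 'm) sfun" where
   "H = (%p. if p \<in> W then (%al I. if I = {} then cinv (%al. G p al {}) al else 0) else (%al I. 0))"
  have GW: "?G \<in> sfuns C n W" by (rule sfuns_restr[OF Gin WV oW])
  have HW: "H \<in> sfuns C n W"
  proof (rule sfunsI)
   fix J :: "nat set"
   have "regular C W (%p al. G p al {})" by (rule regular_mono[OF sfuns_regular[OF Gin] WV])
   then have "regular C W (%p. cinv (%al. G p al {}))"
    by (rule regular_cinv[OF oW]) (simp add: W_def)
   then have "regular C W (%p al. if J = {} then cinv (%al. G p al {}) al else 0)"
    using regular_zero[of C W] by (cases "J = {}") simp_all
   then show "regular C W (%p al. H p al J)"
    by (rule regular_cong[OF oW]) (simp add: H_def)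
  qed (auto simp: H_def odd_support_def)
  have Gbody: "G p = (%al I. if I = {} then G p al {} else 0)" for p
   by (auto simp: G_def component_def sfun_scalar_def fun_eq_iff)
  have "sfun_mult ?G H = sfun_scalar W 1"
  proof (intro ext)
   fix p al J
   show "sfun_mult ?G H p al J = sfun_scalar W 1 p al J"
   proof (cases "p \<in> W")
    case True
    then have nz: "(%al. G p al {}) (%_. 0) ~= 0" by (simp add: W_def)
    have "sfun_mult ?G H p al J = smul (%al I. if I = {} then G p al {} else 0)
      (%al I. if I = {} then cinv (%al. G p al {}) al else 0) al J"
     unfolding sfun_mult_smul using True Gbody[of p] by (simp add: H_def)
    then show ?thesis unfolding smul_body using conv_cinv[of "%al. G p al {}", OF nz, of al] True
     by (auto simp: sfun_scalar_def)
   next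
    case False
    then show ?thesis by (simp add: sfun_mult_smul smul_def sfun_scalar_def)
   qed
  qed
  moreover have "v W (sfun_mult ?G H) = v W ?G * v W H" "v W (sfun_scalar W 1) = 1" "v W ?G = v V G"
   using char(2)[OF oW qW WV GW HW] char(3)[OF oW qW WV] char(4)[OF V order_refl oW qW WV Gin] by simp_all
  ultimately show False using vG by simp
 qed
 have "v V F = (\<Sum>I\<in>Pow {..<n}. v V (component I F))"
  using sum[of "Pow {..<n}" "%I. component I F"] component_in[OF F] sfun_eq_sum_components[OF F] by simp
 also have "... = (\<Sum>I\<in>Pow {..<n}. if I = {} then F q (%_. 0) {} else 0)"
  by (rule sum.cong) (use body nilp in auto)
 also have "... = F q (%_. 0) {}" by (simp add: sum.delta)
 finally show ?thesis .
qed

subsection \<open>Affine changes of coordinates\<close>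

definition dth :: "nat => (nat set => 'k::comm_ring_1) => nat set => 'k" where
 "dth j K I = (if j \<in> I then 0 else inversion_sign {j} I * K (insert j I))"

text \<open>The derivative by a new odd variable whose coordinate field is the combination of the
  old ones with coefficients \<open>\<gamma> j k\<close>.\<close>

definition oder :: "nat => (nat => nat => 'k) => nat => (nat set => 'k::comm_ring_1) => nat set => 'k" where
 "oder n \<gamma> j K I = (\<Sum>k<n. \<gamma> j k * dth k K I)"

definition vanishes_outside :: "nat => (nat set => 'k::zero) => bool" where
 "vanishes_outside n K \<longleftrightarrow> (\<forall>I. \<not> I <= {..<n} --> K I = 0)"

lemma dth_vanishes: "vanishes_outside n K ==> vanishes_outside n (dth j K)"
 by (auto simp: vanishes_outside_def dth_def)

lemma oder_vanishes: "vanishes_outside n K ==> vanishes_outside n (oder n \<gamma> j K)"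
 using dth_vanishes[of n K] unfolding vanishes_outside_def oder_def by simp

text \<open>Removing two odd variables in the two possible orders differs by the sign of exchanging
  them. Infinite \<open>I\<close> is covered by the vanishing of \<open>K\<close>.\<close>

lemma dth_anticommute:
 fixes K :: "nat set => 'k::comm_ring_1"
 assumes "vanishes_outside n K"
 shows "dth j (dth k K) I = - dth k (dth j K) I"
proof (cases "j \<in> I \<or> k \<in> I \<or> j = k")
 case True
 then show ?thesis by (auto simp: dth_def)
next
 case jk: False
 show ?thesis
 proof (cases "finite I")
  case True
  have 1: "(inversion_sign {k} (insert j I) :: 'k) = inversion_sign {k} {j} * inversion_sign {k} I"
   "(inversion_sign {j} (insert k I) :: 'k) = inversion_sign {j} {k} * inversion_sign {j} I"
   using inversion_sign_Un_right[of "{j}" I "{k}"] inversion_sign_Un_right[of "{k}" I "{j}"] jk True by auto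
  have 2: "(inversion_sign {k} {j} :: 'k) = - inversion_sign {j} {k}"
  proof -
   have "(inversion_sign {j} {k} :: 'k) * inversion_sign {k} {j} = - 1"
    using inversion_sign_swap[of "{k}" j, where 'k='k] jk by auto
   then have "inversion_sign {j} {k} * (inversion_sign {j} {k} * inversion_sign {k} {j}) = - (inversion_sign {j} {k} :: 'k)"
    by simp
   then show ?thesis unfolding mult.assoc[symmetric] inversion_sign_square by simp
  qed
  have "dth j (dth k K) I = inversion_sign {j} I * (inversion_sign {k} (insert j I) * K (insert k (insert j I)))"
   using jk by (simp add: dth_def)
  moreover have "dth k (dth j K) I = inversion_sign {k} I * (inversion_sign {j} (insert k I) * K (insert k (insert j I)))"
   using jk by (simp add: dth_def insert_commute)
  ultimately show ?thesis unfolding 1 2 by (simp add: mult_ac)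
 next
  case False
  have "\<not> insert k (insert j I) <= {..<n}" "\<not> insert j (insert k I) <= {..<n}"
   using False by (auto dest: finite_subset)
  then show ?thesis using assms by (simp add: dth_def vanishes_outside_def)
 qed
qed

lemma dth_sum: "dth j (%I. \<Sum>a\<in>S. c a * K a I) I = (\<Sum>a\<in>S. c a * dth j (K a) I)"
 by (simp add: dth_def sum_distrib_left mult_ac)

lemma oder_sum: "oder n \<gamma> j (%I. \<Sum>a\<in>S. c a * K a I) = (%I. \<Sum>a\<in>S. c a * oder n \<gamma> j (K a) I)"
proof
 fix I
 show "oder n \<gamma> j (%I. \<Sum>a\<in>S. c a * K a I) I = (\<Sum>a\<in>S. c a * oder n \<gamma> j (K a) I)"
  unfolding oder_def dth_sum sum_distrib_left by (subst sum.swap) (simp add: mult_ac)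
qed

lemma fold_oder_sum:
 "fold (oder n \<gamma>) xs (%I. \<Sum>a\<in>S. c a * K a I) = (%I. \<Sum>a\<in>S. c a * fold (oder n \<gamma>) xs (K a) I)"
 by (induction xs arbitrary: K) (simp_all add: oder_sum)

lemma fold_oder_uminus: "fold (oder n \<gamma>) xs (%I. - K I) I = - fold (oder n \<gamma>) xs K I"
 using fun_cong[OF fold_oder_sum[of n \<gamma> xs "%_. - 1" "%_. K" "{()}"], of I] by simp

lemma fold_oder_zero: "fold (oder n \<gamma>) xs (%I. 0) = (%I. 0)"
 using fold_oder_sum[of n \<gamma> xs "%_. 0" "%_. %_. 0" "{}"] by simp

lemma oder_anticommute:
 assumes "vanishes_outside n K"
 shows "oder n \<gamma> i (oder n \<gamma> j K) = (%I. - oder n \<gamma> j (oder n \<gamma> i K) I)"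
proof
 fix I
 have e: "oder n \<gamma> i (oder n \<gamma> j K) I = (\<Sum>k<n. \<Sum>l<n. \<gamma> i k * \<gamma> j l * dth k (dth l K) I)" for i j
  unfolding oder_def[of n \<gamma> i] oder_def[of n \<gamma> j, abs_def] dth_sum by (simp add: sum_distrib_left mult_ac)
 have "oder n \<gamma> i (oder n \<gamma> j K) I = (\<Sum>k<n. \<Sum>l<n. - (\<gamma> j l * \<gamma> i k * dth l (dth k K) I))"
  unfolding e
 proof (intro sum.cong refl)
  fix k l
  show "\<gamma> i k * \<gamma> j l * dth k (dth l K) I = - (\<gamma> j l * \<gamma> i k * dth l (dth k K) I)"
   unfolding dth_anticommute[OF assms, of k l] by simp
 qed
 also have "... = - (\<Sum>k<n. \<Sum>l<n. \<gamma> j l * \<gamma> i k * dth l (dth k K) I)"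
  by (simp only: sum_negf)
 also have "(\<Sum>k<n. \<Sum>l<n. \<gamma> j l * \<gamma> i k * dth l (dth k K) I) = oder n \<gamma> j (oder n \<gamma> i K) I"
  unfolding e by (rule sum.swap)
 finally show "oder n \<gamma> i (oder n \<gamma> j K) I = - oder n \<gamma> j (oder n \<gamma> i K) I" .
qed

lemma oder_square:
 fixes K :: "nat set => 'k::field_char_0"
 assumes "vanishes_outside n K"
 shows "oder n \<gamma> i (oder n \<gamma> i K) = (%I. 0)"
proof
 fix I
 show "oder n \<gamma> i (oder n \<gamma> i K) I = 0"
  using fun_cong[OF oder_anticommute[OF assms, of \<gamma> i i], of I] by simp
qed

lemma fold_oder_repeated:
 fixes K :: "nat set => 'k::field_char_0"
 assumes "vanishes_outside n K" "j \<in> set xs"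
 shows "fold (oder n \<gamma>) xs (oder n \<gamma> j K) = (%I. 0)"
 using assms
proof (induction xs arbitrary: K)
 case (Cons x xs)
 show ?case
 proof (cases "x = j")
  case True
  then show ?thesis using oder_square[OF Cons.prems(1)] fold_oder_zero by simp
 next
  case False
  have "fold (oder n \<gamma>) xs (oder n \<gamma> j (oder n \<gamma> x K)) = (%I. 0)"
   by (rule Cons.IH[OF oder_vanishes[OF Cons.prems(1)]]) (use Cons.prems(2) False in simp)
  then show ?thesis
   unfolding fold_simps o_apply oder_anticommute[OF Cons.prems(1), of \<gamma> x j]
   by (simp add: fun_eq_iff fold_oder_uminus)
 qed
qed simp

text \<open>Letting \<open>oder n \<gamma> j\<close> act first instead of at its sorted place moves
  it past exactly the entries below \<open>j\<close>, each at the cost of a sign.\<close>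

lemma fold_oder_insort:
 fixes K :: "nat set => 'k::field_char_0"
 assumes "vanishes_outside n K" "sorted xs" "distinct xs" "j \<notin> set xs"
 shows "fold (oder n \<gamma>) (insort j xs) K I = (-1) ^ card {k\<in>set xs. k < j} * fold (oder n \<gamma>) xs (oder n \<gamma> j K) I"
 using assms
proof (induction xs arbitrary: K)
 case (Cons x xs)
 show ?case
 proof (cases "j < x")
  case True
  then have "{k\<in>set (x # xs). k < j} = {}" using Cons.prems(2) by auto
  then show ?thesis using True by (simp only: card.empty) simp
 next
  case False
  then have jx: "x < j" using Cons.prems(4) by auto
  have "{k\<in>set (x # xs). k < j} = insert x {k\<in>set xs. k < j}" using jx by auto
  then have c: "card {k\<in>set (x # xs). k < j} = Suc (card {k\<in>set xs. k < j})"
   using Cons.prems(3) by simp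
  have "fold (oder n \<gamma>) (insort j (x # xs)) K I = fold (oder n \<gamma>) (insort j xs) (oder n \<gamma> x K) I"
   using jx by simp
  also have "... = (-1) ^ card {k\<in>set xs. k < j} * fold (oder n \<gamma>) xs (oder n \<gamma> j (oder n \<gamma> x K)) I"
   by (rule Cons.IH[OF oder_vanishes[OF Cons.prems(1)]]) (use Cons.prems in auto)
  also have "fold (oder n \<gamma>) xs (oder n \<gamma> j (oder n \<gamma> x K)) I = - fold (oder n \<gamma>) xs (oder n \<gamma> x (oder n \<gamma> j K)) I"
   unfolding oder_anticommute[OF Cons.prems(1), of \<gamma> j x] by (rule fold_oder_uminus)
  finally show ?thesis unfolding c by simp
 qed
qed simp

text \<open>The odd counterpart of \<open>esub\<close>: the coefficient of a product of new odd
  variables is an iterated derivative at zero. \<open>fold\<close> lets the smallest index act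
  first, which strips the leftmost factor.\<close>

definition osub :: "nat => (nat => nat => 'k) => (nat set => 'k::comm_ring_1) => nat set => 'k" where
 "osub n \<gamma> K J = (if J <= {..<n} then fold (oder n \<gamma>) (sorted_list_of_set J) K {} else 0)"

lemma osub_sum: "osub n \<gamma> (%I. \<Sum>a\<in>S. c a * K a I) J = (\<Sum>a\<in>S. c a * osub n \<gamma> (K a) J)"
 by (simp add: osub_def fold_oder_sum)

lemma osub_empty [simp]: "osub n \<gamma> K {} = K {}"
 by (simp add: osub_def)

text \<open>The sign in \<open>dth\<close> is the sign of sorting \<open>j\<close> into
  \<open>J\<close>, so both sides are the same iterated derivative. If \<open>j\<close> is already
  in \<open>J\<close>, a repeated odd derivative vanishes.\<close>

lemma dth_osub:
 fixes K :: "nat set => 'k::field_char_0"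
 assumes K: "vanishes_outside n K" and j: "j < n"
 shows "dth j (osub n \<gamma> K) J = osub n \<gamma> (oder n \<gamma> j K) J"
proof (cases "J <= {..<n}")
 case J: True
 then have fJ: "finite J" using finite_subset by blast
 show ?thesis
 proof (cases "j \<in> J")
  case True
  then show ?thesis using fold_oder_repeated[OF K, of j "sorted_list_of_set J"] fJ J
   by (simp add: dth_def osub_def)
 next
  case False
  have "{(a, k). a \<in> {j} \<and> k \<in> J \<and> k < a} = Pair j ` {k\<in>J. k < j}" by auto
  then have "card {(a, k). a \<in> {j} \<and> k \<in> J \<and> k < a} = card {k\<in>J. k < j}"
   by (simp add: card_image inj_on_def)
  then have s: "(inversion_sign {j} J :: 'k) = (-1) ^ card {k\<in>J. k < j}" by (simp add: inversion_sign_def)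
  have "sorted_list_of_set (insert j J) = insort j (sorted_list_of_set J)"
   using False fJ by (simp add: sorted_list_of_set_insert_remove)
  then have "dth j (osub n \<gamma> K) J =
    inversion_sign {j} J * fold (oder n \<gamma>) (insort j (sorted_list_of_set J)) K {}"
   using False J j by (simp add: dth_def osub_def)
  also have "... = inversion_sign {j} J * (inversion_sign {j} J *
    fold (oder n \<gamma>) (sorted_list_of_set J) (oder n \<gamma> j K) {})"
   using fold_oder_insort[OF K, of "sorted_list_of_set J" j] False fJ unfolding s by simp
  also have "... = osub n \<gamma> (oder n \<gamma> j K) J"
   using J by (simp add: osub_def mult.assoc[symmetric] inversion_sign_square)
  finally show ?thesis .
 qed
next
 case False
 then show ?thesis by (auto simp: dth_def osub_def)
qed

lemma dpow_sum: "dpow g be us (%al. \<Sum>a\<in>S. c a * H a al) = (%al. \<Sum>a\<in>S. c a * dpow g be us (H a) al)"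
proof -
 have 1: "dlin v (%al. \<Sum>a\<in>S. c a * H a al) = (%al. \<Sum>a\<in>S. c a * dlin v (H a) al)" for v H
 proof
  fix al
  show "dlin v (%al. \<Sum>a\<in>S. c a * H a al) al = (\<Sum>a\<in>S. c a * dlin v (H a) al)"
   unfolding dlin_def dser_def sum_distrib_left by (subst sum.swap) (simp add: mult_ac)
 qed
 have 2: "(dlin v ^^ k) (%al. \<Sum>a\<in>S. c a * H a al) = (%al. \<Sum>a\<in>S. c a * (dlin v ^^ k) (H a) al)" for v k H
  by (induction k) (simp_all add: 1)
 show ?thesis unfolding dpow_def by (induction us) (simp_all add: 2)
qed

lemma esub_sum: "esub g (%al. \<Sum>a\<in>S. c a * H a al) be = (\<Sum>a\<in>S. c a * esub g (H a) be)"
 by (simp add: esub_def dpow_sum sum_divide_distrib)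

text \<open>
 \<open>ssub n g H\<close> is the expansion of \<open>H\<close> in new coordinates \<open>y\<close> when \<open>\<partial>/\<partial>y\<^sub>b = \<Sum>\<^sub>a g\<^bsub>ba\<^esub> \<partial>\<^sub>a\<close>;
 the matrix \<open>g\<close> is assumed to preserve the parities, so only its two diagonal blocks enter.
\<close>

definition ssub :: "nat => ('m::finite + nat => 'm + nat => 'k)
  => (('m => nat) => nat set => 'k::field_char_0) => ('m => nat) => nat set => 'k" where
 "ssub n g H be J = esub (%b a. g (Inl b) (Inl a)) (%al. osub n (%j k. g (Inr j) (Inr k)) (H al) J) be"

definition lder :: "nat => ('m::finite + nat => 'k)
  => (('m => nat) => nat set => 'k::comm_ring_1) => ('m => nat) => nat set => 'k" where
 "lder n v H al I = (\<Sum>a\<in>coords n. v a * sder a H al I)"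

definition parity_preserving :: "nat => ('m + nat => 'm + nat => 'k::zero) => bool" where
 "parity_preserving n g \<longleftrightarrow> (\<forall>a\<in>coords n. \<forall>b\<in>coords n. odd_index a ~= odd_index b --> g a b = 0)"

lemma sum_coords:
 fixes f :: "'m::finite + nat => 'k::comm_monoid_add"
 shows "(\<Sum>a\<in>coords n. f a) = (\<Sum>i\<in>UNIV. f (Inl i)) + (\<Sum>j<n. f (Inr j))"
 unfolding coords_def by (subst sum.Plus) auto

lemma ssub_0 [simp]: "ssub n g H (%_. 0) {} = H (%_. 0) {}"
 by (simp add: ssub_def)

lemma ssub_zero: "ssub n g (%al I. 0) be J = 0"
 using esub_sum[of "%b a. g (Inl b) (Inl a)" "%_. 0" "%_ _. 0" "{}" be]
  osub_sum[of n "%j k. g (Inr j) (Inr k)" "%_. 0" "%_ _. 0" "{}" J]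
 by (simp add: ssub_def)

lemma ssub_support: "odd_support n (ssub n g H)"
 using esub_sum[of "%b a. g (Inl b) (Inl a)" "%_. 0" "%_ _. 0" "{}"]
 by (auto simp: odd_support_def ssub_def osub_def)

lemma lder_support: "odd_support n H ==> odd_support n (lder n v H)"
 using sder_support[of n H] by (auto simp: odd_support_def lder_def)

text \<open>The chain rule for a linear substitution. Since \<open>g\<close> preserves parities, a
  new even derivative involves only old even ones and passes to \<open>esub\<close>, while a new odd
  one passes to \<open>osub\<close>.\<close>

lemma sder_ssub:
 assumes g: "parity_preserving n g" and b: "b \<in> coords n" and H: "odd_support n H"
 shows "sder b (ssub n g H) = ssub n g (lder n (g b) H)"
proof (cases b)
 case (Inl i)
 have g0: "g b (Inr j) = 0" if "j < n" for j
  using g b that unfolding parity_preserving_def Inl by simp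
 let ?\<gamma> = "%j k. g (Inr j) (Inr k)"
 show ?thesis
 proof (intro ext)
  fix be J
  let ?X = "%al. osub n ?\<gamma> (H al) J"
  have "sder b (ssub n g H) be J = dser i (esub (%b a. g (Inl b) (Inl a)) ?X) be"
   by (simp add: Inl dser_def ssub_def)
  also have "... = esub (%b a. g (Inl b) (Inl a)) (dlin (%a. g (Inl i) (Inl a)) ?X) be"
   unfolding dser_esub ..
  also have "dlin (%a. g (Inl i) (Inl a)) ?X = (%al. osub n ?\<gamma> (lder n (g b) H al) J)"
  proof
   fix al
   have "dlin (%a. g (Inl i) (Inl a)) ?X al = (\<Sum>a\<in>UNIV. g (Inl i) (Inl a) * of_nat (Suc (al a)) * ?X (al(a := Suc (al a))))"
    by (simp add: dlin_def dser_def mult.assoc)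
   also have "... = osub n ?\<gamma> (%I. \<Sum>a\<in>UNIV. g (Inl i) (Inl a) * of_nat (Suc (al a)) * H (al(a := Suc (al a))) I) J"
    unfolding osub_sum ..
   also have "(%I. \<Sum>a\<in>UNIV. g (Inl i) (Inl a) * of_nat (Suc (al a)) * H (al(a := Suc (al a))) I) = lder n (g b) H al"
    unfolding lder_def fun_eq_iff sum_coords using g0 by (simp add: Inl mult.assoc)
   finally show "dlin (%a. g (Inl i) (Inl a)) ?X al = osub n ?\<gamma> (lder n (g b) H al) J" .
  qed
  finally show "sder b (ssub n g H) be J = ssub n g (lder n (g b) H) be J" by (simp only: ssub_def[of n g "lder n (g b) H"])
 qed
next
 case (Inr j)
 then have j: "j < n" using b by simp
 have g0: "g b (Inl i) = 0" for i
  using g b unfolding parity_preserving_def Inr by simp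
 let ?\<gamma> = "%j k. g (Inr j) (Inr k)" and ?e = "esub (%b a. g (Inl b) (Inl a))"
 have van: "vanishes_outside n (H al)" for al using H by (simp add: odd_support_def vanishes_outside_def)
 show ?thesis
 proof (intro ext)
  fix be J
  have "sder b (ssub n g H) be J = ?e (%al. dth j (osub n ?\<gamma> (H al)) J) be"
  proof (cases "j \<in> J")
   case True
   then show ?thesis using esub_sum[of "%b a. g (Inl b) (Inl a)" "%_. 0" "%_ _. 0" "{}" be]
    by (simp add: Inr dth_def)
  next
   case False
   then show ?thesis
    using esub_sum[of "%b a. g (Inl b) (Inl a)" "%_. inversion_sign {j} J"
      "%_ al. osub n ?\<gamma> (H al) (insert j J)" "{()}" be]
    by (simp add: Inr dth_def ssub_def)
  qed
  also have "(%al. dth j (osub n ?\<gamma> (H al)) J) = (%al. osub n ?\<gamma> (lder n (g b) H al) J)"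
  proof
   fix al
   have "oder n ?\<gamma> j (H al) = lder n (g b) H al"
    unfolding oder_def lder_def fun_eq_iff sum_coords using g0 by (simp add: Inr dth_def)
   then show "dth j (osub n ?\<gamma> (H al)) J = osub n ?\<gamma> (lder n (g b) H al) J"
    using dth_osub[OF van j] by simp
  qed
  finally show "sder b (ssub n g H) be J = ssub n g (lder n (g b) H) be J" by (simp only: ssub_def[of n g "lder n (g b) H"])
 qed
qed

lemma regular_osub:
 assumes "!!I. regular C V (%p al. F p al I)"
 shows "regular C V (%p al. osub n \<gamma> (F p al) J)"
proof -
 have "\<forall>I. regular C V (%p al. fold (oder n \<gamma>) xs (F p al) I)" for xs
  using assms
 proof (induction xs arbitrary: F)
  case (Cons x xs)
  have d: "regular C V (%p al. dth k (F p al) I)" for k I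
   using regular_linear[OF Cons.prems[of "insert k I"] regular_zero, of "inversion_sign {k} I"]
    regular_zero[of C V] by (cases "k \<in> I") (simp_all add: dth_def)
  have "regular C V (%p al. oder n \<gamma> x (F p al) I)" for I
   unfolding oder_def by (rule regular_sum[OF finite_lessThan d])
  from Cons.IH[OF this] show ?case by simp
 qed simp
 then show ?thesis using regular_zero[of C V] by (cases "J <= {..<n}") (simp_all add: osub_def)
qed

lemma sfuns_ssub:
 fixes F :: "('k::{real_normed_field,banach}, 'm::finite) sfun"
 assumes V: "C = Formal \<or> open V" and F: "F \<in> sfuns C n V"
  and \<psi>: "!!q h. \<psi> (q + h) = \<psi> q + (\<chi> a. \<Sum>b\<in>UNIV. h $ b * g (Inl b) (Inl a))"
 shows "(%q. ssub n g (F (\<psi> q))) \<in> sfuns C n (\<psi> -` V)"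
proof (rule sfunsI)
 fix q assume "q \<notin> \<psi> -` V"
 then have F0: "F (\<psi> q) = (%al I. 0)" using sfuns_outside[OF F] by simp
 show "ssub n g (F (\<psi> q)) = (%al I. 0)" unfolding F0 by (intro ext) (rule ssub_zero)
next
 fix J :: "nat set"
 show "regular C (\<psi> -` V) (%q al. ssub n g (F (\<psi> q)) al J)"
  unfolding ssub_def
  by (rule regular_esub[OF V regular_osub \<psi>]) (rule sfuns_regular[OF F])
qed (rule ssub_support)

lemma lder_sum_sder: "lder n v H = (%al I. \<Sum>a\<in>coords n. v a * sder a H al I)"
 by (simp add: lder_def fun_eq_iff)

lemma lder_lder:
 assumes "!!c. c \<in> coords n ==> (\<Sum>b\<in>coords n. v b * g b c) = w c"
 shows "(%al I. \<Sum>b\<in>coords n. v b * lder n (g b) H al I) = lder n w H"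
proof (intro ext)
 fix al I
 have "(\<Sum>b\<in>coords n. v b * lder n (g b) H al I) = (\<Sum>c\<in>coords n. (\<Sum>b\<in>coords n. v b * g b c) * sder c H al I)"
  unfolding lder_def sum_distrib_left sum_distrib_right by (subst sum.swap) (simp add: mult_ac)
 then show "(\<Sum>b\<in>coords n. v b * lder n (g b) H al I) = lder n w H al I"
  using assms by (simp add: lder_def)
qed

lemma ssub_sum: "ssub n g (%al I. \<Sum>a\<in>S. c a * H a al I) = (%al I. \<Sum>a\<in>S. c a * ssub n g (H a) al I)"
 by (simp add: ssub_def fun_eq_iff osub_sum esub_sum)

lemma lder_ssub:
 assumes g: "parity_preserving n g" and H: "odd_support n H"
  and c: "!!c. c \<in> coords n ==> (\<Sum>b\<in>coords n. v b * g b c) = w c"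
 shows "lder n v (ssub n g H) = ssub n g (lder n w H)"
proof -
 have "lder n v (ssub n g H) = (%al I. \<Sum>b\<in>coords n. v b * ssub n g (lder n (g b) H) al I)"
  unfolding lder_sum_sder[of n v] using sder_ssub[OF g _ H] by simp
 also have "... = ssub n g (%al I. \<Sum>b\<in>coords n. v b * lder n (g b) H al I)" unfolding ssub_sum ..
 also have "(%al I. \<Sum>b\<in>coords n. v b * lder n (g b) H al I) = lder n w H" by (rule lder_lder[OF c])
 finally show ?thesis .
qed

lemma lder_delta:
 assumes "a \<in> coords n"
 shows "lder n (%c. if c = a then 1 else 0) H = sder a H"
 using assms by (simp add: lder_def fun_eq_iff if_distrib[of "%x. x * _"] sum.delta cong: if_cong)

text \<open>If \<open>h\<close> is the inverse of \<open>g\<close>, then the operators \<open>\<Sum>\<^sub>b h\<^bsub>ab\<^esub> \<partial>\<^sub>b\<close> correspond to \<open>\<partial>\<^sub>a\<close>.\<close>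

lemma fold_lder_ssub:
 assumes g: "parity_preserving n g" and H: "odd_support n H" and w: "set w <= coords n"
  and inv: "!!a c. a \<in> coords n ==> c \<in> coords n ==> (\<Sum>b\<in>coords n. h a b * g b c) = (if c = a then 1 else 0)"
 shows "fold (%a. lder n (h a)) w (ssub n g H) = ssub n g (fold sder w H)"
 using H w
proof (induction w arbitrary: H)
 case (Cons a w)
 have "lder n (h a) (ssub n g H) = ssub n g (sder a H)"
  using lder_ssub[OF g Cons.prems(1), of "h a" "%c. if c = a then 1 else 0"] inv[of a] Cons.prems(2)
   lder_delta[of a n H] by simp
 then show ?case using Cons by (simp add: sder_support)
qed simp

lemma fold_sder_ssub:
 assumes g: "parity_preserving n g" and H: "odd_support n H" and w: "set w <= coords n"
 shows "fold sder w (ssub n g H) = ssub n g (fold (%a. lder n (g a)) w H)"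
 using H w by (induction w arbitrary: H) (simp_all add: sder_ssub[OF g] lder_support)

text \<open>By \<open>series_determined\<close> it suffices to compare iterated derivatives. The
  outer substitution turns each \<open>sder\<close> into \<open>lder n (h a)\<close>, and the inner
  one turns this back into \<open>sder\<close>.\<close>

lemma ssub_inverse:
 assumes g: "parity_preserving n g" and h: "parity_preserving n h" and H: "odd_support n H"
  and inv: "!!a c. a \<in> coords n ==> c \<in> coords n ==> (\<Sum>b\<in>coords n. h a b * g b c) = (if c = a then 1 else 0)"
 shows "ssub n h (ssub n g H) = H"
proof (rule series_determined)
 fix w :: "('a + nat) list" assume w: "set w <= coords n"
 show "fold sder w (ssub n h (ssub n g H)) (%_. 0) {} = fold sder w H (%_. 0) {}"
  using fold_lder_ssub[OF g H w, of h] inv unfolding fold_sder_ssub[OF h ssub_support w] by simp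
qed (use H ssub_support in auto)

lemma smul_support:
 assumes "odd_support n H" "odd_support n K"
 shows "odd_support n (smul H K)"
 unfolding odd_support_def
proof (intro allI impI)
 fix al I assume I: "\<not> I <= {..<n}"
 have "inversion_sign J (I - J) * H be J * K (%i. al i - be i) (I - J) = 0" if "J \<in> Pow I" for J be
 proof (cases "J <= {..<n}")
  case True
  then have "\<not> I - J <= {..<n}" using I that by auto
  then show ?thesis using assms(2) by (simp add: odd_support_def)
 next
  case False
  then show ?thesis using assms(1) by (simp add: odd_support_def)
 qed
 then show "smul H K al I = 0" by (simp add: smul_def)
qed

lemma smul_add_left: "smul (%al I. H al I + H' al I) K = (%al I. smul H K al I + smul H' K al I)"
 by (simp add: smul_def fun_eq_iff algebra_simps sum.distrib)

lemma smul_add_right: "smul H (%al I. K al I + K' al I) = (%al I. smul H K al I + smul H K' al I)"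
 by (simp add: smul_def fun_eq_iff algebra_simps sum.distrib)

definition homogeneous :: "bool => (('m => nat) => nat set => 'k::zero) => bool" where
 "homogeneous c H \<longleftrightarrow> (\<forall>al I. H al I ~= 0 --> odd (card I) = c)"

lemma sder_homogeneous:
 assumes "homogeneous c H" "odd_support n H"
 shows "homogeneous (c ~= odd_index a) (sder a H)"
proof (cases a)
 case (Inl i)
 show ?thesis unfolding homogeneous_def
 proof (intro allI impI)
  fix al I assume ne: "sder a H al I ~= 0"
  then have "H (al(i := Suc (al i))) I ~= 0" unfolding Inl sder.simps by (metis mult_zero_right)
  then show "odd (card I) = (c ~= odd_index a)" using assms(1) by (simp add: homogeneous_def Inl)
 qed
next
 case (Inr j)
 show ?thesis unfolding homogeneous_def
 proof (intro allI impI)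
  fix al I assume ne: "sder a H al I ~= 0"
  then have jI: "j \<notin> I" and ne': "H al (insert j I) ~= 0" by (auto simp: Inr split: if_splits)
  have "insert j I <= {..<n}" using assms(2) ne' unfolding odd_support_def by blast
  then have "finite I" using finite_subset[OF _ finite_lessThan] by auto
  then have "odd (card (insert j I)) = (\<not> odd (card I))" using jI by simp
  moreover have "odd (card (insert j I)) = c" using assms(1) ne' unfolding homogeneous_def by blast
  ultimately show "odd (card I) = (c ~= odd_index a)" by (auto simp: Inr)
 qed
qed

text \<open>On a homogeneous factor the sign \<open>(-1) ^ card J\<close> is constant, so the even
  and odd product rules take the common form of the Leibniz rule of a derivation.\<close>

lemma sder_smul_homogeneous:
 assumes "homogeneous c H"
 shows "sder a (smul H K) = (%al I. smul (sder a H) K al I + (if odd_index a \<and> c then - 1 else 1) * smul H (sder a K) al I)"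
proof (cases a)
 case (Inl i)
 then show ?thesis by (simp add: fun_eq_iff sder_even_smul del: sder.simps)
next
 case (Inr j)
 have "(-1) ^ card J * H be J = (if c then - 1 else 1) * H be J" for be J
  using assms by (cases "H be J = 0") (auto simp: homogeneous_def)
 then have "(%be J. (-1) ^ card J * H be J) = (%be J. (if c then - 1 else 1) * H be J)" by blast
 moreover have "smul (%be J. x * H be J) L al I = x * smul H L al I" for x L al I
  by (simp add: smul_def sum_distrib_left mult_ac)
 ultimately show ?thesis by (simp add: Inr fun_eq_iff sder_odd_smul del: sder.simps)
qed

section \<open>Sections and vector fields of a ringed superspace\<close>

text \<open>Only additivity on the carrier is assumed, since the lemma serves for maps such as
  evaluation of a field, \<open>nabla\<close> and \<open>circ\<close> in one argument, which are not
  packaged as homomorphisms. Additivity forces zero to zero by cancellation.\<close>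

lemma finsum_hom:
 assumes A: "abelian_group A" and B: "abelian_group B"
  and h: "!!x. x \<in> carrier A ==> h x \<in> carrier B"
   "!!x y. x \<in> carrier A ==> y \<in> carrier A ==> h (x \<oplus>\<^bsub>A\<^esub> y) = h x \<oplus>\<^bsub>B\<^esub> h y"
  and f: "finite S" "!!i. i \<in> S ==> f i \<in> carrier A"
 shows "h (finsum A f S) = finsum B (%i. h (f i)) S"
proof -
 interpret A: abelian_group A by (rule A)
 interpret B: abelian_group B by (rule B)
 have "h \<zero>\<^bsub>A\<^esub> \<oplus>\<^bsub>B\<^esub> h \<zero>\<^bsub>A\<^esub> = h \<zero>\<^bsub>A\<^esub>" using h(2)[of "\<zero>\<^bsub>A\<^esub>" "\<zero>\<^bsub>A\<^esub>"] by simp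
 then have 0: "h \<zero>\<^bsub>A\<^esub> = \<zero>\<^bsub>B\<^esub>"
  using h(1)[of "\<zero>\<^bsub>A\<^esub>"] B.add.l_cancel_one[of "h \<zero>\<^bsub>A\<^esub>" "h \<zero>\<^bsub>A\<^esub>"] by simp
 show ?thesis using f
 proof (induction S)
  case (insert x S)
  have f: "f \<in> S \<rightarrow> carrier A" "f x \<in> carrier A" using insert by auto
  have hf: "(%i. h (f i)) \<in> S \<rightarrow> carrier B" "h (f x) \<in> carrier B" using insert h by auto
  have "h (finsum A f (insert x S)) = h (f x) \<oplus>\<^bsub>B\<^esub> h (finsum A f S)"
   using A.finsum_insert[of S x f] insert.hyps f h(2)[OF f(2) A.finsum_closed[OF f(1)]] by simp
  also have "... = finsum B (%i. h (f i)) (insert x S)"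
   using B.finsum_insert[of S x "%i. h (f i)"] insert hf by simp
  finally show ?case .
 qed (simp add: 0)
qed

lemma (in ring) ksign_closed [simp]: "x \<in> carrier R ==> ksign R b x \<in> carrier R"
 by (simp add: ksign_def)

lemma (in ring) ksign_add: "x \<in> carrier R ==> y \<in> carrier R ==> ksign R b (x \<oplus> y) = ksign R b x \<oplus> ksign R b y"
 by (simp add: ksign_def minus_add)

lemma (in ring) ksign_mult:
 assumes "x \<in> carrier R" "y \<in> carrier R"
 shows "ksign R b x \<otimes> y = ksign R b (x \<otimes> y)" "x \<otimes> ksign R b y = ksign R b (x \<otimes> y)"
 using assms by (auto simp: ksign_def l_minus r_minus)

lemma (in ring) ksign_ksign: "x \<in> carrier R ==> ksign R a (ksign R b x) = ksign R (a ~= b) x"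
 by (auto simp: ksign_def)

lemma opensD: "V \<in> opens X U ==> openin (points X) V" "V \<in> opens X U ==> V <= U"
 by (auto simp: opens_def)

lemma opensI: "openin (points X) V ==> V <= U ==> V \<in> opens X U"
 by (auto simp: opens_def)

lemma opens_trans: "W \<in> opens X V ==> V \<in> opens X U ==> W \<in> opens X U"
 by (auto simp: opens_def)

lemma opens_whole: "V \<in> opens X (whole X) \<longleftrightarrow> openin (points X) V"
 by (auto simp: opens_def dest: openin_subset)

lemma opens_refl: "openin (points X) V ==> V \<in> opens X V"
 by (auto simp: opens_def)

locale ringed_space =
 fixes X :: "('p, 's, 'k::field) superspace"
 assumes ringed: "ringed_superspace X"
begin

abbreviation "sec V \<equiv> sections X V"
abbreviation "opn V \<equiv> openin (points X) V"
abbreviation "ops \<equiv> opens X"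
abbreviation "comb \<equiv> lin_comb X"
abbreviation "ders \<equiv> derivation X"
abbreviation "scl \<equiv> scalar X"
abbreviation "rstr \<equiv> restr X"
abbreviation "vrst \<equiv> vrestr X"
abbreviation "fns V \<equiv> carrier (sec V)"
abbreviation "vfs V \<equiv> carrier (tangent X V)"
abbreviation sec_add (\<open>_ +[_] _\<close> [65, 0, 66] 65) where "f +[V] g \<equiv> add (sec V) f g"
abbreviation sec_mult (\<open>_ *[_] _\<close> [70, 0, 71] 70) where "f *[V] g \<equiv> mult (sec V) f g"
abbreviation field_add (\<open>_ \<boxplus>[_] _\<close> [65, 0, 66] 65) where "D \<boxplus>[V] E \<equiv> add (tangent X V) D E"
abbreviation field_smult (\<open>_ \<cdot>[_] _\<close> [70, 0, 71] 70) where "f \<cdot>[V] D \<equiv> smult (tangent X V) f D"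

lemma algebra_sections: "opn V ==> supercommutative_algebra (sec V) (part X V) (scl V)"
 using ringed unfolding ringed_superspace_def by (simp add: opens_whole)

lemmas algebra_props = algebra_sections[unfolded supercommutative_algebra_def]

lemma ring_sections: "opn V ==> ring (sec V)"
 by (rule algebra_props[THEN conjunct1])

lemma abelian_group_sections: "opn V ==> abelian_group (sec V)"
 by (rule ring.is_abelian_group[OF ring_sections])

lemma part_subgroup: "opn V ==> additive_subgroup (part X V a) (sec V)"
 by (rule algebra_props[THEN conjunct2, THEN conjunct1, rule_format])

lemma part_carrier: "opn V ==> f \<in> part X V a ==> f \<in> fns V"
 using additive_subgroup.a_subset[OF part_subgroup] by (rule subsetD)

lemma part_zero: "opn V ==> \<zero>\<^bsub>sec V\<^esub> \<in> part X V a"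
 by (rule additive_subgroup.zero_closed[OF part_subgroup])

lemma part_add: "opn V ==> f \<in> part X V a ==> g \<in> part X V a ==> f +[V] g \<in> part X V a"
 by (rule additive_subgroup.a_closed[OF part_subgroup])

lemma part_minus: "opn V ==> f \<in> part X V a ==> \<ominus>\<^bsub>sec V\<^esub> f \<in> part X V a"
 by (rule additive_subgroup.a_inv_closed[OF part_subgroup])

lemma part_decomp1:
 "opn V ==> f \<in> fns V ==> \<exists>!q. q \<in> part X V False \<times> part X V True \<and> f = fst q +[V] snd q"
 by (rule algebra_props[THEN conjunct2, THEN conjunct2, THEN conjunct1, rule_format])

lemma part_decomp:
 assumes "opn V" "f \<in> fns V"
 obtains f0 f1 where "f0 \<in> part X V False" "f1 \<in> part X V True" "f = f0 +[V] f1"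
proof -
 obtain q where "q \<in> part X V False \<times> part X V True" "f = fst q +[V] snd q"
  using part_decomp1[OF assms] by (elim ex1E conjE) (rule that)
 then show ?thesis using that[of "fst q" "snd q"] by (simp add: mem_Times_iff)
qed

lemma part_disjoint:
 assumes V: "opn V" and "f \<in> part X V False" "f \<in> part X V True"
 shows "f = \<zero>\<^bsub>sec V\<^esub>"
proof -
 interpret ring "sec V" by (rule ring_sections[OF V])
 have f: "f \<in> fns V" using assms part_carrier by blast
 define P where "P = (%q. q \<in> part X V False \<times> part X V True \<and> f = fst q +[V] snd q)"
 have "\<exists>!q. P q" unfolding P_def by (rule part_decomp1[OF V f])
 moreover have "P (f, \<zero>\<^bsub>sec V\<^esub>)" "P (\<zero>\<^bsub>sec V\<^esub>, f)"
  unfolding P_def mem_Times_iff fst_conv snd_conv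
  by (intro conjI assms part_zero[OF V] r_zero[OF f, symmetric] l_zero[OF f, symmetric])+
 ultimately have "(f, \<zero>\<^bsub>sec V\<^esub>) = (\<zero>\<^bsub>sec V\<^esub>, f)" by blast
 then show ?thesis by (rule Pair_inject)
qed

lemma part_mult: "opn V ==> f \<in> part X V a ==> g \<in> part X V b ==> f *[V] g \<in> part X V (a ~= b)"
 by (rule algebra_props[THEN conjunct2, THEN conjunct2, THEN conjunct2, THEN conjunct1, rule_format, THEN conjunct1])

lemma part_comm:
 "opn V ==> f \<in> part X V a ==> g \<in> part X V b ==> f *[V] g = ksign (sec V) (a \<and> b) (g *[V] f)"
 by (rule algebra_props[THEN conjunct2, THEN conjunct2, THEN conjunct2, THEN conjunct1, rule_format, THEN conjunct2])

lemma scalar_part: "opn V ==> scl V x \<in> part X V False"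
 by (rule algebra_props[THEN conjunct2, THEN conjunct2, THEN conjunct2, THEN conjunct2, THEN conjunct1, rule_format])

lemma scalar_closed: "opn V ==> scl V x \<in> fns V"
 by (rule part_carrier[OF _ scalar_part])

lemma scalar_one: "opn V ==> scl V 1 = \<one>\<^bsub>sec V\<^esub>"
 and scalar_add: "opn V ==> scl V (x + y) = scl V x +[V] scl V y"
 and scalar_mult: "opn V ==> scl V (x * y) = scl V x *[V] scl V y"
 using algebra_props[of V] by simp_all

lemma scalar_zero:
 assumes V: "opn V" shows "scl V 0 = \<zero>\<^bsub>sec V\<^esub>"
proof -
 interpret ring "sec V" by (rule ring_sections[OF V])
 have "scl V 0 +[V] scl V 0 = scl V 0" using scalar_add[OF V, of 0 0] by simp
 then show ?thesis using scalar_closed[OF V, of 0] add.l_cancel_one[of "scl V 0" "scl V 0"] by simp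
qed

lemma scalar_sum: "opn V ==> finite S ==> scl V (\<Sum>a\<in>S. c a) = (\<Oplus>\<^bsub>sec V\<^esub>a\<in>S. scl V (c a))"
proof -
 assume V: "opn V" and S: "finite S"
 interpret ring "sec V" by (rule ring_sections[OF V])
 show ?thesis using S
  by (induction S) (simp_all add: scalar_zero[OF V] scalar_add[OF V] scalar_closed[OF V] finsum_insert Pi_def)
qed

lemma one_part: "opn V ==> \<one>\<^bsub>sec V\<^esub> \<in> part X V False"
 using scalar_part[of V 1] scalar_one by simp

lemma scalar_commute:
 assumes V: "opn V" and f: "f \<in> fns V"
 shows "f *[V] scl V x = scl V x *[V] f"
proof -
 interpret ring "sec V" by (rule ring_sections[OF V])
 obtain f0 f1 where f01: "f0 \<in> part X V False" "f1 \<in> part X V True" "f = f0 +[V] f1"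
  by (rule part_decomp[OF V f])
 have c: "f0 \<in> fns V" "f1 \<in> fns V" using f01 part_carrier[OF V] by auto
 have "f0 *[V] scl V x = scl V x *[V] f0"
  "f1 *[V] scl V x = scl V x *[V] f1"
  using part_comm[OF V f01(1) scalar_part[OF V, of x]] part_comm[OF V f01(2) scalar_part[OF V, of x]]
  by (simp_all add: ksign_def)
 then show ?thesis using c scalar_closed[OF V] by (simp add: f01(3) l_distr r_distr)
qed

lemma restr_props:
 assumes "opn U" "opn V" "V <= U"
 shows "rstr U V \<in> ring_hom (sec U) (sec V)"
  and "f \<in> part X U a ==> rstr U V f \<in> part X V a"
  and "rstr U V (scl U x) = scl V x"
  and "opn W ==> W <= V ==> f \<in> fns U ==> rstr V W (rstr U V f) = rstr U W f"
proof -
 have "U \<in> ops (whole X)" "V \<in> ops U" using assms by (auto simp: opens_whole intro: opensI)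
 then have *: "rstr U V \<in> ring_hom (sec U) (sec V) \<and>
   (\<forall>a. rstr U V ` part X U a <= part X V a) \<and>
   (\<forall>x. rstr U V (scl U x) = scl V x) \<and>
   (\<forall>W\<in>ops V. \<forall>f\<in>fns U. rstr V W (rstr U V f) = rstr U W f)"
  using ringed[unfolded ringed_superspace_def, THEN conjunct2, THEN conjunct2, THEN conjunct1] by simp
 show "rstr U V \<in> ring_hom (sec U) (sec V)" "rstr U V (scl U x) = scl V x"
  using * by auto
 show "f \<in> part X U a ==> rstr U V f \<in> part X V a" using * by blast
 show "opn W ==> W <= V ==> f \<in> fns U ==> rstr V W (rstr U V f) = rstr U W f"
  using * by (simp add: opensI)
qed

lemmas restr_part = restr_props(2) and restr_scalar = restr_props(3) and restr_restr = restr_props(4)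

lemma restr_id: "opn U ==> f \<in> fns U ==> rstr U U f = f"
 using ringed[unfolded ringed_superspace_def, THEN conjunct2, THEN conjunct1] by (simp add: opens_whole)

lemma restr_closed: "opn U ==> opn V ==> V <= U ==> f \<in> fns U ==> rstr U V f \<in> fns V"
 and restr_mult: "opn U ==> opn V ==> V <= U ==> f \<in> fns U ==> g \<in> fns U ==>
  rstr U V (f *[U] g) = rstr U V f *[V] rstr U V g"
 and restr_add: "opn U ==> opn V ==> V <= U ==> f \<in> fns U ==> g \<in> fns U ==>
  rstr U V (f +[U] g) = rstr U V f +[V] rstr U V g"
 and restr_one: "opn U ==> opn V ==> V <= U ==> rstr U V \<one>\<^bsub>sec U\<^esub> = \<one>\<^bsub>sec V\<^esub>"
 using ring_hom_closed[OF restr_props(1)[of U V], of f] ring_hom_mult[OF restr_props(1)[of U V], of f g]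
  ring_hom_add[OF restr_props(1)[of U V], of f g] ring_hom_one[OF restr_props(1)[of U V]] by simp_all

lemma restr_zero: "opn U ==> opn V ==> V <= U ==> rstr U V \<zero>\<^bsub>sec U\<^esub> = \<zero>\<^bsub>sec V\<^esub>"
 using restr_scalar[of U V 0] scalar_zero by simp

lemma restr_opens:
 assumes V: "V \<in> ops U" and W: "W \<in> ops V"
 shows "f \<in> fns V ==> rstr V W f \<in> fns W"
  and "f \<in> fns V ==> g \<in> fns V ==>
   rstr V W (f +[V] g) = rstr V W f +[W] rstr V W g"
  and "rstr V W \<zero>\<^bsub>sec V\<^esub> = \<zero>\<^bsub>sec W\<^esub>"
 using restr_closed[OF opensD(1)[OF V] opensD[OF W]] restr_add[OF opensD(1)[OF V] opensD[OF W]]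
  restr_zero[OF opensD(1)[OF V] opensD[OF W]] by simp_all

lemma glue1:
 assumes "!!V. V \<in> \<U> ==> opn V" "!!V. V \<in> \<U> ==> s V \<in> fns V"
  and "!!V W. V \<in> \<U> ==> W \<in> \<U> ==> rstr V (V \<inter> W) (s V) = rstr W (V \<inter> W) (s W)"
 shows "\<exists>!f. f \<in> fns (\<Union>\<U>) \<and> (\<forall>V\<in>\<U>. rstr (\<Union>\<U>) V f = s V)"
proof -
 have g: "\<forall>\<U> s. \<U> <= ops (whole X) \<and> (\<forall>V\<in>\<U>. s V \<in> fns V) \<and>
    (\<forall>V\<in>\<U>. \<forall>W\<in>\<U>. rstr V (V \<inter> W) (s V) = rstr W (V \<inter> W) (s W)) -->
    (\<exists>!f. f \<in> fns (\<Union>\<U>) \<and> (\<forall>V\<in>\<U>. rstr (\<Union>\<U>) V f = s V))"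
  using ringed[unfolded ringed_superspace_def] by (elim conjE)
 show ?thesis
  by (rule g[rule_format]) (use assms in \<open>auto simp: opens_whole\<close>)
qed

text \<open>The sheaf axiom is stated as unique gluing. Both \<open>f\<close> and \<open>g\<close>
  glue the restrictions of \<open>f\<close> to the open sets on which they agree, and these cover
  \<open>V\<close>.\<close>

lemma section_eqI:
 assumes V: "opn V" and f: "f \<in> fns V" and g: "g \<in> fns V"
  and loc: "!!p. p \<in> V ==> \<exists>W. opn W \<and> W <= V \<and> p \<in> W \<and> rstr V W f = rstr V W g"
 shows "f = g"
proof -
 define \<U> where "\<U> = {W. opn W \<and> W <= V \<and> rstr V W f = rstr V W g}"
 have un: "\<Union>\<U> = V" using loc by (fastforce simp: \<U>_def)
 define P where "P = (%f'. f' \<in> fns (\<Union>\<U>) \<and> (\<forall>W\<in>\<U>. rstr (\<Union>\<U>) W f' = rstr V W f))"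
 have "\<exists>!f'. P f'"
  unfolding P_def
 proof (rule glue1)
  fix W W' assume W: "W \<in> \<U>" "W' \<in> \<U>"
  then have o: "opn W" "opn W'" "opn (W \<inter> W')" "W <= V" "W' <= V" by (auto simp: \<U>_def)
  have "rstr W (W \<inter> W') (rstr V W f) = rstr V (W \<inter> W') f"
   by (rule restr_restr[OF V o(1) o(4) o(3) _ f]) auto
  moreover have "rstr W' (W \<inter> W') (rstr V W' f) = rstr V (W \<inter> W') f"
   by (rule restr_restr[OF V o(2) o(5) o(3) _ f]) auto
  ultimately show "rstr W (W \<inter> W') (rstr V W f) = rstr W' (W \<inter> W') (rstr V W' f)" by simp
 qed (auto simp: \<U>_def intro: restr_closed[OF V _ _ f] restr_closed[OF V _ _ g])
 moreover have "P g" "P f"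
  unfolding P_def un using f g by (auto simp: \<U>_def)
 ultimately show ?thesis by blast
qed

subsection \<open>The module of vector fields\<close>

lemma derivationD:
 assumes D: "D \<in> ders U a" and V: "V \<in> ops U"
 shows "f \<in> fns V ==> D V f \<in> fns V"
  and "f \<in> fns V ==> g \<in> fns V ==> D V (f +[V] g) = D V f +[V] D V g"
  and "f \<in> fns V ==> D V (scl V x *[V] f) = scl V x *[V] D V f"
  and "f \<in> part X V b ==> D V f \<in> part X V (a ~= b)"
  and "f \<in> part X V b ==> g \<in> fns V ==> D V (f *[V] g) =
   (D V f *[V] g) +[V] ksign (sec V) (a \<and> b) (f *[V] D V g)"
  and "W \<in> ops V ==> f \<in> fns V ==> D W (rstr V W f) = rstr V W (D V f)"
proof -
 have 0: "D V \<in> fns V \<rightarrow>\<^sub>E fns V" using D V unfolding derivation_def by blast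
 then show "f \<in> fns V ==> D V f \<in> fns V" by blast
 note * = D[unfolded derivation_def, simplified, THEN conjunct2, rule_format, OF V]
 show "f \<in> fns V ==> g \<in> fns V ==> D V (f +[V] g) = D V f +[V] D V g"
  "f \<in> fns V ==> D V (scl V x *[V] f) = scl V x *[V] D V f"
  "f \<in> part X V b ==> D V f \<in> part X V (a ~= b)"
  "f \<in> part X V b ==> g \<in> fns V ==> D V (f *[V] g) =
   (D V f *[V] g) +[V] ksign (sec V) (a \<and> b) (f *[V] D V g)"
  "W \<in> ops V ==> f \<in> fns V ==> D W (rstr V W f) = rstr V W (D V f)"
  using * by auto
qed

text \<open>Extensional families without any derivation law. Identities between fields are checked
  by evaluation in this larger set.\<close>

definition vfields :: "'p set => ('p, 's) vfield set" where
 "vfields U = (\<Pi>\<^sub>E V\<in>ops U. fns V \<rightarrow>\<^sub>E fns V)"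

lemma vfield_eqI:
 assumes "D \<in> vfields U" "E \<in> vfields U"
  and "!!V f. V \<in> ops U ==> f \<in> fns V ==> D V f = E V f"
 shows "D = E"
proof (rule PiE_ext[OF assms(1,2)[unfolded vfields_def]])
 fix V assume V: "V \<in> ops U"
 then have "D V \<in> fns V \<rightarrow>\<^sub>E fns V" "E V \<in> fns V \<rightarrow>\<^sub>E fns V"
  using assms(1,2) unfolding vfields_def by blast+
 then show "D V = E V" by (rule PiE_ext) (rule assms(3)[OF V])
qed

lemma derivationI:
 assumes "D \<in> vfields U"
  and "!!V f g. V \<in> ops U ==> f \<in> fns V ==> g \<in> fns V ==>
   D V (f +[V] g) = D V f +[V] D V g"
  and "!!V x f. V \<in> ops U ==> f \<in> fns V ==>
   D V (scl V x *[V] f) = scl V x *[V] D V f"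
  and "!!V b f. V \<in> ops U ==> f \<in> part X V b ==> D V f \<in> part X V (a ~= b)"
  and "!!V b f g. V \<in> ops U ==> f \<in> part X V b ==> g \<in> fns V ==> D V (f *[V] g) =
   (D V f *[V] g) +[V] ksign (sec V) (a \<and> b) (f *[V] D V g)"
  and "!!V W f. V \<in> ops U ==> W \<in> ops V ==> f \<in> fns V ==>
   D W (rstr V W f) = rstr V W (D V f)"
 shows "D \<in> ders U a"
 unfolding derivation_def using assms by (auto simp: vfields_def)

lemma derivation_vfields: "D \<in> ders U a ==> D \<in> vfields U"
 by (simp add: derivation_def vfields_def)

lemma tangent_simps:
 "add (tangent X U) = vadd X U"
 "zero (tangent X U) = (\<lambda>V\<in>ops U. \<lambda>f\<in>fns V. \<zero>\<^bsub>sec V\<^esub>)"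
 "smult (tangent X U) = (%g D. \<lambda>V\<in>ops U. \<lambda>f\<in>fns V. rstr U V g *[V] D V f)"
 by (simp_all add: tangent_def)

lemma tangent_eval:
 assumes "V \<in> ops U" "f \<in> fns V"
 shows "(D \<boxplus>[U] E) V f = D V f +[V] E V f"
  and "\<zero>\<^bsub>tangent X U\<^esub> V f = \<zero>\<^bsub>sec V\<^esub>"
  and "(g \<cdot>[U] D) V f = rstr U V g *[V] D V f"
 using assms by (simp_all add: tangent_simps vadd_def)

lemma vfields_closed: "D \<in> vfields U ==> V \<in> ops U ==> f \<in> fns V ==> D V f \<in> fns V"
 unfolding vfields_def by blast

lemma add_vfields:
 "D \<in> vfields U ==> E \<in> vfields U ==> D \<boxplus>[U] E \<in> vfields U"
 using vfields_closed[of D U] vfields_closed[of E U] ring.ring_simprules(1)[OF ring_sections[OF opensD(1)]]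
 by (auto simp: vfields_def tangent_simps vadd_def)

lemma zero_vfields: "\<zero>\<^bsub>tangent X U\<^esub> \<in> vfields U"
 using ring.ring_simprules(2)[OF ring_sections[OF opensD(1)]] by (auto simp: vfields_def tangent_simps)

lemma smult_vfields:
 "opn U ==> g \<in> fns U ==> D \<in> vfields U ==> g \<cdot>[U] D \<in> vfields U"
 using vfields_closed[of D U] ring.ring_simprules(5)[OF ring_sections[OF opensD(1)]]
  restr_closed[of U _ g] opensD[of _ X U]
 by (auto simp: vfields_def tangent_simps)

lemma derivation_add:
 assumes D: "D \<in> ders U a" and E: "E \<in> ders U a"
 shows "D \<boxplus>[U] E \<in> ders U a"
proof (rule derivationI)
 show "D \<boxplus>[U] E \<in> vfields U"
  using D E by (intro add_vfields derivation_vfields)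
next
 fix V f g assume V: "V \<in> ops U" and f: "f \<in> fns V" and g: "g \<in> fns V"
 interpret ring "sec V" by (rule ring_sections[OF opensD(1)[OF V]])
 note d = derivationD[OF D V] and e = derivationD[OF E V]
 show "(D \<boxplus>[U] E) V (f +[V] g) =
   (D \<boxplus>[U] E) V f +[V] (D \<boxplus>[U] E) V g"
  using f g V d(1) e(1) by (simp add: tangent_eval d(2) e(2) a_ac)
next
 fix V x f assume V: "V \<in> ops U" and f: "f \<in> fns V"
 interpret ring "sec V" by (rule ring_sections[OF opensD(1)[OF V]])
 have x: "scl V x \<in> fns V" by (rule scalar_closed[OF opensD(1)[OF V]])
 note d = derivationD[OF D V] and e = derivationD[OF E V]
 show "(D \<boxplus>[U] E) V (scl V x *[V] f) =
   scl V x *[V] (D \<boxplus>[U] E) V f"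
  using f V x d(1) e(1) by (simp add: tangent_eval d(3) e(3) r_distr)
next
 fix V b f assume V: "V \<in> ops U" and f: "f \<in> part X V b"
 have fc: "f \<in> fns V" by (rule part_carrier[OF opensD(1)[OF V] f])
 note d = derivationD[OF D V] and e = derivationD[OF E V]
 show "(D \<boxplus>[U] E) V f \<in> part X V (a ~= b)"
  unfolding tangent_eval[OF V fc] by (rule part_add[OF opensD(1)[OF V] d(4)[OF f] e(4)[OF f]])
next
 fix V b f g assume V: "V \<in> ops U" and f: "f \<in> part X V b" and g: "g \<in> fns V"
 interpret ring "sec V" by (rule ring_sections[OF opensD(1)[OF V]])
 have fc: "f \<in> fns V" by (rule part_carrier[OF opensD(1)[OF V] f])
 note d = derivationD[OF D V] and e = derivationD[OF E V]
 show "(D \<boxplus>[U] E) V (f *[V] g) =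
   ((D \<boxplus>[U] E) V f *[V] g) +[V]
   ksign (sec V) (a \<and> b) (f *[V] (D \<boxplus>[U] E) V g)"
  using fc g V d(1) e(1)
  by (simp add: tangent_eval d(5)[OF f g] e(5)[OF f g] l_distr r_distr ksign_add a_ac)
next
 fix V W f assume V: "V \<in> ops U" and W: "W \<in> ops V" and f: "f \<in> fns V"
 have WU: "W \<in> ops U" by (rule opens_trans[OF W V])
 have rf: "rstr V W f \<in> fns W" by (rule restr_opens(1)[OF V W f])
 note d = derivationD[OF D V] and e = derivationD[OF E V]
 show "(D \<boxplus>[U] E) W (rstr V W f) = rstr V W ((D \<boxplus>[U] E) V f)"
  unfolding tangent_eval[OF V f] tangent_eval[OF WU rf] d(6)[OF W f] e(6)[OF W f]
  by (rule restr_opens(2)[OF V W d(1)[OF f] e(1)[OF f], symmetric])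
qed

lemma derivation_zero: "\<zero>\<^bsub>tangent X U\<^esub> \<in> ders U a"
proof (rule derivationI)
 fix V W f assume V: "V \<in> ops U" and W: "W \<in> ops V" and f: "f \<in> fns V"
 have WU: "W \<in> ops U" by (rule opens_trans[OF W V])
 have rf: "rstr V W f \<in> fns W" by (rule restr_opens(1)[OF V W f])
 show "\<zero>\<^bsub>tangent X U\<^esub> W (rstr V W f) = rstr V W (\<zero>\<^bsub>tangent X U\<^esub> V f)"
  unfolding tangent_eval[OF V f] tangent_eval[OF WU rf] by (rule restr_opens(3)[OF V W, symmetric])
next
 fix V b f assume V: "V \<in> ops U" and f: "f \<in> part X V b"
 have fc: "f \<in> fns V" by (rule part_carrier[OF opensD(1)[OF V] f])
 show "\<zero>\<^bsub>tangent X U\<^esub> V f \<in> part X V (a ~= b)"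
  unfolding tangent_eval[OF V fc] by (rule part_zero[OF opensD(1)[OF V]])
next
 fix V b f g assume V: "V \<in> ops U" and f: "f \<in> part X V b" and g: "g \<in> fns V"
 interpret ring "sec V" by (rule ring_sections[OF opensD(1)[OF V]])
 have fc: "f \<in> fns V" by (rule part_carrier[OF opensD(1)[OF V] f])
 show "\<zero>\<^bsub>tangent X U\<^esub> V (f *[V] g) = (\<zero>\<^bsub>tangent X U\<^esub> V f *[V] g) +[V]
   ksign (sec V) (a \<and> b) (f *[V] \<zero>\<^bsub>tangent X U\<^esub> V g)"
  using fc g V by (simp add: tangent_eval ksign_def)
next
 fix V f g assume V: "V \<in> ops U" and f: "f \<in> fns V" and g: "g \<in> fns V"
 interpret ring "sec V" by (rule ring_sections[OF opensD(1)[OF V]])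
 show "\<zero>\<^bsub>tangent X U\<^esub> V (f +[V] g) = \<zero>\<^bsub>tangent X U\<^esub> V f +[V] \<zero>\<^bsub>tangent X U\<^esub> V g"
  using f g V by (simp add: tangent_eval)
next
 fix V x f assume V: "V \<in> ops U" and f: "f \<in> fns V"
 interpret ring "sec V" by (rule ring_sections[OF opensD(1)[OF V]])
 have x: "scl V x \<in> fns V" by (rule scalar_closed[OF opensD(1)[OF V]])
 show "\<zero>\<^bsub>tangent X U\<^esub> V (scl V x *[V] f) = scl V x *[V] \<zero>\<^bsub>tangent X U\<^esub> V f"
  using f x V by (simp add: tangent_eval)
qed (rule zero_vfields)

text \<open>Moving \<open>h\<close> past a function of parity \<open>b\<close> gives the sign of
  \<open>c \<and> b\<close>, which combines with the sign of \<open>a \<and> b\<close> to that of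
  \<open>(a ~= c) \<and> b\<close>.\<close>

lemma derivation_smult:
 assumes U: "opn U" and h: "h \<in> part X U c" and D: "D \<in> ders U a"
 shows "h \<cdot>[U] D \<in> ders U (a ~= c)"
proof (rule derivationI)
 have hc: "h \<in> fns U" by (rule part_carrier[OF U h])
 show "h \<cdot>[U] D \<in> vfields U"
  using U hc D by (intro smult_vfields derivation_vfields)
 fix V assume V: "V \<in> ops U"
 note oV = opensD[OF V]
 interpret ring "sec V" by (rule ring_sections[OF oV(1)])
 note d = derivationD[OF D V]
 define r where "r = rstr U V h"
 have rp: "r \<in> part X V c" unfolding r_def by (rule restr_part[OF U oV h])
 then have rc: "r \<in> fns V" by (rule part_carrier[OF oV(1)])
 have ev: "(h \<cdot>[U] D) V f = r *[V] D V f" if "f \<in> fns V" for f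
  using that V by (simp add: tangent_eval r_def)
 have x: "scl V x \<in> fns V" for x by (rule scalar_closed[OF oV(1)])
 { fix f g assume f: "f \<in> fns V" and g: "g \<in> fns V"
  show "(h \<cdot>[U] D) V (f +[V] g) =
    (h \<cdot>[U] D) V f +[V] (h \<cdot>[U] D) V g"
   using f g rc d(1) by (simp add: ev d(2) r_distr) }
 { fix x f assume f: "f \<in> fns V"
  have "r *[V] (scl V x *[V] D V f) = scl V x *[V] (r *[V] D V f)"
   using rc x d(1)[OF f] scalar_commute[OF oV(1) rc, of x] by (metis m_assoc)
  then show "(h \<cdot>[U] D) V (scl V x *[V] f) =
    scl V x *[V] (h \<cdot>[U] D) V f"
   using f x by (simp add: ev d(3)) }
 { fix b f assume f: "f \<in> part X V b"
  then have fc: "f \<in> fns V" by (rule part_carrier[OF oV(1)])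
  have "r *[V] D V f \<in> part X V (c ~= (a ~= b))" by (rule part_mult[OF oV(1) rp d(4)[OF f]])
  moreover have "(c ~= (a ~= b)) = ((a ~= c) ~= b)" by auto
  ultimately show "(h \<cdot>[U] D) V f \<in> part X V ((a ~= c) ~= b)" by (simp add: ev fc)
  fix g assume g: "g \<in> fns V"
  have "r *[V] (f *[V] D V g) = ksign (sec V) (c \<and> b) (f *[V] (r *[V] D V g))"
   using part_comm[OF oV(1) rp f] rc fc d(1)[OF g] ksign_mult(1)[of "f *[V] r" "D V g" "c \<and> b"]
   by (metis m_assoc m_closed)
  then have "r *[V] ksign (sec V) (a \<and> b) (f *[V] D V g) =
    ksign (sec V) ((a ~= c) \<and> b) (f *[V] (r *[V] D V g))"
   using rc fc d(1)[OF g] by (simp add: ksign_mult ksign_ksign) (auto simp: ksign_def)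
  then show "(h \<cdot>[U] D) V (f *[V] g) =
    ((h \<cdot>[U] D) V f *[V] g) +[V]
    ksign (sec V) ((a ~= c) \<and> b) (f *[V] (h \<cdot>[U] D) V g)"
   using rc fc g d(1) by (simp add: ev d(5)[OF f g] r_distr m_assoc) }
 { fix W f assume W: "W \<in> ops V" and f: "f \<in> fns V"
  note oW = opensD[OF W] subset_trans[OF opensD(2)[OF W] oV(2)]
  have WU: "W \<in> ops U" by (rule opens_trans[OF W V])
  have rf: "rstr V W f \<in> fns W" by (rule restr_opens(1)[OF V W f])
  have "rstr V W r = rstr U W h" unfolding r_def using restr_restr[OF U oV oW(1,2) hc] .
  then show "(h \<cdot>[U] D) W (rstr V W f) = rstr V W ((h \<cdot>[U] D) V f)"
   unfolding ev[OF f] tangent_eval[OF WU rf] d(6)[OF W f]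
   using restr_mult[OF oV(1) oW(1,2) rc d(1)[OF f]] by simp }
qed

end

context ringed_space
begin

lemma tangentE:
 assumes "D \<in> vfs U"
 obtains D0 D1 where "D0 \<in> ders U False" "D1 \<in> ders U True"
  "D = D0 \<boxplus>[U] D1"
 using assms by (auto simp: tangent_def)

lemma tangentI:
 assumes "D0 \<in> ders U False" "D1 \<in> ders U True"
 shows "D0 \<boxplus>[U] D1 \<in> vfs U"
 using assms by (auto simp: tangent_def)

lemma derivation_tangent:
 assumes D: "D \<in> ders U a"
 shows "D \<in> vfs U"
proof -
 have eq: "D = D \<boxplus>[U] \<zero>\<^bsub>tangent X U\<^esub>" "D = \<zero>\<^bsub>tangent X U\<^esub> \<boxplus>[U] D"
 proof -
  have v: "D \<in> vfields U" "\<zero>\<^bsub>tangent X U\<^esub> \<in> vfields U"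
   using D by (auto intro: derivation_vfields zero_vfields)
  have r: "D V f +[V] \<zero>\<^bsub>sec V\<^esub> = D V f" "\<zero>\<^bsub>sec V\<^esub> +[V] D V f = D V f"
   if "V \<in> ops U" "f \<in> fns V" for V f
  proof -
   interpret ring "sec V" by (rule ring_sections[OF opensD(1)[OF that(1)]])
   show "D V f +[V] \<zero>\<^bsub>sec V\<^esub> = D V f" "\<zero>\<^bsub>sec V\<^esub> +[V] D V f = D V f"
    using vfields_closed[OF v(1) that] by simp_all
  qed
  show "D = D \<boxplus>[U] \<zero>\<^bsub>tangent X U\<^esub>"
   by (rule vfield_eqI[OF v(1) add_vfields[OF v]]) (simp add: tangent_eval r)
  show "D = \<zero>\<^bsub>tangent X U\<^esub> \<boxplus>[U] D"
   by (rule vfield_eqI[OF v(1) add_vfields[OF v(2,1)]]) (simp add: tangent_eval r)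
 qed
 show ?thesis
 proof (cases a)
  case False
  then have "D \<in> ders U False" using D by simp
  from tangentI[OF this derivation_zero] show ?thesis using eq(1) by simp
 next
  case True
  then have "D \<in> ders U True" using D by simp
  from tangentI[OF derivation_zero this] show ?thesis using eq(2) by simp
 qed
qed

lemma tangent_vfields: "D \<in> vfs U ==> D \<in> vfields U"
 by (erule tangentE) (auto intro: add_vfields derivation_vfields)

lemma tangentD:
 assumes D: "D \<in> vfs U" and V: "V \<in> ops U"
 shows "f \<in> fns V ==> D V f \<in> fns V"
  and "f \<in> fns V ==> g \<in> fns V ==> D V (f +[V] g) = D V f +[V] D V g"
  and "f \<in> fns V ==> D V (scl V x *[V] f) = scl V x *[V] D V f"
  and "W \<in> ops V ==> f \<in> fns V ==> D W (rstr V W f) = rstr V W (D V f)"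
  and "D V \<one>\<^bsub>sec V\<^esub> = \<zero>\<^bsub>sec V\<^esub>"
proof -
 interpret ring "sec V" by (rule ring_sections[OF opensD(1)[OF V]])
 obtain D0 D1 where D0: "D0 \<in> ders U False" and D1: "D1 \<in> ders U True"
  and eq: "D = D0 \<boxplus>[U] D1" using D by (rule tangentE)
 note d0 = derivationD[OF D0 V] and d1 = derivationD[OF D1 V]
 have x: "scl V x \<in> fns V" for x by (rule scalar_closed[OF opensD(1)[OF V]])
 have ev: "D V f = D0 V f +[V] D1 V f" if "f \<in> fns V" for f
  unfolding eq using V that by (simp add: tangent_eval)
 show "D V f \<in> fns V" if "f \<in> fns V" for f
  using that d0(1) d1(1) by (simp add: ev)
 show "D V (f +[V] g) = D V f +[V] D V g" if "f \<in> fns V" "g \<in> fns V" for f g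
  using that d0(1) d1(1) by (simp add: ev d0(2) d1(2) a_ac)
 show "D V (scl V x *[V] f) = scl V x *[V] D V f" if "f \<in> fns V" for f
  using that d0(1) d1(1) x by (simp add: ev d0(3) d1(3) r_distr)
 show "D W (rstr V W f) = rstr V W (D V f)" if W: "W \<in> ops V" and f: "f \<in> fns V" for W f
  unfolding eq tangent_eval[OF V f] tangent_eval[OF opens_trans[OF W V] restr_opens(1)[OF V W f]]
   d0(6)[OF W f] d1(6)[OF W f]
  by (rule restr_opens(2)[OF V W d0(1)[OF f] d1(1)[OF f], symmetric])
 have one: "E V \<one>\<^bsub>sec V\<^esub> = \<zero>\<^bsub>sec V\<^esub>" if E: "E \<in> ders U a" for E a
 proof -
  have c: "E V \<one>\<^bsub>sec V\<^esub> \<in> fns V" using derivationD(1)[OF E V] by simp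
  have "E V (\<one>\<^bsub>sec V\<^esub> *[V] \<one>\<^bsub>sec V\<^esub>) = E V \<one>\<^bsub>sec V\<^esub> *[V] \<one>\<^bsub>sec V\<^esub> +[V]
    ksign (sec V) (a \<and> False) (\<one>\<^bsub>sec V\<^esub> *[V] E V \<one>\<^bsub>sec V\<^esub>)"
   by (rule derivationD(5)[OF E V one_part[OF opensD(1)[OF V]]]) simp
  then have "E V \<one>\<^bsub>sec V\<^esub> +[V] E V \<one>\<^bsub>sec V\<^esub> = E V \<one>\<^bsub>sec V\<^esub>"
   using c by (simp add: ksign_def)
  then show ?thesis using c add.l_cancel_one[OF c c] by simp
 qed
 show "D V \<one>\<^bsub>sec V\<^esub> = \<zero>\<^bsub>sec V\<^esub>" using ev[of "\<one>\<^bsub>sec V\<^esub>"] one[OF D0] one[OF D1] by simp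
qed

lemma tangent_eqI:
 assumes "D \<in> vfs U" "E \<in> vfs U"
  and "!!V f. V \<in> ops U ==> f \<in> fns V ==> D V f = E V f"
 shows "D = E"
 using assms by (intro vfield_eqI[of D U E] tangent_vfields)

lemma tangent_scalar:
 assumes "D \<in> vfs U" "V \<in> ops U"
 shows "D V (scl V x) = \<zero>\<^bsub>sec V\<^esub>"
proof -
 interpret ring "sec V" by (rule ring_sections[OF opensD(1)[OF assms(2)]])
 have x: "scl V x \<in> fns V" by (rule scalar_closed[OF opensD(1)[OF assms(2)]])
 show ?thesis using tangentD(3)[OF assms, of "\<one>\<^bsub>sec V\<^esub>" x] tangentD(5)[OF assms] x by simp
qed

lemma tangent_add_closed:
 assumes "D \<in> vfs U" "E \<in> vfs U"
 shows "D \<boxplus>[U] E \<in> vfs U"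
proof -
 obtain D0 D1 where D: "D0 \<in> ders U False" "D1 \<in> ders U True" "D = D0 \<boxplus>[U] D1"
  using assms(1) by (rule tangentE)
 obtain E0 E1 where E: "E0 \<in> ders U False" "E1 \<in> ders U True" "E = E0 \<boxplus>[U] E1"
  using assms(2) by (rule tangentE)
 have DE: "D0 \<boxplus>[U] E0 \<in> ders U False" "D1 \<boxplus>[U] E1 \<in> ders U True"
  using D E derivation_add by auto
 have "D \<boxplus>[U] E = (D0 \<boxplus>[U] E0) \<boxplus>[U] (D1 \<boxplus>[U] E1)"
 proof (rule vfield_eqI)
  show "D \<boxplus>[U] E \<in> vfields U" using assms by (intro add_vfields tangent_vfields)
  show "(D0 \<boxplus>[U] E0) \<boxplus>[U] (D1 \<boxplus>[U] E1) \<in> vfields U"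
   using DE by (intro add_vfields derivation_vfields)
  fix V f assume V: "V \<in> ops U" and f: "f \<in> fns V"
  interpret ring "sec V" by (rule ring_sections[OF opensD(1)[OF V]])
  have "D0 V f \<in> fns V" "D1 V f \<in> fns V" "E0 V f \<in> fns V" "E1 V f \<in> fns V"
   using derivationD(1)[OF _ V f] D E by auto
  then show "(D \<boxplus>[U] E) V f = ((D0 \<boxplus>[U] E0) \<boxplus>[U] (D1 \<boxplus>[U] E1)) V f"
   unfolding D(3) E(3) using V f by (simp add: tangent_eval a_ac)
 qed
 then show ?thesis using tangentI[OF DE] by simp
qed

lemma tangent_zero_closed: "\<zero>\<^bsub>tangent X U\<^esub> \<in> vfs U"
 by (rule derivation_tangent[OF derivation_zero])

lemma tangent_smult_add:
 assumes U: "opn U"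
 shows "f \<in> fns U ==> g \<in> fns U ==> D \<in> vfields U ==>
   (f +[U] g) \<cdot>[U] D = (f \<cdot>[U] D) \<boxplus>[U] (g \<cdot>[U] D)"
  and "f \<in> fns U ==> D \<in> vfields U ==> E \<in> vfields U ==>
   f \<cdot>[U] (D \<boxplus>[U] E) = (f \<cdot>[U] D) \<boxplus>[U] (f \<cdot>[U] E)"
  and "f \<in> fns U ==> g \<in> fns U ==> D \<in> vfields U ==>
   (f *[U] g) \<cdot>[U] D = f \<cdot>[U] (g \<cdot>[U] D)"
  and "D \<in> vfields U ==> \<one>\<^bsub>sec U\<^esub> \<cdot>[U] D = D"
  and "D \<in> vfields U ==> \<zero>\<^bsub>sec U\<^esub> \<cdot>[U] D = \<zero>\<^bsub>tangent X U\<^esub>"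
proof -
 interpret U: ring "sec U" by (rule ring_sections[OF U])
 have R: "ring (sec V)" if "V \<in> ops U" for V by (rule ring_sections[OF opensD(1)[OF that]])
 have res: "rstr U V f \<in> fns V" if "V \<in> ops U" "f \<in> fns U" for V f
  using restr_opens(1)[OF opens_refl[OF U] that] .
 note cl = add_vfields smult_vfields[OF U] zero_vfields
 { assume f: "f \<in> fns U" and g: "g \<in> fns U" and D: "D \<in> vfields U"
  show "(f +[U] g) \<cdot>[U] D = (f \<cdot>[U] D) \<boxplus>[U] (g \<cdot>[U] D)"
  proof (rule vfield_eqI)
   fix V x assume V: "V \<in> ops U" and x: "x \<in> fns V"
   interpret ring "sec V" by (rule R[OF V])
   show "((f +[U] g) \<cdot>[U] D) V x = ((f \<cdot>[U] D) \<boxplus>[U] (g \<cdot>[U] D)) V x"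
    unfolding tangent_eval[OF V x] restr_opens(2)[OF opens_refl[OF U] V f g]
    by (rule l_distr[OF res[OF V f] res[OF V g] vfields_closed[OF D V x]])
  qed (use f g D in \<open>simp_all add: cl\<close>)
  show "(f *[U] g) \<cdot>[U] D = f \<cdot>[U] (g \<cdot>[U] D)"
  proof (rule vfield_eqI)
   fix V x assume V: "V \<in> ops U" and x: "x \<in> fns V"
   interpret ring "sec V" by (rule R[OF V])
   show "((f *[U] g) \<cdot>[U] D) V x = (f \<cdot>[U] (g \<cdot>[U] D)) V x"
    unfolding tangent_eval[OF V x] restr_mult[OF U opensD[OF V] f g]
    by (rule m_assoc[OF res[OF V f] res[OF V g] vfields_closed[OF D V x]])
  qed (use f g D in \<open>simp_all add: cl\<close>) }
 { assume f: "f \<in> fns U" and D: "D \<in> vfields U" and E: "E \<in> vfields U"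
  show "f \<cdot>[U] (D \<boxplus>[U] E) = (f \<cdot>[U] D) \<boxplus>[U] (f \<cdot>[U] E)"
  proof (rule vfield_eqI)
   fix V x assume V: "V \<in> ops U" and x: "x \<in> fns V"
   interpret ring "sec V" by (rule R[OF V])
   show "(f \<cdot>[U] (D \<boxplus>[U] E)) V x = ((f \<cdot>[U] D) \<boxplus>[U] (f \<cdot>[U] E)) V x"
    unfolding tangent_eval[OF V x]
    by (rule r_distr[OF vfields_closed[OF D V x] vfields_closed[OF E V x] res[OF V f]])
  qed (use f D E in \<open>simp_all add: cl\<close>) }
 { assume D: "D \<in> vfields U"
  show "\<one>\<^bsub>sec U\<^esub> \<cdot>[U] D = D"
  proof (rule vfield_eqI)
   fix V x assume V: "V \<in> ops U" and x: "x \<in> fns V"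
   interpret ring "sec V" by (rule R[OF V])
   show "(\<one>\<^bsub>sec U\<^esub> \<cdot>[U] D) V x = D V x"
    unfolding tangent_eval[OF V x] restr_one[OF U opensD[OF V]] by (rule l_one[OF vfields_closed[OF D V x]])
  qed (use D in \<open>simp_all add: cl\<close>)
  show "\<zero>\<^bsub>sec U\<^esub> \<cdot>[U] D = \<zero>\<^bsub>tangent X U\<^esub>"
  proof (rule vfield_eqI)
   fix V x assume V: "V \<in> ops U" and x: "x \<in> fns V"
   interpret ring "sec V" by (rule R[OF V])
   show "(\<zero>\<^bsub>sec U\<^esub> \<cdot>[U] D) V x = \<zero>\<^bsub>tangent X U\<^esub> V x"
    unfolding tangent_eval[OF V x] restr_zero[OF U opensD[OF V]] by (rule l_null[OF vfields_closed[OF D V x]])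
  qed (use D in \<open>simp_all add: cl\<close>) }
qed

lemma tangent_smult_closed:
 assumes U: "opn U" and f: "f \<in> fns U" and D: "D \<in> vfs U"
 shows "f \<cdot>[U] D \<in> vfs U"
proof -
 obtain f0 f1 where f01: "f0 \<in> part X U False" "f1 \<in> part X U True" "f = f0 +[U] f1"
  by (rule part_decomp[OF U f])
 have c: "f0 \<in> fns U" "f1 \<in> fns U" using f01 part_carrier[OF U] by auto
 obtain D0 D1 where D01: "D0 \<in> ders U False" "D1 \<in> ders U True" "D = D0 \<boxplus>[U] D1"
  using D by (rule tangentE)
 have g: "h \<cdot>[U] D \<in> vfs U" if h: "h \<in> part X U b" for h b
 proof -
  have "h \<cdot>[U] D = (h \<cdot>[U] D0) \<boxplus>[U] (h \<cdot>[U] D1)"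
   unfolding D01(3) using D01 part_carrier[OF U h] by (intro tangent_smult_add(2)[OF U] derivation_vfields)
  moreover have "h \<cdot>[U] D0 \<in> vfs U" "h \<cdot>[U] D1 \<in> vfs U"
   using derivation_smult[OF U h] D01 derivation_tangent by blast+
  ultimately show ?thesis using tangent_add_closed by simp
 qed
 have "f \<cdot>[U] D = (f0 \<cdot>[U] D) \<boxplus>[U] (f1 \<cdot>[U] D)"
  unfolding f01(3) using c D by (intro tangent_smult_add(1)[OF U] tangent_vfields)
 then show ?thesis using g[OF f01(1)] g[OF f01(2)] tangent_add_closed by simp
qed

lemma abelian_group_tangent:
 assumes U: "opn U"
 shows "abelian_group (tangent X U)"
proof (rule abelian_groupI)
 interpret U: ring "sec U" by (rule ring_sections[OF U])
 fix D E F assume D: "D \<in> vfs U" and E: "E \<in> vfs U" and F: "F \<in> vfs U"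
 show "D \<boxplus>[U] E \<in> vfs U" using D E by (rule tangent_add_closed)
 show "(D \<boxplus>[U] E) \<boxplus>[U] F = D \<boxplus>[U] (E \<boxplus>[U] F)"
 proof (rule tangent_eqI)
  fix V f assume V: "V \<in> ops U" and f: "f \<in> fns V"
  interpret ring "sec V" by (rule ring_sections[OF opensD(1)[OF V]])
  show "((D \<boxplus>[U] E) \<boxplus>[U] F) V f = (D \<boxplus>[U] (E \<boxplus>[U] F)) V f"
   using tangentD(1)[OF _ V f] D E F V f by (simp add: tangent_eval a_assoc)
 qed (use D E F in \<open>auto intro: tangent_add_closed\<close>)
next
 fix D E assume D: "D \<in> vfs U" and E: "E \<in> vfs U"
 show "D \<boxplus>[U] E = E \<boxplus>[U] D"
 proof (rule tangent_eqI)
  fix V f assume V: "V \<in> ops U" and f: "f \<in> fns V"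
  interpret ring "sec V" by (rule ring_sections[OF opensD(1)[OF V]])
  show "(D \<boxplus>[U] E) V f = (E \<boxplus>[U] D) V f"
   using tangentD(1)[OF _ V f] D E V f by (simp add: tangent_eval a_comm)
 qed (use D E in \<open>auto intro: tangent_add_closed\<close>)
next
 fix D assume D: "D \<in> vfs U"
 show "\<zero>\<^bsub>tangent X U\<^esub> \<boxplus>[U] D = D"
 proof (rule tangent_eqI)
  fix V f assume V: "V \<in> ops U" and f: "f \<in> fns V"
  interpret ring "sec V" by (rule ring_sections[OF opensD(1)[OF V]])
  show "(\<zero>\<^bsub>tangent X U\<^esub> \<boxplus>[U] D) V f = D V f"
   using tangentD(1)[OF _ V f] D V f by (simp add: tangent_eval)
 qed (use D in \<open>auto intro: tangent_add_closed tangent_zero_closed\<close>)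
 interpret U: ring "sec U" by (rule ring_sections[OF U])
 have m: "\<ominus>\<^bsub>sec U\<^esub> \<one>\<^bsub>sec U\<^esub> \<in> fns U" by simp
 have Dv: "D \<in> vfields U" using D by (rule tangent_vfields)
 have "((\<ominus>\<^bsub>sec U\<^esub> \<one>\<^bsub>sec U\<^esub>) \<cdot>[U] D) \<boxplus>[U] (\<one>\<^bsub>sec U\<^esub> \<cdot>[U] D) = \<zero>\<^bsub>tangent X U\<^esub>"
  using tangent_smult_add(1)[OF U m U.one_closed Dv] tangent_smult_add(5)[OF U Dv] by (simp add: U.l_neg)
 then have "((\<ominus>\<^bsub>sec U\<^esub> \<one>\<^bsub>sec U\<^esub>) \<cdot>[U] D) \<boxplus>[U] D = \<zero>\<^bsub>tangent X U\<^esub>"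
  by (simp add: tangent_smult_add(4)[OF U Dv])
 then show "\<exists>E\<in>vfs U. E \<boxplus>[U] D = \<zero>\<^bsub>tangent X U\<^esub>"
  using tangent_smult_closed[OF U m D] by blast
qed (rule tangent_zero_closed)

lemma tangent_minus_eval:
 assumes U: "opn U" and D: "D \<in> vfs U" and V: "V \<in> ops U" and f: "f \<in> fns V"
 shows "(\<ominus>\<^bsub>tangent X U\<^esub> D) V f = \<ominus>\<^bsub>sec V\<^esub> D V f"
proof -
 interpret T: abelian_group "tangent X U" by (rule abelian_group_tangent[OF U])
 interpret ring "sec V" by (rule ring_sections[OF opensD(1)[OF V]])
 have m: "\<ominus>\<^bsub>tangent X U\<^esub> D \<in> vfs U" using D by simp
 have "(\<ominus>\<^bsub>tangent X U\<^esub> D) V f +[V] D V f = \<zero>\<^bsub>sec V\<^esub>"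
  using T.l_neg[OF D] tangent_eval(1)[OF V f, of "\<ominus>\<^bsub>tangent X U\<^esub> D" D] tangent_eval(2)[OF V f] by simp
 then show ?thesis using tangentD(1)[OF m V f] tangentD(1)[OF D V f] by (metis minus_equality)
qed

lemma derivation_minus:
 assumes U: "opn U" and D: "D \<in> ders U a"
 shows "\<ominus>\<^bsub>tangent X U\<^esub> D \<in> ders U a"
proof -
 interpret U: ring "sec U" by (rule ring_sections[OF U])
 interpret T: abelian_group "tangent X U" by (rule abelian_group_tangent[OF U])
 have m: "\<ominus>\<^bsub>sec U\<^esub> \<one>\<^bsub>sec U\<^esub> \<in> fns U" "\<ominus>\<^bsub>sec U\<^esub> \<one>\<^bsub>sec U\<^esub> \<in> part X U False"
  using one_part[OF U] part_minus[OF U] by auto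
 have Dt: "D \<in> vfs U" by (rule derivation_tangent[OF D])
 have Dv: "D \<in> vfields U" by (rule tangent_vfields[OF Dt])
 have "((\<ominus>\<^bsub>sec U\<^esub> \<one>\<^bsub>sec U\<^esub>) \<cdot>[U] D) \<boxplus>[U] D = \<zero>\<^bsub>tangent X U\<^esub>"
  using tangent_smult_add(1)[OF U m(1) U.one_closed Dv] tangent_smult_add(5)[OF U Dv]
  by (simp add: U.l_neg tangent_smult_add(4)[OF U Dv])
 then have "\<ominus>\<^bsub>tangent X U\<^esub> D = (\<ominus>\<^bsub>sec U\<^esub> \<one>\<^bsub>sec U\<^esub>) \<cdot>[U] D"
  using T.minus_equality[OF _ Dt tangent_smult_closed[OF U m(1) Dt]] by simp
 then show ?thesis using derivation_smult[OF U m(2) D] by simp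
qed

text \<open>A homogeneous function is sent to a function that is both even and odd, hence to
  zero.\<close>

lemma derivation_both_zero:
 assumes "D \<in> ders U False" "D \<in> ders U True"
 shows "D = \<zero>\<^bsub>tangent X U\<^esub>"
proof (rule tangent_eqI)
 fix V f assume V: "V \<in> ops U" and f: "f \<in> fns V"
 note oV = opensD(1)[OF V]
 interpret ring "sec V" by (rule ring_sections[OF oV])
 obtain f0 f1 where f01: "f0 \<in> part X V False" "f1 \<in> part X V True" "f = f0 +[V] f1"
  by (rule part_decomp[OF oV f])
 have "D V f0 = \<zero>\<^bsub>sec V\<^esub>"
  using derivationD(4)[OF assms(1) V f01(1)] derivationD(4)[OF assms(2) V f01(1)]
  by (intro part_disjoint[OF oV]) simp_all
 moreover have "D V f1 = \<zero>\<^bsub>sec V\<^esub>"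
  using derivationD(4)[OF assms(1) V f01(2)] derivationD(4)[OF assms(2) V f01(2)]
  by (intro part_disjoint[OF oV]) simp_all
 ultimately show "D V f = \<zero>\<^bsub>tangent X U\<^esub> V f"
  using f01 part_carrier[OF oV] V f by (simp add: tangent_eval derivationD(2)[OF assms(1) V])
qed (use assms derivation_tangent tangent_zero_closed in auto)

subsection \<open>Restriction of vector fields\<close>

lemma vrestr_eval: "W \<in> ops V ==> vrst V D W = D W"
 by (simp add: vrestr_def)

lemma vrestr_derivation:
 assumes D: "D \<in> ders U a" and V: "V \<in> ops U"
 shows "vrst V D \<in> ders V a"
proof (rule derivationI)
 show "vrst V D \<in> vfields V"
  using derivation_vfields[OF D] opens_trans[OF _ V] unfolding vfields_def vrestr_def by (auto simp: PiE_iff)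
qed (use derivationD[OF D] opens_trans[OF _ V] opens_trans[of _ X _ V] in \<open>simp_all add: vrestr_eval\<close>)

lemma vrestr_tangent:
 assumes D: "D \<in> vfs U" and V: "V \<in> ops U"
 shows "vrst V D \<in> vfs V"
proof -
 obtain D0 D1 where D01: "D0 \<in> ders U False" "D1 \<in> ders U True" "D = D0 \<boxplus>[U] D1"
  using D by (rule tangentE)
 have "vrst V D = vrst V D0 \<boxplus>[V] vrst V D1"
 proof
  fix W
  show "vrst V D W = (vrst V D0 \<boxplus>[V] vrst V D1) W"
   unfolding D01(3) using opens_trans[OF _ V]
   by (cases "W \<in> ops V") (simp_all add: vrestr_def tangent_simps vadd_def)
 qed
 then show ?thesis using tangentI vrestr_derivation[OF D01(1) V] vrestr_derivation[OF D01(2) V] by simp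
qed

lemma vrestr_vrestr: "W \<in> ops V ==> vrst W (vrst V D) = vrst W D"
 using opens_trans[of _ X W V] by (auto simp: vrestr_def fun_eq_iff)

lemma vrestr_self: "D \<in> vfs U ==> vrst U D = D"
 using tangent_vfields[of D U] by (auto simp: vrestr_def vfields_def)

lemma vrestr_smult:
 assumes U: "opn U" and V: "V \<in> ops U" and f: "f \<in> fns U"
 shows "vrst V (f \<cdot>[U] D) = rstr U V f \<cdot>[V] vrst V D"
proof
 fix W
 show "vrst V (f \<cdot>[U] D) W = (rstr U V f \<cdot>[V] vrst V D) W"
 proof (cases "W \<in> ops V")
  case True
  then show ?thesis using opens_trans[OF True V] restr_restr[OF U opensD[OF V] opensD[OF True] f]
   by (simp add: vrestr_def tangent_simps)
 qed (simp add: vrestr_def tangent_simps)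
qed

lemma tangent_eqI_local:
 assumes D: "D \<in> vfs U" and E: "E \<in> vfs U"
  and loc: "!!p. p \<in> U ==> \<exists>V\<in>ops U. p \<in> V \<and> vrst V D = vrst V E"
 shows "D = E"
proof (rule tangent_eqI[OF D E])
 fix W f assume W: "W \<in> ops U" and f: "f \<in> fns W"
 show "D W f = E W f"
 proof (rule section_eqI[OF opensD(1)[OF W] tangentD(1)[OF D W f] tangentD(1)[OF E W f]])
  fix p assume p: "p \<in> W"
  then obtain V where V: "V \<in> ops U" "p \<in> V" "vrst V D = vrst V E"
   using loc opensD(2)[OF W] by blast
  have o: "opn (W \<inter> V)" using opensD(1)[OF W] opensD(1)[OF V(1)] by blast
  have WV: "W \<inter> V \<in> ops W" "W \<inter> V \<in> ops V" using o by (auto intro: opensI)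
  have "D (W \<inter> V) = E (W \<inter> V)"
   using vrestr_eval[OF WV(2), of D] vrestr_eval[OF WV(2), of E] V(3) by simp
  then have "rstr W (W \<inter> V) (D W f) = rstr W (W \<inter> V) (E W f)"
   using tangentD(4)[OF D W WV(1) f] tangentD(4)[OF E W WV(1) f] by simp
  then show "\<exists>V. opn V \<and> V <= W \<and> p \<in> V \<and> rstr W V (D W f) = rstr W V (E W f)"
   using o p V(2) by (intro exI[of _ "W \<inter> V"]) auto
 qed
qed

subsection \<open>Linear combinations and frames\<close>

lemma finsum_tangent_eval:
 assumes U: "opn U" and V: "V \<in> ops U" and f: "f \<in> fns V"
  and S: "finite S" and E: "!!i. i \<in> S ==> E i \<in> vfs U"
 shows "(\<Oplus>\<^bsub>tangent X U\<^esub>i\<in>S. E i) V f = (\<Oplus>\<^bsub>sec V\<^esub>i\<in>S. E i V f)"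
 by (rule finsum_hom[OF abelian_group_tangent[OF U] abelian_group_sections[OF opensD(1)[OF V]], of "%D. D V f"])
  (use V f S E in \<open>auto simp: tangent_eval intro: tangentD(1)\<close>)

text \<open>The weaker notion under which linear combinations are computed; a full flat frame is
  called for only by existence and uniqueness of coefficients and by flatness.\<close>

definition vector_family :: "nat => 'p set => ('m::finite + nat => ('p, 's) vfield) => bool" where
 "vector_family n U d \<longleftrightarrow> opn U \<and> (\<forall>i\<in>coords n. d i \<in> ders U (odd_index i))"

definition coeffs :: "nat => 'p set => ('m::finite + nat => 's) => bool" where
 "coeffs n V f \<longleftrightarrow> (\<forall>i\<in>coords n. f i \<in> fns V)"

context
 fixes n U and d :: "'m::finite + nat => ('p, 's) vfield"
 assumes d: "vector_family n U d"
begin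

lemma family_derivation: "i \<in> coords n ==> V \<in> ops U ==> vrst V (d i) \<in> ders V (odd_index i)"
 using d vrestr_derivation unfolding vector_family_def by blast

lemma family_tangent: "i \<in> coords n ==> V \<in> ops U ==> vrst V (d i) \<in> vfs V"
 using family_derivation derivation_tangent by blast

lemma lin_comb_term:
 "V \<in> ops U ==> coeffs n V f ==> i \<in> coords n ==> f i \<cdot>[V] vrst V (d i) \<in> vfs V"
 using tangent_smult_closed[OF opensD(1)] family_tangent unfolding coeffs_def by blast

lemma lin_comb_closed:
 assumes V: "V \<in> ops U" and f: "coeffs n V f"
 shows "comb n V f d \<in> vfs V"
proof -
 interpret T: abelian_group "tangent X V" by (rule abelian_group_tangent[OF opensD(1)[OF V]])
 show ?thesis unfolding lin_comb_def using lin_comb_term[OF V f] by (intro T.finsum_closed) auto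
qed

lemma lin_comb_eval:
 assumes V: "V \<in> ops U" and f: "coeffs n V f" and W: "W \<in> ops V" and g: "g \<in> fns W"
 shows "comb n V f d W g = (\<Oplus>\<^bsub>sec W\<^esub>i\<in>coords n. rstr V W (f i) *[W] d i W g)"
proof -
 have "comb n V f d W g = (\<Oplus>\<^bsub>sec W\<^esub>i\<in>coords n. (f i \<cdot>[V] vrst V (d i)) W g)"
  unfolding lin_comb_def
  by (rule finsum_tangent_eval[OF opensD(1)[OF V] W g finite_coords lin_comb_term[OF V f]])
 then show ?thesis by (simp only: tangent_eval[OF W g] vrestr_eval[OF W])
qed

lemma family_closed:
 assumes "i \<in> coords n" "V \<in> ops U" "f \<in> fns V"
 shows "d i V f \<in> fns V"
 using assms d derivationD(1) unfolding vector_family_def by blast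

lemma lin_comb_cong:
 assumes "V \<in> ops U" "coeffs n V g" "!!i. i \<in> coords n ==> f i = g i"
 shows "comb n V f d = comb n V g d"
proof -
 interpret T: abelian_group "tangent X V" by (rule abelian_group_tangent[OF opensD(1)[OF assms(1)]])
 show ?thesis unfolding lin_comb_def using lin_comb_term[OF assms(1,2)] assms(3)
  by (intro T.finsum_cong') auto
qed

lemma lin_comb_restr:
 assumes V: "V \<in> ops U" and f: "coeffs n V f" and W: "W \<in> ops V"
 shows "vrst W (comb n V f d) = comb n W (%i. rstr V W (f i)) d"
proof (rule tangent_eqI)
 have c: "coeffs n W (%i. rstr V W (f i))"
  using f restr_opens(1)[OF V W] by (auto simp: coeffs_def)
 have WU: "W \<in> ops U" by (rule opens_trans[OF W V])
 show "vrst W (comb n V f d) \<in> vfs W"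
  by (rule vrestr_tangent[OF lin_comb_closed[OF V f] W])
 show "comb n W (%i. rstr V W (f i)) d \<in> vfs W"
  by (rule lin_comb_closed[OF WU c])
 fix W' g assume W': "W' \<in> ops W" and g: "g \<in> fns W'"
 interpret ring "sec W'" by (rule ring_sections[OF opensD(1)[OF W']])
 have W'V: "W' \<in> ops V" by (rule opens_trans[OF W' W])
 show "vrst W (comb n V f d) W' g = comb n W (%i. rstr V W (f i)) d W' g"
  unfolding vrestr_eval[OF W'] lin_comb_eval[OF V f W'V g] lin_comb_eval[OF WU c W' g]
 proof (rule finsum_cong')
  show "(%i. rstr W W' (rstr V W (f i)) *[W'] d i W' g) \<in> coords n \<rightarrow> fns W'"
   using f restr_opens(1)[OF V W] restr_opens(1)[OF WU W'] family_closed[OF _ opens_trans[OF W'V V] g]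
   by (auto simp: coeffs_def)
  show "rstr V W' (f i) *[W'] d i W' g = rstr W W' (rstr V W (f i)) *[W'] d i W' g"
   if "i \<in> coords n" for i
   using restr_restr[OF opensD(1)[OF V] opensD[OF W] opensD[OF W'], of "f i"] f that by (simp add: coeffs_def)
 qed simp
qed

lemma lin_comb_add:
 assumes V: "V \<in> ops U" and f: "coeffs n V f" and g: "coeffs n V g"
 shows "comb n V (%i. f i +[V] g i) d = comb n V f d \<boxplus>[V] comb n V g d"
proof -
 interpret T: abelian_group "tangent X V" by (rule abelian_group_tangent[OF opensD(1)[OF V]])
 have "comb n V (%i. f i +[V] g i) d =
   (\<Oplus>\<^bsub>tangent X V\<^esub>i\<in>coords n. (f i \<cdot>[V] vrst V (d i)) \<boxplus>[V] (g i \<cdot>[V] vrst V (d i)))"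
  unfolding lin_comb_def
 proof (rule T.finsum_cong')
  fix i :: "'m + nat" assume i: "i \<in> coords n"
  have fg: "f i \<in> fns V" "g i \<in> fns V" using f g i by (auto simp: coeffs_def)
  show "(f i +[V] g i) \<cdot>[V] vrst V (d i) =
    (f i \<cdot>[V] vrst V (d i)) \<boxplus>[V] (g i \<cdot>[V] vrst V (d i))"
   by (rule tangent_smult_add(1)[OF opensD(1)[OF V] fg tangent_vfields[OF family_tangent[OF i V]]])
 qed (use lin_comb_term[OF V f] lin_comb_term[OF V g] in auto)
 then show ?thesis unfolding lin_comb_def
  using lin_comb_term[OF V f] lin_comb_term[OF V g] by (simp add: T.finsum_addf Pi_def)
qed

lemma lin_comb_smult:
 assumes V: "V \<in> ops U" and f: "coeffs n V f" and g: "g \<in> fns V"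
 shows "g \<cdot>[V] comb n V f d = comb n V (%i. g *[V] f i) d"
proof -
 note oV = opensD(1)[OF V]
 interpret ring "sec V" by (rule ring_sections[OF oV])
 interpret T: abelian_group "tangent X V" by (rule abelian_group_tangent[OF oV])
 have gf: "coeffs n V (%i. g *[V] f i)" using f g by (auto simp: coeffs_def)
 have "g \<cdot>[V] comb n V f d =
   (\<Oplus>\<^bsub>tangent X V\<^esub>i\<in>coords n. g \<cdot>[V] (f i \<cdot>[V] vrst V (d i)))"
  unfolding lin_comb_def
  by (rule finsum_hom[OF abelian_group_tangent[OF oV] abelian_group_tangent[OF oV]])
   (use lin_comb_term[OF V f] g in \<open>auto intro: tangent_smult_closed[OF oV] tangent_smult_add(2)[OF oV] tangent_vfields\<close>)
 also have "... = comb n V (%i. g *[V] f i) d"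
  unfolding lin_comb_def
  using lin_comb_term[OF V gf] f g family_tangent[OF _ V]
  by (intro T.finsum_cong') (auto simp: coeffs_def intro!: tangent_smult_add(3)[OF oV, symmetric] tangent_vfields)
 finally show ?thesis .
qed

lemma lin_comb_homogeneous:
 assumes V: "V \<in> ops U" and f: "!!i. i \<in> coords n ==> f i \<in> part X V (c ~= odd_index i)"
 shows "comb n V f d \<in> ders V c"
proof -
 note oV = opensD(1)[OF V]
 interpret T: abelian_group "tangent X V" by (rule abelian_group_tangent[OF oV])
 have t: "f i \<cdot>[V] vrst V (d i) \<in> ders V c" if "i \<in> coords n" for i
 proof -
  have "(odd_index i ~= (c ~= odd_index i)) = c" by auto
  then show ?thesis using derivation_smult[OF oV f[OF that] family_derivation[OF that V]] by simp
 qed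
 have "(\<Oplus>\<^bsub>tangent X V\<^esub>i\<in>S. f i \<cdot>[V] vrst V (d i)) \<in> ders V c"
  if "finite S" "S <= coords n" for S using that
 proof (induction S)
  case empty
  then show ?case using derivation_zero by simp
 next
  case (insert x S)
  then show ?case using t derivation_tangent[OF t]
   by (subst T.finsum_insert) (auto intro!: derivation_add)
 qed
 then show ?thesis unfolding lin_comb_def by simp
qed

end

end

context ringed_space
begin

lemma vrestr_add: "V \<in> ops U ==>
  vrst V (D \<boxplus>[U] E) = vrst V D \<boxplus>[V] vrst V E"
proof
 fix W assume V: "V \<in> ops U"
 show "vrst V (D \<boxplus>[U] E) W = (vrst V D \<boxplus>[V] vrst V E) W"
  using opens_trans[OF _ V] by (cases "W \<in> ops V") (simp_all add: vrestr_def tangent_simps vadd_def)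
qed

lemma tangent_minus_smult:
 assumes U: "opn U" and D: "D \<in> vfs U"
 shows "\<ominus>\<^bsub>tangent X U\<^esub> D = (\<ominus>\<^bsub>sec U\<^esub> \<one>\<^bsub>sec U\<^esub>) \<cdot>[U] D"
proof -
 interpret U: ring "sec U" by (rule ring_sections[OF U])
 interpret T: abelian_group "tangent X U" by (rule abelian_group_tangent[OF U])
 have m: "\<ominus>\<^bsub>sec U\<^esub> \<one>\<^bsub>sec U\<^esub> \<in> fns U" by simp
 have Dv: "D \<in> vfields U" by (rule tangent_vfields[OF D])
 have "((\<ominus>\<^bsub>sec U\<^esub> \<one>\<^bsub>sec U\<^esub>) \<cdot>[U] D) \<boxplus>[U] D = \<zero>\<^bsub>tangent X U\<^esub>"
  using tangent_smult_add(1)[OF U m U.one_closed Dv] tangent_smult_add(5)[OF U Dv]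
  by (simp add: U.l_neg tangent_smult_add(4)[OF U Dv])
 then show ?thesis using T.minus_equality[OF _ D tangent_smult_closed[OF U m D]] by simp
qed

lemma ksign_tangent_closed:
 "opn U ==> D \<in> vfs U ==> ksign (tangent X U) b D \<in> vfs U"
 using abelian_group.a_inv_closed[OF abelian_group_tangent] by (simp add: ksign_def)

lemma vrestr_minus:
 assumes U: "opn U" and V: "V \<in> ops U" and D: "D \<in> vfs U"
 shows "vrst V (\<ominus>\<^bsub>tangent X U\<^esub> D) = \<ominus>\<^bsub>tangent X V\<^esub> vrst V D"
proof -
 note oV = opensD(1)[OF V]
 interpret T: abelian_group "tangent X U" by (rule abelian_group_tangent[OF U])
 interpret TV: abelian_group "tangent X V" by (rule abelian_group_tangent[OF oV])
 show ?thesis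
 proof (rule tangent_eqI)
  show "vrst V (\<ominus>\<^bsub>tangent X U\<^esub> D) \<in> vfs V" using D V by (intro vrestr_tangent) auto
  show "\<ominus>\<^bsub>tangent X V\<^esub> vrst V D \<in> vfs V" using vrestr_tangent[OF D V] by simp
  fix W f assume W: "W \<in> ops V" and f: "f \<in> fns W"
  show "vrst V (\<ominus>\<^bsub>tangent X U\<^esub> D) W f = (\<ominus>\<^bsub>tangent X V\<^esub> vrst V D) W f"
   unfolding vrestr_eval[OF W] tangent_minus_eval[OF U D opens_trans[OF W V] f]
    tangent_minus_eval[OF oV vrestr_tangent[OF D V] W f] ..
 qed
qed

text \<open>The component of the wrong parity is locally a difference of two fields of parity
  \<open>a\<close>; it then has both parities and is zero.\<close>

lemma derivation_local:
 assumes U: "opn U" and F: "F \<in> vfs U"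
  and loc: "!!p. p \<in> U ==> \<exists>V\<in>ops U. p \<in> V \<and> vrst V F \<in> ders V a"
 shows "F \<in> ders U a"
proof -
 interpret T: abelian_group "tangent X U" by (rule abelian_group_tangent[OF U])
 obtain F0 F1 where F01: "F0 \<in> ders U False" "F1 \<in> ders U True" "F = F0 \<boxplus>[U] F1"
  using F by (rule tangentE)
 have "\<exists>G H. G \<in> ders U a \<and> H \<in> ders U (\<not> a) \<and> F = G \<boxplus>[U] H"
 proof (cases a)
  case True
  then show ?thesis using F01 T.a_comm[OF derivation_tangent[OF F01(1)] derivation_tangent[OF F01(2)]] by auto
 qed (use F01 in auto)
 then obtain G H where G: "G \<in> ders U a" and H: "H \<in> ders U (\<not> a)"
  and FGH: "F = G \<boxplus>[U] H" by blast
 have Gt: "G \<in> vfs U" and Ht: "H \<in> vfs U" using G H derivation_tangent by auto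
 have "H = \<zero>\<^bsub>tangent X U\<^esub>"
 proof (rule tangent_eqI_local[OF Ht tangent_zero_closed])
  fix p assume "p \<in> U"
  then obtain V where V: "V \<in> ops U" "p \<in> V" "vrst V F \<in> ders V a" using loc by blast
  note oV = opensD(1)[OF V(1)]
  interpret TV: abelian_group "tangent X V" by (rule abelian_group_tangent[OF oV])
  have g: "vrst V G \<in> ders V a" and h: "vrst V H \<in> ders V (\<not> a)"
   using vrestr_derivation[OF G V(1)] vrestr_derivation[OF H V(1)] by auto
  have gt: "vrst V G \<in> vfs V" and ht: "vrst V H \<in> vfs V"
   using g h derivation_tangent by auto
  have "vrst V H = \<ominus>\<^bsub>tangent X V\<^esub> vrst V G \<boxplus>[V] vrst V F"
   unfolding FGH vrestr_add[OF V(1)] using gt ht by (simp add: TV.r_neg1)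
  then have "vrst V H \<in> ders V a"
   using derivation_add[OF derivation_minus[OF oV g] V(3)] by simp
  then have "vrst V H = \<zero>\<^bsub>tangent X V\<^esub>"
   using h derivation_both_zero[of "vrst V H" V] by (cases a) auto
  moreover have "vrst V \<zero>\<^bsub>tangent X U\<^esub> = \<zero>\<^bsub>tangent X V\<^esub>"
   using opens_trans[OF _ V(1)] by (auto simp: vrestr_def tangent_simps fun_eq_iff)
  ultimately show "\<exists>V\<in>ops U. p \<in> V \<and> vrst V H = vrst V \<zero>\<^bsub>tangent X U\<^esub>"
   using V by auto
 qed
 then show ?thesis using FGH G Gt by simp
qed

lemma lin_comb_ksign:
 assumes d: "vector_family n U d" and V: "V \<in> ops U" and f: "coeffs n V f"
 shows "comb n V (%i. ksign (sec V) b (f i)) d = ksign (tangent X V) b (comb n V f d)"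
proof (cases b)
 case True
 note oV = opensD(1)[OF V]
 interpret ring "sec V" by (rule ring_sections[OF oV])
 have mf: "coeffs n V (%i. (\<ominus>\<^bsub>sec V\<^esub> \<one>\<^bsub>sec V\<^esub>) *[V] f i)" using f by (auto simp: coeffs_def)
 have "comb n V (%i. \<ominus>\<^bsub>sec V\<^esub> f i) d = comb n V (%i. (\<ominus>\<^bsub>sec V\<^esub> \<one>\<^bsub>sec V\<^esub>) *[V] f i) d"
  by (rule lin_comb_cong[OF d V mf]) (use f in \<open>auto simp: coeffs_def l_minus\<close>)
 also have "... = \<ominus>\<^bsub>tangent X V\<^esub> comb n V f d"
  using tangent_minus_smult[OF oV lin_comb_closed[OF d V f]] lin_comb_smult[OF d V f] by simp
 finally show ?thesis using True by (simp add: ksign_def)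
qed (simp add: ksign_def)

lemma family_basis:
 assumes d: "vector_family n U d" and V: "V \<in> ops U" and i: "i \<in> coords n"
 shows "vrst V (d i) = comb n V (%j. if j = i then \<one>\<^bsub>sec V\<^esub> else \<zero>\<^bsub>sec V\<^esub>) d"
proof -
 note oV = opensD(1)[OF V]
 interpret ring "sec V" by (rule ring_sections[OF oV])
 interpret T: abelian_group "tangent X V" by (rule abelian_group_tangent[OF oV])
 note t = family_tangent[OF d _ V]
 have "comb n V (%j. if j = i then \<one>\<^bsub>sec V\<^esub> else \<zero>\<^bsub>sec V\<^esub>) d =
   (\<Oplus>\<^bsub>tangent X V\<^esub>j\<in>coords n. if i = j then vrst V (d j) else \<zero>\<^bsub>tangent X V\<^esub>)"
  unfolding lin_comb_def
  by (rule T.finsum_cong') (use t in \<open>auto simp: tangent_smult_add(4,5)[OF oV tangent_vfields[OF t]] intro: tangent_zero_closed\<close>)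
 also have "... = vrst V (d i)"
  by (rule T.finsum_singleton[OF i]) (use t in auto)
 finally show ?thesis ..
qed

subsection \<open>Flat frames\<close>

lemma flat_frame_family: "flat_frame n X T U d ==> vector_family n U d"
 by (auto simp: flat_frame_def vector_family_def opens_whole)

context
 fixes n T U and d :: "'m::finite + nat => ('p, 's) vfield"
 assumes ff: "flat_frame n X T U d"
begin

lemma flat_frame_props:
 assumes V: "V \<in> ops U"
 shows "D \<in> vfs V ==>
   \<exists>!f. f \<in> coords n \<rightarrow>\<^sub>E fns V \<and> D = comb n V f d"
  and "f \<in> coords n \<rightarrow> fns V ==>
   comb n V f d \<in> T V \<longleftrightarrow> (\<forall>i\<in>coords n. locally_constant X V (f i))"
proof -
 note * = ff[unfolded flat_frame_def, THEN conjunct2, THEN conjunct2, rule_format, OF V]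
 show "D \<in> vfs V ==> \<exists>!f. f \<in> coords n \<rightarrow>\<^sub>E fns V \<and> D = comb n V f d"
  using *[THEN conjunct1] by simp
 show "f \<in> coords n \<rightarrow> fns V ==>
   comb n V f d \<in> T V \<longleftrightarrow> (\<forall>i\<in>coords n. locally_constant X V (f i))"
  using *[THEN conjunct2] by simp
qed

lemma frame_coeffs:
 assumes V: "V \<in> ops U" and D: "D \<in> vfs V"
 obtains f where "coeffs n V f" "D = comb n V f d"
proof -
 obtain f where "f \<in> coords n \<rightarrow>\<^sub>E fns V" "D = comb n V f d"
  using flat_frame_props(1)[OF V D] by (elim ex1E conjE) (rule that)
 then show ?thesis using that[of f] by (auto simp: coeffs_def)
qed

lemma frame_unique:
 assumes V: "V \<in> ops U" and f: "coeffs n V f" and g: "coeffs n V g"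
  and eq: "comb n V f d = comb n V g d" and i: "i \<in> coords n"
 shows "f i = g i"
proof -
 note fam = flat_frame_family[OF ff]
 define D where "D = comb n V f d"
 define P where "P = (%h. h \<in> coords n \<rightarrow>\<^sub>E fns V \<and> D = comb n V h d)"
 have "\<exists>!h. P h"
  unfolding P_def by (rule flat_frame_props(1)[OF V]) (use lin_comb_closed[OF fam V f] in \<open>simp add: D_def\<close>)
 moreover have "P (restrict f (coords n))"
  unfolding P_def D_def using f lin_comb_cong[OF fam V f, of "restrict f (coords n)"] by (auto simp: coeffs_def)
 moreover have "P (restrict g (coords n))"
  unfolding P_def D_def eq using g lin_comb_cong[OF fam V g, of "restrict g (coords n)"] by (auto simp: coeffs_def)
 ultimately have "restrict f (coords n) = restrict g (coords n)" by blast
 then show ?thesis using i by (metis restrict_apply')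
qed

lemma frame_flat:
 "V \<in> ops U ==> coeffs n V f ==>
  comb n V f d \<in> T V \<longleftrightarrow> (\<forall>i\<in>coords n. locally_constant X V (f i))"
 by (rule flat_frame_props(2)) (auto simp: coeffs_def)

text \<open>Split the coefficients into parts; those of the wrong parity combine to a field that is both even and odd.\<close>

lemma frame_homogeneous:
 assumes V: "V \<in> ops U" and f: "coeffs n V f" and D: "comb n V f d \<in> ders V c"
  and i: "i \<in> coords n"
 shows "f i \<in> part X V (c ~= odd_index i)"
proof -
 note oV = opensD(1)[OF V] and fam = flat_frame_family[OF ff]
 interpret ring "sec V" by (rule ring_sections[OF oV])
 interpret T: abelian_group "tangent X V" by (rule abelian_group_tangent[OF oV])
 have "\<exists>h k. h \<in> part X V (c ~= odd_index j) \<and> k \<in> part X V ((\<not> c) ~= odd_index j) \<and> f j = h +[V] k"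
  if j: "j \<in> coords n" for j
 proof -
  have fj: "f j \<in> fns V" using f j by (simp add: coeffs_def)
  obtain f0 f1 where f01: "f0 \<in> part X V False" "f1 \<in> part X V True" "f j = f0 +[V] f1"
   by (rule part_decomp[OF oV fj])
  have comm: "f j = f1 +[V] f0"
   unfolding f01(3) using part_carrier[OF oV f01(1)] part_carrier[OF oV f01(2)] by (rule a_comm)
  show ?thesis
  proof (cases "c ~= odd_index j")
   case True
   have "f1 \<in> part X V (c ~= odd_index j) \<and> f0 \<in> part X V ((\<not> c) ~= odd_index j)"
   proof -
    have e: "(c ~= odd_index j) = True" "((\<not> c) ~= odd_index j) = False" using True by auto
    show ?thesis unfolding e by (intro conjI f01)
   qed
   then show ?thesis using comm by blast
  next
   case False
   have "f0 \<in> part X V (c ~= odd_index j) \<and> f1 \<in> part X V ((\<not> c) ~= odd_index j)"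
   proof -
    have e: "(c ~= odd_index j) = False" "((\<not> c) ~= odd_index j) = True" using False by auto
    show ?thesis unfolding e by (intro conjI f01)
   qed
   then show ?thesis using f01(3) by blast
  qed
 qed
 then obtain h k where hk: "!!j. j \<in> coords n ==> h j \<in> part X V (c ~= odd_index j)"
  "!!j. j \<in> coords n ==> k j \<in> part X V ((\<not> c) ~= odd_index j)"
  "!!j. j \<in> coords n ==> f j = h j +[V] k j" by metis
 have ch: "coeffs n V h" and ck: "coeffs n V k" using hk(1,2) part_carrier[OF oV] by (auto simp: coeffs_def)
 have z: "coeffs n V (%_. \<zero>\<^bsub>sec V\<^esub>)" by (simp add: coeffs_def)
 have chk: "coeffs n V (%j. h j +[V] k j)" using ch ck by (simp add: coeffs_def)
 have H: "comb n V h d \<in> ders V c" by (rule lin_comb_homogeneous[OF fam V hk(1)])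
 have K: "comb n V k d \<in> ders V (\<not> c)" by (rule lin_comb_homogeneous[OF fam V hk(2)])
 have Ht: "comb n V h d \<in> vfs V" and Kt: "comb n V k d \<in> vfs V"
  using H K derivation_tangent by auto
 have sum: "comb n V f d = comb n V h d \<boxplus>[V] comb n V k d"
  using lin_comb_cong[OF fam V chk, of f] hk(3) lin_comb_add[OF fam V ch ck] by simp
 have "comb n V k d = \<ominus>\<^bsub>tangent X V\<^esub> comb n V h d \<boxplus>[V] comb n V f d"
  unfolding sum using Ht Kt by (simp add: T.r_neg1)
 then have "comb n V k d \<in> ders V c"
  using derivation_add[OF derivation_minus[OF oV H] D] by simp
 then have k0: "comb n V k d = \<zero>\<^bsub>tangent X V\<^esub>"
  using K derivation_both_zero[of "comb n V k d" V] by (cases c) auto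
 have "comb n V (%_. \<zero>\<^bsub>sec V\<^esub>) d = \<zero>\<^bsub>tangent X V\<^esub>"
  unfolding lin_comb_def using tangent_smult_add(5)[OF oV tangent_vfields[OF family_tangent[OF fam _ V]]]
  by (subst T.finsum_cong'[of _ _ "%_. \<zero>\<^bsub>tangent X V\<^esub>"]) auto
 then have "k i = \<zero>\<^bsub>sec V\<^esub>" using frame_unique[OF V ck z _ i] k0 by simp
 then show ?thesis using hk(1,3)[OF i] part_carrier[OF oV] by simp
qed

end

end

section \<open>The commutativity equations\<close>

locale flat_superspace = ringed_space X
 for X :: "('p, 's, 'k::field) superspace" +
 fixes L :: "('k^'m::finite, ('k, 'm) sfun, 'k) superspace" and n :: nat
  and T :: "'p set => ('p, 's) vfield set" and nabla :: "('p, 's) connection"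
 assumes flat: "affine_flat_structure L n X T" and connection: "flat_connection X T nabla"
begin

lemma flat_props:
 assumes U: "opn U"
 shows "T U <= vfs U"
  and "D \<in> T U ==> V \<in> ops U ==> vrst V D \<in> T V"
  and "D \<in> vfs U ==> (\<forall>p\<in>U. \<exists>V\<in>ops U. p \<in> V \<and> vrst V D \<in> T V) ==> D \<in> T U"
  and "D \<in> T U ==> D \<in> ders U a ==> E \<in> T U ==> E \<in> ders U b ==> V \<in> ops U ==>
   f \<in> fns V ==> D V (E V f) = ksign (sec V) (a \<and> b) (E V (D V f))"
proof -
 have "U \<in> ops (whole X)" using U by (simp add: opens_whole)
 note * = flat[unfolded affine_flat_structure_def, THEN conjunct1, rule_format, OF this]
 show "T U <= vfs U" using * by (elim conjE)
 have r: "\<forall>D\<in>T U. \<forall>V\<in>ops U. vrst V D \<in> T V" using * by (elim conjE)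
 then show "D \<in> T U ==> V \<in> ops U ==> vrst V D \<in> T V" by simp
 have l: "\<forall>D\<in>vfs U. (\<forall>p\<in>U. \<exists>V\<in>ops U. p \<in> V \<and> vrst V D \<in> T V) --> D \<in> T U"
  using * by (elim conjE)
 then show "D \<in> vfs U ==> (\<forall>p\<in>U. \<exists>V\<in>ops U. p \<in> V \<and> vrst V D \<in> T V) ==> D \<in> T U"
  by simp
 have c: "\<forall>a b. \<forall>D\<in>T U \<inter> ders U a. \<forall>E\<in>T U \<inter> ders U b.
   \<forall>V\<in>ops U. \<forall>f\<in>fns V. D V (E V f) = ksign (sec V) (a \<and> b) (E V (D V f))"
  using * by (elim conjE)
 then show "D \<in> T U ==> D \<in> ders U a ==> E \<in> T U ==> E \<in> ders U b ==> V \<in> ops U ==>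
   f \<in> fns V ==> D V (E V f) = ksign (sec V) (a \<and> b) (E V (D V f))" by simp
qed

lemma flat_coordinates_near:
 assumes U: "opn U" and p: "p \<in> U"
 obtains V U' d where "V \<in> ops U" "p \<in> V" "V \<in> ops U'" "flat_coordinates L n X T U' d"
proof -
 have "p \<in> whole X" using p openin_subset[OF U] by auto
 then obtain U' d where d: "p \<in> U'" "flat_coordinates L n X T U' d"
  using flat[unfolded affine_flat_structure_def, THEN conjunct2] by blast
 have U': "opn U'" using d(2) unfolding flat_coordinates_def flat_frame_def by (simp add: opens_whole)
 show ?thesis
  by (rule that[of "U \<inter> U'" U' d]) (use U U' p d in \<open>auto intro!: opensI\<close>)
qed

lemma nabla_props:
 assumes U: "opn U" and D: "D \<in> vfs U"
 shows "E \<in> vfs U ==> nabla U D E \<in> vfs U"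
  and "E \<in> vfs U ==> E' \<in> vfs U ==>
   nabla U D (E \<boxplus>[U] E') = nabla U D E \<boxplus>[U] nabla U D E'"
  and "E \<in> vfs U ==> V \<in> ops U ==>
   vrst V (nabla U D E) = nabla V (vrst V D) (vrst V E)"
  and "g \<in> fns U ==> s \<in> T U ==> nabla U D (g \<cdot>[U] s) = D U g \<cdot>[U] s"
proof -
 have "U \<in> ops (whole X)" using U by (simp add: opens_whole)
 note * = connection[unfolded flat_connection_def, rule_format, OF this D]
 note 1 = *[THEN conjunct1, rule_format]
 show "E \<in> vfs U ==> nabla U D E \<in> vfs U"
  "E \<in> vfs U ==> E' \<in> vfs U ==>
   nabla U D (E \<boxplus>[U] E') = nabla U D E \<boxplus>[U] nabla U D E'"
  "E \<in> vfs U ==> V \<in> ops U ==>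
   vrst V (nabla U D E) = nabla V (vrst V D) (vrst V E)"
  using 1 by simp_all
 show "g \<in> fns U ==> s \<in> T U ==> nabla U D (g \<cdot>[U] s) = D U g \<cdot>[U] s"
  using *[THEN conjunct2] by simp
qed

lemma coeffs_derivative:
 "D \<in> vfs V ==> opn V ==> coeffs n V f ==> coeffs n V (%i. D V (f i))"
 using tangentD(1)[OF _ opens_refl] by (auto simp: coeffs_def)

text \<open>The fields \<open>d i\<close> are flat, so only the coefficients are
  differentiated.\<close>

lemma nabla_lin_comb:
 fixes d :: "'m + nat => ('p, 's) vfield"
 assumes d: "flat_frame n X T U d" and V: "V \<in> ops U" and D: "D \<in> vfs V" and f: "coeffs n V f"
 shows "nabla V D (comb n V f d) = comb n V (%i. D V (f i)) d"
proof -
 note oV = opensD(1)[OF V] and fam = flat_frame_family[OF d]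
 interpret A: abelian_group "tangent X V" by (rule abelian_group_tangent[OF oV])
 have U: "opn U" using fam by (simp add: vector_family_def)
 have flat: "vrst V (d i) \<in> T V" if "i \<in> coords n" for i
  using d that V flat_props(2)[OF U] unfolding flat_frame_def by blast
 have "nabla V D (comb n V f d) =
   (\<Oplus>\<^bsub>tangent X V\<^esub>i\<in>coords n. nabla V D (f i \<cdot>[V] vrst V (d i)))"
  unfolding lin_comb_def
  by (rule finsum_hom[OF abelian_group_tangent[OF oV] abelian_group_tangent[OF oV]
     nabla_props(1)[OF oV D] nabla_props(2)[OF oV D] finite_coords lin_comb_term[OF fam V f]])
 also have "... = comb n V (%i. D V (f i)) d"
  unfolding lin_comb_def
 proof (rule A.finsum_cong')
  show "(%i. D V (f i) \<cdot>[V] vrst V (d i)) \<in> coords n \<rightarrow> vfs V"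
   using lin_comb_term[OF fam V coeffs_derivative[OF D oV f]] by auto
  show "nabla V D (f i \<cdot>[V] vrst V (d i)) = D V (f i) \<cdot>[V] vrst V (d i)"
   if "i \<in> coords n" for i
   using nabla_props(4)[OF oV D _ flat[OF that]] f that by (simp add: coeffs_def)
 qed simp
 finally show ?thesis .
qed

lemma tangent_eqI_frames:
 assumes U: "opn U" and D: "D \<in> vfs U" and E: "E \<in> vfs U"
  and loc: "!!V U' d. V \<in> ops U ==> V \<in> ops U' ==> flat_coordinates L n X T U' d ==>
   vrst V D = vrst V E"
 shows "D = E"
proof (rule tangent_eqI_local[OF D E])
 fix p assume "p \<in> U"
 from flat_coordinates_near[OF U this] obtain V U' d where
  "V \<in> ops U" "p \<in> V" "V \<in> ops U'" "flat_coordinates L n X T U' d" .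
 then show "\<exists>V\<in>ops U. p \<in> V \<and> vrst V D = vrst V E" using loc by blast
qed

lemma flat_coordinates_frame: "flat_coordinates L n X T U d ==> flat_frame n X T U d"
 by (simp add: flat_coordinates_def)

text \<open>\<open>flat_connection\<close> prescribes additivity in the differentiated field. In the
  direction it follows from the expression in a flat frame, where \<open>nabla\<close>
  differentiates coefficients.\<close>

lemma nabla_add_left:
 assumes U: "opn U" and D: "D \<in> vfs U" and D': "D' \<in> vfs U"
  and E: "E \<in> vfs U"
 shows "nabla U (D \<boxplus>[U] D') E = nabla U D E \<boxplus>[U] nabla U D' E"
proof (rule tangent_eqI_frames[OF U])
 fix V U' d assume V: "V \<in> ops U" and VU': "V \<in> ops U'" and "flat_coordinates L n X T U' d"
 then have d: "flat_frame n X T U' d" by (simp add: flat_coordinates_def)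
 note oV = opensD(1)[OF V] and fam = flat_frame_family[OF d]
 note r = vrestr_tangent[OF D V] vrestr_tangent[OF D' V]
 obtain f where f: "coeffs n V f" "vrst V E = comb n V f d"
  using frame_coeffs[OF d VU' vrestr_tangent[OF E V]] .
 have "nabla V (vrst V D \<boxplus>[V] vrst V D') (comb n V f d) =
   comb n V (%i. (vrst V D \<boxplus>[V] vrst V D') V (f i)) d"
  by (rule nabla_lin_comb[OF d VU' tangent_add_closed[OF r] f(1)])
 also have "... = comb n V (%i. vrst V D V (f i) +[V] vrst V D' V (f i)) d"
  by (rule lin_comb_cong[OF fam VU'])
   (use f coeffs_derivative[OF r(1) oV f(1)] coeffs_derivative[OF r(2) oV f(1)]
    ring.ring_simprules(1)[OF ring_sections[OF oV]] in
    \<open>auto simp: coeffs_def tangent_eval(1)[OF opens_refl[OF oV]]\<close>)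
 also have "... = nabla V (vrst V D) (comb n V f d) \<boxplus>[V] nabla V (vrst V D') (comb n V f d)"
  unfolding nabla_lin_comb[OF d VU' r(1) f(1)] nabla_lin_comb[OF d VU' r(2) f(1)]
  by (rule lin_comb_add[OF fam VU' coeffs_derivative[OF r(1) oV f(1)] coeffs_derivative[OF r(2) oV f(1)]])
 finally show "vrst V (nabla U (D \<boxplus>[U] D') E) =
   vrst V (nabla U D E \<boxplus>[U] nabla U D' E)"
  unfolding vrestr_add[OF V] nabla_props(3)[OF U tangent_add_closed[OF D D'] E V]
   nabla_props(3)[OF U D E V] nabla_props(3)[OF U D' E V] f(2) .
qed (use D D' E nabla_props(1)[OF U] in \<open>auto intro: tangent_add_closed\<close>)

lemma nabla_smult_left:
 assumes U: "opn U" and g: "g \<in> fns U" and D: "D \<in> vfs U" and E: "E \<in> vfs U"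
 shows "nabla U (g \<cdot>[U] D) E = g \<cdot>[U] nabla U D E"
proof (rule tangent_eqI_frames[OF U])
 fix V U' d assume V: "V \<in> ops U" and VU': "V \<in> ops U'" and "flat_coordinates L n X T U' d"
 then have d: "flat_frame n X T U' d" by (simp add: flat_coordinates_def)
 note oV = opensD(1)[OF V] and fam = flat_frame_family[OF d]
 interpret ring "sec V" by (rule ring_sections[OF oV])
 note r = vrestr_tangent[OF D V]
 have gV: "rstr U V g \<in> fns V" by (rule restr_opens(1)[OF opens_refl[OF U] V g])
 obtain f where f: "coeffs n V f" "vrst V E = comb n V f d"
  using frame_coeffs[OF d VU' vrestr_tangent[OF E V]] .
 note Df = coeffs_derivative[OF r oV f(1)]
 have "nabla V (rstr U V g \<cdot>[V] vrst V D) (comb n V f d) =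
   comb n V (%i. (rstr U V g \<cdot>[V] vrst V D) V (f i)) d"
  by (rule nabla_lin_comb[OF d VU' tangent_smult_closed[OF oV gV r] f(1)])
 also have "... = comb n V (%i. rstr U V g *[V] vrst V D V (f i)) d"
  by (rule lin_comb_cong[OF fam VU'])
   (use f gV Df in \<open>auto simp: coeffs_def tangent_eval(3)[OF opens_refl[OF oV]] restr_id[OF oV]\<close>)
 also have "... = rstr U V g \<cdot>[V] nabla V (vrst V D) (comb n V f d)"
  unfolding nabla_lin_comb[OF d VU' r f(1)] by (rule lin_comb_smult[OF fam VU' Df gV, symmetric])
 finally show "vrst V (nabla U (g \<cdot>[U] D) E) = vrst V (g \<cdot>[U] nabla U D E)"
  unfolding vrestr_smult[OF U V g] nabla_props(3)[OF U tangent_smult_closed[OF U g D] E V]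
   nabla_props(3)[OF U D E V] f(2) .
qed (use g D E nabla_props(1)[OF U] tangent_smult_closed[OF U] in auto)

lemma ksign_vrestr:
 assumes U: "opn U" and V: "V \<in> ops U" and D: "D \<in> vfs U"
 shows "vrst V (ksign (tangent X U) b D) = ksign (tangent X V) b (vrst V D)"
 using vrestr_minus[OF U V D] by (simp add: ksign_def)

text \<open>In a flat frame this is the Leibniz rule of \<open>D\<close> on the products of
  \<open>g\<close> with the coefficients of \<open>E\<close>.\<close>

lemma nabla_leibniz:
 assumes U: "opn U" and D: "D \<in> ders U a" and g: "g \<in> part X U b" and E: "E \<in> vfs U"
 shows "nabla U D (g \<cdot>[U] E) =
  (D U g \<cdot>[U] E) \<boxplus>[U] ksign (tangent X U) (a \<and> b) (g \<cdot>[U] nabla U D E)"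
proof (rule tangent_eqI_frames[OF U])
 have Dt: "D \<in> vfs U" and gc: "g \<in> fns U"
  using derivation_tangent[OF D] part_carrier[OF U g] by auto
 have Dg: "D U g \<in> fns U" by (rule tangentD(1)[OF Dt opens_refl[OF U] gc])
 note cl = tangent_smult_closed[OF U gc E] tangent_smult_closed[OF U Dg E]
  tangent_smult_closed[OF U gc nabla_props(1)[OF U Dt E]]
 show "nabla U D (g \<cdot>[U] E) \<in> vfs U" by (rule nabla_props(1)[OF U Dt cl(1)])
 show "(D U g \<cdot>[U] E) \<boxplus>[U] ksign (tangent X U) (a \<and> b) (g \<cdot>[U] nabla U D E)
   \<in> vfs U"
  by (intro tangent_add_closed cl ksign_tangent_closed[OF U])
 fix V U' d assume V: "V \<in> ops U" and VU': "V \<in> ops U'" and "flat_coordinates L n X T U' d"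
 then have d: "flat_frame n X T U' d" by (simp add: flat_coordinates_def)
 note oV = opensD(1)[OF V] and fam = flat_frame_family[OF d]
 interpret ring "sec V" by (rule ring_sections[OF oV])
 note D' = vrestr_derivation[OF D V]
 note r = derivation_tangent[OF D']
 define h where "h = rstr U V g"
 have hp: "h \<in> part X V b" unfolding h_def by (rule restr_part[OF U opensD[OF V] g])
 have hc: "h \<in> fns V" by (rule part_carrier[OF oV hp])
 have Dh: "rstr U V (D U g) = vrst V D V h"
  unfolding h_def vrestr_eval[OF opens_refl[OF oV]] by (rule tangentD(4)[OF Dt opens_refl[OF U] V gc, symmetric])
 have Dhc: "vrst V D V h \<in> fns V" by (rule tangentD(1)[OF r opens_refl[OF oV] hc])
 obtain f where f: "coeffs n V f" "vrst V E = comb n V f d"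
  using frame_coeffs[OF d VU' vrestr_tangent[OF E V]] .
 note Df = coeffs_derivative[OF r oV f(1)]
 have hf: "coeffs n V (%i. h *[V] f i)" and hDf: "coeffs n V (%i. h *[V] vrst V D V (f i))"
  and Dhf: "coeffs n V (%i. vrst V D V h *[V] f i)"
  using f Df hc Dhc by (auto simp: coeffs_def)
 have khDf: "coeffs n V (%i. ksign (sec V) (a \<and> b) (h *[V] vrst V D V (f i)))"
  using hDf by (auto simp: coeffs_def)
 have "nabla V (vrst V D) (h \<cdot>[V] comb n V f d) =
   comb n V (%i. vrst V D V (h *[V] f i)) d"
  unfolding lin_comb_smult[OF fam VU' f(1) hc] by (rule nabla_lin_comb[OF d VU' r hf])
 also have "... = comb n V (%i. (vrst V D V h *[V] f i) +[V]
   ksign (sec V) (a \<and> b) (h *[V] vrst V D V (f i))) d"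
  by (rule lin_comb_cong[OF fam VU'])
   (use Dhf khDf f derivationD(5)[OF D' opens_refl[OF oV] hp] in \<open>auto simp: coeffs_def\<close>)
 also have "... = (vrst V D V h \<cdot>[V] comb n V f d) \<boxplus>[V]
   ksign (tangent X V) (a \<and> b) (h \<cdot>[V] nabla V (vrst V D) (comb n V f d))"
  unfolding lin_comb_add[OF fam VU' Dhf khDf] lin_comb_ksign[OF fam VU' hDf]
   lin_comb_smult[OF fam VU' f(1) Dhc] nabla_lin_comb[OF d VU' r f(1)] lin_comb_smult[OF fam VU' Df hc] ..
 finally show "vrst V (nabla U D (g \<cdot>[U] E)) = vrst V ((D U g \<cdot>[U] E) \<boxplus>[U]
   ksign (tangent X U) (a \<and> b) (g \<cdot>[U] nabla U D E))"
  unfolding vrestr_add[OF V] ksign_vrestr[OF U V cl(3)] vrestr_smult[OF U V gc] vrestr_smult[OF U V Dg]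
   nabla_props(3)[OF U Dt cl(1) V] nabla_props(3)[OF U Dt E V] f(2) Dh h_def[symmetric] .
qed

lemma nabla_homogeneous:
 assumes U: "opn U" and D: "D \<in> ders U a" and E: "E \<in> ders U b"
 shows "nabla U D E \<in> ders U (a ~= b)"
proof (rule derivation_local[OF U])
 have Dt: "D \<in> vfs U" and Et: "E \<in> vfs U" using D E derivation_tangent by auto
 show "nabla U D E \<in> vfs U" by (rule nabla_props(1)[OF U Dt Et])
 fix p assume "p \<in> U"
 from flat_coordinates_near[OF U this] obtain V U' d where
  V: "V \<in> ops U" "p \<in> V" "V \<in> ops U'" and "flat_coordinates L n X T U' d" .
 then have d: "flat_frame n X T U' d" by (simp add: flat_coordinates_def)
 note oV = opensD(1)[OF V(1)] and fam = flat_frame_family[OF d]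
 obtain f where f: "coeffs n V f" "vrst V E = comb n V f d"
  using frame_coeffs[OF d V(3) vrestr_tangent[OF Et V(1)]] .
 have fp: "f i \<in> part X V (b ~= odd_index i)" if "i \<in> coords n" for i
  using frame_homogeneous[OF d V(3) f(1) _ that, of b] vrestr_derivation[OF E V(1)] f(2) by simp
 have "nabla V (vrst V D) (vrst V E) = comb n V (%i. vrst V D V (f i)) d"
  unfolding f(2) by (rule nabla_lin_comb[OF d V(3) vrestr_tangent[OF Dt V(1)] f(1)])
 also have "... \<in> ders V (a ~= b)"
 proof (rule lin_comb_homogeneous[OF fam V(3)])
  fix i :: "'m + nat" assume "i \<in> coords n"
  then have "vrst V D V (f i) \<in> part X V (a ~= (b ~= odd_index i))"
   using derivationD(4)[OF vrestr_derivation[OF D V(1)] opens_refl[OF oV]] fp by blast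
  moreover have "(a ~= (b ~= odd_index i)) = ((a ~= b) ~= odd_index i)" by auto
  ultimately show "vrst V D V (f i) \<in> part X V ((a ~= b) ~= odd_index i)" by simp
 qed
 finally show "\<exists>V\<in>ops U. p \<in> V \<and> vrst V (nabla U D E) \<in> ders V (a ~= b)"
  using V nabla_props(3)[OF U Dt Et V(1)] by auto
qed

end

section \<open>The endomorphism defined by the potential and its covariant derivative\<close>

locale potential_field = flat_superspace X L n T nabla
 for X :: "('p, 's, 'k::field) superspace" and L :: "('k^'m::finite, ('k, 'm) sfun, 'k) superspace"
  and n T nabla +
 fixes A :: "('p, 's) vfield"
 assumes A: "A \<in> ders (whole X) False"
begin

abbreviation "B \<equiv> j_nabla X nabla A"

lemma A_restr:
 assumes "opn U"
 shows "vrst U A \<in> ders U False" "vrst U A \<in> vfs U"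
 using vrestr_derivation[OF A] assms derivation_tangent by (auto simp: opens_whole)

lemma B_eq: "B U D = nabla U D (vrst U A)"
 by (simp add: j_nabla_def)

lemma B_closed: "opn U ==> D \<in> vfs U ==> B U D \<in> vfs U"
 unfolding B_eq by (intro nabla_props(1) A_restr)

lemma B_restr:
 assumes U: "opn U" and D: "D \<in> vfs U" and V: "V \<in> ops U"
 shows "vrst V (B U D) = B V (vrst V D)"
proof -
 have "vrst V (vrst U A) = vrst V A" by (rule vrestr_vrestr[OF V])
 then show ?thesis unfolding B_eq nabla_props(3)[OF U D A_restr(2)[OF U] V] by simp
qed

lemma B_smult: "opn U ==> g \<in> fns U ==> D \<in> vfs U ==>
  B U (g \<cdot>[U] D) = g \<cdot>[U] B U D"
 unfolding B_eq by (intro nabla_smult_left A_restr)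

lemma B_add: "opn U ==> D \<in> vfs U ==> E \<in> vfs U ==>
  B U (D \<boxplus>[U] E) = B U D \<boxplus>[U] B U E"
 unfolding B_eq by (intro nabla_add_left A_restr)

lemma B_homogeneous: "opn U ==> D \<in> ders U a ==> B U D \<in> ders U a"
 unfolding B_eq using nabla_homogeneous[OF _ _ A_restr(1), of U D a] by simp

lemma B_ksign:
 assumes U: "opn U" and D: "D \<in> vfs U"
 shows "B U (ksign (tangent X U) b D) = ksign (tangent X U) b (B U D)"
proof -
 interpret ring "sec U" by (rule ring_sections[OF U])
 have "B U (\<ominus>\<^bsub>tangent X U\<^esub> D) = \<ominus>\<^bsub>tangent X U\<^esub> B U D"
  unfolding tangent_minus_smult[OF U D] tangent_minus_smult[OF U B_closed[OF U D]] by (rule B_smult[OF U _ D]) simp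
 then show ?thesis by (simp add: ksign_def)
qed

lemma even_endomorphism_B: "even_endomorphism X B"
 unfolding even_endomorphism_def
 by (intro ballI conjI allI impI)
  (simp_all add: opens_whole B_closed B_homogeneous B_add B_smult B_restr)

lemma endo_deriv_closed:
 assumes "opn U" "D \<in> vfs U" "E \<in> vfs U"
 shows "endo_deriv X nabla B U D E \<in> vfs U"
proof -
 interpret T: abelian_group "tangent X U" by (rule abelian_group_tangent[OF assms(1)])
 show ?thesis unfolding endo_deriv_def using assms B_closed nabla_props(1) by (intro T.minus_closed) auto
qed

lemma endo_deriv_add:
 assumes U: "opn U" and D: "D \<in> vfs U" and E: "E \<in> vfs U" "E' \<in> vfs U"
 shows "endo_deriv X nabla B U D (E \<boxplus>[U] E') =
  endo_deriv X nabla B U D E \<boxplus>[U] endo_deriv X nabla B U D E'"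
proof -
 interpret T: abelian_group "tangent X U" by (rule abelian_group_tangent[OF U])
 note n = nabla_props(1)[OF U D]
 show ?thesis
  unfolding endo_deriv_def B_add[OF U E] nabla_props(2)[OF U D E]
   nabla_props(2)[OF U D B_closed[OF U E(1)] B_closed[OF U E(2)]] B_add[OF U n[OF E(1)] n[OF E(2)]]
  using n[OF B_closed[OF U E(1)]] n[OF B_closed[OF U E(2)]] B_closed[OF U n[OF E(1)]] B_closed[OF U n[OF E(2)]]
  by (simp add: a_minus_def T.minus_add T.a_ac)
qed

text \<open>The terms in which \<open>D\<close> differentiates \<open>g\<close> cancel in the
  commutator, leaving linearity over functions up to the Koszul sign.\<close>

lemma endo_deriv_smult:
 assumes U: "opn U" and D: "D \<in> ders U a" and g: "g \<in> part X U b" and E: "E \<in> vfs U"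
 shows "endo_deriv X nabla B U D (g \<cdot>[U] E) =
  ksign (tangent X U) (a \<and> b) (g \<cdot>[U] endo_deriv X nabla B U D E)"
proof -
 interpret T: abelian_group "tangent X U" by (rule abelian_group_tangent[OF U])
 have Dt: "D \<in> vfs U" and gc: "g \<in> fns U"
  using derivation_tangent[OF D] part_carrier[OF U g] by auto
 have Dg: "D U g \<in> fns U" by (rule tangentD(1)[OF Dt opens_refl[OF U] gc])
 note n = nabla_props(1)[OF U Dt] and BE = B_closed[OF U E] and sm = tangent_smult_closed[OF U]
 let ?k = "ksign (tangent X U) (a \<and> b)"
 have k: "?k Z \<in> vfs U" if "Z \<in> vfs U" for Z
  by (rule ksign_tangent_closed[OF U that])
 have 1: "nabla U D (B U (g \<cdot>[U] E)) = (D U g \<cdot>[U] B U E) \<boxplus>[U]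
   ?k (g \<cdot>[U] nabla U D (B U E))"
  unfolding B_smult[OF U gc E] by (rule nabla_leibniz[OF U D g BE])
 have 2: "B U (nabla U D (g \<cdot>[U] E)) = (D U g \<cdot>[U] B U E) \<boxplus>[U]
   ?k (g \<cdot>[U] B U (nabla U D E))"
  unfolding nabla_leibniz[OF U D g E] B_add[OF U sm[OF Dg E] k[OF sm[OF gc n[OF E]]]]
   B_ksign[OF U sm[OF gc n[OF E]]] B_smult[OF U gc n[OF E]] B_smult[OF U Dg E] ..
 define P where "P = D U g \<cdot>[U] B U E"
 define Q where "Q = g \<cdot>[U] nabla U D (B U E)"
 define R where "R = g \<cdot>[U] B U (nabla U D E)"
 have c: "P \<in> vfs U" "Q \<in> vfs U" "R \<in> vfs U"
  unfolding P_def Q_def R_def by (intro sm Dg gc BE n B_closed[OF U] E)+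
 have gm: "g \<cdot>[U] (\<ominus>\<^bsub>tangent X U\<^esub> B U (nabla U D E)) = \<ominus>\<^bsub>tangent X U\<^esub> R"
 proof -
  let ?Z = "B U (nabla U D E)"
  have z: "?Z \<in> vfs U" by (rule B_closed[OF U n[OF E]])
  interpret ring "sec U" by (rule ring_sections[OF U])
  have m: "\<ominus>\<^bsub>sec U\<^esub> \<one>\<^bsub>sec U\<^esub> \<in> fns U" by simp
  have "g \<cdot>[U] ((\<ominus>\<^bsub>sec U\<^esub> \<one>\<^bsub>sec U\<^esub>) \<cdot>[U] ?Z) = (g *[U] \<ominus>\<^bsub>sec U\<^esub> \<one>\<^bsub>sec U\<^esub>) \<cdot>[U] ?Z"
   by (rule tangent_smult_add(3)[OF U gc m tangent_vfields[OF z], symmetric])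
  also have "g *[U] \<ominus>\<^bsub>sec U\<^esub> \<one>\<^bsub>sec U\<^esub> = (\<ominus>\<^bsub>sec U\<^esub> \<one>\<^bsub>sec U\<^esub>) *[U] g" using gc by (simp add: l_minus r_minus)
  also have "... \<cdot>[U] ?Z = (\<ominus>\<^bsub>sec U\<^esub> \<one>\<^bsub>sec U\<^esub>) \<cdot>[U] (g \<cdot>[U] ?Z)"
   by (rule tangent_smult_add(3)[OF U m gc tangent_vfields[OF z]])
  finally show ?thesis
   unfolding tangent_minus_smult[OF U z] R_def tangent_minus_smult[OF U c(3)[unfolded R_def]] .
 qed
 have "(P \<boxplus>[U] ?k Q) \<ominus>\<^bsub>tangent X U\<^esub> (P \<boxplus>[U] ?k R) = ?k (Q \<ominus>\<^bsub>tangent X U\<^esub> R)"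
 proof -
  have "(P \<boxplus>[U] ?k Q) \<ominus>\<^bsub>tangent X U\<^esub> (P \<boxplus>[U] ?k R) = ?k Q \<boxplus>[U] \<ominus>\<^bsub>tangent X U\<^esub> ?k R"
   using c k[OF c(2)] k[OF c(3)] by (simp add: a_minus_def T.minus_add T.a_ac T.r_neg1 T.r_neg2)
  then show ?thesis using c by (simp add: ksign_def a_minus_def T.minus_add)
 qed
 moreover have "Q \<ominus>\<^bsub>tangent X U\<^esub> R = g \<cdot>[U] endo_deriv X nabla B U D E"
  unfolding endo_deriv_def a_minus_def gm[symmetric] Q_def
  using n[OF BE] B_closed[OF U n[OF E]]
  by (intro tangent_smult_add(2)[OF U gc, symmetric] tangent_vfields) auto
 ultimately show ?thesis unfolding endo_deriv_def[of _ _ _ U D "g \<cdot>[U] E"] 1 2 P_def Q_def R_def by simp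
qed

end

context potential_field
begin

lemma endo_deriv_restr:
 assumes U: "opn U" and D: "D \<in> vfs U" and E: "E \<in> vfs U" and V: "V \<in> ops U"
 shows "vrst V (endo_deriv X nabla B U D E) = endo_deriv X nabla B V (vrst V D) (vrst V E)"
 unfolding endo_deriv_def a_minus_def vrestr_add[OF V]
  vrestr_minus[OF U V B_closed[OF U nabla_props(1)[OF U D E]]]
  nabla_props(3)[OF U D B_closed[OF U E] V] B_restr[OF U E V]
  B_restr[OF U nabla_props(1)[OF U D E] V] nabla_props(3)[OF U D E V] ..

context
 fixes circ
 assumes pm: "potential_multiplication L n X T A circ"
begin

lemma circ_props:
 assumes U: "opn U" and D: "D \<in> vfs U" and E: "E \<in> vfs U"
 shows "circ U D E \<in> vfs U"
  and "E' \<in> vfs U ==> circ U (E \<boxplus>[U] E') D = circ U E D \<boxplus>[U] circ U E' D"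
  and "E' \<in> vfs U ==> circ U D (E \<boxplus>[U] E') = circ U D E \<boxplus>[U] circ U D E'"
  and "f \<in> fns U ==> circ U (f \<cdot>[U] D) E = f \<cdot>[U] circ U D E"
  and "f \<in> part X U b ==> D \<in> ders U a ==>
   circ U D (f \<cdot>[U] E) = ksign (tangent X U) (a \<and> b) (f \<cdot>[U] circ U D E)"
  and "V \<in> ops U ==> vrst V (circ U D E) = circ V (vrst V D) (vrst V E)"
proof -
 have "U \<in> ops (whole X)" using U by (simp add: opens_whole)
 note * = pm[unfolded potential_multiplication_def bilinear_multiplication_def, THEN conjunct1, rule_format, OF this D E]
 show "circ U D E \<in> vfs U"
  "E' \<in> vfs U ==> circ U (E \<boxplus>[U] E') D = circ U E D \<boxplus>[U] circ U E' D"
  "E' \<in> vfs U ==> circ U D (E \<boxplus>[U] E') = circ U D E \<boxplus>[U] circ U D E'"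
  "f \<in> fns U ==> circ U (f \<cdot>[U] D) E = f \<cdot>[U] circ U D E"
  "V \<in> ops U ==> vrst V (circ U D E) = circ V (vrst V D) (vrst V E)"
  using * by simp_all
 show "f \<in> part X U b ==> D \<in> ders U a ==>
   circ U D (f \<cdot>[U] E) = ksign (tangent X U) (a \<and> b) (f \<cdot>[U] circ U D E)"
  using *[THEN conjunct2, THEN conjunct2, THEN conjunct2, THEN conjunct1, rule_format] by simp
qed

text \<open>On coordinate fields both sides have the second derivatives of the coefficients of
  \<open>A\<close> as coefficients. Both are linear over functions in the left argument, without
  signs, and so agree for all \<open>D\<close>.\<close>

lemma circ_basis:
 assumes d: "flat_coordinates L n X T U d" and V: "V \<in> ops U" and D: "D \<in> vfs V" and b: "b \<in> coords n"
 shows "circ V D (vrst V (d b)) = nabla V D (B V (vrst V (d b)))"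
proof -
 note ff = flat_coordinates_frame[OF d]
 note fam = flat_frame_family[OF ff]
 have U: "opn U" using fam by (simp add: vector_family_def)
 note oV = opensD(1)[OF V] and UU = opens_refl[OF U]
 have dt: "d i \<in> vfs U" if "i \<in> coords n" for i
  using that fam derivation_tangent unfolding vector_family_def by blast
 obtain f where f: "coeffs n U f" "vrst U A = comb n U f d"
  using frame_coeffs[OF ff UU A_restr(2)[OF U]] .
 have basis: "circ U (d a) (d b) = nabla U (d a) (B U (d b))" if a: "a \<in> coords n" for a
 proof -
  have "circ U (d a) (d b) = comb n U (%c. d a U (d b U (f c))) d"
   using pm d f a b unfolding potential_multiplication_def coeffs_def by blast
  moreover have "B U (d b) = comb n U (%c. d b U (f c)) d"
   unfolding B_eq f(2) by (rule nabla_lin_comb[OF ff UU dt[OF b] f(1)])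
  ultimately show ?thesis
   using nabla_lin_comb[OF ff UU dt[OF a] coeffs_derivative[OF dt[OF b] U f(1)]] by simp
 qed
 let ?E = "vrst V (d b)"
 have E: "?E \<in> vfs V" by (rule family_tangent[OF fam b V])
 note BE = B_closed[OF oV E]
 have basisV: "circ V (vrst V (d a)) ?E = nabla V (vrst V (d a)) (B V ?E)" if a: "a \<in> coords n" for a
  using arg_cong[OF basis[OF a], of "vrst V"]
  unfolding circ_props(6)[OF U dt[OF a] dt[OF b] V] nabla_props(3)[OF U dt[OF a] B_closed[OF U dt[OF b]] V]
   B_restr[OF U dt[OF b] V] .
 obtain g where g: "coeffs n V g" "D = comb n V g d" using frame_coeffs[OF ff V D] .
 interpret A: abelian_group "tangent X V" by (rule abelian_group_tangent[OF oV])
 have "circ V D ?E = (\<Oplus>\<^bsub>tangent X V\<^esub>i\<in>coords n. circ V (g i \<cdot>[V] vrst V (d i)) ?E)"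
  unfolding g(2) lin_comb_def
  by (rule finsum_hom[OF abelian_group_tangent[OF oV] abelian_group_tangent[OF oV]])
   (use circ_props(1)[OF oV _ E] circ_props(2)[OF oV E] lin_comb_term[OF fam V g(1)] in auto)
 also have "... = (\<Oplus>\<^bsub>tangent X V\<^esub>i\<in>coords n. nabla V (g i \<cdot>[V] vrst V (d i)) (B V ?E))"
 proof (rule A.finsum_cong')
  show "(%i. nabla V (g i \<cdot>[V] vrst V (d i)) (B V ?E)) \<in> coords n \<rightarrow> vfs V"
   using nabla_props(1)[OF oV lin_comb_term[OF fam V g(1)] BE] by auto
  fix i :: "'m + nat" assume i: "i \<in> coords n"
  have gi: "g i \<in> fns V" using g(1) i by (simp add: coeffs_def)
  show "circ V (g i \<cdot>[V] vrst V (d i)) ?E = nabla V (g i \<cdot>[V] vrst V (d i)) (B V ?E)"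
   unfolding circ_props(4)[OF oV family_tangent[OF fam i V] E gi]
    nabla_smult_left[OF oV gi family_tangent[OF fam i V] BE] basisV[OF i] ..
 qed simp
 also have "... = nabla V D (B V ?E)"
  unfolding g(2) lin_comb_def
  by (rule finsum_hom[OF abelian_group_tangent[OF oV] abelian_group_tangent[OF oV], of "%D. nabla V D (B V ?E)", symmetric])
   (use nabla_props(1)[OF oV _ BE] nabla_add_left[OF oV _ _ BE] lin_comb_term[OF fam V g(1)] in auto)
 finally show ?thesis .
qed

text \<open>A coordinate field is flat, so the term of \<open>endo_deriv\<close> that contains its
  covariant derivative drops out and \<open>circ_basis\<close> applies. Both sides obey the same
  sign rule for a homogeneous coefficient, so the coefficients of \<open>E\<close> are split by
  parity.\<close>

lemma circ_eq_endo_deriv: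
 assumes U: "opn U" and D: "D \<in> ders U a" and E: "E \<in> vfs U"
 shows "circ U D E = endo_deriv X nabla B U D E"
proof (rule tangent_eqI_frames[OF U])
 have Dt: "D \<in> vfs U" by (rule derivation_tangent[OF D])
 show "circ U D E \<in> vfs U" "endo_deriv X nabla B U D E \<in> vfs U"
  using circ_props(1)[OF U Dt E] endo_deriv_closed[OF U Dt E] by auto
 fix V U' d assume V: "V \<in> ops U" and VU': "V \<in> ops U'" and d: "flat_coordinates L n X T U' d"
 note ff = flat_coordinates_frame[OF d]
 note oV = opensD(1)[OF V] and fam = flat_frame_family[OF ff]
 interpret A: abelian_group "tangent X V" by (rule abelian_group_tangent[OF oV])
 define D' where "D' = vrst V D"
 have D': "D' \<in> ders V a" unfolding D'_def by (rule vrestr_derivation[OF D V])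
 have D't: "D' \<in> vfs V" by (rule derivation_tangent[OF D'])
 obtain f where f: "coeffs n V f" "vrst V E = comb n V f d"
  using frame_coeffs[OF ff VU' vrestr_tangent[OF E V]] .
 let ?P = "circ V D'" and ?Q = "endo_deriv X nabla B V D'"
 have basis: "?P (vrst V (d b)) = ?Q (vrst V (d b))" if b: "b \<in> coords n" for b
 proof -
  let ?E = "vrst V (d b)"
  have t: "?E \<in> vfs V" by (rule family_tangent[OF fam b VU'])
  have flat: "?E \<in> T V"
   using ff b VU' flat_props(2)[of U' "d b" V] fam unfolding flat_frame_def vector_family_def by blast
  interpret ring "sec V" by (rule ring_sections[OF oV])
  \<comment> \<open>Written as 1 times itself, the flat field fits the defining formula of
    \<open>nabla\<close>, and fields annihilate 1.\<close>
  have "nabla V D' ?E = nabla V D' (\<one>\<^bsub>sec V\<^esub> \<cdot>[V] ?E)"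
   using tangent_smult_add(4)[OF oV tangent_vfields[OF t]] by simp
  also have "... = \<zero>\<^bsub>tangent X V\<^esub>"
   unfolding nabla_props(4)[OF oV D't one_closed flat] tangentD(5)[OF D't opens_refl[OF oV]]
   by (rule tangent_smult_add(5)[OF oV tangent_vfields[OF t]])
  finally have n0: "nabla V D' ?E = \<zero>\<^bsub>tangent X V\<^esub>" .
  have "B V \<zero>\<^bsub>tangent X V\<^esub> = \<zero>\<^bsub>tangent X V\<^esub>"
   using B_smult[OF oV zero_closed t] tangent_smult_add(5)[OF oV tangent_vfields[OF t]]
    tangent_smult_add(5)[OF oV tangent_vfields[OF B_closed[OF oV t]]] by simp
  then show ?thesis
   unfolding circ_basis[OF d VU' D't b] endo_deriv_def n0
   using nabla_props(1)[OF oV D't B_closed[OF oV t]] by (simp add: a_minus_def)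
 qed
 have homog: "?P (g \<cdot>[V] vrst V (d b)) = ?Q (g \<cdot>[V] vrst V (d b))"
  if g: "g \<in> part X V c" and b: "b \<in> coords n" for g c b
  unfolding circ_props(5)[OF oV D't family_tangent[OF fam b VU'] g D']
   endo_deriv_smult[OF oV D' g family_tangent[OF fam b VU']] basis[OF b] ..
 have all: "?P (f b \<cdot>[V] vrst V (d b)) = ?Q (f b \<cdot>[V] vrst V (d b))"
  if b: "b \<in> coords n" for b
 proof -
  have fb: "f b \<in> fns V" using f(1) b by (simp add: coeffs_def)
  obtain f0 f1 where f01: "f0 \<in> part X V False" "f1 \<in> part X V True" "f b = f0 +[V] f1"
   by (rule part_decomp[OF oV fb])
  note t = family_tangent[OF fam b VU']
  note c = part_carrier[OF oV f01(1)] part_carrier[OF oV f01(2)]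
  note s = tangent_smult_closed[OF oV c(1) t] tangent_smult_closed[OF oV c(2) t]
  show ?thesis
   unfolding f01(3) tangent_smult_add(1)[OF oV c tangent_vfields[OF t]]
    circ_props(3)[OF oV D't s] endo_deriv_add[OF oV D't s] homog[OF f01(1) b] homog[OF f01(2) b] ..
 qed
 have "?P (vrst V E) = (\<Oplus>\<^bsub>tangent X V\<^esub>b\<in>coords n. ?P (f b \<cdot>[V] vrst V (d b)))"
  unfolding f(2) lin_comb_def
  by (rule finsum_hom[OF abelian_group_tangent[OF oV] abelian_group_tangent[OF oV]])
   (use circ_props(1)[OF oV D't] circ_props(3)[OF oV D't] lin_comb_term[OF fam VU' f(1)] in auto)
 also have "... = (\<Oplus>\<^bsub>tangent X V\<^esub>b\<in>coords n. ?Q (f b \<cdot>[V] vrst V (d b)))"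
  by (rule A.finsum_cong')
   (use all endo_deriv_closed[OF oV D't lin_comb_term[OF fam VU' f(1)]] in auto)
 also have "... = ?Q (vrst V E)"
  unfolding f(2) lin_comb_def
  by (rule finsum_hom[OF abelian_group_tangent[OF oV] abelian_group_tangent[OF oV], symmetric])
   (use endo_deriv_closed[OF oV D't] endo_deriv_add[OF oV D't] lin_comb_term[OF fam VU' f(1)] in auto)
 finally show "vrst V (circ U D E) = vrst V (endo_deriv X nabla B U D E)"
  unfolding circ_props(6)[OF U Dt E V] endo_deriv_restr[OF U Dt E V] D'_def .
qed

lemma circ_ksign_left:
 assumes U: "opn U" and D: "D \<in> vfs U" and E: "E \<in> vfs U"
 shows "circ U (ksign (tangent X U) b D) E = ksign (tangent X U) b (circ U D E)"
proof -
 interpret ring "sec U" by (rule ring_sections[OF U])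
 have m: "\<ominus>\<^bsub>sec U\<^esub> \<one>\<^bsub>sec U\<^esub> \<in> fns U" by simp
 have "circ U (\<ominus>\<^bsub>tangent X U\<^esub> D) E = \<ominus>\<^bsub>tangent X U\<^esub> circ U D E"
  unfolding tangent_minus_smult[OF U D] tangent_minus_smult[OF U circ_props(1)[OF U D E]]
  by (rule circ_props(4)[OF U D E m])
 then show ?thesis by (simp add: ksign_def)
qed

end

lemma commutativity:
 assumes oa: "oriented_associativity L n X T A"
 shows "commutativity_solution X nabla B"
proof -
 obtain circ where pm: "potential_multiplication L n X T A circ"
  and all: "\<forall>U\<in>ops (whole X). \<forall>D\<in>vfs U. \<forall>E\<in>vfs U.
   (\<forall>F\<in>vfs U. circ U (circ U D E) F = circ U D (circ U E F)) \<and>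
   (\<forall>a b. D \<in> ders U a \<and> E \<in> ders U b -->
    circ U D E = ksign (tangent X U) (a \<and> b) (circ U E D))"
  using oa unfolding oriented_associativity_def by (elim conjE exE) (rule that)
 have assoc: "circ U (circ U D E) F = circ U D (circ U E F)"
  if "opn U" "D \<in> vfs U" "E \<in> vfs U" "F \<in> vfs U" for U D E F
  using all that by (simp add: opens_whole)
 have comm: "circ U D E = ksign (tangent X U) (a \<and> b) (circ U E D)"
  if "opn U" "D \<in> ders U a" "E \<in> ders U b" for U D E a b
 proof -
  have "U \<in> ops (whole X)" using that(1) by (simp add: opens_whole)
  from all[rule_format, OF this derivation_tangent[OF that(2)] derivation_tangent[OF that(3)], THEN conjunct2,
    rule_format, OF conjI[OF that(2,3)]] show ?thesis .
 qed
 show ?thesis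
  unfolding commutativity_solution_def opens_whole mem_Collect_eq
 proof (intro conjI ballI allI even_endomorphism_B)
  fix U a b D D' E assume "U \<in> ops (whole X)" and D: "D \<in> ders U a" and D': "D' \<in> ders U b"
   and E: "E \<in> vfs U"
  then have U: "opn U" by (simp add: opens_whole)
  have t: "D \<in> vfs U" "D' \<in> vfs U" using D D' derivation_tangent by auto
  note eq = circ_eq_endo_deriv[OF pm U, symmetric]
  note cl = circ_props(1)[OF pm U]
  have "circ U D (circ U D' E) = circ U (circ U D D') E" by (rule assoc[OF U t E, symmetric])
  also have "... = circ U (ksign (tangent X U) (a \<and> b) (circ U D' D)) E" using comm[OF U D D'] by simp
  also have "... = ksign (tangent X U) (a \<and> b) (circ U (circ U D' D) E)"
   by (rule circ_ksign_left[OF pm U cl[OF t(2,1)] E])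
  also have "circ U (circ U D' D) E = circ U D' (circ U D E)" by (rule assoc[OF U t(2,1) E])
  finally show "endo_deriv X nabla B U D (endo_deriv X nabla B U D' E) =
    ksign (tangent X U) (a \<and> b) (endo_deriv X nabla B U D' (endo_deriv X nabla B U D E))"
   unfolding eq[OF D' E] eq[OF D E] eq[OF D cl[OF t(2) E]] eq[OF D' cl[OF t(1) E]] .
 qed
qed

text \<open>Since \<open>e\<close> commutes with flat fields, \<open>\<nabla>\<^sub>D (B e) = e \<circ> D = D\<close> for flat \<open>D\<close>.\<close>

lemma nabla_B_identity:
 assumes fi: "flat_identity L n X T A e" and U: "opn U" and D: "D \<in> vfs U"
 shows "nabla U D (B U (vrst U e)) = D"
proof -
 \<comment> \<open>This multiplication need not be the one provided by
   \<open>oriented_associativity\<close>; \<open>circ_basis\<close> supplies its relation to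
   \<open>A\<close>.\<close>
 obtain circ where e: "e \<in> T (whole X)" "e \<in> ders (whole X) False"
  and pm: "potential_multiplication L n X T A circ"
  and id: "!!U D. opn U ==> D \<in> vfs U ==> circ U (vrst U e) D = D"
  using fi unfolding flat_identity_def opens_whole by (elim conjE exE) (simp add: opens_whole)
 have er: "vrst V e \<in> ders V False" "vrst V e \<in> T V" if "opn V" for V
  using vrestr_derivation[OF e(2)] flat_props(2)[OF openin_topspace e(1)] that by (auto simp: opens_whole)
 have et: "vrst V e \<in> vfs V" if "opn V" for V by (rule derivation_tangent[OF er(1)[OF that]])
 show ?thesis
 proof (rule tangent_eqI_frames[OF U nabla_props(1)[OF U D B_closed[OF U et[OF U]]] D])
  fix V U' d assume V: "V \<in> ops U" and VU': "V \<in> ops U'" and d: "flat_coordinates L n X T U' d"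
  note ff = flat_coordinates_frame[OF d]
  note oV = opensD(1)[OF V] and fam = flat_frame_family[OF ff]
  have oU': "opn U'" using fam by (simp add: vector_family_def)
  interpret A: abelian_group "tangent X V" by (rule abelian_group_tangent[OF oV])
  interpret ring "sec V" by (rule ring_sections[OF oV])
  let ?e = "vrst V e"
  note eV = et[OF oV]
  obtain f where f: "coeffs n V f" "vrst V A = comb n V f d"
   using frame_coeffs[OF ff VU' A_restr(2)[OF oV]] .
  have Be: "B V ?e = comb n V (%c. ?e V (f c)) d"
   unfolding B_eq f(2) by (rule nabla_lin_comb[OF ff VU' eV f(1)])
  have basis: "nabla V (vrst V (d a)) (B V ?e) = vrst V (d a)" if a: "a \<in> coords n" for a
  proof -
   let ?d = "vrst V (d a)"
   have dt: "?d \<in> vfs V" by (rule family_tangent[OF fam a VU'])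
   have dd: "?d \<in> ders V (odd_index a)" by (rule family_derivation[OF fam a VU'])
   have df: "?d \<in> T V" using flat_props(2)[OF oU' _ VU'] ff a unfolding flat_frame_def by blast
   note c1 = coeffs_derivative[OF dt oV f(1)] and c2 = coeffs_derivative[OF eV oV f(1)]
   have "?d = nabla V ?e (B V ?d)" using id[OF oV dt] circ_basis[OF pm d VU' eV a] by simp
   also have "... = comb n V (%c. ?e V (?d V (f c))) d"
    unfolding B_eq f(2) nabla_lin_comb[OF ff VU' dt f(1)] by (rule nabla_lin_comb[OF ff VU' eV c1])
   \<comment> \<open>Flat fields supercommute, and \<open>e\<close> is even, so no sign
     appears.\<close>
   also have "... = comb n V (%c. ?d V (?e V (f c))) d"
   proof (rule lin_comb_cong[OF fam VU' coeffs_derivative[OF dt oV c2]])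
    fix i :: "'m + nat" assume "i \<in> coords n"
    then have "f i \<in> fns V" using f(1) by (simp add: coeffs_def)
    then show "?e V (?d V (f i)) = ?d V (?e V (f i))"
     using flat_props(4)[OF oV er(2)[OF oV] er(1)[OF oV] df dd opens_refl[OF oV]] by (simp add: ksign_def)
   qed
   also have "... = nabla V ?d (B V ?e)" unfolding Be by (rule nabla_lin_comb[OF ff VU' dt c2, symmetric])
   finally show ?thesis ..
  qed
  note BeV = B_closed[OF oV eV]
  obtain g where g: "coeffs n V g" "vrst V D = comb n V g d"
   using frame_coeffs[OF ff VU' vrestr_tangent[OF D V]] .
  have "nabla V (vrst V D) (B V ?e) =
    (\<Oplus>\<^bsub>tangent X V\<^esub>i\<in>coords n. nabla V (g i \<cdot>[V] vrst V (d i)) (B V ?e))"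
   unfolding g(2) lin_comb_def
   by (rule finsum_hom[OF abelian_group_tangent[OF oV] abelian_group_tangent[OF oV], of "%D. nabla V D (B V ?e)"])
    (use nabla_props(1)[OF oV _ BeV] nabla_add_left[OF oV _ _ BeV] lin_comb_term[OF fam VU' g(1)] in auto)
  also have "... = comb n V g d"
   unfolding lin_comb_def
  proof (rule A.finsum_cong')
   show "(%i. g i \<cdot>[V] vrst V (d i)) \<in> coords n \<rightarrow> vfs V"
    using lin_comb_term[OF fam VU' g(1)] by auto
   fix i :: "'m + nat" assume i: "i \<in> coords n"
   have gi: "g i \<in> fns V" using g(1) i by (simp add: coeffs_def)
   show "nabla V (g i \<cdot>[V] vrst V (d i)) (B V ?e) = g i \<cdot>[V] vrst V (d i)"
    unfolding nabla_smult_left[OF oV gi family_tangent[OF fam i VU'] BeV] basis[OF i] ..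
  qed simp
  finally have "nabla V (vrst V D) (B V ?e) = vrst V D" unfolding g(2) .
  then show "vrst V (nabla U D (B U (vrst U e))) = vrst V D"
   unfolding nabla_props(3)[OF U D B_closed[OF U et[OF U]] V] B_restr[OF U et[OF U] V] vrestr_vrestr[OF V] .
 qed
qed

text \<open>By \<open>nabla_B_identity\<close> the covariant derivative of \<open>B e\<close> along
  \<open>s a\<close> is \<open>s a\<close> itself; comparing coefficients gives the last claim. The
  frame may be any flat frame, not only one of coordinate fields.\<close>

lemma identity_coordinates:
 fixes s :: "'m + nat => ('p, 's) vfield"
 assumes fi: "flat_identity L n X T A e" and s: "flat_frame n X T U s"
 obtains y where "B U (vrst U e) = comb n U y s"
  and "!!c. c \<in> coords n ==> y c \<in> part X U (odd_index c)"
  and "!!a c. a \<in> coords n ==> c \<in> coords n ==> s a U (y c) = scl U (if c = a then 1 else 0)"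
proof -
 note fam = flat_frame_family[OF s]
 have U: "opn U" using fam by (simp add: vector_family_def)
 note UU = opens_refl[OF U]
 have ed: "vrst U e \<in> ders U False"
  using fi vrestr_derivation[of e "whole X" False U] U unfolding flat_identity_def by (simp add: opens_whole)
 have Be: "B U (vrst U e) \<in> ders U False" by (rule B_homogeneous[OF U ed])
 obtain y where y: "coeffs n U y" "B U (vrst U e) = comb n U y s"
  using frame_coeffs[OF s UU derivation_tangent[OF Be]] .
 show ?thesis
 proof (rule that[OF y(2)])
  show "y c \<in> part X U (odd_index c)" if "c \<in> coords n" for c
   using frame_homogeneous[OF s UU y(1) _ that, of False] Be y(2) by simp
  fix a c :: "'m + nat" assume a: "a \<in> coords n" and c: "c \<in> coords n"
  have sa: "s a \<in> vfs U" using fam a derivation_tangent unfolding vector_family_def by blast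
  have "comb n U (%c. s a U (y c)) s = vrst U (s a)"
   using nabla_lin_comb[OF s UU sa y(1)] nabla_B_identity[OF fi U sa] y(2) vrestr_self[OF sa] by simp
  also have "... = comb n U (%j. if j = a then \<one>\<^bsub>sec U\<^esub> else \<zero>\<^bsub>sec U\<^esub>) s"
   by (rule family_basis[OF fam UU a])
  finally have eq: "comb n U (%c. s a U (y c)) s =
    comb n U (%j. if j = a then \<one>\<^bsub>sec U\<^esub> else \<zero>\<^bsub>sec U\<^esub>) s" .
  have "coeffs n U (%j. if j = a then \<one>\<^bsub>sec U\<^esub> else \<zero>\<^bsub>sec U\<^esub>)"
   using ring.ring_simprules(2,6)[OF ring_sections[OF U]] by (auto simp: coeffs_def)
  from frame_unique[OF s UU coeffs_derivative[OF sa U y(1)] this eq c]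
  have "s a U (y c) = (if c = a then \<one>\<^bsub>sec U\<^esub> else \<zero>\<^bsub>sec U\<^esub>)" .
  then show "s a U (y c) = scl U (if c = a then 1 else 0)"
   by (simp add: scalar_one[OF U] scalar_zero[OF U])
 qed
qed

end

subsection \<open>Products of superfunctions\<close>

lemma taylor_smooth_conv:
 assumes f: "taylor_smooth V f" and g: "taylor_smooth V g"
 shows "taylor_smooth V (%p. conv (f p) (g p))"
 unfolding taylor_smooth_iff
proof (intro conjI allI ballI)
 fix al show "continuous_on V (%p. conv (f p) (g p) al)"
  unfolding conv_def using f g unfolding taylor_smooth_iff by (intro continuous_intros) auto
next
 fix al p i assume p: "p \<in> V"
 have d: "((%z. f (p + axis i z) be) has_field_derivative dser i (f p) be) (at 0)"
  "((%z. g (p + axis i z) be) has_field_derivative dser i (g p) be) (at 0)" for be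
  using f g p unfolding taylor_smooth_iff by blast+
 have "((%z. \<Sum>be | \<forall>i. be i \<le> al i. f (p + axis i z) be * g (p + axis i z) (%i. al i - be i)) has_field_derivative
   (\<Sum>be | \<forall>i. be i \<le> al i. dser i (f p) be * g p (%i. al i - be i) + dser i (g p) (%i. al i - be i) * f p be)) (at 0)"
 proof (rule DERIV_sum)
  fix be
  from DERIV_mult[OF d(1)[of be] d(2)[of "%i. al i - be i"]]
  show "((%z. f (p + axis i z) be * g (p + axis i z) (%i. al i - be i)) has_field_derivative
   dser i (f p) be * g p (%i. al i - be i) + dser i (g p) (%i. al i - be i) * f p be) (at 0)" by simp
 qed
 then show "((%z. conv (f (p + axis i z)) (g (p + axis i z)) al) has_field_derivative
   dser i (conv (f p) (g p)) al) (at 0)"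
  unfolding dser_conv by (simp add: conv_def sum.distrib mult.commute)
qed

lemma card_below: "card {be::'m::finite => nat. \<forall>i. be i \<le> al i} \<le> 2 ^ sum al UNIV"
proof -
 have "{be::'m => nat. \<forall>i. be i \<le> al i} = (\<Pi>\<^sub>E i\<in>UNIV. {..al i})" by (auto simp: PiE_def Pi_def)
 then have "card {be::'m => nat. \<forall>i. be i \<le> al i} = (\<Prod>i\<in>UNIV. Suc (al i))" by (simp add: card_PiE)
 also have "... \<le> (\<Prod>i\<in>UNIV. 2 ^ al i)" by (intro prod_mono) (auto simp: Suc_leI)
 finally show ?thesis by (simp add: power_sum)
qed

text \<open>At most \<open>2 ^ sum al UNIV\<close> pairs of indices contribute
  (\<open>card_below\<close>), whence the factor 2 in the ratio.\<close>

lemma geometric_bound_conv: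
 fixes H G :: "('m::finite => nat) => 'k::real_normed_field"
 assumes "geometric_bound C K H" "geometric_bound C' K' G"
 shows "geometric_bound (C * C') (2 * max K K') (conv H G)"
 unfolding geometric_bound_def
proof (intro conjI allI)
 let ?M = "max K K'"
 have c: "0 \<le> C" "0 < K" "0 \<le> C'" "0 < K'" using assms by (auto simp: geometric_bound_def)
 then show "0 \<le> C * C'" "0 < 2 * ?M" by auto
 have up: "geometric_bound C ?M H" "geometric_bound C' ?M G"
  using assms c unfolding geometric_bound_def
  by (auto intro: order_trans[OF _ mult_left_mono[OF power_mono]])
 fix al :: "'m => nat"
 let ?S = "{be::'m => nat. \<forall>i. be i \<le> al i}"
 have "norm (conv H G al) \<le> (\<Sum>be\<in>?S. C * C' * ?M ^ sum al UNIV)"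
  unfolding conv_def
 proof (rule order_trans[OF norm_sum sum_mono])
  fix be assume b: "be \<in> ?S"
  have "norm (H be * G (%i. al i - be i)) \<le> (C * ?M ^ sum be UNIV) * (C' * ?M ^ (\<Sum>i\<in>UNIV. al i - be i))"
   unfolding norm_mult using up c by (intro mult_mono) (auto simp: geometric_bound_def)
  also have "... = C * C' * ?M ^ sum al UNIV"
   using degree_diff[of be al] b by (simp add: power_add[symmetric] mult_ac)
  finally show "norm (H be * G (%i. al i - be i)) \<le> C * C' * ?M ^ sum al UNIV" .
 qed
 also have "... = real (card ?S) * (C * C' * ?M ^ sum al UNIV)" by simp
 also have "... \<le> 2 ^ sum al UNIV * (C * C' * ?M ^ sum al UNIV)"
  using card_below[of al] c by (intro mult_right_mono) (auto simp: numeral_power_le_of_nat_cancel_iff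
    intro: order_trans[OF of_nat_mono[OF card_below]])
 finally show "norm (conv H G al) \<le> C * C' * (2 * ?M) ^ sum al UNIV"
  by (simp add: power_mult_distrib mult_ac)
qed

lemma taylor_convergent_conv:
 fixes f g :: "'k::{real_normed_field,banach}^'m::finite => ('m => nat) => 'k"
 assumes f: "taylor_convergent V f" and g: "taylor_convergent V g"
 shows "taylor_convergent V (%p. conv (f p) (g p))"
proof (rule taylor_convergentI)
 fix p assume p: "p \<in> V"
 obtain r C K where rCK: "r > 0" "geometric_bound C K (f p)"
  "!!h. norm h < r ==> ((%al. f p al * multi_power (%i. h $ i) al) has_sum f (p + h) (%_. 0)) UNIV"
  by (rule taylor_convergent_bound[OF f p]) (rule that)
 obtain r' C' K' where rCK': "r' > 0" "geometric_bound C' K' (g p)"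
  "!!h. norm h < r' ==> ((%al. g p al * multi_power (%i. h $ i) al) has_sum g (p + h) (%_. 0)) UNIV"
  by (rule taylor_convergent_bound[OF g p]) (rule that)
 have K: "K > 0" "K' > 0" using rCK(2) rCK'(2) by (simp_all add: geometric_bound_def)
 define M where "M = 2 * max K K'"
 have M: "M > 0" "K < M" "K' < M" using K by (auto simp: M_def)
 define t where "t = 1 / (2 * M)"
 have t: "0 < t" "M * t < 1" using M by (simp_all add: t_def)
 have "K * t \<le> M * t" "K' * t \<le> M * t" using M t by (auto intro!: mult_right_mono)
 then have Kt: "K * t < 1" "K' * t < 1" using t by linarith+
 have gb: "geometric_bound (C * C') M (conv (f p) (g p))"
  unfolding M_def by (rule geometric_bound_conv[OF rCK(2) rCK'(2)])
 define s where "s = min t (min r r')"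
 have s: "s > 0" using t rCK rCK' by (simp add: s_def)
 show "\<exists>r>0. \<forall>h. norm h < r -->
   (%al. norm (conv (f p) (g p) al * multi_power (%i. h $ i) al)) summable_on UNIV \<and>
   level_sum (conv (f p) (g p)) (%i. h $ i) sums conv (f (p + h)) (g (p + h)) (%_. 0)"
 proof (intro exI[of _ s] conjI allI impI s)
  fix h :: "'k^'m" assume h: "norm h < s"
  have hi: "norm (h $ i) \<le> t" for i
   using h Finite_Cartesian_Product.norm_nth_le[of h i] by (simp add: s_def)
  show "(%al. norm (conv (f p) (g p) al * multi_power (%i. h $ i) al)) summable_on UNIV"
   by (rule geometric_bound_summable[OF gb hi _ t(2)]) (use t in auto)
  let ?h = "%i. h $ i"
  have lev: "summable (%r. norm (level_sum H ?h r))" if "geometric_bound C K H" "K * t < 1"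
   for C K and H :: "('m => nat) => 'k"
   by (rule summable_comparison_test'[OF geometric_bound_level_summable[OF that(1) less_imp_le[OF t(1)] that(2)]])
    (use level_sum_norm_le[OF hi less_imp_le[OF t(1)]] in simp)
  have A: "level_sum (f p) ?h sums f (p + h) (%_. 0)" "level_sum (g p) ?h sums g (p + h) (%_. 0)"
   using has_sum_levels[OF rCK(3), of h] has_sum_levels[OF rCK'(3), of h] h unfolding level_sum_def
   by (simp_all add: s_def)
  have "(%k. \<Sum>i\<le>k. level_sum (f p) ?h i * level_sum (g p) ?h (k - i)) sums
    ((\<Sum>k. level_sum (f p) ?h k) * (\<Sum>k. level_sum (g p) ?h k))"
   by (rule Cauchy_product_sums) (rule lev[OF rCK(2) Kt(1)], rule lev[OF rCK'(2) Kt(2)])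
  then have "level_sum (conv (f p) (g p)) ?h sums (f (p + h) (%_. 0) * g (p + h) (%_. 0))"
   unfolding level_sum_conv[symmetric] using A by (simp add: sums_iff)
  moreover have "conv (f (p + h)) (g (p + h)) (%_. 0) = f (p + h) (%_. 0) * g (p + h) (%_. 0)"
  proof -
   have "{be::'m => nat. \<forall>i. be i = 0} = {%_. 0}" by auto
   then show ?thesis unfolding conv_def le_zero_eq by simp
  qed
  ultimately show "level_sum (conv (f p) (g p)) ?h sums conv (f (p + h)) (g (p + h)) (%_. 0)" by simp
 qed
qed

lemma regular_conv:
 assumes "regular C V f" "regular C V g"
 shows "regular C V (%p. conv (f p) (g p))"
 using assms taylor_smooth_conv[of V f g] taylor_convergent_conv[of V f g] by (cases C) auto

lemma sfuns_mult:
 assumes F: "F \<in> sfuns C n V" and G: "G \<in> sfuns C n V"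
 shows "sfun_mult F G \<in> sfuns C n V"
proof (rule sfunsI)
 show "sfun_mult F G p = (%al I. 0)" if "p \<notin> V" for p
  using sfuns_outside[OF F that] by (simp add: sfun_mult_smul smul_def fun_eq_iff)
 show "odd_support n (sfun_mult F G p)" for p
  unfolding sfun_mult_smul by (intro smul_support sfuns_support[OF F] sfuns_support[OF G])
 fix I :: "nat set" assume "I <= {..<n}"
 then have fI: "finite (Pow I)" using finite_subset by blast
 have "regular C V (%p al. \<Sum>J\<in>Pow I. inversion_sign J (I - J) * conv (%al. F p al J) (%al. G p al (I - J)) al)"
  by (intro regular_sum[OF fI] regular_conv sfuns_regular[OF F] sfuns_regular[OF G])
 also have "(%p al. \<Sum>J\<in>Pow I. inversion_sign J (I - J) * conv (%al. F p al J) (%al. G p al (I - J)) al) =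
   (%p al. sfun_mult F G p al I)"
  unfolding sfun_mult_smul smul_def conv_def fun_eq_iff sum_distrib_left
  by (intro allI, subst sum.swap) (simp add: mult_ac)
 finally show "regular C V (%p al. sfun_mult F G p al I)" .
qed

section \<open>Values of sections\<close>

lemma open_sub_simps [simp]:
 "sections (open_sub X U) = sections X" "part (open_sub X U) = part X"
 "scalar (open_sub X U) = scalar X" "restr (open_sub X U) = restr X"
 "points (open_sub X U) = subtopology (points X) U"
 by (simp_all add: open_sub_def)

lemma whole_open_sub: "openin (points X) U ==> whole (open_sub X U) = U"
 using openin_subset by fastforce

lemma opens_open_sub: "openin (points X) U ==> opens (open_sub X U) V = opens X (V \<inter> U)"
 by (auto simp: opens_def openin_open_subtopology)

lemma preim_open_sub: "openin (points X) U ==> preim (open_sub X U) \<phi> W = {p \<in> U. fst \<phi> p \<in> W}"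
 unfolding preim_def by (simp only: whole_open_sub)

locale super_charts = ringed_space X
 for X :: "('p, 's, 'k::{real_normed_field,banach}) superspace" +
 fixes C :: category and n :: nat and L :: "('k^'m::finite, ('k, 'm) sfun, 'k) superspace"
 assumes L: "L = affine_superspace C n" and manifold: "supermanifold L X"
begin

abbreviation "opL W \<equiv> C = Formal \<or> open W"
abbreviation "pre U \<phi> W \<equiv> {p \<in> U. fst \<phi> p \<in> W}"

lemma openin_L: "openin (points L) W \<longleftrightarrow> opL W"
 by (simp add: L openin_affine)

definition mor :: "'p set => ('k^'m) set => ('p, 's, 'k^'m, ('k, 'm) sfun) smorph => bool" where
 "mor U W \<phi> \<longleftrightarrow> opn U \<and> opL W \<and> is_morphism (open_sub X U) (open_sub L W) \<phi>"

lemma mor_props: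
 assumes m: "mor U W \<phi>" and W': "opL W'" "W' <= W"
 shows "opn (pre U \<phi> W')"
  and "F \<in> sfuns C n W' ==> snd \<phi> W' F \<in> fns (pre U \<phi> W')"
  and "F \<in> sfuns C n W' ==> G \<in> sfuns C n W' ==>
   snd \<phi> W' (%p al I. F p al I + G p al I) = snd \<phi> W' F +[pre U \<phi> W'] snd \<phi> W' G"
  and "F \<in> sfuns C n W' ==> G \<in> sfuns C n W' ==>
   snd \<phi> W' (sfun_mult F G) = snd \<phi> W' F *[pre U \<phi> W'] snd \<phi> W' G"
  and "snd \<phi> W' (sfun_scalar W' x) = scl (pre U \<phi> W') x"
  and "opL W'' ==> W'' <= W' ==> F \<in> sfuns C n W' ==>
   snd \<phi> W'' (%p. if p \<in> W'' then F p else (%al I. 0)) = rstr (pre U \<phi> W') (pre U \<phi> W'') (snd \<phi> W' F)"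
proof -
 have U: "opn U" and W: "opL W" using m by (auto simp: mor_def)
 have oW: "openin (points L) W" using W by (simp add: openin_L)
 have "W' \<in> opens (open_sub L W) (whole (open_sub L W))"
  unfolding whole_open_sub[OF oW] opens_open_sub[OF oW] using W' by (auto intro!: opensI simp: openin_L)
 note * = conjunct2[OF m[unfolded mor_def is_morphism_def, THEN conjunct2, THEN conjunct2], rule_format, OF this,
   unfolded preim_open_sub[OF U] open_sub_simps]
 have cont: "continuous_map (subtopology (points X) U) (subtopology (points L) W) (fst \<phi>)"
  using m by (simp add: mor_def is_morphism_def)
 have "openin (subtopology (points L) W) W'"
  using W' W oW by (simp add: openin_open_subtopology openin_L)
 from openin_continuous_map_preimage[OF cont this]
 have "openin (subtopology (points X) U) {p \<in> whole (open_sub X U). fst \<phi> p \<in> W'}" by simp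
 then show "opn (pre U \<phi> W')"
  unfolding whole_open_sub[OF U] using U by (simp add: openin_open_subtopology)
 have hom: "snd \<phi> W' \<in> ring_hom (sections L W') (sec (pre U \<phi> W'))" using * by blast
 show "F \<in> sfuns C n W' ==> snd \<phi> W' F \<in> fns (pre U \<phi> W')"
  using ring_hom_closed[OF hom] by (simp add: L)
 show "F \<in> sfuns C n W' ==> G \<in> sfuns C n W' ==>
   snd \<phi> W' (%p al I. F p al I + G p al I) = snd \<phi> W' F +[pre U \<phi> W'] snd \<phi> W' G"
  using ring_hom_add[OF hom, of F G] by (simp add: L)
 show "F \<in> sfuns C n W' ==> G \<in> sfuns C n W' ==>
   snd \<phi> W' (sfun_mult F G) = snd \<phi> W' F *[pre U \<phi> W'] snd \<phi> W' G"
  using ring_hom_mult[OF hom, of F G] by (simp add: L)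
 have "\<forall>x. snd \<phi> W' (scalar L W' x) = scl (pre U \<phi> W') x" using * by blast
 then show "snd \<phi> W' (sfun_scalar W' x) = scl (pre U \<phi> W') x" by (simp add: L)
 have r: "\<forall>W''\<in>opens (open_sub L W) W'. \<forall>g\<in>carrier (sections L W').
     snd \<phi> W'' (restr L W' W'' g) = rstr (pre U \<phi> W') (pre U \<phi> W'') (snd \<phi> W' g)"
  using * by blast
 show "snd \<phi> W'' (%p. if p \<in> W'' then F p else (%al I. 0)) = rstr (pre U \<phi> W') (pre U \<phi> W'') (snd \<phi> W' F)"
  if "opL W''" "W'' <= W'" "F \<in> sfuns C n W'" for W''
 proof -
  have "W'' \<in> opens (open_sub L W) W'"
   unfolding opens_open_sub[OF oW] using that W' by (auto intro!: opensI simp: openin_L)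
  then show ?thesis using r that by (simp add: L)
 qed
qed

definition iso :: "'p set => ('k^'m) set => ('p, 's, 'k^'m, ('k, 'm) sfun) smorph => bool" where
 "iso U W \<phi> \<longleftrightarrow> opn U \<and> opL W \<and> is_iso (open_sub X U) (open_sub L W) \<phi>"

lemma iso_mor: "iso U W \<phi> ==> mor U W \<phi>"
 by (simp add: iso_def mor_def is_iso_def)

lemma iso_props:
 assumes i: "iso U W \<phi>"
 shows "bij_betw (fst \<phi>) U W"
  and "opn V ==> V <= U ==> opL (fst \<phi> ` V)"
  and "opL W' ==> W' <= W ==> bij_betw (snd \<phi> W') (sfuns C n W') (fns (pre U \<phi> W'))"
  and "V <= U ==> pre U \<phi> (fst \<phi> ` V) = V"
proof -
 have U: "opn U" and W: "opL W" using i by (auto simp: iso_def)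
 have oW: "openin (points L) W" using W by (simp add: openin_L)
 have h: "homeomorphic_map (subtopology (points X) U) (subtopology (points L) W) (fst \<phi>)"
  using i by (simp add: iso_def is_iso_def)
 have "topspace (subtopology (points X) U) = U" "topspace (subtopology (points L) W) = W"
  using whole_open_sub[OF U] whole_open_sub[OF oW] by simp_all
 then show b: "bij_betw (fst \<phi>) U W"
  using homeomorphic_imp_injective_map[OF h] homeomorphic_imp_surjective_map[OF h] by (auto simp: bij_betw_def)
 show "opn V ==> V <= U ==> opL (fst \<phi> ` V)"
  using homeomorphic_imp_open_map[OF h] U oW unfolding open_map_def
  by (simp add: openin_open_subtopology openin_L)
 show "V <= U ==> pre U \<phi> (fst \<phi> ` V) = V"
  using b by (auto simp: bij_betw_def inj_on_def)
 assume W': "opL W'" "W' <= W"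
 have "W' \<in> opens (open_sub L W) (whole (open_sub L W))"
  unfolding whole_open_sub[OF oW] opens_open_sub[OF oW] using W' by (auto intro!: opensI simp: openin_L)
 then show "bij_betw (snd \<phi> W') (sfuns C n W') (fns (pre U \<phi> W'))"
  using i unfolding iso_def is_iso_def preim_open_sub[OF U] open_sub_simps by (simp add: L)
qed

text \<open>The chart need not contain \<open>V\<close>, so the section is restricted to
  \<open>V \<inter> U\<close>, carried to the image of this set in the model and evaluated
  there.\<close>

definition chart_val ::
  "('p, 's, 'k^'m, ('k, 'm) sfun) smorph => 'p set => 'p => 'p set => 's => 'k" where
 "chart_val \<phi> U p V G =
  inv_into (sfuns C n (fst \<phi> ` (V \<inter> U))) (snd \<phi> (fst \<phi> ` (V \<inter> U))) (rstr V (V \<inter> U) G) (fst \<phi> p) (%_. 0) {}"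

context
 fixes U W \<phi> assumes i: "iso U W \<phi>"
begin

lemma chart_expand:
 assumes V: "opn V" and G: "G \<in> fns V"
 obtains F where "F \<in> sfuns C n (fst \<phi> ` (V \<inter> U))" "rstr V (V \<inter> U) G = snd \<phi> (fst \<phi> ` (V \<inter> U)) F"
  and "!!p. chart_val \<phi> U p V G = F (fst \<phi> p) (%_. 0) {}"
proof -
 have U: "opn U" using i by (simp add: iso_def)
 let ?W = "fst \<phi> ` (V \<inter> U)"
 have VU: "opn (V \<inter> U)" using U V by blast
 have W: "opL ?W" by (rule iso_props(2)[OF i VU]) auto
 have WW: "?W <= W" using iso_props(1)[OF i] by (auto simp: bij_betw_def)
 have p: "pre U \<phi> ?W = V \<inter> U" by (rule iso_props(4)[OF i]) auto
 have b: "bij_betw (snd \<phi> ?W) (sfuns C n ?W) (fns (V \<inter> U))"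
  using iso_props(3)[OF i W WW] unfolding p .
 have r: "rstr V (V \<inter> U) G \<in> fns (V \<inter> U)" by (rule restr_closed[OF V VU _ G]) auto
 show ?thesis
  by (rule that[of "inv_into (sfuns C n ?W) (snd \<phi> ?W) (rstr V (V \<inter> U) G)"])
   (use b r in \<open>auto simp: chart_val_def bij_betw_def inv_into_into f_inv_into_f\<close>)
qed

lemma chart_val_eq:
 assumes V: "opn V" and F: "F \<in> sfuns C n (fst \<phi> ` (V \<inter> U))"
  and G: "rstr V (V \<inter> U) G = snd \<phi> (fst \<phi> ` (V \<inter> U)) F"
 shows "chart_val \<phi> U p V G = F (fst \<phi> p) (%_. 0) {}"
proof -
 have U: "opn U" using i by (simp add: iso_def)
 let ?W = "fst \<phi> ` (V \<inter> U)"
 have VU: "opn (V \<inter> U)" using U V by blast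
 have W: "opL ?W" by (rule iso_props(2)[OF i VU]) auto
 have WW: "?W <= W" using iso_props(1)[OF i] by (auto simp: bij_betw_def)
 have "inj_on (snd \<phi> ?W) (sfuns C n ?W)" using iso_props(3)[OF i W WW] by (simp add: bij_betw_def)
 then show ?thesis unfolding chart_val_def G using F by simp
qed

lemma chart_val_hom:
 assumes V: "opn V" and p: "p \<in> V" "p \<in> U"
 shows "F \<in> fns V ==> G \<in> fns V ==>
   chart_val \<phi> U p V (F +[V] G) = chart_val \<phi> U p V F + chart_val \<phi> U p V G"
  and "F \<in> fns V ==> G \<in> fns V ==>
   chart_val \<phi> U p V (F *[V] G) = chart_val \<phi> U p V F * chart_val \<phi> U p V G"
  and "chart_val \<phi> U p V (scl V x) = x"
  and "opn V' ==> V' <= V ==> p \<in> V' ==> F \<in> fns V ==>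
   chart_val \<phi> U p V' (rstr V V' F) = chart_val \<phi> U p V F"
proof -
 have U: "opn U" using i by (simp add: iso_def)
 let ?W = "fst \<phi> ` (V \<inter> U)"
 have VU: "opn (V \<inter> U)" using U V by blast
 have W: "opL ?W" by (rule iso_props(2)[OF i VU]) auto
 have WW: "?W <= W" using iso_props(1)[OF i] by (auto simp: bij_betw_def)
 have pr: "pre U \<phi> ?W = V \<inter> U" by (rule iso_props(4)[OF i]) auto
 note m = mor_props[OF iso_mor[OF i] W WW, unfolded pr]
 { assume F: "F \<in> fns V" and G: "G \<in> fns V"
  obtain F' where F': "F' \<in> sfuns C n ?W" "rstr V (V \<inter> U) F = snd \<phi> ?W F'"
   "!!p. chart_val \<phi> U p V F = F' (fst \<phi> p) (%_. 0) {}" by (rule chart_expand[OF V F]) (rule that)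
  obtain G' where G': "G' \<in> sfuns C n ?W" "rstr V (V \<inter> U) G = snd \<phi> ?W G'"
   "!!p. chart_val \<phi> U p V G = G' (fst \<phi> p) (%_. 0) {}" by (rule chart_expand[OF V G]) (rule that)
  have "rstr V (V \<inter> U) (F +[V] G) = snd \<phi> ?W (%p al I. F' p al I + G' p al I)"
   unfolding m(3)[OF F'(1) G'(1)] F'(2)[symmetric] G'(2)[symmetric]
   by (rule restr_add[OF V VU _ F G]) auto
  from chart_val_eq[OF V sfuns_add[OF F'(1) G'(1)] this]
  show "chart_val \<phi> U p V (F +[V] G) = chart_val \<phi> U p V F + chart_val \<phi> U p V G"
   unfolding F'(3) G'(3) .
  have "rstr V (V \<inter> U) (F *[V] G) = snd \<phi> ?W (sfun_mult F' G')"
   unfolding m(4)[OF F'(1) G'(1)] F'(2)[symmetric] G'(2)[symmetric]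
   by (rule restr_mult[OF V VU _ F G]) auto
  from chart_val_eq[OF V sfuns_mult[OF F'(1) G'(1)] this]
  show "chart_val \<phi> U p V (F *[V] G) = chart_val \<phi> U p V F * chart_val \<phi> U p V G"
   unfolding F'(3) G'(3) sfun_mult_smul smul_0_0 . }
 have "rstr V (V \<inter> U) (scl V x) = snd \<phi> ?W (sfun_scalar ?W x)"
  unfolding m(5) by (rule restr_scalar[OF V VU]) auto
 from chart_val_eq[OF V sfun_scalar_in[OF W] this]
 show "chart_val \<phi> U p V (scl V x) = x" using p by (simp add: sfun_scalar_def)
 { assume V': "opn V'" "V' <= V" "p \<in> V'" and F: "F \<in> fns V"
  let ?W' = "fst \<phi> ` (V' \<inter> U)"
  have V'U: "opn (V' \<inter> U)" using U V' by blast
  have W': "opL ?W'" by (rule iso_props(2)[OF i V'U]) auto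
  have W'W: "?W' <= ?W" using V' by auto
  have pr': "pre U \<phi> ?W' = V' \<inter> U" by (rule iso_props(4)[OF i]) auto
  obtain F' where F': "F' \<in> sfuns C n ?W" "rstr V (V \<inter> U) F = snd \<phi> ?W F'"
   "!!p. chart_val \<phi> U p V F = F' (fst \<phi> p) (%_. 0) {}" by (rule chart_expand[OF V F]) (rule that)
  have "rstr V' (V' \<inter> U) (rstr V V' F) = rstr V (V' \<inter> U) F"
   by (rule restr_restr[OF V V'(1,2) V'U _ F]) auto
  also have "... = rstr (V \<inter> U) (V' \<inter> U) (rstr V (V \<inter> U) F)"
   by (rule restr_restr[OF V VU _ V'U _ F, symmetric]) (use V' in auto)
  also have "... = snd \<phi> ?W' (%p. if p \<in> ?W' then F' p else (%al I. 0))"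
   unfolding F'(2) m(6)[OF W' W'W F'(1)] pr' ..
  finally show "chart_val \<phi> U p V' (rstr V V' F) = chart_val \<phi> U p V F"
   using chart_val_eq[OF V'(1) sfuns_restr[OF F'(1) W'W W'], of "rstr V V' F" p] V'(3) p F'(3) by simp }
qed

end

definition chart_at :: "'p => 'p set \<times> ('k^'m) set \<times> ('p, 's, 'k^'m, ('k, 'm) sfun) smorph" where
 "chart_at p = (SOME (U, W, \<phi>). p \<in> U \<and> iso U W \<phi>)"

text \<open>The chart is an arbitrary choice. By \<open>val_mor\<close> every morphism to the model,
  in particular every other chart, yields the same values.\<close>

definition val :: "'p => 'p set => 's => 'k" where
 "val p = (case chart_at p of (U, W, \<phi>) => chart_val \<phi> U p)"

lemma val_chart:
 assumes "p \<in> whole X"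
 obtains U W \<phi> where "iso U W \<phi>" "p \<in> U" "val p = chart_val \<phi> U p"
proof -
 have "\<exists>U W \<phi>. p \<in> U \<and> is_chart L X U W \<phi>"
  using manifold assms unfolding supermanifold_def by blast
 then obtain U W \<phi> where "p \<in> U \<and> is_chart L X U W \<phi>" by blast
 then have "case (U, W, \<phi>) of (U, W, \<phi>) => p \<in> U \<and> iso U W \<phi>"
  by (auto simp: is_chart_def iso_def opens_whole openin_L)
 then have "case chart_at p of (U, W, \<phi>) => p \<in> U \<and> iso U W \<phi>"
  unfolding chart_at_def by (rule someI)
 then show ?thesis
  using that by (auto simp: val_def split: prod.splits)
qed

lemma val_hom:
 assumes V: "opn V" and p: "p \<in> V"
 shows "F \<in> fns V ==> G \<in> fns V ==> val p V (F +[V] G) = val p V F + val p V G"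
  and "F \<in> fns V ==> G \<in> fns V ==> val p V (F *[V] G) = val p V F * val p V G"
  and "val p V (scl V x) = x"
  and "opn V' ==> V' <= V ==> p \<in> V' ==> F \<in> fns V ==> val p V' (rstr V V' F) = val p V F"
proof -
 have "p \<in> whole X" using p openin_subset[OF V] by auto
 then obtain U W \<phi> where c: "iso U W \<phi>" "p \<in> U" "val p = chart_val \<phi> U p" by (rule val_chart)
 note h = chart_val_hom[OF c(1) V p c(2)]
 show "F \<in> fns V ==> G \<in> fns V ==> val p V (F +[V] G) = val p V F + val p V G"
  "F \<in> fns V ==> G \<in> fns V ==> val p V (F *[V] G) = val p V F * val p V G"
  "val p V (scl V x) = x"
  "opn V' ==> V' <= V ==> p \<in> V' ==> F \<in> fns V ==> val p V' (rstr V V' F) = val p V F"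
  unfolding c(3) using h by auto
qed

lemma val_zero: "opn V ==> p \<in> V ==> val p V \<zero>\<^bsub>sec V\<^esub> = 0"
 using val_hom(3)[of V p 0] scalar_zero by simp

lemma val_minus:
 assumes "opn V" "p \<in> V" "F \<in> fns V"
 shows "val p V (\<ominus>\<^bsub>sec V\<^esub> F) = - val p V F"
proof -
 interpret ring "sec V" by (rule ring_sections[OF assms(1)])
 have "val p V (\<ominus>\<^bsub>sec V\<^esub> F +[V] F) = val p V (\<ominus>\<^bsub>sec V\<^esub> F) + val p V F"
  using assms by (intro val_hom(1)) auto
 then show ?thesis using assms by (simp add: l_neg val_zero eq_neg_iff_add_eq_0)
qed

text \<open>The square of an odd section is its own negative.\<close>

lemma val_odd:
 assumes V: "opn V" and p: "p \<in> V" and F: "F \<in> part X V True"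
 shows "val p V F = 0"
proof -
 interpret ring "sec V" by (rule ring_sections[OF V])
 have Fc: "F \<in> fns V" by (rule part_carrier[OF V F])
 have "F *[V] F = \<ominus>\<^bsub>sec V\<^esub> (F *[V] F)" using part_comm[OF V F F] by (simp add: ksign_def)
 then have "val p V (F *[V] F) = - val p V (F *[V] F)"
  using val_minus[OF V p, of "F *[V] F"] Fc by simp
 then have "val p V F * val p V F = - (val p V F * val p V F)"
  unfolding val_hom(2)[OF V p Fc Fc] .
 then show ?thesis by simp
qed

text \<open>A pullback composed with the value at a point is a local character, hence an evaluation.\<close>

lemma val_mor:
 assumes m: "mor U W \<phi>" and W': "opL W'" "W' <= W" and p: "p \<in> U" "fst \<phi> p \<in> W'" and F: "F \<in> sfuns C n W'"
 shows "val p (pre U \<phi> W') (snd \<phi> W' F) = F (fst \<phi> p) (%_. 0) {}"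
proof (rule germ_character_eval[of C n "fst \<phi> p" "%V F. val p (pre U \<phi> V) (snd \<phi> V F)" W' F])
 show "germ_character C n (fst \<phi> p) (%V F. val p (pre U \<phi> V) (snd \<phi> V F)) W'"
  unfolding germ_character_def
 proof (intro allI impI conjI ballI)
  fix V assume V: "opL V \<and> fst \<phi> p \<in> V \<and> V <= W'"
  then have VW: "V <= W" and oV: "opL V" using W' by auto
  note mp = mor_props[OF m oV VW]
  have pV: "p \<in> pre U \<phi> V" using p V by auto
  note h = val_hom[OF mp(1) pV]
  show "val p (pre U \<phi> V) (snd \<phi> V (sfun_scalar V x)) = x" for x unfolding mp(5) by (rule h(3))
  { fix F G assume F: "F \<in> sfuns C n V" and G: "G \<in> sfuns C n V"
   show "val p (pre U \<phi> V) (snd \<phi> V (%p al I. F p al I + G p al I)) =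
     val p (pre U \<phi> V) (snd \<phi> V F) + val p (pre U \<phi> V) (snd \<phi> V G)"
    unfolding mp(3)[OF F G] by (rule h(1)[OF mp(2)[OF F] mp(2)[OF G]])
   show "val p (pre U \<phi> V) (snd \<phi> V (sfun_mult F G)) =
     val p (pre U \<phi> V) (snd \<phi> V F) * val p (pre U \<phi> V) (snd \<phi> V G)"
    unfolding mp(4)[OF F G] by (rule h(2)[OF mp(2)[OF F] mp(2)[OF G]]) }
  fix V' F assume V': "opL V' \<and> fst \<phi> p \<in> V' \<and> V' <= V" and F: "F \<in> sfuns C n V"
  have V'W: "V' <= W" and oV': "opL V'" "V' <= V" using V' VW by auto
  show "val p (pre U \<phi> V') (snd \<phi> V' (%p. if p \<in> V' then F p else (%al I. 0))) = val p (pre U \<phi> V) (snd \<phi> V F)"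
   unfolding mp(6)[OF oV' F]
   by (rule h(4)[OF mor_props(1)[OF m oV'(1) V'W] _ _ mp(2)[OF F]]) (use V' p in auto)
 qed
qed (use W' p F in auto)

end

section \<open>Auxiliary facts on finite sums, scalars and affine maps\<close>

lemma finsum_swap:
 assumes A: "abelian_group A" and S: "finite S" "finite T"
  and f: "!!a b. a \<in> S ==> b \<in> T ==> f a b \<in> carrier A"
 shows "(\<Oplus>\<^bsub>A\<^esub>a\<in>S. \<Oplus>\<^bsub>A\<^esub>b\<in>T. f a b) = (\<Oplus>\<^bsub>A\<^esub>b\<in>T. \<Oplus>\<^bsub>A\<^esub>a\<in>S. f a b)"
proof -
 interpret A: abelian_group A by (rule A)
 show ?thesis using S(1) f
 proof (induction S)
  case empty
  then show ?case by simp
 next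
  case (insert x S)
  have c: "(%b. f x b) \<in> T \<rightarrow> carrier A" "(%b. \<Oplus>\<^bsub>A\<^esub>a\<in>S. f a b) \<in> T \<rightarrow> carrier A"
   "(%a. \<Oplus>\<^bsub>A\<^esub>b\<in>T. f a b) \<in> S \<rightarrow> carrier A"
   using insert.prems by (auto intro!: A.finsum_closed)
  have "(\<Oplus>\<^bsub>A\<^esub>a\<in>insert x S. \<Oplus>\<^bsub>A\<^esub>b\<in>T. f a b) =
    (\<Oplus>\<^bsub>A\<^esub>b\<in>T. f x b) \<oplus>\<^bsub>A\<^esub> (\<Oplus>\<^bsub>A\<^esub>a\<in>S. \<Oplus>\<^bsub>A\<^esub>b\<in>T. f a b)"
   using insert.hyps c A.finsum_closed[OF c(1)] by (intro A.finsum_insert) auto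
  also have "... = (\<Oplus>\<^bsub>A\<^esub>b\<in>T. f x b) \<oplus>\<^bsub>A\<^esub> (\<Oplus>\<^bsub>A\<^esub>b\<in>T. \<Oplus>\<^bsub>A\<^esub>a\<in>S. f a b)"
   using insert by simp
  also have "... = (\<Oplus>\<^bsub>A\<^esub>b\<in>T. f x b \<oplus>\<^bsub>A\<^esub> (\<Oplus>\<^bsub>A\<^esub>a\<in>S. f a b))"
   using A.finsum_addf[OF c(1,2)] by simp
  also have "... = (\<Oplus>\<^bsub>A\<^esub>b\<in>T. \<Oplus>\<^bsub>A\<^esub>a\<in>insert x S. f a b)"
   using insert.hyps insert.prems c
   by (intro A.finsum_cong' refl) (auto intro!: A.finsum_closed A.finsum_insert[symmetric])
  finally show ?case .
 qed
qed

text \<open>Only the zero exponent and the empty set contribute from the left factor. For infinite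
  \<open>I\<close> the sum is zero by convention, and \<open>H\<close> vanishes there because of its
  support.\<close>

lemma smul_scalar:
 fixes H :: "('m::finite => nat) => nat set => 'k::comm_ring_1"
 assumes "odd_support n H"
 shows "smul (%al I. if al = (%_. 0) \<and> I = {} then x else 0) H = (%al I. x * H al I)"
proof (intro ext)
 fix al :: "'m => nat" and I
 have "smul (%al I. if al = (%_. 0) \<and> I = {} then x else 0) H al I =
   (\<Sum>be | \<forall>i. be i \<le> al i. if be = (%_. 0) then (\<Sum>J\<in>Pow I. if J = {} then x * H al I else 0) else 0)"
  unfolding smul_def by (intro sum.cong refl) (auto intro!: sum.cong sum.neutral)
 also have "... = (\<Sum>J\<in>Pow I. if J = {} then x * H al I else 0)"
  by (simp add: sum.delta finite_below)
 also have "... = x * H al I"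
 proof (cases "finite I")
  case True
  then show ?thesis by (simp add: sum.delta)
 next
  case False
  then have "\<not> I <= {..<n}" using finite_subset by blast
  then show ?thesis using assms False by (simp add: odd_support_def)
 qed
 finally show "smul (%al I. if al = (%_. 0) \<and> I = {} then x else 0) H al I = x * H al I" .
qed

lemma sfun_mult_scalar:
 assumes "F \<in> sfuns C n V"
 shows "sfun_mult (sfun_scalar V x) F = (%p al I. x * F p al I)"
proof
 fix p
 show "sfun_mult (sfun_scalar V x) F p = (%al I. x * F p al I)"
 proof (cases "p \<in> V")
  case True
  then have "sfun_scalar V x p = (%al I. if al = (%_. 0) \<and> I = {} then x else 0)"
   by (auto simp: sfun_scalar_def fun_eq_iff)
  then show ?thesis unfolding sfun_mult_smul using smul_scalar[OF sfuns_support[OF assms]] by simp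
 next
  case False
  then show ?thesis using sfuns_outside[OF assms False] by (simp add: sfun_mult_smul smul_def fun_eq_iff)
 qed
qed

lemma sfuns_lder:
 assumes "C = Formal \<or> open V" "F \<in> sfuns C n V"
 shows "(%q. lder n v (F q)) \<in> sfuns C n V"
proof -
 have "(%p al I. \<Sum>a\<in>coords n. v a * coord_deriv a F p al I) \<in> sfuns C n V"
  by (intro sfuns_sum sfuns_coord_deriv assms) auto
 then show ?thesis by (simp add: lder_def[abs_def] coord_deriv_sder)
qed

lemma fold_sder_linear:
 "fold sder w (%al I. x * H al I + K al I) = (%al I. x * fold sder w H al I + fold sder w K al I)"
proof (induction w arbitrary: H K)
 case (Cons a w)
 have "sder a (%al I. x * H al I + K al I) = (%al I. x * sder a H al I + sder a K al I)"
  by (cases a) (auto simp: fun_eq_iff algebra_simps)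
 then show ?case using Cons.IH by simp
qed simp

lemma fold_sder_zero: "fold sder w (%al I. 0 :: 'k::comm_ring_1) = (%al I. 0)"
proof (induction w)
 case (Cons a w)
 have "sder a (%al I. 0 :: 'k) = (%al I. 0)" by (cases a) (auto simp: fun_eq_iff)
 then show ?case by (simp only: fold_simps Cons.IH)
qed simp

text \<open>The affine map taking \<open>q0\<close> to \<open>y0\<close> whose linear part is the
  even block of \<open>g\<close>, acting on row vectors.\<close>

definition aff :: "('m::finite + nat => 'm + nat => 'k::comm_ring_1) => 'k^'m => 'k^'m => 'k^'m => 'k^'m" where
 "aff g q0 y0 q = y0 + (\<chi> a. \<Sum>b\<in>UNIV. (q - q0) $ b * g (Inl b) (Inl a))"

lemma aff_add: "aff g q0 y0 (q + h) = aff g q0 y0 q + (\<chi> a. \<Sum>b\<in>UNIV. h $ b * g (Inl b) (Inl a))"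
proof -
 have "(q + h - q0) $ b * g (Inl b) (Inl a) = (q - q0) $ b * g (Inl b) (Inl a) + h $ b * g (Inl b) (Inl a)" for a b
  by (simp add: algebra_simps)
 then show ?thesis by (simp only: aff_def vec_eq_iff sum.distrib vector_add_component vec_lambda_beta add.assoc) simp
qed

text \<open>As \<open>h\<close> preserves parities, the odd indices contribute nothing to the even
  block of the product, so the even blocks are inverse to each other.\<close>

lemma aff_inverse:
 assumes h: "parity_preserving n h"
  and inv: "!!a c. a \<in> coords n ==> c \<in> coords n ==> (\<Sum>b\<in>coords n. h a b * g b c) = (if c = a then 1 else 0)"
 shows "aff g q0 y0 (aff h y0 q0 y) = y"
proof -
 have 1: "(\<Sum>b\<in>UNIV. h (Inl a) (Inl b) * g (Inl b) (Inl c)) = (if c = a then 1 else 0)" for a c :: 'a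
 proof -
  have "(\<Sum>j<n. h (Inl a) (Inr j) * g (Inr j) (Inl c)) = 0"
   by (rule sum.neutral) (use h in \<open>auto simp: parity_preserving_def\<close>)
  then show ?thesis using inv[of "Inl a" "Inl c"] by (simp add: sum_coords)
 qed
 have "(\<Sum>b\<in>UNIV. (\<Sum>a\<in>UNIV. (y - y0) $ a * h (Inl a) (Inl b)) * g (Inl b) (Inl c)) = (y - y0) $ c" for c
 proof -
  have "(\<Sum>b\<in>UNIV. (\<Sum>a\<in>UNIV. (y - y0) $ a * h (Inl a) (Inl b)) * g (Inl b) (Inl c)) =
    (\<Sum>a\<in>UNIV. (y - y0) $ a * (\<Sum>b\<in>UNIV. h (Inl a) (Inl b) * g (Inl b) (Inl c)))"
   unfolding sum_distrib_right sum_distrib_left by (subst sum.swap) (simp add: mult.assoc)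
  also have "... = (y - y0) $ c" unfolding 1 by (simp add: if_distrib[of "%x. _ * x"] sum.delta cong: if_cong)
  finally show ?thesis .
 qed
 then show ?thesis by (simp add: aff_def vec_eq_iff)
qed

lemma continuous_aff: "continuous_on S (aff g q0 (y0 :: 'k::real_normed_field^'m::finite))"
 unfolding aff_def[abs_def] by (intro continuous_intros)

section \<open>Taylor expansions in a frame\<close>

locale flat_supermanifold = super_charts X C n L + flat_superspace X L n T nabla
 for X :: "('p, 's, 'k::{real_normed_field,banach}) superspace" and C n
  and L :: "('k^'m::finite, ('k, 'm) sfun, 'k) superspace" and T nabla
begin

definition word :: "('m + nat => ('p, 's) vfield) => 'p set => ('m + nat) list => 's => 's" where
 "word s V w G = fold (%a. s a V) w G"

definition word_parity :: "('m + nat) list => bool" where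
 "word_parity w = odd (length (filter odd_index w))"

text \<open>For coordinates with coordinate fields \<open>s a\<close>, this says that
  \<open>H\<close> is the Taylor series of \<open>G\<close> at \<open>p\<close>. It is phrased
  through values of iterated derivatives, so that no such coordinates are presupposed.\<close>

definition tay :: "('m + nat => ('p, 's) vfield) => 'p => 'p set => 's => (('m => nat) => nat set => 'k) => bool" where
 "tay s p V G H \<longleftrightarrow> odd_support n H \<and>
  (\<forall>w. set w <= coords n --> val p V (word s V w G) = fold sder w H (%_. 0) {})"

lemma word_simps [simp]: "word s V [] G = G" "word s V (a # w) G = word s V w (s a V G)"
 by (simp_all add: word_def)

lemma tay_unique: "tay s p V G H ==> tay s p V G H' ==> H = H'"
 unfolding tay_def by (intro series_determined[of n H H']) auto

context
 fixes U and s :: "'m + nat => ('p, 's) vfield"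
 assumes fam: "vector_family n U s"
begin

lemma family_der: "a \<in> coords n ==> s a \<in> ders U (odd_index a)"
 using fam by (simp add: vector_family_def)

lemma word_closed:
 assumes V: "V \<in> ops U" and w: "set w <= coords n" and G: "G \<in> fns V"
 shows "word s V w G \<in> fns V"
 using w G by (induction w arbitrary: G) (auto intro: derivationD(1)[OF family_der V])

lemma word_add:
 assumes V: "V \<in> ops U" and w: "set w <= coords n" and G: "G \<in> fns V" "G' \<in> fns V"
 shows "word s V w (G +[V] G') = word s V w G +[V] word s V w G'"
 using w G
 by (induction w arbitrary: G G') (simp_all add: derivationD(1,2)[OF family_der V])

lemma word_zero:
 assumes V: "V \<in> ops U" and w: "set w <= coords n"
 shows "word s V w \<zero>\<^bsub>sec V\<^esub> = \<zero>\<^bsub>sec V\<^esub>"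
proof -
 have "s a V \<zero>\<^bsub>sec V\<^esub> = \<zero>\<^bsub>sec V\<^esub>" if "a \<in> coords n" for a
  using tangent_scalar[OF derivation_tangent[OF family_der[OF that]] V, of 0] scalar_zero[OF opensD(1)[OF V]] by simp
 then show ?thesis using w by (induction w) simp_all
qed

lemma word_minus:
 assumes V: "V \<in> ops U" and w: "set w <= coords n" and G: "G \<in> fns V"
 shows "word s V w (\<ominus>\<^bsub>sec V\<^esub> G) = \<ominus>\<^bsub>sec V\<^esub> word s V w G"
proof -
 interpret ring "sec V" by (rule ring_sections[OF opensD(1)[OF V]])
 have "word s V w (\<ominus>\<^bsub>sec V\<^esub> G) +[V] word s V w G = \<zero>\<^bsub>sec V\<^esub>"
  using word_add[OF V w, of "\<ominus>\<^bsub>sec V\<^esub> G" G] G word_zero[OF V w] by (simp add: l_neg)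
 then show ?thesis
  using minus_equality[of "word s V w (\<ominus>\<^bsub>sec V\<^esub> G)" "word s V w G"] word_closed[OF V w] G by simp
qed

lemma word_restr:
 assumes V: "V \<in> ops U" and V': "V' \<in> ops V" and w: "set w <= coords n" and G: "G \<in> fns V"
 shows "word s V' w (rstr V V' G) = rstr V V' (word s V w G)"
 using w G
 by (induction w arbitrary: G) (simp_all add: derivationD(1)[OF family_der V] derivationD(6)[OF family_der V V'])

lemma word_part:
 assumes V: "V \<in> ops U" and w: "set w <= coords n" and G: "G \<in> part X V c"
 shows "word s V w G \<in> part X V (c ~= word_parity w)"
 using w G
proof (induction w arbitrary: G c)
 case Nil
 then show ?case by (simp add: word_parity_def)
next
 case (Cons a w)
 have "s a V G \<in> part X V (odd_index a ~= c)"
  using derivationD(4)[OF family_der V] Cons.prems by simp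
 then have "word s V w (s a V G) \<in> part X V ((odd_index a ~= c) ~= word_parity w)"
  using Cons by simp
 moreover have "((odd_index a ~= c) ~= word_parity w) = (c ~= word_parity (a # w))"
  by (auto simp: word_parity_def)
 ultimately show ?case by simp
qed

lemma tay_restr:
 assumes V: "V \<in> ops U" and V': "V' \<in> ops V" and p: "p \<in> V'" and G: "G \<in> fns V"
 shows "tay s p V' (rstr V V' G) H \<longleftrightarrow> tay s p V G H"
proof -
 have "val p V' (word s V' w (rstr V V' G)) = val p V (word s V w G)" if w: "set w <= coords n" for w
  unfolding word_restr[OF V V' w G]
  using val_hom(4)[OF opensD(1)[OF V] _ opensD[OF V'] p word_closed[OF V w G]] opensD(2)[OF V'] p by blast
 then show ?thesis by (simp add: tay_def)
qed

lemma tay_step: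
 "tay s p V G H ==> a \<in> coords n ==> tay s p V (s a V G) (sder a H)"
 unfolding tay_def
proof (intro conjI allI impI)
 fix w :: "('m + nat) list" assume t: "odd_support n H \<and>
  (\<forall>w. set w <= coords n --> val p V (word s V w G) = fold sder w H (%_. 0) {})"
  and a: "a \<in> coords n" and w: "set w <= coords n"
 show "val p V (word s V w (s a V G)) = fold sder w (sder a H) (%_. 0) {}"
  using conjunct2[OF t, rule_format, of "a # w"] a w by simp
qed (auto simp: sder_support)

lemma tay_add:
 assumes V: "V \<in> ops U" and p: "p \<in> V" and G: "G \<in> fns V" "G' \<in> fns V"
  and t: "tay s p V G H" "tay s p V G' H'"
 shows "tay s p V (G +[V] G') (%al I. H al I + H' al I)"
 unfolding tay_def
proof (intro conjI allI impI)
 show "odd_support n (%al I. H al I + H' al I)" using t by (simp add: tay_def odd_support_def)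
 fix w :: "('m + nat) list" assume w: "set w <= coords n"
 show "val p V (word s V w (G +[V] G')) = fold sder w (%al I. H al I + H' al I) (%_. 0) {}"
  unfolding word_add[OF V w G] val_hom(1)[OF opensD(1)[OF V] p word_closed[OF V w G(1)] word_closed[OF V w G(2)]]
  using t w fold_sder_linear[of w 1 H H'] by (simp add: tay_def)
qed

lemma tay_scalar:
 assumes V: "V \<in> ops U" and p: "p \<in> V"
 shows "tay s p V (scl V x) (%al I. if al = (%_. 0) \<and> I = {} then x else 0)"
 unfolding tay_def
proof (intro conjI allI impI)
 let ?H = "%al I. if al = (%_. 0) \<and> I = {} then x else (0::'k)"
 show "odd_support n ?H" by (auto simp: odd_support_def)
 fix w :: "('m + nat) list" assume w: "set w <= coords n"
 show "val p V (word s V w (scl V x)) = fold sder w ?H (%_. 0) {}"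
 proof (cases w)
  case Nil
  then show ?thesis using val_hom(3)[OF opensD(1)[OF V] p] by simp
 next
  case (Cons a w')
  have a: "a \<in> coords n" and w': "set w' <= coords n" using w Cons by auto
  have "sder a ?H = (%al I. 0)"
  proof (cases a)
   case (Inl i)
   have "al(i := Suc (al i)) ~= (%_. 0)" for al :: "'m => nat" by (metis fun_upd_same nat.distinct(1))
   then show ?thesis by (intro ext) (simp add: Inl del: fun_upd_apply)
  qed (auto simp: fun_eq_iff)
  moreover have "s a V (scl V x) = \<zero>\<^bsub>sec V\<^esub>"
   by (rule tangent_scalar[OF derivation_tangent[OF family_der[OF a]] V])
  ultimately show ?thesis
   unfolding Cons using word_zero[OF V w'] val_zero[OF opensD(1)[OF V] p] by (simp add: fold_sder_zero)
 qed
qed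

text \<open>Induction over the word: its first letter is distributed over the product by the Leibniz
  rule for \<open>s a\<close> on one side and for \<open>sder a\<close> on the other. The signs
  agree because \<open>G\<close> and \<open>H\<close> have the same parity \<open>c\<close>.\<close>

lemma tay_mult_homogeneous:
 assumes V: "V \<in> ops U" and p: "p \<in> V" and w: "set w <= coords n"
 shows "G \<in> part X V c ==> homogeneous c H ==> tay s p V G H ==> G' \<in> fns V ==> tay s p V G' H' ==>
  val p V (word s V w (G *[V] G')) = fold sder w (smul H H') (%_. 0) {}"
 using w
proof (induction w arbitrary: G c H G' H')
 case Nil
 note oV = opensD(1)[OF V]
 have "G \<in> fns V" by (rule part_carrier[OF oV Nil(1)])
 moreover have "val p V G = H (%_. 0) {}" "val p V G' = H' (%_. 0) {}"
  using Nil(3,5) unfolding tay_def by (metis empty_set empty_subsetI fold_simps(1) id_apply word_simps(1))+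
 ultimately show ?case using val_hom(2)[OF oV p _ Nil(4)] by (simp add: smul_0_0)
next
 case (Cons a w)
 note oV = opensD(1)[OF V]
 interpret ring "sec V" by (rule ring_sections[OF oV])
 have a: "a \<in> coords n" and w: "set w <= coords n" using Cons.prems(6) by auto
 have Gc: "G \<in> fns V" by (rule part_carrier[OF oV Cons.prems(1)])
 note d = derivationD[OF family_der[OF a] V]
 have supp: "odd_support n H" using Cons.prems(3) by (simp add: tay_def)
 have sG: "s a V G \<in> part X V (c ~= odd_index a)"
 proof -
  have "(odd_index a ~= c) = (c ~= odd_index a)" by auto
  then show ?thesis using d(4)[OF Cons.prems(1)] by simp
 qed
 note sGc = part_carrier[OF oV sG]
 have sG'c: "s a V G' \<in> fns V" by (rule d(1)[OF Cons.prems(4)])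
 let ?k = "odd_index a \<and> c"
 have 1: "val p V (word s V w (s a V G *[V] G')) = fold sder w (smul (sder a H) H') (%_. 0) {}"
  by (rule Cons.IH[OF sG sder_homogeneous[OF Cons.prems(2) supp] tay_step[OF Cons.prems(3) a] Cons.prems(4,5) w])
 have 2: "val p V (word s V w (G *[V] s a V G')) = fold sder w (smul H (sder a H')) (%_. 0) {}"
  by (rule Cons.IH[OF Cons.prems(1-3) sG'c tay_step[OF Cons.prems(5) a] w])
 have "word s V (a # w) (G *[V] G') =
   word s V w (s a V G *[V] G') +[V] word s V w (ksign (sec V) ?k (G *[V] s a V G'))"
  unfolding word_simps d(5)[OF Cons.prems(1,4)]
  by (rule word_add[OF V w]) (use Gc sGc sG'c Cons.prems(4) in auto)
 also have "word s V w (ksign (sec V) ?k (G *[V] s a V G')) = ksign (sec V) ?k (word s V w (G *[V] s a V G'))"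
  using word_minus[OF V w, of "G *[V] s a V G'"] Gc sG'c by (simp add: ksign_def)
 finally have "val p V (word s V (a # w) (G *[V] G')) =
   val p V (word s V w (s a V G *[V] G')) +
   (if ?k then - 1 else 1) * val p V (word s V w (G *[V] s a V G'))"
  using val_hom(1)[OF oV p] val_minus[OF oV p] word_closed[OF V w] Gc sGc sG'c Cons.prems(4)
  by (simp add: ksign_def)
 also have "... = fold sder w (sder a (smul H H')) (%_. 0) {}"
  unfolding 1 2 sder_smul_homogeneous[OF Cons.prems(2)]
  using fold_sder_linear[of w "if ?k then - 1 else 1" "smul H (sder a H')" "smul (sder a H) H'"]
  by (simp add: add.commute)
 finally show ?case by simp
qed

lemma tay_mult:
 assumes V: "V \<in> ops U" and p: "p \<in> V" and G: "G \<in> part X V c" and H: "homogeneous c H"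
  and t: "tay s p V G H" and G': "G' \<in> fns V" and t': "tay s p V G' H'"
 shows "tay s p V (G *[V] G') (smul H H')"
 unfolding tay_def
 using tay_mult_homogeneous[OF V p _ G H t G' t'] smul_support t t' unfolding tay_def by blast

end

end

section \<open>Restriction of isomorphisms and pullbacks of linear combinations\<close>

context super_charts
begin

lemma mor_more:
 assumes m: "mor U W \<phi>" and W': "opL W'" "W' <= W"
 shows "snd \<phi> W' \<in> ring_hom (sections L W') (sec (pre U \<phi> W'))"
  and "F \<in> part L W' a ==> snd \<phi> W' F \<in> part X (pre U \<phi> W') a"
proof -
 have U: "opn U" and W: "opL W" using m by (auto simp: mor_def)
 have oW: "openin (points L) W" using W by (simp add: openin_L)
 have "W' \<in> opens (open_sub L W) (whole (open_sub L W))"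
  unfolding whole_open_sub[OF oW] opens_open_sub[OF oW] using W' by (auto intro!: opensI simp: openin_L)
 note * = conjunct2[OF m[unfolded mor_def is_morphism_def, THEN conjunct2, THEN conjunct2], rule_format, OF this,
   unfolded preim_open_sub[OF U] open_sub_simps]
 show "snd \<phi> W' \<in> ring_hom (sections L W') (sec (pre U \<phi> W'))" by (rule conjunct1[OF *])
 have "\<forall>a. snd \<phi> W' ` part L W' a <= part X (pre U \<phi> W') a" by (rule conjunct1[OF conjunct2[OF *]])
 then show "F \<in> part L W' a ==> snd \<phi> W' F \<in> part X (pre U \<phi> W') a" by auto
qed

lemma isoI:
 assumes U: "opn U" and W: "opL W"
  and h: "homeomorphic_map (subtopology (points X) U) (subtopology (points L) W) (fst \<phi>)"
  and hom: "!!W'. opL W' ==> W' <= W ==> snd \<phi> W' \<in> ring_hom (sections L W') (sec (pre U \<phi> W'))"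
  and parts: "!!W' a F. opL W' ==> W' <= W ==> F \<in> part L W' a ==> snd \<phi> W' F \<in> part X (pre U \<phi> W') a"
  and scal: "!!W' x. opL W' ==> W' <= W ==> snd \<phi> W' (sfun_scalar W' x) = scl (pre U \<phi> W') x"
  and res: "!!W' W'' F. opL W' ==> W' <= W ==> opL W'' ==> W'' <= W' ==> F \<in> sfuns C n W' ==>
   snd \<phi> W'' (%p. if p \<in> W'' then F p else (%al I. 0)) = rstr (pre U \<phi> W') (pre U \<phi> W'') (snd \<phi> W' F)"
  and bij: "!!W'. opL W' ==> W' <= W ==> bij_betw (snd \<phi> W') (sfuns C n W') (fns (pre U \<phi> W'))"
 shows "iso U W \<phi>"
proof -
 have oW: "openin (points L) W" using W by (simp add: openin_L)
 have *: "W' \<in> opens (open_sub L W) W \<longleftrightarrow> opL W' \<and> W' <= W" for W'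
  unfolding opens_open_sub[OF oW] by (simp add: opens_def openin_L)
 have **: "W'' \<in> opens (open_sub L W) W' ==> opL W'' \<and> W'' <= W'" for W' W''
  unfolding opens_open_sub[OF oW] by (simp add: opens_def openin_L)
 show ?thesis
  unfolding iso_def is_iso_def is_morphism_def preim_open_sub[OF U] whole_open_sub[OF oW]
  unfolding open_sub_simps
 proof (intro conjI U W h homeomorphic_imp_continuous_map[OF h] ballI allI)
  fix W' assume W': "W' \<in> opens (open_sub L W) W"
  then have c: "opL W'" "W' <= W" unfolding * by auto
  show "snd \<phi> W' \<in> ring_hom (sections L W') (sec (pre U \<phi> W'))" by (rule hom[OF c])
  show "snd \<phi> W' ` part L W' a <= part X (pre U \<phi> W') a" for a using parts[OF c] by auto
  show "snd \<phi> W' (scalar L W' x) = scl (pre U \<phi> W') x" for x using scal[OF c] by (simp add: L)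
  show "bij_betw (snd \<phi> W') (carrier (sections L W')) (fns (pre U \<phi> W'))"
   using bij[OF c] by (simp add: L)
 next
  fix W' W'' F assume W': "W' \<in> opens (open_sub L W) W"
   and W'': "W'' \<in> opens (open_sub L W) W'" and F: "F \<in> carrier (sections L W')"
  have c: "opL W'" "W' <= W" using W' unfolding * by auto
  have "F \<in> sfuns C n W'" using F by (simp add: L)
  from res[OF c conjunct1[OF **[OF W'']] conjunct2[OF **[OF W'']] this]
  show "snd \<phi> W'' (restr L W' W'' F) = rstr (pre U \<phi> W') (pre U \<phi> W'') (snd \<phi> W' F)"
   by (simp add: L)
 qed
qed

lemma iso_restrict:
 assumes i: "iso U W \<phi>" and V: "opn V" "V <= U"
 shows "iso V (fst \<phi> ` V) \<phi>"
  and "W' <= fst \<phi> ` V ==> pre V \<phi> W' = pre U \<phi> W'"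
  and "fst \<phi> ` V <= W"
proof -
 have U: "opn U" and W: "opL W" using i by (auto simp: iso_def)
 have oW: "openin (points L) W" using W by (simp add: openin_L)
 let ?W = "fst \<phi> ` V"
 have inj: "inj_on (fst \<phi>) U" and im: "fst \<phi> ` U = W" using iso_props(1)[OF i] by (auto simp: bij_betw_def)
 show WW: "?W <= W" using im V by auto
 have oWV: "opL ?W" by (rule iso_props(2)[OF i V])
 have pr: "pre V \<phi> W' = pre U \<phi> W'" if W': "W' <= ?W" for W'
 proof
  show "pre V \<phi> W' <= pre U \<phi> W'" using V by auto
  show "pre U \<phi> W' <= pre V \<phi> W'"
  proof
   fix p assume p: "p \<in> pre U \<phi> W'"
   then obtain v where v: "v \<in> V" "fst \<phi> p = fst \<phi> v" using W' by blast
   then have "p = v" using inj p V by (auto simp: inj_on_def)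
   then show "p \<in> pre V \<phi> W'" using v p by auto
  qed
 qed
 then show "W' <= fst \<phi> ` V ==> pre V \<phi> W' = pre U \<phi> W'" .
 have h0: "homeomorphic_map (subtopology (points X) U) (subtopology (points L) W) (fst \<phi>)"
  using i by (simp add: iso_def is_iso_def)
 have t: "topspace (subtopology (points X) U) = U" "topspace (subtopology (points L) W) = W"
  using whole_open_sub[OF U] whole_open_sub[OF oW] by simp_all
 have "homeomorphic_map (subtopology (subtopology (points X) U) V) (subtopology (subtopology (points L) W) ?W) (fst \<phi>)"
  by (rule homeomorphic_map_subtopologies[OF h0]) (use t V WW in blast)
 then have h: "homeomorphic_map (subtopology (points X) V) (subtopology (points L) ?W) (fst \<phi>)"
  using V WW by (simp add: subtopology_subtopology Int_absorb1)
 show "iso V ?W \<phi>"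
 proof (rule isoI[OF V(1) oWV h])
  fix W' assume W': "opL W'" "W' <= ?W"
  have W'W: "W' <= W" using W' WW by auto
  note m = mor_props[OF iso_mor[OF i] W'(1) W'W] and m' = mor_more[OF iso_mor[OF i] W'(1) W'W]
  note P = pr[OF W'(2)]
  show "snd \<phi> W' \<in> ring_hom (sections L W') (sec (pre V \<phi> W'))" unfolding P by (rule m'(1))
  show "F \<in> part L W' a ==> snd \<phi> W' F \<in> part X (pre V \<phi> W') a" for a F unfolding P by (rule m'(2))
  show "snd \<phi> W' (sfun_scalar W' x) = scl (pre V \<phi> W') x" for x unfolding P by (rule m(5))
  show "bij_betw (snd \<phi> W') (sfuns C n W') (fns (pre V \<phi> W'))"
   unfolding P by (rule iso_props(3)[OF i W'(1) W'W])
  show "snd \<phi> W'' (%p. if p \<in> W'' then F p else (%al I. 0)) = rstr (pre V \<phi> W') (pre V \<phi> W'') (snd \<phi> W' F)"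
   if "opL W''" "W'' <= W'" "F \<in> sfuns C n W'" for W'' F
   unfolding P pr[OF order_trans[OF that(2) W'(2)]] by (rule m(6)[OF that])
 qed
qed

lemma mor_sum:
 assumes m: "mor U W \<phi>" and W': "opL W'" "W' <= W" and S: "finite S"
 shows "(!!b. b \<in> S ==> F b \<in> sfuns C n W') ==>
  snd \<phi> W' (%p al I. \<Sum>b\<in>S. c b * F b p al I) =
  (\<Oplus>\<^bsub>sec (pre U \<phi> W')\<^esub>b\<in>S. scl (pre U \<phi> W') (c b) *[pre U \<phi> W'] snd \<phi> W' (F b))"
 using S
proof (induction S)
 note mp = mor_props[OF m W']
 case empty
 have "snd \<phi> W' (%p al I. 0) = \<zero>\<^bsub>sec (pre U \<phi> W')\<^esub>"
  using mp(5)[of 0] scalar_zero[OF mp(1)] by simp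
 moreover interpret abelian_group "sec (pre U \<phi> W')" by (rule abelian_group_sections[OF mp(1)])
 show ?case using calculation by simp
next
 note mp = mor_props[OF m W']
 case (insert b S)
 interpret ring "sec (pre U \<phi> W')" by (rule ring_sections[OF mp(1)])
 have Fb: "F b \<in> sfuns C n W'" by (rule insert.prems) simp
 have FS: "F a \<in> sfuns C n W'" if "a \<in> S" for a by (rule insert.prems) (use that in simp)
 let ?t = "%b. scl (pre U \<phi> W') (c b) *[pre U \<phi> W'] snd \<phi> W' (F b)"
 have t: "snd \<phi> W' (%p al I. c b * F b p al I) = ?t b"
  using mp(4)[OF sfun_scalar_in[OF W'(1), of "c b"] Fb] unfolding sfun_mult_scalar[OF Fb] mp(5) .
 have cl: "?t a \<in> fns (pre U \<phi> W')" if "a \<in> insert b S" for a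
  using mp(2)[OF insert.prems[OF that]] scalar_closed[OF mp(1)] by simp
 have "snd \<phi> W' (%p al I. \<Sum>b\<in>insert b S. c b * F b p al I) =
   snd \<phi> W' (%p al I. c b * F b p al I + (\<Sum>b\<in>S. c b * F b p al I))"
  using insert.hyps by simp
 also have "... = ?t b +[pre U \<phi> W'] (\<Oplus>\<^bsub>sec (pre U \<phi> W')\<^esub>b\<in>S. ?t b)"
 proof -
  have s1: "(%p al I. c b * F b p al I) \<in> sfuns C n W'" by (rule sfuns_scale[OF Fb])
  have s2: "(%p al I. \<Sum>b\<in>S. c b * F b p al I) \<in> sfuns C n W'" by (rule sfuns_sum[OF insert.hyps(1) FS])
  show ?thesis using mp(3)[OF s1 s2] insert.IH[OF FS] t by simp
 qed
 also have "... = (\<Oplus>\<^bsub>sec (pre U \<phi> W')\<^esub>b\<in>insert b S. ?t b)"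
  using cl insert.hyps by (intro finsum_insert[symmetric]) auto
 finally show ?case .
qed

end

section \<open>Locally constant coefficients and constant changes of frame\<close>

context ringed_space
begin

lemma locally_constant_finite:
 assumes V: "opn V" and p: "p \<in> V" and S: "finite S"
 shows "(!!i. i \<in> S ==> locally_constant X V (f i)) ==>
  \<exists>V1\<in>ops V. p \<in> V1 \<and> (\<exists>x. \<forall>i\<in>S. rstr V V1 (f i) = scl V1 (x i))"
 using S
proof (induction S)
 case empty
 then show ?case using opens_refl[OF V] p by auto
next
 case (insert j S)
 have ls: "locally_constant X V (f i)" if "i \<in> S" for i by (rule insert.prems) (use that in simp)
 from insert.IH[OF ls] obtain V1 x where V1: "V1 \<in> ops V" "p \<in> V1"
  "!!i. i \<in> S ==> rstr V V1 (f i) = scl V1 (x i)" by blast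
 have lj: "locally_constant X V (f j)" by (rule insert.prems) simp
 then obtain V2 z where V2: "V2 \<in> ops V" "p \<in> V2" "rstr V V2 (f j) = scl V2 z"
  using p unfolding locally_constant_def by blast
 let ?V = "V1 \<inter> V2"
 have o: "opn ?V" using opensD(1)[OF V1(1)] opensD(1)[OF V2(1)] by blast
 have c: "f i \<in> fns V" if "i \<in> insert j S" for i
  using insert.prems[OF that] by (simp add: locally_constant_def)
 have "rstr V ?V (f i) = scl ?V ((x(j := z)) i)" if i: "i \<in> insert j S" for i
 proof (cases "i = j")
  case True
  have "rstr V ?V (f i) = rstr V2 ?V (rstr V V2 (f i))"
   by (rule restr_props(4)[OF V opensD[OF V2(1)] o _ c[OF i], symmetric]) auto
  also have "... = scl ?V z"
   unfolding True V2(3) by (rule restr_props(3)[OF opensD(1)[OF V2(1)] o]) auto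
  finally show ?thesis using True by simp
 next
  case False
  then have iS: "i \<in> S" using i by simp
  have "rstr V ?V (f i) = rstr V1 ?V (rstr V V1 (f i))"
   by (rule restr_props(4)[OF V opensD[OF V1(1)] o _ c[OF i], symmetric]) auto
  also have "... = scl ?V (x i)"
   unfolding V1(3)[OF iS] by (rule restr_props(3)[OF opensD(1)[OF V1(1)] o]) auto
  finally show ?thesis using False by simp
 qed
 then show ?case using o V1 V2 opensD(2)[OF V1(1)] by (intro bexI[of _ ?V] conjI exI[of _ "x(j := z)"]) (auto intro: opensI)
qed

lemma lin_comb_scalar_comp:
 fixes d s :: "'m::finite + nat => ('p, 's) vfield"
 assumes d: "vector_family n U d" and s: "vector_family n U' s" and V: "V \<in> ops U" "V \<in> ops U'"
  and ds: "!!b. b \<in> coords n ==> vrst V (d b) = comb n V (%c. scl V (g b c)) s"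
 shows "comb n V (%b. scl V (v b)) d = comb n V (%c. scl V (\<Sum>b\<in>coords n. v b * g b c)) s"
proof (rule tangent_eqI[of _ V])
 note oV = opensD(1)[OF V(1)]
 have co: "coeffs n V (%c. scl V (x c))" for x :: "'m + nat => 'k" by (simp add: coeffs_def scalar_closed[OF oV])
 show "comb n V (%b. scl V (v b)) d \<in> vfs V" by (rule lin_comb_closed[OF d V(1) co])
 show "comb n V (%c. scl V (\<Sum>b\<in>coords n. v b * g b c)) s \<in> vfs V"
  by (rule lin_comb_closed[OF s V(2) co])
 fix W f assume W: "W \<in> ops V" and f: "f \<in> fns W"
 note oW = opensD(1)[OF W]
 note WU = opens_trans[OF W V(1)] and WU' = opens_trans[OF W V(2)]
 interpret ring "sec W" by (rule ring_sections[OF oW])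
 have res: "rstr V W (scl V x) = scl W x" for x
  by (rule restr_props(3)[OF oV oW opensD(2)[OF W]])
 have sc: "s c W f \<in> fns W" if "c \<in> coords n" for c by (rule family_closed[OF s that WU' f])
 have dc: "d c W f \<in> fns W" if "c \<in> coords n" for c by (rule family_closed[OF d that WU f])
 note k = scalar_closed[OF oW]
 have db: "d b W f = (\<Oplus>\<^bsub>sec W\<^esub>c\<in>coords n. scl W (g b c) *[W] s c W f)" if b: "b \<in> coords n" for b
 proof -
  have "d b W f = vrst V (d b) W f" by (simp add: vrestr_eval[OF W])
  also have "... = (\<Oplus>\<^bsub>sec W\<^esub>c\<in>coords n. rstr V W (scl V (g b c)) *[W] s c W f)"
   unfolding ds[OF b] by (rule lin_comb_eval[OF s V(2) co W f])
  finally show ?thesis unfolding res .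
 qed
 have "comb n V (%b. scl V (v b)) d W f = (\<Oplus>\<^bsub>sec W\<^esub>b\<in>coords n. scl W (v b) *[W] d b W f)"
  unfolding lin_comb_eval[OF d V(1) co W f] res ..
 also have "... = (\<Oplus>\<^bsub>sec W\<^esub>b\<in>coords n. \<Oplus>\<^bsub>sec W\<^esub>c\<in>coords n. scl W (v b * g b c) *[W] s c W f)"
 proof (intro finsum_cong' refl)
  fix b :: "'m + nat" assume b: "b \<in> coords n"
  have "scl W (v b) *[W] d b W f =
    (\<Oplus>\<^bsub>sec W\<^esub>c\<in>coords n. scl W (v b) *[W] (scl W (g b c) *[W] s c W f))"
   unfolding db[OF b] by (rule finsum_rdistr) (use sc k in auto)
  also have "... = (\<Oplus>\<^bsub>sec W\<^esub>c\<in>coords n. scl W (v b * g b c) *[W] s c W f)"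
   by (intro finsum_cong' refl) (use sc k in \<open>auto simp: scalar_mult[OF oW] m_assoc\<close>)
  finally show "scl W (v b) *[W] d b W f = (\<Oplus>\<^bsub>sec W\<^esub>c\<in>coords n. scl W (v b * g b c) *[W] s c W f)" .
 qed (use sc k in \<open>auto intro!: finsum_closed\<close>)
 also have "... = (\<Oplus>\<^bsub>sec W\<^esub>c\<in>coords n. \<Oplus>\<^bsub>sec W\<^esub>b\<in>coords n. scl W (v b * g b c) *[W] s c W f)"
  by (rule finsum_swap[OF abelian_group_sections[OF oW]]) (use sc k in auto)
 also have "... = (\<Oplus>\<^bsub>sec W\<^esub>c\<in>coords n. scl W (\<Sum>b\<in>coords n. v b * g b c) *[W] s c W f)"
 proof (intro finsum_cong' refl)
  fix c :: "'m + nat" assume c: "c \<in> coords n"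
  show "(\<Oplus>\<^bsub>sec W\<^esub>b\<in>coords n. scl W (v b * g b c) *[W] s c W f) =
    scl W (\<Sum>b\<in>coords n. v b * g b c) *[W] s c W f"
   unfolding scalar_sum[OF oW finite_coords] by (rule finsum_ldistr[symmetric]) (use sc[OF c] k in auto)
 qed (use sc k in auto)
 also have "... = comb n V (%c. scl V (\<Sum>b\<in>coords n. v b * g b c)) s W f"
  unfolding lin_comb_eval[OF s V(2) co W f] res ..
 finally show "comb n V (%b. scl V (v b)) d W f =
   comb n V (%c. scl V (\<Sum>b\<in>coords n. v b * g b c)) s W f" .
qed

end

context flat_supermanifold
begin

text \<open>A chart in which \<open>s a\<close> becomes the operator with constant coefficients
  \<open>h a b\<close>, with \<open>g\<close> the inverse matrix. Both one-sided inverse laws are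
  recorded, as substitutions are undone in both directions.\<close>

definition adapted ::
  "('m + nat => ('p, 's) vfield) => 'p set => ('k^'m) set => ('p, 's, 'k^'m, ('k, 'm) sfun) smorph
   => ('m + nat => 'm + nat => 'k) => ('m + nat => 'm + nat => 'k) => bool" where
 "adapted s V W \<phi> h g \<longleftrightarrow> iso V W \<phi> \<and> parity_preserving n h \<and> parity_preserving n g \<and>
  (\<forall>a\<in>coords n. \<forall>c\<in>coords n. (\<Sum>b\<in>coords n. h a b * g b c) = (if c = a then 1 else 0)) \<and>
  (\<forall>a\<in>coords n. \<forall>c\<in>coords n. (\<Sum>b\<in>coords n. g a b * h b c) = (if c = a then 1 else 0)) \<and>
  (\<forall>W' a. \<forall>F\<in>sfuns C n W'. opL W' \<and> W' <= W \<and> a \<in> coords n -->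
    s a (pre V \<phi> W') (snd \<phi> W' F) = snd \<phi> W' (%q. lder n (h a) (F q)))"

lemma adaptedD:
 assumes "adapted s V W \<phi> h g"
 shows "iso V W \<phi>" "parity_preserving n h" "parity_preserving n g"
  and "a \<in> coords n ==> c \<in> coords n ==> (\<Sum>b\<in>coords n. h a b * g b c) = (if c = a then 1 else 0)"
  and "a \<in> coords n ==> c \<in> coords n ==> (\<Sum>b\<in>coords n. g a b * h b c) = (if c = a then 1 else 0)"
  and "opL W' ==> W' <= W ==> a \<in> coords n ==> F \<in> sfuns C n W' ==>
   s a (pre V \<phi> W') (snd \<phi> W' F) = snd \<phi> W' (%q. lder n (h a) (F q))"
 using assms unfolding adapted_def by auto

lemma adapted_restrict:
 assumes a: "adapted s V W \<phi> h g" and V': "V' \<in> ops V"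
 shows "adapted s V' (fst \<phi> ` V') \<phi> h g" "fst \<phi> ` V' <= W"
proof -
 note r = iso_restrict[OF adaptedD(1)[OF a] opensD[OF V']]
 show "fst \<phi> ` V' <= W" by (rule r(3))
 have "s b (pre V' \<phi> W') (snd \<phi> W' F) = snd \<phi> W' (%q. lder n (h b) (F q))"
  if F: "F \<in> sfuns C n W'" and W': "opL W' \<and> W' <= fst \<phi> ` V' \<and> b \<in> coords n" for W' b F
 proof -
  have w: "opL W'" "W' <= fst \<phi> ` V'" "W' <= W" "b \<in> coords n" using W' r(3) by auto
  show ?thesis unfolding r(2)[OF w(2)] by (rule adaptedD(6)[OF a w(1,3,4) F])
 qed
 then show "adapted s V' (fst \<phi> ` V') \<phi> h g"
  unfolding adapted_def by (intro conjI ballI allI impI r(1) adaptedD(2-5)[OF a])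
qed

text \<open>Near \<open>p\<close> there are flat coordinates, whose fields \<open>d\<close> are a
  second flat frame. The transition matrices between two flat frames are locally constant, hence
  constant near \<open>p\<close>. They are mutually inverse by uniqueness of coefficients and
  preserve parity because an odd scalar is zero.\<close>

lemma frame_near:
 assumes s: "flat_frame n X T U s" and V: "V \<in> ops U" and p: "p \<in> V"
 obtains V1 W \<phi> h g where "V1 \<in> ops V" "p \<in> V1" "adapted s V1 W \<phi> h g"
proof -
 note oV = opensD(1)[OF V]
 obtain V0 U' d where V0: "V0 \<in> ops V" "p \<in> V0" "V0 \<in> ops U'" and fc: "flat_coordinates L n X T U' d"
  by (rule flat_coordinates_near[OF oV p]) (rule that)
 note d = flat_coordinates_frame[OF fc]
 note fd = flat_frame_family[OF d] and fs = flat_frame_family[OF s]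
 note oV0 = opensD(1)[OF V0(1)]
 have V0U: "V0 \<in> ops U" by (rule opens_trans[OF V0(1) V])
 obtain W \<phi> where ch: "is_chart L X U' W \<phi>"
  and rel: "!!i. i \<in> coords n ==> related (open_sub X U') (open_sub L W) \<phi> (d i) (coord_field L W i)"
  using conjunct2[OF fc[unfolded flat_coordinates_def]] by (elim exE conjE) (rule that, auto)
 have ic: "iso U' W \<phi>" using ch unfolding is_chart_def iso_def opens_whole openin_L by blast
 have oU': "opn U'" using ic by (simp add: iso_def)
 have oU: "opn U" using s by (simp add: flat_frame_def opens_whole)
 have oW: "openin (points L) W" using ic by (simp add: iso_def openin_L)
 have dT: "d i \<in> T U'" "d i \<in> ders U' (odd_index i)" if "i \<in> coords n" for i
  using d that by (auto simp: flat_frame_def)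
 have sT: "s i \<in> T U" "s i \<in> ders U (odd_index i)" if "i \<in> coords n" for i
  using s that by (auto simp: flat_frame_def)
 have ex1: "\<exists>f. coeffs n V0 f \<and> vrst V0 (s a) = comb n V0 f d \<and> (\<forall>i\<in>coords n. locally_constant X V0 (f i))"
  if a: "a \<in> coords n" for a
 proof -
  obtain f where f: "coeffs n V0 f" "vrst V0 (s a) = comb n V0 f d"
   by (rule frame_coeffs[OF d V0(3) family_tangent[OF fs a V0U]]) (rule that)
  have "comb n V0 f d \<in> T V0" using flat_props(2)[OF oU sT(1)[OF a] V0U] f(2) by simp
  then show ?thesis using f frame_flat[OF d V0(3) f(1)] by blast
 qed
 have ex2: "\<exists>f. coeffs n V0 f \<and> vrst V0 (d a) = comb n V0 f s \<and> (\<forall>i\<in>coords n. locally_constant X V0 (f i))"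
  if a: "a \<in> coords n" for a
 proof -
  obtain f where f: "coeffs n V0 f" "vrst V0 (d a) = comb n V0 f s"
   by (rule frame_coeffs[OF s V0U family_tangent[OF fd a V0(3)]]) (rule that)
  have "comb n V0 f s \<in> T V0" using flat_props(2)[OF oU' dT(1)[OF a] V0(3)] f(2) by simp
  then show ?thesis using f frame_flat[OF s V0U f(1)] by blast
 qed
 obtain c where c: "!!a. a \<in> coords n ==> coeffs n V0 (c a) \<and> vrst V0 (s a) = comb n V0 (c a) d \<and>
   (\<forall>i\<in>coords n. locally_constant X V0 (c a i))" using ex1 by metis
 obtain c' where c': "!!a. a \<in> coords n ==> coeffs n V0 (c' a) \<and> vrst V0 (d a) = comb n V0 (c' a) s \<and>
   (\<forall>i\<in>coords n. locally_constant X V0 (c' a i))" using ex2 by metis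
 \<comment> \<open>The boolean selects one of the two transition matrices, so that a single
   neighbourhood makes all entries of both constant.\<close>
 let ?I = "(UNIV :: bool set) \<times> (coords n :: ('m + nat) set) \<times> (coords n :: ('m + nat) set)"
 let ?f = "%(t, a, b). if t then c a b else c' a b"
 have fin: "finite ?I" by simp
 have lc: "locally_constant X V0 (?f i)" if "i \<in> ?I" for i
  using that c c' by (auto split: prod.splits)
 have "\<exists>V1\<in>ops V0. p \<in> V1 \<and> (\<exists>x. \<forall>i\<in>?I. rstr V0 V1 (?f i) = scl V1 (x i))"
  by (rule locally_constant_finite[OF oV0 V0(2) fin]) (rule lc)
 then obtain V1 x where V1: "V1 \<in> ops V0" "p \<in> V1" and x0: "\<forall>i\<in>?I. rstr V0 V1 (?f i) = scl V1 (x i)"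
  by (elim bexE conjE exE) (rule that)
 note x = bspec[OF x0]
 define h where "h a b = x (True, a, b)" for a b
 define g where "g a b = x (False, a, b)" for a b
 have hx: "rstr V0 V1 (c a b) = scl V1 (h a b)" if "a \<in> coords n" "b \<in> coords n" for a b
  using x[of "(True, a, b)"] that by (simp add: h_def)
 have gx: "rstr V0 V1 (c' a b) = scl V1 (g a b)" if "a \<in> coords n" "b \<in> coords n" for a b
  using x[of "(False, a, b)"] that by (simp add: g_def)
 note oV1 = opensD(1)[OF V1(1)]
 have V1U: "V1 \<in> ops U" and V1U': "V1 \<in> ops U'" by (rule opens_trans[OF V1(1) V0U], rule opens_trans[OF V1(1) V0(3)])
 have co: "coeffs n V1 (%c. scl V1 (x c))" for x :: "'m + nat => 'k" by (simp add: coeffs_def scalar_closed[OF oV1])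
 have sd: "vrst V1 (s a) = comb n V1 (%b. scl V1 (h a b)) d" if a: "a \<in> coords n" for a
 proof -
  have "vrst V1 (s a) = vrst V1 (vrst V0 (s a))" by (simp add: vrestr_vrestr[OF V1(1)])
  also have "... = comb n V1 (%b. rstr V0 V1 (c a b)) d"
   using c[OF a] lin_comb_restr[OF fd V0(3) _ V1(1)] by simp
  also have "... = comb n V1 (%b. scl V1 (h a b)) d"
   by (rule lin_comb_cong[OF fd V1U' co]) (rule hx[OF a])
  finally show ?thesis .
 qed
 have ds: "vrst V1 (d a) = comb n V1 (%b. scl V1 (g a b)) s" if a: "a \<in> coords n" for a
 proof -
  have "vrst V1 (d a) = vrst V1 (vrst V0 (d a))" by (simp add: vrestr_vrestr[OF V1(1)])
  also have "... = comb n V1 (%b. rstr V0 V1 (c' a b)) s"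
   using c'[OF a] lin_comb_restr[OF fs V0U _ V1(1)] by simp
  also have "... = comb n V1 (%b. scl V1 (g a b)) s"
   by (rule lin_comb_cong[OF fs V1U co]) (rule gx[OF a])
  finally show ?thesis .
 qed
 have delta: "coeffs n V1 (%j. if j = a then \<one>\<^bsub>sec V1\<^esub> else \<zero>\<^bsub>sec V1\<^esub>)" for a :: "'m + nat"
 proof -
  interpret ring "sec V1" by (rule ring_sections[OF oV1])
  show ?thesis by (simp add: coeffs_def)
 qed
 \<comment> \<open>Equations between coefficient sections become equations in the ground field by
   evaluating at \<open>p\<close>.\<close>
 have pick: "val p V1 (if j = a then \<one>\<^bsub>sec V1\<^esub> else \<zero>\<^bsub>sec V1\<^esub>) = (if j = a then 1 else 0)" for j a :: "'m + nat"
  using val_hom(3)[OF oV1 V1(2), of 1] val_zero[OF oV1 V1(2)] scalar_one[OF oV1] by simp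
 have comp: "comb n V1 (%b. scl V1 (v b)) d = comb n V1 (%c. scl V1 (\<Sum>b\<in>coords n. v b * g b c)) s" for v
  by (rule lin_comb_scalar_comp[OF fd fs V1U' V1U]) (rule ds)
 have comp': "comb n V1 (%b. scl V1 (v b)) s = comb n V1 (%c. scl V1 (\<Sum>b\<in>coords n. v b * h b c)) d" for v
  by (rule lin_comb_scalar_comp[OF fs fd V1U V1U']) (rule sd)
 have hg: "(\<Sum>b\<in>coords n. h a b * g b e) = (if e = a then 1 else 0)" if a: "a \<in> coords n" and e: "e \<in> coords n" for a e
 proof -
  have "comb n V1 (%c. scl V1 (\<Sum>b\<in>coords n. h a b * g b c)) s =
    comb n V1 (%j. if j = a then \<one>\<^bsub>sec V1\<^esub> else \<zero>\<^bsub>sec V1\<^esub>) s"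
   unfolding comp[of "h a", symmetric] sd[OF a, symmetric]
   by (rule family_basis[OF fs V1U a])
  from frame_unique[OF s V1U co delta this e]
  have "val p V1 (scl V1 (\<Sum>b\<in>coords n. h a b * g b e)) = (if e = a then 1 else 0)" using pick[of e a] by simp
  then show ?thesis unfolding val_hom(3)[OF oV1 V1(2)] .
 qed
 have gh: "(\<Sum>b\<in>coords n. g a b * h b e) = (if e = a then 1 else 0)" if a: "a \<in> coords n" and e: "e \<in> coords n" for a e
 proof -
  have "comb n V1 (%c. scl V1 (\<Sum>b\<in>coords n. g a b * h b c)) d =
    comb n V1 (%j. if j = a then \<one>\<^bsub>sec V1\<^esub> else \<zero>\<^bsub>sec V1\<^esub>) d"
   unfolding comp'[of "g a", symmetric] ds[OF a, symmetric]
   by (rule family_basis[OF fd V1U' a])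
  from frame_unique[OF d V1U' co delta this e]
  have "val p V1 (scl V1 (\<Sum>b\<in>coords n. g a b * h b e)) = (if e = a then 1 else 0)" using pick[of e a] by simp
  then show ?thesis unfolding val_hom(3)[OF oV1 V1(2)] .
 qed
 have odd0: "y = 0" if "scl V1 y \<in> part X V1 True" for y
  using val_odd[OF oV1 V1(2) that] unfolding val_hom(3)[OF oV1 V1(2)] .
 have ph: "parity_preserving n h"
  unfolding parity_preserving_def
 proof (intro ballI impI)
  fix a b :: "'m + nat" assume a: "a \<in> coords n" and b: "b \<in> coords n" and ne: "odd_index a ~= odd_index b"
  have "comb n V1 (%b. scl V1 (h a b)) d \<in> ders V1 (odd_index a)"
   using family_derivation[OF fs a V1U] sd[OF a] by simp
  from frame_homogeneous[OF d V1U' co this b] show "h a b = 0" using ne odd0 by simp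
 qed
 have pg: "parity_preserving n g"
  unfolding parity_preserving_def
 proof (intro ballI impI)
  fix a b :: "'m + nat" assume a: "a \<in> coords n" and b: "b \<in> coords n" and ne: "odd_index a ~= odd_index b"
  have "comb n V1 (%b. scl V1 (g a b)) s \<in> ders V1 (odd_index a)"
   using family_derivation[OF fd a V1U'] ds[OF a] by simp
  from frame_homogeneous[OF s V1U co this b] show "g a b = 0" using ne odd0 by simp
 qed
 note r = iso_restrict[OF ic opensD[OF V1U']]
 have der: "s a (pre V1 \<phi> W') (snd \<phi> W' F) = snd \<phi> W' (%q. lder n (h a) (F q))"
  if F: "F \<in> sfuns C n W'" and W': "opL W'" "W' <= fst \<phi> ` V1" and a: "a \<in> coords n" for W' a F
 proof -
  let ?P = "pre V1 \<phi> W'"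
  have W'W: "W' <= W" using W' r(3) by auto
  note P = r(2)[OF W'(2)]
  note m = mor_props[OF iso_mor[OF r(1)] W']
  have PV1: "?P \<in> ops V1" using m(1) by (auto intro: opensI)
  note PU' = opens_trans[OF PV1 V1U']
  have Fc: "snd \<phi> W' F \<in> fns ?P" by (rule m(2)[OF F])
  have W'o: "W' \<in> opens (open_sub L W) (whole (open_sub L W))" "W' \<in> opens L W"
   unfolding whole_open_sub[OF oW] opens_open_sub[OF oW] using W' W'W by (auto intro!: opensI simp: openin_L)
  have db: "d b ?P (snd \<phi> W' F) = snd \<phi> W' (coord_deriv b F)" if b: "b \<in> coords n" for b
  proof -
   have "d b (preim (open_sub X U') \<phi> W') (snd \<phi> W' F) = snd \<phi> W' (coord_field L W b W' F)"
    using rel[OF b, unfolded related_def, rule_format, OF W'o(1)] F by (simp add: L)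
   then show ?thesis unfolding preim_open_sub[OF oU'] P using W'o(2) F by (simp add: coord_field_def L)
  qed
  interpret ring "sec ?P" by (rule ring_sections[OF m(1)])
  have "s a ?P (snd \<phi> W' F) = vrst V1 (s a) ?P (snd \<phi> W' F)" by (simp add: vrestr_eval[OF PV1])
  also have "... = (\<Oplus>\<^bsub>sec ?P\<^esub>b\<in>coords n. rstr V1 ?P (scl V1 (h a b)) *[?P] d b ?P (snd \<phi> W' F))"
   unfolding sd[OF a] by (rule lin_comb_eval[OF fd V1U' co PV1 Fc])
  also have "... = (\<Oplus>\<^bsub>sec ?P\<^esub>b\<in>coords n. scl ?P (h a b) *[?P] snd \<phi> W' (coord_deriv b F))"
   by (intro finsum_cong' refl)
    (use db restr_props(3)[OF oV1 opensD[OF PV1]] m(2)[OF sfuns_coord_deriv[OF W'(1) F]] scalar_closed[OF m(1)] in auto)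
  also have "... = snd \<phi> W' (%p al I. \<Sum>b\<in>coords n. h a b * coord_deriv b F p al I)"
   by (rule mor_sum[OF iso_mor[OF r(1)] W' finite_coords, symmetric]) (rule sfuns_coord_deriv[OF W'(1) F])
  also have "(%p al I. \<Sum>b\<in>coords n. h a b * coord_deriv b F p al I) = (%q. lder n (h a) (F q))"
   by (simp add: lder_def[abs_def] coord_deriv_sder)
  finally show ?thesis .
 qed
 have "adapted s V1 (fst \<phi> ` V1) \<phi> h g"
  unfolding adapted_def by (intro conjI ballI allI impI r(1) ph pg) (auto simp: hg gh der)
 then show ?thesis by (rule that[OF opens_trans[OF V1(1) V0(1)] V1(2)])
qed

lemma word_adapted:
 assumes a: "adapted s V W \<phi> h g" and W': "opL W'" "W' <= W"
 shows "F \<in> sfuns C n W' ==> set w <= coords n ==>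
  word s (pre V \<phi> W') w (snd \<phi> W' F) = snd \<phi> W' (%q. fold (%a. lder n (h a)) w (F q)) \<and>
  (%q. fold (%a. lder n (h a)) w (F q)) \<in> sfuns C n W'"
proof (induction w arbitrary: F)
 case (Cons b w)
 have b: "b \<in> coords n" and w: "set w <= coords n" using Cons.prems(2) by auto
 show ?case
  using Cons.IH[OF sfuns_lder[OF W'(1) Cons.prems(1), of "h b"] w]
  by (simp add: adaptedD(6)[OF a W' b Cons.prems(1)])
qed simp

text \<open>In the chart, words in \<open>s\<close> are words in the operators
  \<open>lder n (h a)\<close>, and \<open>ssub n h\<close> converts these into words in
  \<open>sder\<close> without changing the value at the base point.\<close>

lemma tay_adapted:
 assumes a: "adapted s V W \<phi> h g" and W': "opL W'" "W' <= W" and F: "F \<in> sfuns C n W'"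
  and q: "q \<in> V" "fst \<phi> q \<in> W'"
 shows "tay s q (pre V \<phi> W') (snd \<phi> W' F) (ssub n h (F (fst \<phi> q)))"
 unfolding tay_def
proof (intro conjI allI impI ssub_support)
 fix w :: "('m + nat) list" assume w: "set w <= coords n"
 note wa = word_adapted[OF a W' F w]
 have "val q (pre V \<phi> W') (word s (pre V \<phi> W') w (snd \<phi> W' F)) = fold (%a. lder n (h a)) w (F (fst \<phi> q)) (%_. 0) {}"
  unfolding conjunct1[OF wa] by (rule val_mor[OF iso_mor[OF adaptedD(1)[OF a]] W' q conjunct2[OF wa]])
 also have "... = ssub n h (fold (%a. lder n (h a)) w (F (fst \<phi> q))) (%_. 0) {}" by simp
 also have "... = fold sder w (ssub n h (F (fst \<phi> q))) (%_. 0) {}"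
  unfolding fold_sder_ssub[OF adaptedD(2)[OF a] sfuns_support[OF F] w] ..
 finally show "val q (pre V \<phi> W') (word s (pre V \<phi> W') w (snd \<phi> W' F)) = fold sder w (ssub n h (F (fst \<phi> q))) (%_. 0) {}" .
qed

text \<open>In an adapted chart the two sections come from functions \<open>F\<close> and
  \<open>F'\<close> with \<open>ssub n h (F x) = ssub n h (F' x)\<close> at each point
  \<open>x\<close>, and \<open>ssub n g\<close> undoes the substitution.\<close>

lemma tay_section_eqI:
 assumes s: "flat_frame n X T U s" and V: "V \<in> ops U"
  and G: "G \<in> fns V" "G' \<in> fns V"
  and eq: "!!p. p \<in> V ==> \<exists>H. tay s p V G H \<and> tay s p V G' H"
 shows "G = G'"
proof (rule section_eqI[OF opensD(1)[OF V] G])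
 fix p assume p: "p \<in> V"
 obtain V1 W \<phi> h g where V1: "V1 \<in> ops V" "p \<in> V1" and a: "adapted s V1 W \<phi> h g"
  by (rule frame_near[OF s V p]) (rule that)
 note fs = flat_frame_family[OF s]
 note i = adaptedD(1)[OF a]
 have b: "bij_betw (fst \<phi>) V1 W" by (rule iso_props(1)[OF i])
 have W: "opL W" using i by (simp add: iso_def)
 have pW: "pre V1 \<phi> W = V1" using b by (auto simp: bij_betw_def)
 have sb: "bij_betw (snd \<phi> W) (sfuns C n W) (fns V1)" using iso_props(3)[OF i W order_refl] unfolding pW .
 have surj: "\<exists>F. F \<in> sfuns C n W \<and> rstr V V1 G = snd \<phi> W F" if "G \<in> fns V" for G
  using restr_closed[OF opensD(1)[OF V] opensD[OF V1(1)] that] sb by (auto simp: bij_betw_def image_iff)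
 obtain F where F: "F \<in> sfuns C n W" "rstr V V1 G = snd \<phi> W F" using surj[OF G(1)] by blast
 obtain F' where F': "F' \<in> sfuns C n W" "rstr V V1 G' = snd \<phi> W F'" using surj[OF G(2)] by blast
 have "F = F'"
 proof
  fix x
  show "F x = F' x"
  proof (cases "x \<in> W")
   case True
   then obtain q where q: "q \<in> V1" "fst \<phi> q = x" using b by (auto simp: bij_betw_def)
   have qV: "q \<in> V" using q opensD(2)[OF V1(1)] by auto
   obtain H where H: "tay s q V G H" "tay s q V G' H" using eq[OF qV] by blast
   have "tay s q V1 (snd \<phi> W F) H" "tay s q V1 (snd \<phi> W F') H"
    using tay_restr[OF fs V V1(1) q(1)] G H unfolding F(2)[symmetric] F'(2)[symmetric] by blast+
   moreover have "tay s q V1 (snd \<phi> W F) (ssub n h (F x))" "tay s q V1 (snd \<phi> W F') (ssub n h (F' x))"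
    using tay_adapted[OF a W order_refl F(1) q(1)] tay_adapted[OF a W order_refl F'(1) q(1)] True q pW by simp_all
   ultimately have "ssub n h (F x) = ssub n h (F' x)"
    using tay_unique[of s q V1] by blast
   then have "ssub n g (ssub n h (F x)) = ssub n g (ssub n h (F' x))" by simp
   then show ?thesis
    using ssub_inverse[OF adaptedD(2,3)[OF a] sfuns_support[OF F(1)] adaptedD(5)[OF a]]
     ssub_inverse[OF adaptedD(2,3)[OF a] sfuns_support[OF F'(1)] adaptedD(5)[OF a]] by simp
  qed (simp add: sfuns_outside[OF F(1)] sfuns_outside[OF F'(1)])
 qed
 then show "\<exists>W. opn W \<and> W <= V \<and> p \<in> W \<and> rstr V W G = rstr V W G'"
  using V1 opensD[OF V1(1)] F F' by auto
qed

end

section \<open>The map to the fiber given by sections dual to a flat frame\<close>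

lemma sder_coord:
 fixes a c :: "'m::finite + nat" and q :: "'k::comm_ring_1^'m"
 shows "sder a (coord c q) = (%al I. if al = (%_. 0) \<and> I = {} then (if c = a then 1 else 0) else 0)"
proof (intro ext)
 fix al :: "'m => nat" and I
 show "sder a (coord c q) al I = (if al = (%_. 0) \<and> I = {} then (if c = a then 1 else 0) else 0)"
 proof (cases a)
  case a: (Inl i)
  have n0: "al(i := Suc (al i)) ~= (%_. 0)" by (metis fun_upd_same nat.distinct(1))
  show ?thesis
  proof (cases c)
   case (Inl j)
   have upd: "al(i := Suc (al i)) = (%_. 0)(j := 1) \<longleftrightarrow> i = j \<and> al = (%_. 0)"
   proof
    assume e: "al(i := Suc (al i)) = (%_. 0)(j := 1)"
    have ij: "i = j" using fun_cong[OF e, of i] by (auto split: if_splits)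
    have "al k = 0" for k using fun_cong[OF e, of k] ij by (cases "k = i") auto
    then show "i = j \<and> al = (%_. 0)" using ij by auto
   qed auto
   have "coord c q (al(i := Suc (al i))) I = (if I = {} \<and> i = j \<and> al = (%_. 0) then 1 else 0)"
    unfolding Inl coord.simps upd if_not_P[OF n0] by simp
   then have "sder a (coord c q) al I = of_nat (Suc (al i)) * (if I = {} \<and> i = j \<and> al = (%_. 0) then 1 else 0)"
    unfolding a sder.simps by (rule arg_cong)
   then show ?thesis by (cases "al = (%_. 0)"; cases "i = j") (simp_all add: a Inl)
  qed (use n0 in \<open>simp add: a del: fun_upd_apply\<close>)
 next
  case a: (Inr k)
  have "insert k I = {j} \<longleftrightarrow> I = {} \<and> k = j" if "k \<notin> I" for j using that by auto
  then show ?thesis by (cases c) (auto simp: a inversion_sign_def)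
 qed
qed

lemma coord_support: "c \<in> coords n ==> odd_support n (coord c q)"
 by (cases c) (auto simp: odd_support_def)

lemma preim_eq_openin:
 assumes "!!p. p \<in> S ==> \<exists>T. openin X T \<and> p \<in> T \<and> T <= S"
 shows "openin X S"
 using assms by (subst openin_subopen) blast

text \<open>What the construction of the map to the fiber takes from the potential and its identity:
  sections \<open>y\<close> of the right parities that are dual to the frame.\<close>

locale flat_frame_map = flat_supermanifold X C n L T nabla
 for X :: "('p, 's, 'k::{real_normed_field,banach}) superspace" and C n
  and L :: "('k^'m::finite, ('k, 'm) sfun, 'k) superspace" and T nabla +
 fixes U and s :: "'m + nat => ('p, 's) vfield" and y :: "'m + nat => 's"
 assumes s: "flat_frame n X T U s"
  and y_part: "!!c. c \<in> coords n ==> y c \<in> part X U (odd_index c)"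
  and y_der: "!!a c. a \<in> coords n ==> c \<in> coords n ==> s a U (y c) = scl U (if c = a then 1 else 0)"
begin

lemma frame_open: "opn U"
 using s by (simp add: flat_frame_def opens_whole)

lemma y_closed: "c \<in> coords n ==> y c \<in> fns U"
 by (rule part_carrier[OF frame_open y_part])

text \<open>Odd sections vanish at points, so the map of points is given by the even
  \<open>y\<close> alone.\<close>

definition body_map :: "'p => 'k^'m" where
 "body_map q = (\<chi> i. val q U (y (Inl i)))"

text \<open>In an adapted chart the even \<open>y\<close> have constant first derivatives, the
  entries of \<open>g\<close>, because \<open>g\<close> inverts the matrix that expresses
  \<open>s\<close> in chart derivatives. A function with constant first derivatives on a ball is
  affine.\<close>

lemma chart_near:
 assumes V: "V \<in> ops U" and p: "p \<in> V"
 obtains V1 W \<phi> h g q0 y0 where "V1 \<in> ops V" "p \<in> V1" "adapted s V1 W \<phi> h g"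
  and "!!q. q \<in> V1 ==> body_map q = aff g q0 y0 (fst \<phi> q)"
proof -
 obtain V2 W2 \<phi> h g where V2: "V2 \<in> ops V" "p \<in> V2" and a: "adapted s V2 W2 \<phi> h g"
  by (rule frame_near[OF s V p]) (rule that)
 note fs = flat_frame_family[OF s]
 note i = adaptedD(1)[OF a]
 have V2U: "V2 \<in> ops U" by (rule opens_trans[OF V2(1) V])
 have b: "bij_betw (fst \<phi>) V2 W2" by (rule iso_props(1)[OF i])
 have W2: "opL W2" using i by (simp add: iso_def)
 have pW: "pre V2 \<phi> W2 = V2" using b by (auto simp: bij_betw_def)
 have sb: "bij_betw (snd \<phi> W2) (sfuns C n W2) (fns V2)" using iso_props(3)[OF i W2 order_refl] unfolding pW .
 have "\<exists>F. F \<in> sfuns C n W2 \<and> rstr U V2 (y (Inl i)) = snd \<phi> W2 F" for i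
  using restr_closed[OF frame_open opensD[OF V2U] y_closed[OF Inl_coords]] sb by (auto simp: bij_betw_def image_iff)
 then obtain F where F: "!!i. F i \<in> sfuns C n W2" "!!i. rstr U V2 (y (Inl i)) = snd \<phi> W2 (F i)" by metis
 have lF: "lder n (h a) (F i x) (%_. 0) {} = (if Inl i = a then 1 else 0)" if ac: "a \<in> coords n" and x: "x \<in> W2" for a i x
 proof -
  have "snd \<phi> W2 (%q. lder n (h a) (F i q)) = s a V2 (rstr U V2 (y (Inl i)))"
   using adaptedD(6)[OF a W2 order_refl ac F(1)[of i]] unfolding pW F(2) by simp
  also have "... = rstr U V2 (s a U (y (Inl i)))"
   by (rule derivationD(6)[OF family_der[OF fs ac] opens_refl[OF frame_open] V2U y_closed[OF Inl_coords]])
  also have "... = scl V2 (if Inl i = a then 1 else 0)"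
   unfolding y_der[OF ac Inl_coords] by (rule restr_props(3)[OF frame_open opensD[OF V2U]])
  also have "... = snd \<phi> W2 (sfun_scalar W2 (if Inl i = a then 1 else 0))"
   using mor_props(5)[OF iso_mor[OF i] W2 order_refl] unfolding pW by simp
  finally have "(%q. lder n (h a) (F i q)) = sfun_scalar W2 (if Inl i = a then 1 else 0)"
   using sb sfuns_lder[OF W2 F(1)] sfun_scalar_in[OF W2] unfolding bij_betw_def by (blast dest: inj_onD)
  from fun_cong[OF this, of x] show ?thesis using x by (simp add: sfun_scalar_def)
 qed
 have dF: "sder b (F i x) (%_. 0) {} = g b (Inl i)" if bc: "b \<in> coords n" and x: "x \<in> W2" for b i x
 proof -
  have "sder b (F i x) = (%al I. \<Sum>a\<in>coords n. g b a * lder n (h a) (F i x) al I)"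
   unfolding lder_delta[OF bc, of "F i x", symmetric]
   by (rule lder_lder[symmetric]) (rule adaptedD(5)[OF a bc])
  then have "sder b (F i x) (%_. 0) {} = (\<Sum>a\<in>coords n. g b a * (if Inl i = a then 1 else 0))"
   using lF[OF _ x] by simp
  also have "... = g b (Inl i)" by (simp add: if_distrib[of "%x. _ * x"] sum.delta' cong: if_cong)
  finally show ?thesis .
 qed
 have vF: "body_map q $ i = F i (fst \<phi> q) (%_. 0) {}" if q: "q \<in> V2" for q i
 proof -
  have qW: "fst \<phi> q \<in> W2" using q pW by blast
  have "val q U (y (Inl i)) = val q V2 (rstr U V2 (y (Inl i)))"
   by (rule val_hom(4)[OF frame_open _ opensD[OF V2U] q y_closed[OF Inl_coords], symmetric]) (use q opensD(2)[OF V2U] in auto)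
  then show ?thesis using val_mor[OF iso_mor[OF i] W2 order_refl q qW F(1)[of i]]
   unfolding F(2) pW body_map_def by simp
 qed
 define q0 where "q0 = fst \<phi> p"
 have q0: "q0 \<in> W2" using V2(2) pW unfolding q0_def by blast
 obtain W1 where W1: "opL W1" "W1 <= W2" "q0 \<in> W1"
  and lin: "!!x i. x \<in> W1 ==> F i x (%_. 0) {} = F i q0 (%_. 0) {} + (\<Sum>b\<in>UNIV. (x $ b - q0 $ b) * g (Inl b) (Inl i))"
 proof (cases "C = Formal")
  case True
  \<comment> \<open>Single points are open in the formal category, and at \<open>q0\<close> the
    affine formula is trivial.\<close>
  show ?thesis by (rule that[of "{q0}"]) (use True q0 in auto)
 next
  case False
  then have "open W2" using W2 by simp
  then obtain r where r: "r > 0" "ball q0 r <= W2" using q0 open_contains_ball by blast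
  have "F i x (%_. 0) {} = F i q0 (%_. 0) {} + (\<Sum>b\<in>UNIV. (x $ b - q0 $ b) * g (Inl b) (Inl i))"
   if x: "x \<in> ball q0 r" for x i
  proof (rule taylor_smooth_affine[where f = "%p al. F i p al {}", OF _ _ x])
   have "regular C (ball q0 r) (%p al. F i p al {})" by (rule regular_mono[OF sfuns_regular[OF F(1)] r(2)])
   then show "taylor_smooth (ball q0 r) (%p al. F i p al {})" using False by (cases C) auto
   show "dser b (%al. F i q al {}) (%_. 0) = g (Inl b) (Inl i)" if "q \<in> ball q0 r" for q b
    using dF[OF Inl_coords, of q b i] that r(2) by (auto simp: dser_def simp del: fun_upd_apply)
  qed
  then show ?thesis by (rule that[of "ball q0 r", rotated 3]) (use r in auto)
 qed
 let ?V1 = "pre V2 \<phi> W1"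
 have V1: "?V1 \<in> ops V2" using mor_props(1)[OF iso_mor[OF i] W1(1,2)] by (auto intro: opensI)
 show ?thesis
 proof (rule that)
  show "?V1 \<in> ops V" by (rule opens_trans[OF V1 V2(1)])
  show "p \<in> ?V1" using V2(2) W1(3) by (simp add: q0_def)
  show "adapted s ?V1 (fst \<phi> ` ?V1) \<phi> h g" by (rule adapted_restrict(1)[OF a V1])
  show "body_map q = aff g q0 (\<chi> i. F i q0 (%_. 0) {}) (fst \<phi> q)" if "q \<in> ?V1" for q
   using that by (simp add: vec_eq_iff vF lin aff_def)
 qed
qed

text \<open>\<open>G\<close> is the pullback of \<open>F\<close> along the map with components
  \<open>y\<close>. As these are dual to the frame, the frame plays the role of the coordinate
  fields, and the series of the pullback at \<open>p\<close> must be that of \<open>F\<close> at the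
  image of \<open>p\<close>.\<close>

definition compatible :: "'p set => 's => ('k, 'm) sfun => bool" where
 "compatible V G F \<longleftrightarrow> G \<in> fns V \<and> (\<forall>p\<in>V. tay s p V G (F (body_map p)))"

lemma compatible_unique:
 assumes "V \<in> ops U" "compatible V G F" "compatible V G' F"
 shows "G = G'"
 using assms unfolding compatible_def by (intro tay_section_eqI[OF s assms(1)]) auto

lemma compatible_restr:
 assumes V: "V \<in> ops U" and c: "compatible V G F" and V': "V' \<in> ops V"
  and F: "!!p. p \<in> V' ==> F' (body_map p) = F (body_map p)"
 shows "compatible V' (rstr V V' G) F'"
 unfolding compatible_def
proof (intro conjI ballI)
 have G: "G \<in> fns V" using c by (simp add: compatible_def)
 show "rstr V V' G \<in> fns V'" by (rule restr_closed[OF opensD(1)[OF V] opensD[OF V'] G])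
 fix p assume p: "p \<in> V'"
 then have "tay s p V G (F (body_map p))" using c opensD(2)[OF V'] by (auto simp: compatible_def)
 then show "tay s p V' (rstr V V' G) (F' (body_map p))"
  unfolding tay_restr[OF flat_frame_family[OF s] V V' p G] F[OF p] .
qed

abbreviation "over W \<equiv> {p \<in> U. body_map p \<in> W}"

text \<open>In an adapted chart the required section is the pullback of \<open>F\<close> under an affine map.\<close>

lemma compatible_local:
 assumes W: "opL W" and F: "F \<in> sfuns C n W" and V: "V \<in> ops U" and p: "p \<in> V" "body_map p \<in> W"
 obtains V' G where "V' \<in> ops V" "p \<in> V'" "V' <= over W" "compatible V' G F"
proof -
 obtain V1 W1 \<phi> h g q0 y0 where V1: "V1 \<in> ops V" "p \<in> V1" and a: "adapted s V1 W1 \<phi> h g"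
  and Y: "!!q. q \<in> V1 ==> body_map q = aff g q0 y0 (fst \<phi> q)"
  by (rule chart_near[OF V p(1)]) (rule that)
 note i = adaptedD(1)[OF a]
 have W1: "opL W1" using i by (simp add: iso_def)
 have b: "bij_betw (fst \<phi>) V1 W1" by (rule iso_props(1)[OF i])
 let ?\<psi> = "aff g q0 y0"
 define F' where "F' = (%q. ssub n g (F (?\<psi> q)))"
 have F': "F' \<in> sfuns C n (?\<psi> -` W)" unfolding F'_def by (rule sfuns_ssub[OF W F aff_add])
 define W2 where "W2 = W1 \<inter> ?\<psi> -` W"
 have W2: "opL W2" "W2 <= W1" using W W1 continuous_aff[of UNIV g q0 y0] by (auto simp: W2_def intro!: open_Int open_vimage)
 define F2 where "F2 = (%q. if q \<in> W2 then F' q else (%al I. 0))"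
 have F2: "F2 \<in> sfuns C n W2" unfolding F2_def by (rule sfuns_restr[OF F']) (use W2 in \<open>auto simp: W2_def\<close>)
 let ?V = "pre V1 \<phi> W2"
 have o: "opn ?V" by (rule mor_props(1)[OF iso_mor[OF i] W2])
 have V1W: "fst \<phi> q \<in> W1" if "q \<in> V1" for q using b that by (auto simp: bij_betw_def)
 have VU: "V1 <= U" using opensD(2)[OF V1(1)] opensD(2)[OF V] by auto
 show ?thesis
 proof (rule that)
  show "?V \<in> ops V" using o opensD(2)[OF V1(1)] by (auto intro!: opensI)
  show "p \<in> ?V" using V1(2) V1W[OF V1(2)] Y[OF V1(2)] p(2) by (simp add: W2_def)
  show "?V <= over W" using VU Y by (auto simp: W2_def)
  show "compatible ?V (snd \<phi> W2 F2) F"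
   unfolding compatible_def
  proof (intro conjI ballI)
   show "snd \<phi> W2 F2 \<in> fns ?V" by (rule mor_props(2)[OF iso_mor[OF i] W2 F2])
   fix q assume q: "q \<in> ?V"
   then have q': "q \<in> V1" "fst \<phi> q \<in> W2" by auto
   have "ssub n h (F2 (fst \<phi> q)) = ssub n h (ssub n g (F (body_map q)))"
    using q' by (simp add: F2_def F'_def Y)
   also have "... = F (body_map q)"
    by (rule ssub_inverse[OF adaptedD(3,2)[OF a] sfuns_support[OF F] adaptedD(4)[OF a]])
   finally show "tay s q ?V (snd \<phi> W2 F2) (F (body_map q))" using tay_adapted[OF a W2 F2 q'] by simp
  qed
 qed
qed

text \<open>Continuity of the map of points is read off from \<open>compatible_local\<close> for the
  zero function: the neighbourhood it supplies lies over \<open>W\<close>.\<close>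

lemma over_open:
 assumes W: "opL W"
 shows "over W \<in> ops U"
proof (rule opensI)
 show "opn (over W)"
 proof (rule preim_eq_openin)
  fix p assume "p \<in> over W"
  then have p: "p \<in> U" "body_map p \<in> W" by auto
  obtain V' G where "V' \<in> ops U" "p \<in> V'" "V' <= over W" "compatible V' G (sfun_scalar W 0)"
   by (rule compatible_local[OF W sfun_scalar_in[OF W] opens_refl[OF frame_open] p]) (rule that)
  then show "\<exists>T. opn T \<and> p \<in> T \<and> T <= over W" using opensD(1) by blast
 qed
qed auto

lemma compatible_exists:
 assumes W: "opL W" and F: "F \<in> sfuns C n W"
 shows "\<exists>G. compatible (over W) G F"
proof -
 note VW = over_open[OF W] and oVW = opensD(1)[OF over_open[OF W]]
 define \<U> where "\<U> = {V \<in> ops (over W). \<exists>G. compatible V G F}"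
 define \<sigma> where "\<sigma> V = (SOME G. compatible V G F)" for V
 have \<sigma>: "compatible V (\<sigma> V) F" if "V \<in> \<U>" for V
  using that unfolding \<U>_def \<sigma>_def by (auto intro: someI)
 have \<U>: "V \<in> ops (over W)" "V \<in> ops U" if "V \<in> \<U>" for V
  using that opens_trans[OF _ VW] by (auto simp: \<U>_def)
 have un: "\<Union>\<U> = over W"
 proof
  show "\<Union>\<U> <= over W" using \<U>(1) opensD(2) by blast
  show "over W <= \<Union>\<U>"
  proof
   fix p assume p: "p \<in> over W"
   then have pW: "body_map p \<in> W" by simp
   obtain V' G where "V' \<in> ops (over W)" "p \<in> V'" "V' <= over W" "compatible V' G F"
    by (rule compatible_local[OF W F VW p pW]) (rule that)
   then show "p \<in> \<Union>\<U>" by (auto simp: \<U>_def)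
  qed
 qed
 have gl: "\<exists>!f. f \<in> fns (\<Union>\<U>) \<and> (\<forall>V\<in>\<U>. rstr (\<Union>\<U>) V f = \<sigma> V)"
 proof (rule glue1)
  fix V assume V: "V \<in> \<U>"
  show "opn V" by (rule opensD(1)[OF \<U>(1)[OF V]])
  show "\<sigma> V \<in> fns V" using \<sigma>[OF V] by (simp add: compatible_def)
  fix V' assume V': "V' \<in> \<U>"
  have o: "opn (V \<inter> V')" using opensD(1)[OF \<U>(1)[OF V]] opensD(1)[OF \<U>(1)[OF V']] by blast
  have i: "V \<inter> V' \<in> ops V" "V \<inter> V' \<in> ops V'" using o by (auto intro: opensI)
  show "rstr V (V \<inter> V') (\<sigma> V) = rstr V' (V \<inter> V') (\<sigma> V')"
   by (rule compatible_unique[OF opens_trans[OF i(1) \<U>(2)[OF V]]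
     compatible_restr[OF \<U>(2)[OF V] \<sigma>[OF V] i(1) refl] compatible_restr[OF \<U>(2)[OF V'] \<sigma>[OF V'] i(2) refl]])
 qed
 obtain G where G0: "G \<in> fns (over W) \<and> (\<forall>V\<in>\<U>. rstr (over W) V G = \<sigma> V)"
  by (rule exE[OF ex1_implies_ex[OF gl[unfolded un]]]) (rule that)
 note G = conjunct1[OF G0] bspec[OF conjunct2[OF G0]]
 have "tay s p (over W) G (F (body_map p))" if p: "p \<in> over W" for p
 proof -
  obtain V where V: "V \<in> \<U>" "p \<in> V" using p un by blast
  have "tay s p V (\<sigma> V) (F (body_map p))" using \<sigma>[OF V(1)] V(2) by (simp add: compatible_def)
  then show ?thesis
   using tay_restr[OF flat_frame_family[OF s] VW \<U>(1)[OF V(1)] V(2) G(1)] G(2)[OF V(1)] by simp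
 qed
 then show ?thesis using G(1) unfolding compatible_def by blast
qed

definition fiber_map :: "('p, 's, 'k^'m, ('k, 'm) sfun) smorph" where
 "fiber_map = (body_map, %W F. THE G. compatible (over W) G F)"

lemma fst_fiber_map [simp]: "fst fiber_map = body_map"
 by (simp add: fiber_map_def)

text \<open>Compatible sections are unique, so properties of the pullback can be proved by
  exhibiting a section with the right series.\<close>

lemma fiber_map_eqI:
 assumes "opL W" "compatible (over W) G F"
 shows "snd fiber_map W F = G"
 unfolding fiber_map_def snd_conv
 by (rule the_equality[where P = "%G. compatible (over W) G F", OF assms(2)])
  (rule compatible_unique[OF over_open[OF assms(1)] _ assms(2)])

lemma fiber_map_compatible:
 assumes W: "opL W" and F: "F \<in> sfuns C n W"
 shows "compatible (over W) (snd fiber_map W F) F"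
proof -
 obtain G where G: "compatible (over W) G F" using compatible_exists[OF W F] by (rule exE)
 show ?thesis unfolding fiber_map_eqI[OF W G] by (rule G)
qed

text \<open>The empty word gives the value, which is zero for odd \<open>c\<close>; a longer word
  begins by turning both \<open>y c\<close> and the coordinate into the same constant.\<close>

lemma fiber_map_coord:
 assumes c: "c \<in> coords n"
 shows "snd fiber_map UNIV (coord c) = y c"
proof (rule fiber_map_eqI)
 note oU = opens_refl[OF frame_open] and fs = flat_frame_family[OF s]
 have "tay s p U (y c) (coord c (body_map p))" if p: "p \<in> U" for p
  unfolding tay_def
 proof (intro conjI allI impI coord_support[OF c])
  fix w :: "('m + nat) list" assume w: "set w <= coords n"
  show "val p U (word s U w (y c)) = fold sder w (coord c (body_map p)) (%_. 0) {}"
  proof (cases w)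
   case Nil
   show ?thesis
   proof (cases c)
    case (Inr j)
    then show ?thesis using val_odd[OF frame_open p] y_part[OF c] Nil by simp
   qed (simp add: Nil body_map_def)
  next
   case (Cons a w')
   then have a: "a \<in> coords n" and w': "set w' <= coords n" using w by auto
   show ?thesis
    using tay_scalar[OF fs oU p, of "if c = a then 1 else 0"] w'
    by (simp add: Cons y_der[OF a c] sder_coord tay_def)
  qed
 qed
 then show "compatible (over UNIV) (y c) (coord c)" using y_closed[OF c] by (simp add: compatible_def)
qed simp

end

section \<open>The map to the fiber as a morphism and a local isomorphism\<close>

definition epart :: "bool => ('k::zero, 'm) sfun => ('k, 'm) sfun" where
 "epart e F = (%p al I. if odd (card I) = e then F p al I else 0)"

lemma epart_in:
 assumes "F \<in> sfuns C n V"
 shows "epart e F \<in> sfuns C n V"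
proof (rule sfunsI)
 show "epart e F p = (%al I. 0)" if "p \<notin> V" for p
  using sfuns_outside[OF assms that] by (simp add: epart_def fun_eq_iff)
 show "odd_support n (epart e F p)" for p
  using sfuns_support[OF assms, of p] by (simp add: odd_support_def epart_def)
 fix I :: "nat set"
 show "regular C V (%p al. epart e F p al I)"
  using sfuns_regular[OF assms, of I] regular_zero by (cases "odd (card I) = e") (simp_all add: epart_def)
qed

lemma epart_homogeneous: "homogeneous e (epart e F p)"
 by (auto simp: homogeneous_def epart_def)

lemma epart_sum: "(%p al I. epart False F p al I + epart True F p al I) = (F :: ('k::comm_ring_1, 'm) sfun)"
 by (auto simp: epart_def fun_eq_iff)

context flat_supermanifold
begin

lemma fold_sder_homogeneous:
 fixes w :: "('m + nat) list" and H :: "('m => nat) => nat set => 'k"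
 shows "homogeneous c H ==> odd_support n H ==> homogeneous (c ~= word_parity w) (fold sder w H)"
proof (induction w arbitrary: c H)
 case (Cons a w)
 have "homogeneous ((c ~= odd_index a) ~= word_parity w) (fold sder w (sder a H))"
  by (rule Cons.IH[OF sder_homogeneous[OF Cons.prems] sder_support[OF Cons.prems(2)]])
 moreover have "((c ~= odd_index a) ~= word_parity w) = (c ~= word_parity (a # w))" by (auto simp: word_parity_def)
 ultimately show ?case by simp
qed (simp add: word_parity_def)

end

context flat_frame_map
begin

lemma fiber_map_props:
 assumes W: "opL W" and F: "F \<in> sfuns C n W"
 shows "snd fiber_map W F \<in> fns (over W)"
  and "p \<in> over W ==> tay s p (over W) (snd fiber_map W F) (F (body_map p))"
 using fiber_map_compatible[OF W F] unfolding compatible_def by blast+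

text \<open>A homogeneous component of the wrong parity has no Taylor coefficients, because odd sections
 vanish at every point.\<close>

lemma fiber_map_part:
 assumes W: "opL W" and F: "F \<in> sfuns C n W" and h: "!!p. homogeneous e (F p)"
 shows "snd fiber_map W F \<in> part X (over W) e"
proof -
 note VU = over_open[OF W] and fs = flat_frame_family[OF s]
 note oV = opensD(1)[OF VU]
 let ?V = "over W" and ?G = "snd fiber_map W F"
 note G = fiber_map_props(1)[OF W F]
 interpret ring "sec ?V" by (rule ring_sections[OF oV])
 obtain G0 G1 where G01: "G0 \<in> part X ?V False" "G1 \<in> part X ?V True" "?G = G0 +[?V] G1"
  by (rule part_decomp[OF oV G]) (rule that)
 define K where "K b = (if b then G1 else G0)" for b
 have K: "K b \<in> part X ?V b" for b using G01 by (simp add: K_def)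
 note Kc = part_carrier[OF oV K]
 have GK: "?G = K e +[?V] K (\<not> e)"
  using G01 Kc[of True] Kc[of False] by (cases e) (auto simp: K_def a_comm)
 have "compatible ?V (K e) F"
  unfolding compatible_def
 proof (intro conjI ballI Kc)
  fix p assume p: "p \<in> ?V"
  note tG = fiber_map_props(2)[OF W F p]
  show "tay s p ?V (K e) (F (body_map p))"
   unfolding tay_def
  proof (intro conjI allI impI sfuns_support[OF F])
   fix w :: "('m + nat) list" assume w: "set w <= coords n"
   have vG: "val p ?V (word s ?V w ?G) = fold sder w (F (body_map p)) (%_. 0) {}"
    using tG w by (simp add: tay_def)
   have sum: "val p ?V (word s ?V w ?G) = val p ?V (word s ?V w (K e)) + val p ?V (word s ?V w (K (\<not> e)))"
    unfolding GK word_add[OF fs VU w Kc Kc]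
    by (rule val_hom(1)[OF oV p word_closed[OF fs VU w Kc] word_closed[OF fs VU w Kc]])
   have z: "val p ?V (word s ?V w (K b)) = 0" if "b ~= word_parity w" for b
    using word_part[OF fs VU w K[of b]] that val_odd[OF oV p] by simp
   show "val p ?V (word s ?V w (K e)) = fold sder w (F (body_map p)) (%_. 0) {}"
   proof (cases "e = word_parity w")
    case True
    then show ?thesis using vG sum z[of "\<not> e"] by simp
   next
    case False
    then have "homogeneous True (fold sder w (F (body_map p)))"
     using fold_sder_homogeneous[where w = w, OF h sfuns_support[OF F], of "body_map p"] by simp
    then have "fold sder w (F (body_map p)) (%_. 0) {} = 0" unfolding homogeneous_def by fastforce
    then show ?thesis using z[of e] False by simp
   qed
  qed
 qed
 then have "?G = K e" by (rule fiber_map_eqI[OF W])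
 then show ?thesis using K by simp
qed

lemma fiber_map_scalar:
 assumes W: "opL W"
 shows "snd fiber_map W (sfun_scalar W x) = scl (over W) x"
proof (rule fiber_map_eqI[OF W])
 note VU = over_open[OF W] and fs = flat_frame_family[OF s]
 have "sfun_scalar W x (body_map p) = (%al I. if al = (%_. 0) \<and> I = {} then x else 0)" if "p \<in> over W" for p
  using that by (intro ext) (simp add: sfun_scalar_def)
 then show "compatible (over W) (scl (over W) x) (sfun_scalar W x)"
  unfolding compatible_def
  using tay_scalar[OF fs VU] scalar_closed[OF opensD(1)[OF VU]] by simp
qed

lemma fiber_map_add:
 assumes W: "opL W" and F: "F \<in> sfuns C n W" "F' \<in> sfuns C n W"
 shows "snd fiber_map W (%p al I. F p al I + F' p al I) = snd fiber_map W F +[over W] snd fiber_map W F'"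
proof (rule fiber_map_eqI[OF W])
 note VU = over_open[OF W] and fs = flat_frame_family[OF s]
 interpret ring "sec (over W)" by (rule ring_sections[OF opensD(1)[OF VU]])
 show "compatible (over W) (snd fiber_map W F +[over W] snd fiber_map W F') (%p al I. F p al I + F' p al I)"
  unfolding compatible_def
 proof (intro conjI ballI)
  show "snd fiber_map W F +[over W] snd fiber_map W F' \<in> fns (over W)"
   by (intro a_closed fiber_map_props(1)[OF W] F)
  fix p assume p: "p \<in> over W"
  show "tay s p (over W) (snd fiber_map W F +[over W] snd fiber_map W F')
    (%al I. F (body_map p) al I + F' (body_map p) al I)"
   by (rule tay_add[OF fs VU p fiber_map_props(1)[OF W F(1)] fiber_map_props(1)[OF W F(2)]
     fiber_map_props(2)[OF W F(1) p] fiber_map_props(2)[OF W F(2) p]])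
 qed
qed

lemma fiber_map_mult_homogeneous:
 assumes W: "opL W" and F: "F \<in> sfuns C n W" "F' \<in> sfuns C n W" and h: "!!p. homogeneous e (F p)"
 shows "snd fiber_map W (sfun_mult F F') = snd fiber_map W F *[over W] snd fiber_map W F'"
proof (rule fiber_map_eqI[OF W])
 note VU = over_open[OF W] and fs = flat_frame_family[OF s]
 interpret ring "sec (over W)" by (rule ring_sections[OF opensD(1)[OF VU]])
 show "compatible (over W) (snd fiber_map W F *[over W] snd fiber_map W F') (sfun_mult F F')"
  unfolding compatible_def
 proof (intro conjI ballI)
  show "snd fiber_map W F *[over W] snd fiber_map W F' \<in> fns (over W)"
   by (intro m_closed fiber_map_props(1)[OF W] F)
  fix p assume p: "p \<in> over W"
  show "tay s p (over W) (snd fiber_map W F *[over W] snd fiber_map W F') (sfun_mult F F' (body_map p))"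
   unfolding sfun_mult_smul
   by (rule tay_mult[OF fs VU p fiber_map_part[OF W F(1) h] h fiber_map_props(2)[OF W F(1) p]
     fiber_map_props(1)[OF W F(2)] fiber_map_props(2)[OF W F(2) p]])
 qed
qed

text \<open>The comparison of Leibniz rules requires a homogeneous left factor, so \<open>F\<close>
  is split into its even and odd parts.\<close>

lemma fiber_map_mult:
 assumes W: "opL W" and F: "F \<in> sfuns C n W" "F' \<in> sfuns C n W"
 shows "snd fiber_map W (sfun_mult F F') = snd fiber_map W F *[over W] snd fiber_map W F'"
proof -
 note VU = over_open[OF W]
 interpret ring "sec (over W)" by (rule ring_sections[OF opensD(1)[OF VU]])
 let ?F = "%e. epart e F" and ?S = "snd fiber_map W"
 note E = epart_in[OF F(1)] and c = fiber_map_props(1)[OF W]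
 have "sfun_mult F F' = (%p al I. sfun_mult (?F False) F' p al I + sfun_mult (?F True) F' p al I)"
 proof
  fix p
  have "F p = (%al I. ?F False p al I + ?F True p al I)" using fun_cong[OF epart_sum[of F], of p] by simp
  then show "sfun_mult F F' p = (%al I. sfun_mult (?F False) F' p al I + sfun_mult (?F True) F' p al I)"
   unfolding sfun_mult_smul smul_add_left[symmetric] by simp
 qed
 then have "?S (sfun_mult F F') = ?S (sfun_mult (?F False) F') +[over W] ?S (sfun_mult (?F True) F')"
  using fiber_map_add[OF W sfuns_mult[OF E F(2)] sfuns_mult[OF E F(2)]] by simp
 also have "... = (?S (?F False) +[over W] ?S (?F True)) *[over W] ?S F'"
  unfolding fiber_map_mult_homogeneous[OF W E F(2) epart_homogeneous]
  by (rule l_distr[OF c[OF E] c[OF E] c[OF F(2)], symmetric])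
 also have "?S (?F False) +[over W] ?S (?F True) = ?S F"
  using fiber_map_add[OF W E E, of False True] unfolding epart_sum by simp
 finally show ?thesis .
qed

lemma fiber_map_restr:
 assumes W: "opL W" and F: "F \<in> sfuns C n W" and W': "opL W'" "W' <= W"
 shows "snd fiber_map W' (%p. if p \<in> W' then F p else (%al I. 0)) = rstr (over W) (over W') (snd fiber_map W F)"
proof (rule fiber_map_eqI[OF W'(1)])
 have "over W' \<in> ops (over W)" using opensD(1)[OF over_open[OF W'(1)]] W'(2) by (auto intro!: opensI)
 from compatible_restr[OF over_open[OF W] fiber_map_compatible[OF W F] this]
 show "compatible (over W') (rstr (over W) (over W') (snd fiber_map W F)) (%p. if p \<in> W' then F p else (%al I. 0))"
  by simp
qed

lemma fiber_map_hom:
 assumes W: "opL W"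
 shows "snd fiber_map W \<in> ring_hom (sections L W) (sec (over W))"
proof (rule ring_hom_memI)
 show "snd fiber_map W F \<in> fns (over W)" if "F \<in> carrier (sections L W)" for F
  using that fiber_map_props(1)[OF W, of F] by (simp add: L)
 show "snd fiber_map W \<one>\<^bsub>sections L W\<^esub> = \<one>\<^bsub>sec (over W)\<^esub>"
  using fiber_map_scalar[OF W, of 1] scalar_one[OF opensD(1)[OF over_open[OF W]]] by (simp add: L)
 fix F G assume "F \<in> carrier (sections L W)" "G \<in> carrier (sections L W)"
 then have FG: "F \<in> sfuns C n W" "G \<in> sfuns C n W" by (simp_all add: L)
 show "snd fiber_map W (F \<otimes>\<^bsub>sections L W\<^esub> G) = snd fiber_map W F *[over W] snd fiber_map W G"
  using fiber_map_mult[OF W FG] by (simp add: L)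
 show "snd fiber_map W (F \<oplus>\<^bsub>sections L W\<^esub> G) = snd fiber_map W F +[over W] snd fiber_map W G"
  using fiber_map_add[OF W FG] by (simp add: L)
qed

lemma fiber_map_parts:
 assumes W: "opL W" and F: "F \<in> part L W a"
 shows "snd fiber_map W F \<in> part X (over W) a"
 by (rule fiber_map_part[OF W]) (use F in \<open>auto simp: L homogeneous_def\<close>)

lemma whole_L: "whole L = UNIV"
 by (simp add: L)

lemma preim_fiber_map: "preim (open_sub X U) fiber_map W = over W"
 unfolding preim_open_sub[OF frame_open] fst_fiber_map ..

lemma fiber_map_morphism: "is_morphism (open_sub X U) L fiber_map"
proof -
 have op: "opens L (whole L) = {W. opL W}" by (simp add: opens_def whole_L openin_L)
 show ?thesis
  unfolding is_morphism_def preim_fiber_map op fst_fiber_map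
 proof (intro conjI ballI allI)
  show "continuous_map (points (open_sub X U)) (points L) body_map"
   unfolding continuous_map_def openin_L whole_open_sub[OF frame_open]
  proof (intro conjI allI impI)
   show "body_map \<in> U \<rightarrow> topspace (points L)" by (simp add: whole_L)
   fix W :: "('k^'m) set" assume "opL W"
   from over_open[OF this] show "openin (points (open_sub X U)) (over W)"
    using frame_open by (simp add: openin_open_subtopology opens_def)
  qed
 next
  fix W :: "('k^'m) set" assume "W \<in> {W. opL W}"
  then have W: "opL W" by simp
  show "snd fiber_map W \<in> ring_hom (sections L W) (sections (open_sub X U) (over W))"
   using fiber_map_hom[OF W] by simp
  show "snd fiber_map W ` part L W a <= part (open_sub X U) (over W) a" for a
   using fiber_map_parts[OF W] by auto
  show "snd fiber_map W (scalar L W x) = scalar (open_sub X U) (over W) x" for x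
   using fiber_map_scalar[OF W] by (simp add: L)
 next
  fix W W' :: "('k^'m) set" and F assume "W \<in> {W. opL W}" and W': "W' \<in> opens L W" and F: "F \<in> carrier (sections L W)"
  then have "opL W" "opL W'" "W' <= W" "F \<in> sfuns C n W" by (simp_all add: opens_def openin_L L openin_affine)
  then show "snd fiber_map W' (restr L W W' F) =
    restr (open_sub X U) (over W) (over W') (snd fiber_map W F)"
   using fiber_map_restr[of W F W'] by (simp add: L)
 qed
qed

definition local_fiber_map :: "'p set => ('p, 's, 'k^'m, ('k, 'm) sfun) smorph" where
 "local_fiber_map V = restrict_mor (open_sub X U) V fiber_map"

lemma open_sub_open_sub: "V <= U ==> open_sub (open_sub X U) V = open_sub X V"
 by (simp add: open_sub_def subtopology_subtopology Int_absorb1)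

lemma local_fiber_map_eq:
 assumes "V \<in> ops U"
 shows "fst (local_fiber_map V) = body_map"
  and "snd (local_fiber_map V) W = rstr (over W) {p \<in> V. body_map p \<in> W} \<circ> snd fiber_map W"
 using preim_fiber_map preim_open_sub[OF opensD(1)[OF assms], of fiber_map] opensD(2)[OF assms]
 by (simp_all add: local_fiber_map_def restrict_mor_def open_sub_open_sub o_def)

lemma continuous_map_aff: "continuous_map (points L) (points L) (aff g q0 y0)"
 unfolding continuous_map_def openin_L whole_L
 using continuous_aff[of UNIV g q0 y0] open_vimage by (auto simp: vimage_def)

text \<open>In an adapted chart the map of points is the chart followed by an affine isomorphism.
  Pullback is injective because each point of \<open>W'\<close> is an image point, where the series
  of \<open>F\<close> is read off from its pullback. It is surjective because a section with chart
  function \<open>K\<close> is the pullback of the inverse affine substitution of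
  \<open>K\<close>.\<close>

lemma fiber_map_local_iso:
 assumes V: "V \<in> ops U" and p: "p \<in> V"
 obtains V' W where "V' \<in> ops V" "p \<in> V'" "iso V' W (local_fiber_map V')"
proof -
 obtain V1 W1 \<phi> h g q0 y0 where V1: "V1 \<in> ops V" "p \<in> V1" and a: "adapted s V1 W1 \<phi> h g"
  and Y: "!!q. q \<in> V1 ==> body_map q = aff g q0 y0 (fst \<phi> q)"
  by (rule chart_near[OF V p]) (rule that)
 note i = adaptedD(1)[OF a]
 note V1U = opens_trans[OF V1(1) V]
 have W1: "opL W1" using i by (simp add: iso_def)
 have b: "bij_betw (fst \<phi>) V1 W1" by (rule iso_props(1)[OF i])
 let ?f = "aff g q0 y0" and ?f' = "aff h y0 q0"
 have inv: "?f (?f' x) = x" "?f' (?f x) = x" for x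
  by (rule aff_inverse[OF adaptedD(2)[OF a] adaptedD(4)[OF a]], assumption+)
   (rule aff_inverse[OF adaptedD(3)[OF a] adaptedD(5)[OF a]], assumption+)
 \<comment> \<open>The image of the chart's range \<open>W1\<close> under \<open>?f\<close>, written
   as a preimage under the inverse so that openness follows from continuity.\<close>
 define W where "W = ?f' -` W1"
 have W: "opL W" using W1 continuous_aff[of UNIV h y0 q0] by (auto simp: W_def intro!: open_vimage)
 have oV1: "opn V1" by (rule opensD(1)[OF V1(1)])
 have oW: "openin (points L) W" "openin (points L) W1" using W W1 by (simp_all add: openin_L)
 note \<rho> = local_fiber_map_eq[OF V1U]
 let ?P = "%W'. {p \<in> V1. body_map p \<in> W'}"
 have over_P: "?P W' \<in> ops (over W')" "opn (?P W')" if "opL W'" for W'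
 proof -
  have "?P W' = V1 \<inter> over W'" using opensD(2)[OF V1U] by auto
  then show "opn (?P W')" using openin_Int[OF oV1 opensD(1)[OF over_open[OF that]]] by simp
  then show "?P W' \<in> ops (over W')" using opensD(2)[OF V1U] by (auto intro!: opensI)
 qed
 have P_chart: "?P W' = pre V1 \<phi> (W1 \<inter> ?f -` W')" for W'
  using b Y by (auto simp: bij_betw_def)
 have comp: "compatible (?P W') (snd (local_fiber_map V1) W' F) F" if "opL W'" "F \<in> sfuns C n W'" for W' F
  unfolding \<rho>(2) o_apply
  by (rule compatible_restr[OF over_open[OF that(1)] fiber_map_compatible[OF that] over_P(1)[OF that(1)] refl])
 have "iso V1 W (local_fiber_map V1)"
 proof (rule isoI[OF oV1 W])
  show "homeomorphic_map (subtopology (points X) V1) (subtopology (points L) W) (fst (local_fiber_map V1))"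
  proof -
   have 1: "homeomorphic_map (subtopology (points X) V1) (subtopology (points L) W1) (fst \<phi>)"
    using i by (simp add: iso_def is_iso_def)
   have "homeomorphic_maps (subtopology (points L) W1) (subtopology (points L) W) ?f ?f'"
    unfolding homeomorphic_maps_def
    by (intro conjI ballI continuous_map_into_subtopology continuous_map_from_subtopology continuous_map_aff inv)
     (auto simp: W_def inv)
   then have 2: "homeomorphic_map (subtopology (points L) W1) (subtopology (points L) W) ?f"
    by (rule homeomorphic_maps_imp_map)
   show ?thesis unfolding \<rho>(1)
    by (rule homeomorphic_map_eq[OF homeomorphic_map_compose[OF 1 2]]) (use Y in auto)
  qed
 next
  fix W' assume W': "opL W'" "W' <= W"
  note oP = over_P[OF W'(1)] and oO = opensD(1)[OF over_open[OF W'(1)]]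
  note r = restr_props[OF oO oP(2) opensD(2)[OF oP(1)]]
  show "snd (local_fiber_map V1) W' \<in> ring_hom (sections L W') (sec (pre V1 (local_fiber_map V1) W'))"
   unfolding \<rho> by (rule ring_hom_trans[OF fiber_map_hom[OF W'(1)] r(1)])
  show "snd (local_fiber_map V1) W' F \<in> part X (pre V1 (local_fiber_map V1) W') e" if "F \<in> part L W' e" for F e
   unfolding \<rho> o_apply by (rule r(2)[OF fiber_map_parts[OF W'(1) that]])
  show "snd (local_fiber_map V1) W' (sfun_scalar W' x) = scl (pre V1 (local_fiber_map V1) W') x" for x
   unfolding \<rho> o_apply fiber_map_scalar[OF W'(1)] by (rule r(3))
  show "bij_betw (snd (local_fiber_map V1) W') (sfuns C n W') (carrier (sec (pre V1 (local_fiber_map V1) W')))"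
   unfolding bij_betw_def \<rho>(1)
  proof (intro conjI inj_onI equalityI subsetI)
   fix F F' assume F: "F \<in> sfuns C n W'" "F' \<in> sfuns C n W'"
    and eq: "snd (local_fiber_map V1) W' F = snd (local_fiber_map V1) W' F'"
   show "F = F'"
   proof
    fix x
    show "F x = F' x"
    proof (cases "x \<in> W'")
     case True
     then have "?f' x \<in> W1" using W'(2) by (auto simp: W_def)
     then obtain q where q: "q \<in> V1" "fst \<phi> q = ?f' x" using b by (auto simp: bij_betw_def)
     then have Yq: "body_map q = x" using Y inv by simp
     then have qP: "q \<in> ?P W'" using q True by simp
     have "tay s q (?P W') (snd (local_fiber_map V1) W' F) (F (body_map q))"
      "tay s q (?P W') (snd (local_fiber_map V1) W' F') (F' (body_map q))"
      using comp[OF W'(1) F(1)] comp[OF W'(1) F(2)] qP unfolding compatible_def by blast+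
     then have "F (body_map q) = F' (body_map q)" unfolding eq by (rule tay_unique)
     then show ?thesis unfolding Yq .
    qed (simp add: sfuns_outside[OF F(1)] sfuns_outside[OF F(2)])
   qed
  next
   fix G assume "G \<in> snd (local_fiber_map V1) W' ` sfuns C n W'"
   then show "G \<in> fns (?P W')" using comp[OF W'(1)] unfolding compatible_def by blast
  next
   fix G assume G: "G \<in> fns (?P W')"
   define W2 where "W2 = W1 \<inter> ?f -` W'"
   have W2: "opL W2" "W2 <= W1" using W'(1) W1 continuous_aff[of UNIV g q0 y0] by (auto simp: W2_def intro!: open_Int open_vimage)
   note P2 = P_chart[of W', folded W2_def]
   obtain K where K: "K \<in> sfuns C n W2" "G = snd \<phi> W2 K"
    using iso_props(3)[OF i W2] G unfolding P2 by (auto simp: bij_betw_def image_iff)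
   have K': "(%x. ssub n h (K (?f' x))) \<in> sfuns C n (?f' -` W2)" by (rule sfuns_ssub[OF W2(1) K(1) aff_add])
   have sub: "W' <= ?f' -` W2" using W'(2) by (auto simp: W2_def W_def inv)
   \<comment> \<open>Substitution by \<open>h\<close> converts the chart expansion of
     \<open>G\<close> into its expansion in the frame; a function on \<open>W'\<close> has to be
     zero outside.\<close>
   define F where "F = (%x. if x \<in> W' then ssub n h (K (?f' x)) else (%al I. 0))"
   have F: "F \<in> sfuns C n W'" unfolding F_def by (rule sfuns_restr[OF K' sub W'(1)])
   have "compatible (?P W') G F"
    unfolding compatible_def
   proof (intro conjI ballI G)
    fix q assume q: "q \<in> ?P W'"
    then have q2: "q \<in> V1" "fst \<phi> q \<in> W2" unfolding P2 by auto
    have "F (body_map q) = ssub n h (K (fst \<phi> q))"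
     using q q2 by (simp add: F_def Y inv)
    then show "tay s q (?P W') G (F (body_map q))"
     unfolding K(2) P2 using tay_adapted[OF a W2 K(1) q2] by simp
   qed
   then have "G = snd (local_fiber_map V1) W' F"
    by (rule compatible_unique[OF opens_trans[OF oP(1) over_open[OF W'(1)]] _ comp[OF W'(1) F]])
   then show "G \<in> snd (local_fiber_map V1) W' ` sfuns C n W'" using F by blast
  qed
 next
  fix W' W'' F assume W': "opL W'" "W' <= W" and W'': "opL W''" "W'' <= W'" and F: "F \<in> sfuns C n W'"
  note oP' = over_P[OF W'(1)] and oO' = opensD(1)[OF over_open[OF W'(1)]]
  note oP'' = over_P[OF W''(1)] and oO'' = opensD(1)[OF over_open[OF W''(1)]]
  note c = fiber_map_props(1)[OF W'(1) F]
  have s1: "over W'' <= over W'" "?P W'' <= ?P W'" using W''(2) by auto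
  have "rstr (over W'') (?P W'') (rstr (over W') (over W'') (snd fiber_map W' F)) =
    rstr (over W') (?P W'') (snd fiber_map W' F)"
   by (rule restr_props(4)[OF oO' oO'' s1(1) oP''(2) opensD(2)[OF oP''(1)] c])
  also have "... = rstr (?P W') (?P W'') (rstr (over W') (?P W') (snd fiber_map W' F))"
   by (rule restr_props(4)[OF oO' oP'(2) opensD(2)[OF oP'(1)] oP''(2) s1(2) c, symmetric])
  finally show "snd (local_fiber_map V1) W'' (%p. if p \<in> W'' then F p else (%al I. 0)) =
    rstr (pre V1 (local_fiber_map V1) W') (pre V1 (local_fiber_map V1) W'') (snd (local_fiber_map V1) W' F)"
   unfolding \<rho> o_apply fiber_map_restr[OF W'(1) F W''] .
 qed
 then show ?thesis by (rule that[OF V1])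
qed

lemma fiber_map_is_local_iso: "local_iso (open_sub X U) L fiber_map"
 unfolding local_iso_def whole_open_sub[OF frame_open] opens_open_sub[OF frame_open]
proof (intro conjI ballI fiber_map_morphism)
 fix p assume p: "p \<in> U"
 obtain V W where V: "V \<in> ops U" "p \<in> V" and i: "iso V W (local_fiber_map V)"
  by (rule fiber_map_local_iso[OF opens_refl[OF frame_open] p]) (rule that)
 have "is_iso (open_sub X V) (open_sub L W) (local_fiber_map V)" "opL W" using i by (simp_all add: iso_def)
 then show "\<exists>V\<in>ops (U \<inter> U). p \<in> V \<and> (\<exists>W\<in>opens L (whole L).
   is_iso (open_sub (open_sub X U) V) (open_sub L W) (restrict_mor (open_sub X U) V fiber_map))"
  unfolding local_fiber_map_def[symmetric] using V open_sub_open_sub[OF opensD(2)[OF V(1)]]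
  by (auto simp: opens_whole openin_L intro!: bexI[of _ V] bexI[of _ W])
qed

end

section \<open>Vector fields on the affine superspace\<close>

lemma smul_scale:
 "smul (%al I. c * H al I) K = (%al I. c * smul H K al I)"
 "smul H (%al I. c * K al I) = (%al I. c * smul H K al I)"
 by (simp_all add: smul_def fun_eq_iff sum_distrib_left mult_ac)

lemma sder_linear:
 "sder a (%al I. x * H al I + K al I) = (%al I. x * sder a H al I + sder a K al I)"
 using fold_sder_linear[of "[a]" x H K] by simp

lemma abelian_group_sfuns:
 fixes V :: "('k::{real_normed_field,banach}^'m::finite) set"
 shows "abelian_group (sections (affine_superspace C n) V)"
proof (rule abelian_groupI, unfold affine_superspace_simps)
 fix F :: "('k, 'm) sfun" assume "F \<in> sfuns C n V"
 then show "\<exists>G\<in>sfuns C n V. (%p al I. G p al I + F p al I) = (%p al I. 0)"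
  using sfuns_scale[of F C n V "- 1"] by (intro bexI[of _ "%p al I. - 1 * F p al I"]) auto
qed (auto intro: sfuns_add sfuns_zero simp: add_ac)

lemma sfun_ksign:
 assumes "F \<in> sfuns C n V"
 shows "ksign (sections (affine_superspace C n) V) b F = (%p al I. (if b then - 1 else 1) * F p al I)"
proof -
 interpret abelian_group "sections (affine_superspace C n) V" by (rule abelian_group_sfuns)
 have "a_inv (sections (affine_superspace C n) V) F = (%p al I. - 1 * F p al I)"
  by (rule minus_equality) (use assms sfuns_scale[OF assms, of "- 1"] in auto)
 then show ?thesis by (simp add: ksign_def)
qed

lemma ball_Collect_cong:
 "(!!x. x \<in> S ==> P x ==> Q x = R x) ==> (\<forall>x\<in>{x \<in> S. P x}. Q x) \<longleftrightarrow> (\<forall>x\<in>S. P x --> R x)"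
 by auto

context
 fixes C n and L :: "('k::{real_normed_field,banach}^'m::finite, ('k, 'm) sfun, 'k) superspace"
 assumes L: "L = affine_superspace C n"
begin

abbreviation fields :: "('k^'m) set => ('k^'m, ('k, 'm) sfun) vfield set" where
 "fields U \<equiv> (\<Pi>\<^sub>E V\<in>opens L U. sfuns C n V \<rightarrow>\<^sub>E sfuns C n V)"

text \<open>\<open>ringed_space\<close> is interpreted for \<open>X\<close> only. The few facts
  about fields on the model space are derived directly from expansions, and this puts the derivation
  laws into that form.\<close>

lemma affine_derivation:
 "D \<in> derivation L U a \<longleftrightarrow> D \<in> fields U \<and>
  (\<forall>V\<in>opens L U.
   (\<forall>F\<in>sfuns C n V. \<forall>G\<in>sfuns C n V. D V (%p al I. F p al I + G p al I) = (%p al I. D V F p al I + D V G p al I)) \<and>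
   (\<forall>x. \<forall>F\<in>sfuns C n V. D V (%p al I. x * F p al I) = (%p al I. x * D V F p al I)) \<and>
   (\<forall>b. \<forall>F\<in>sfuns C n V. (\<forall>p. homogeneous b (F p)) --> (\<forall>p. homogeneous (a ~= b) (D V F p)) \<and>
    (\<forall>G\<in>sfuns C n V. D V (sfun_mult F G) = (%p al I. smul (D V F p) (G p) al I +
     (if a \<and> b then - 1 else 1) * smul (F p) (D V G p) al I))) \<and>
   (\<forall>W\<in>opens L V. \<forall>F\<in>sfuns C n V. D W (%p. if p \<in> W then F p else (%al I. 0)) =
    (%p. if p \<in> W then D V F p else (%al I. 0))))"
proof -
 have part: "part L V b = {F \<in> sfuns C n V. \<forall>p. homogeneous b (F p)}" for V b
  by (auto simp: L homogeneous_def)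
 have car: "carrier (sections L V) = sfuns C n V" for V by (simp add: L)
 show ?thesis
  unfolding derivation_def mem_Collect_eq part car
 proof (rule conj_cong[OF refl], rule ball_cong[OF refl], intro conj_cong)
  fix V assume D: "D \<in> fields U" and V: "V \<in> opens L U"
  have cl: "D V F \<in> sfuns C n V" if "F \<in> sfuns C n V" for F using D V that by (auto simp: PiE_def Pi_def)
  show "(\<forall>f\<in>sfuns C n V. \<forall>g\<in>sfuns C n V. D V (f \<oplus>\<^bsub>sections L V\<^esub> g) = D V f \<oplus>\<^bsub>sections L V\<^esub> D V g) \<longleftrightarrow>
   (\<forall>F\<in>sfuns C n V. \<forall>G\<in>sfuns C n V. D V (%p al I. F p al I + G p al I) = (%p al I. D V F p al I + D V G p al I))"
   by (simp add: L)
  show "(\<forall>x. \<forall>f\<in>sfuns C n V. D V (scalar L V x \<otimes>\<^bsub>sections L V\<^esub> f) = scalar L V x \<otimes>\<^bsub>sections L V\<^esub> D V f) \<longleftrightarrow>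
   (\<forall>x. \<forall>F\<in>sfuns C n V. D V (%p al I. x * F p al I) = (%p al I. x * D V F p al I))"
   by (simp add: L sfun_mult_scalar[OF cl] sfun_mult_scalar[of _ C n] cong: ball_cong)
  show "(\<forall>b. \<forall>f\<in>{F \<in> sfuns C n V. \<forall>p. homogeneous b (F p)}.
    (D V f \<in> sfuns C n V \<and> (\<forall>p. homogeneous (a ~= b) (D V f p))) \<and>
    (\<forall>g\<in>sfuns C n V. D V (f \<otimes>\<^bsub>sections L V\<^esub> g) = (D V f \<otimes>\<^bsub>sections L V\<^esub> g) \<oplus>\<^bsub>sections L V\<^esub>
     ksign (sections L V) (a \<and> b) (f \<otimes>\<^bsub>sections L V\<^esub> D V g))) \<longleftrightarrow>
   (\<forall>b. \<forall>F\<in>sfuns C n V. (\<forall>p. homogeneous b (F p)) --> (\<forall>p. homogeneous (a ~= b) (D V F p)) \<and>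
    (\<forall>G\<in>sfuns C n V. D V (sfun_mult F G) = (%p al I. smul (D V F p) (G p) al I +
     (if a \<and> b then - 1 else 1) * smul (F p) (D V G p) al I)))"
  proof -
   have *: "(D V F \<otimes>\<^bsub>sections L V\<^esub> G) \<oplus>\<^bsub>sections L V\<^esub> ksign (sections L V) (a \<and> b) (F \<otimes>\<^bsub>sections L V\<^esub> D V G) =
     (%p al I. smul (D V F p) (G p) al I + (if a \<and> b then - 1 else 1) * smul (F p) (D V G p) al I)"
    if "F \<in> sfuns C n V" "G \<in> sfuns C n V" for F G b
    using sfun_ksign[OF sfuns_mult[OF that(1) cl[OF that(2)]], of "a \<and> b"] unfolding L affine_superspace_simps sfun_mult_smul
    by simp
   have m: "F \<otimes>\<^bsub>sections L V\<^esub> G = sfun_mult F G" for F G by (simp add: L)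
   show ?thesis
   proof (rule iff_allI, rule ball_Collect_cong, unfold m, intro conj_cong ball_cong refl)
    fix b F assume F: "F \<in> sfuns C n V"
    show "D V F \<in> sfuns C n V \<and> (\<forall>p. homogeneous (a ~= b) (D V F p)) \<longleftrightarrow> (\<forall>p. homogeneous (a ~= b) (D V F p))"
     using cl[OF F] by blast
    fix G assume G: "G \<in> sfuns C n V"
    show "D V (sfun_mult F G) = sfun_mult (D V F) G \<oplus>\<^bsub>sections L V\<^esub> ksign (sections L V) (a \<and> b) (sfun_mult F (D V G)) \<longleftrightarrow>
     D V (sfun_mult F G) = (%p al I. smul (D V F p) (G p) al I + (if a \<and> b then - 1 else 1) * smul (F p) (D V G p) al I)"
     by (simp only: *[OF F G, unfolded m])
   qed
  qed
  show "(\<forall>W\<in>opens L V. \<forall>f\<in>sfuns C n V. D W (restr L V W f) = restr L V W (D V f)) \<longleftrightarrow>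
   (\<forall>W\<in>opens L V. \<forall>F\<in>sfuns C n V. D W (%p. if p \<in> W then F p else (%al I. 0)) =
    (%p. if p \<in> W then D V F p else (%al I. 0)))"
   by (simp add: L)
 qed
qed

lemma affine_vadd: "vadd L U D E = (\<lambda>V\<in>opens L U. \<lambda>F\<in>sfuns C n V. %p al I. D V F p al I + E V F p al I)"
 by (simp add: vadd_def L)

lemma affine_vadd_eval:
 "V \<in> opens L U ==> F \<in> sfuns C n V ==> vadd L U D E V F = (%p al I. D V F p al I + E V F p al I)"
 by (simp add: affine_vadd)

lemma fields_closed: "D \<in> fields U ==> V \<in> opens L U ==> F \<in> sfuns C n V ==> D V F \<in> sfuns C n V"
 by (auto simp: PiE_def Pi_def)

lemma vadd_fields: "D \<in> fields U ==> E \<in> fields U ==> vadd L U D E \<in> fields U"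
 unfolding affine_vadd by (simp add: restrict_PiE_iff fields_closed sfuns_add)

lemma fields_eqI:
 assumes "D \<in> fields U" "E \<in> fields U" "!!V F. V \<in> opens L U ==> F \<in> sfuns C n V ==> D V F = E V F"
 shows "D = E"
proof (rule PiE_ext[OF assms(1,2)])
 fix V assume V: "V \<in> opens L U"
 show "D V = E V"
  by (rule PiE_ext[where k = "sfuns C n V" and s = "%_. sfuns C n V"]) (use V assms in \<open>auto simp: PiE_def Pi_def\<close>)
qed

lemma homogeneous_add: "homogeneous c H ==> homogeneous c K ==> homogeneous c (%al I. H al I + K al I :: 'k)"
 unfolding homogeneous_def by (metis add.right_neutral)

lemma affine_derivation_add:
 assumes D: "D \<in> derivation L U a" and E: "E \<in> derivation L U a"
 shows "vadd L U D E \<in> derivation L U a"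
 unfolding affine_derivation
proof (intro conjI ballI allI impI)
 note d = D[unfolded affine_derivation] and e = E[unfolded affine_derivation]
 note fd = conjunct1[OF d] and fe = conjunct1[OF e]
 show "vadd L U D E \<in> fields U" by (rule vadd_fields[OF fd fe])
 fix V assume V: "V \<in> opens L U"
 note dV = bspec[OF conjunct2[OF d] V] and eV = bspec[OF conjunct2[OF e] V]
 note ev = affine_vadd_eval[OF V]
 { fix F assume F: "F \<in> sfuns C n V"
  { fix x
   have "D V (%p al I. x * F p al I) = (%p al I. x * D V F p al I)" "E V (%p al I. x * F p al I) = (%p al I. x * E V F p al I)"
    using dV eV F by blast+
   then show "vadd L U D E V (%p al I. x * F p al I) = (%p al I. x * vadd L U D E V F p al I)"
    unfolding ev[OF F] ev[OF sfuns_scale[OF F]] by (simp add: algebra_simps) }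
  { fix b p assume b: "\<forall>p. homogeneous b (F p)"
   have "\<forall>p. homogeneous (a ~= b) (D V F p)" "\<forall>p. homogeneous (a ~= b) (E V F p)" using dV eV F b by blast+
   then show "homogeneous (a ~= b) (vadd L U D E V F p)" unfolding ev[OF F] by (blast intro: homogeneous_add) }
  { fix W assume W: "W \<in> opens L V"
   have WU: "W \<in> opens L U" and W': "W <= V" "C = Formal \<or> open W"
    using opens_trans[OF W V] opensD[OF W] by (auto simp: L openin_affine)
   have "D W (%p. if p \<in> W then F p else (%al I. 0)) = (%p. if p \<in> W then D V F p else (%al I. 0))"
    "E W (%p. if p \<in> W then F p else (%al I. 0)) = (%p. if p \<in> W then E V F p else (%al I. 0))"
    using dV eV F W by blast+
   then show "vadd L U D E W (%p. if p \<in> W then F p else (%al I. 0)) =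
     (%p. if p \<in> W then vadd L U D E V F p else (%al I. 0))"
    unfolding ev[OF F] affine_vadd_eval[OF WU sfuns_restr[OF F W']] by (simp add: fun_eq_iff) }
  fix G assume G: "G \<in> sfuns C n V"
  have "D V (%p al I. F p al I + G p al I) = (%p al I. D V F p al I + D V G p al I)"
   "E V (%p al I. F p al I + G p al I) = (%p al I. E V F p al I + E V G p al I)" using dV eV F G by blast+
  then show "vadd L U D E V (%p al I. F p al I + G p al I) = (%p al I. vadd L U D E V F p al I + vadd L U D E V G p al I)"
   unfolding ev[OF F] ev[OF G] ev[OF sfuns_add[OF F G]] by (simp add: add_ac)
  fix b assume b: "\<forall>p. homogeneous b (F p)"
  have "D V (sfun_mult F G) = (%p al I. smul (D V F p) (G p) al I + (if a \<and> b then - 1 else 1) * smul (F p) (D V G p) al I)"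
   "E V (sfun_mult F G) = (%p al I. smul (E V F p) (G p) al I + (if a \<and> b then - 1 else 1) * smul (F p) (E V G p) al I)"
   using dV eV F G b by blast+
  then show "vadd L U D E V (sfun_mult F G) = (%p al I. smul (vadd L U D E V F p) (G p) al I +
    (if a \<and> b then - 1 else 1) * smul (F p) (vadd L U D E V G p) al I)"
   unfolding ev[OF F] ev[OF G] ev[OF sfuns_mult[OF F G]] smul_add_left smul_add_right
   by (simp add: algebra_simps) }
qed

definition affine_zero :: "('k^'m) set => ('k^'m, ('k, 'm) sfun) vfield" where
 "affine_zero U = (\<lambda>V\<in>opens L U. \<lambda>F\<in>sfuns C n V. %p al I. 0)"

lemma affine_derivation_zero: "affine_zero U \<in> derivation L U a"
proof -
 have z: "smul (%al I. 0) H = (%al I. 0)" "smul H (%al I. 0) = (%al I. 0)" for H :: "('m => nat) => nat set => 'k"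
  by (simp_all add: smul_def fun_eq_iff)
 have ev: "affine_zero U V F = (%p al I. 0)" if "V \<in> opens L U" "F \<in> sfuns C n V" for V F
  using that by (simp add: affine_zero_def)
 show ?thesis
  unfolding affine_derivation
 proof (intro conjI ballI allI impI)
  show "affine_zero U \<in> fields U" by (simp add: affine_zero_def restrict_PiE_iff sfuns_zero)
  fix V W F assume V: "V \<in> opens L U" and F: "F \<in> sfuns C n V" and W: "W \<in> opens L V"
  have "W \<in> opens L U" "W <= V" "C = Formal \<or> open W"
   using opens_trans[OF W V] opensD[OF W] by (auto simp: L openin_affine)
  then show "affine_zero U W (%p. if p \<in> W then F p else (%al I. 0)) = (%p. if p \<in> W then affine_zero U V F p else (%al I. 0))"
   using ev[OF V F] ev sfuns_restr[OF F] by (simp add: fun_eq_iff)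
 qed (simp_all add: ev sfuns_add sfuns_scale sfuns_mult z homogeneous_def)
qed

lemma derivation_fields: "D \<in> derivation L U a ==> D \<in> fields U"
 by (simp add: affine_derivation)

lemma tangent_fields: "D \<in> carrier (tangent L U) ==> D \<in> fields U"
proof -
 assume "D \<in> carrier (tangent L U)"
 then obtain D0 D1 where D: "D = vadd L U D0 D1" "D0 \<in> derivation L U False" "D1 \<in> derivation L U True"
  by (auto simp: tangent_def)
 show ?thesis unfolding D(1) by (rule vadd_fields[OF derivation_fields[OF D(2)] derivation_fields[OF D(3)]])
qed

lemma affine_tangent_simps:
 "add (tangent L U) = vadd L U" "zero (tangent L U) = affine_zero U"
 unfolding tangent_def affine_zero_def by (simp_all add: L)

lemma affine_derivation_tangent:
 assumes D: "D \<in> derivation L U a"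
 shows "D \<in> carrier (tangent L U)"
proof -
 note f = derivation_fields[OF D] and z = affine_derivation_zero[of U]
 note fz = derivation_fields[OF z]
 have e: "D = vadd L U D (affine_zero U)" "D = vadd L U (affine_zero U) D"
  by (rule fields_eqI[OF f vadd_fields[OF f fz]], simp add: affine_vadd_eval affine_zero_def,
    rule fields_eqI[OF f vadd_fields[OF fz f]], simp add: affine_vadd_eval affine_zero_def)
 show ?thesis
 proof (cases a)
  case True
  then show ?thesis unfolding tangent_def using D z e(2) by auto
 next
  case False
  then show ?thesis unfolding tangent_def using D z e(1) by auto
 qed
qed

text \<open>A commutative monoid is enough to evaluate the finite sums in
  \<open>lin_comb\<close>.\<close>

lemma affine_abelian_monoid: "abelian_monoid (tangent L U)"
proof (rule abelian_monoidI, unfold affine_tangent_simps)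
 show "affine_zero U \<in> carrier (tangent L U)" by (rule affine_derivation_tangent[OF affine_derivation_zero])
 fix D E assume D: "D \<in> carrier (tangent L U)" and E: "E \<in> carrier (tangent L U)"
 note f = tangent_fields[OF D] tangent_fields[OF E]
 note fz = derivation_fields[OF affine_derivation_zero[of U]]
 show "vadd L U D E = vadd L U E D"
  by (rule fields_eqI[OF vadd_fields[OF f] vadd_fields[OF f(2,1)]]) (simp add: affine_vadd_eval add.commute)
 show "vadd L U (affine_zero U) D = D"
  by (rule fields_eqI[OF vadd_fields[OF fz f(1)] f(1)]) (simp add: affine_vadd_eval affine_zero_def)
 obtain D0 D1 where D': "D = vadd L U D0 D1" "D0 \<in> derivation L U False" "D1 \<in> derivation L U True"
  using D by (auto simp: tangent_def)
 obtain E0 E1 where E': "E = vadd L U E0 E1" "E0 \<in> derivation L U False" "E1 \<in> derivation L U True"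
  using E by (auto simp: tangent_def)
 note g = D'(2,3)[THEN derivation_fields] E'(2,3)[THEN derivation_fields]
 have "vadd L U D E = vadd L U (vadd L U D0 E0) (vadd L U D1 E1)"
  unfolding D'(1) E'(1)
  by (rule fields_eqI[where U = U]) (simp_all add: vadd_fields g affine_vadd_eval add_ac)
 then show "vadd L U D E \<in> carrier (tangent L U)"
  using affine_derivation_add[OF D'(2) E'(2)] affine_derivation_add[OF D'(3) E'(3)]
  by (auto simp: tangent_def)
next
 fix D E F assume "D \<in> carrier (tangent L U)" "E \<in> carrier (tangent L U)" "F \<in> carrier (tangent L U)"
 note f = this[THEN tangent_fields]
 show "vadd L U (vadd L U D E) F = vadd L U D (vadd L U E F)"
  by (rule fields_eqI[where U = U]) (simp_all add: vadd_fields f affine_vadd_eval add.assoc)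
qed

lemma affine_finsum_eval:
 assumes V: "V \<in> opens L U" and F: "F \<in> sfuns C n V" and S: "finite S"
 shows "(!!i. i \<in> S ==> E i \<in> carrier (tangent L U)) ==>
  (\<Oplus>\<^bsub>tangent L U\<^esub>i\<in>S. E i) V F = (%p al I. \<Sum>i\<in>S. E i V F p al I)"
 using S
proof (induction S)
 interpret abelian_monoid "tangent L U" by (rule affine_abelian_monoid)
 case empty
 then show ?case using V F by (simp add: affine_tangent_simps affine_zero_def)
next
 interpret abelian_monoid "tangent L U" by (rule affine_abelian_monoid)
 case (insert j S)
 have "(\<Oplus>\<^bsub>tangent L U\<^esub>i\<in>insert j S. E i) = vadd L U (E j) (\<Oplus>\<^bsub>tangent L U\<^esub>i\<in>S. E i)"
  unfolding affine_tangent_simps(1)[symmetric]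
  by (rule finsum_insert[OF insert.hyps]) (use insert.prems in auto)
 then show ?case using insert.IH insert.prems insert.hyps by (simp add: affine_vadd_eval[OF V F])
qed

lemma locally_constant_series:
 assumes f: "locally_constant L W f" and p: "p \<in> W"
 shows "f p = (%al I. if al = (%_. 0) \<and> I = {} then f p (%_. 0) {} else 0)"
proof -
 obtain V x where V: "p \<in> V" "restr L W V f = sfun_scalar V x"
  using f p unfolding locally_constant_def by (auto simp: L)
 have "f p = sfun_scalar V x p" using fun_cong[OF V(2), of p] V(1) by (simp add: L)
 then show ?thesis using V(1) by (intro ext) (simp add: sfun_scalar_def)
qed

text \<open>A locally constant coefficient has a constant expansion at each point, though the
  constant may vary with the point; multiplying by it scales the expansion there.\<close>

lemma constant_field_derivation:
 assumes W: "C = Formal \<or> open W" and f: "locally_constant L W f" and i: "i \<in> coords n"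
 shows "smult (tangent L W) f (vrestr L W (coord_field L W i)) \<in> derivation L W (odd_index i)" (is "?D \<in> _")
  and "V \<in> opens L W ==> F \<in> sfuns C n V ==>
   smult (tangent L W) f (vrestr L W (coord_field L W i)) V F = (%p al I. f p (%_. 0) {} * coord_deriv i F p al I)"
proof -
 let ?c = "%p. f p (%_. 0) {}"
 have sz: "sder i (%al I. 0 :: 'k) = (%al I. 0)" using fold_sder_zero[of "[i]", where ?'k = 'k] by simp
 have fs: "f \<in> sfuns C n W" using f by (simp add: locally_constant_def L)
 have oV: "C = Formal \<or> open V" "V <= W" if "V \<in> opens L W" for V using opensD[OF that] by (auto simp: L openin_affine)
 have D: "?D = (\<lambda>V\<in>opens L W. \<lambda>F\<in>sfuns C n V. sfun_mult (%p. if p \<in> V then f p else (%al I. 0)) (coord_deriv i F))"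
  unfolding tangent_def vrestr_def coord_field_def by (simp add: L restrict_def fun_eq_iff)
 have m: "sfun_mult (%p. if p \<in> V then f p else (%al I. 0)) (coord_deriv i F) = (%p al I. ?c p * coord_deriv i F p al I)"
  if V: "V \<in> opens L W" and F: "F \<in> sfuns C n V" for V F
 proof
  fix p
  note dF = sfuns_coord_deriv[OF oV(1)[OF V] F, of i]
  show "sfun_mult (%p. if p \<in> V then f p else (%al I. 0)) (coord_deriv i F) p = (%al I. ?c p * coord_deriv i F p al I)"
  proof (cases "p \<in> V")
   case True
   then have pW: "p \<in> W" using oV(2)[OF V] by auto
   have "smul (f p) (coord_deriv i F p) = (%al I. ?c p * coord_deriv i F p al I)"
    by (subst locally_constant_series[OF f pW], rule smul_scalar[OF sfuns_support[OF dF]])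
   then show ?thesis using True by (simp add: sfun_mult_smul)
  next
   case False
   then show ?thesis using sfuns_outside[OF dF False] by (simp add: sfun_mult_smul smul_def fun_eq_iff)
  qed
 qed
 have ev: "?D V F = (%p al I. ?c p * coord_deriv i F p al I)" if "V \<in> opens L W" "F \<in> sfuns C n V" for V F
  unfolding D using that by (simp add: m)
 then show "V \<in> opens L W ==> F \<in> sfuns C n V ==> ?D V F = (%p al I. ?c p * coord_deriv i F p al I)" .
 show "?D \<in> derivation L W (odd_index i)"
  unfolding affine_derivation
 proof (intro conjI ballI allI impI)
  have "sfun_mult (%p. if p \<in> V then f p else (%al I. 0)) (coord_deriv i F) \<in> sfuns C n V"
   if V: "V \<in> opens L W" and F: "F \<in> sfuns C n V" for V F
   by (rule sfuns_mult[OF sfuns_restr[OF fs oV(2)[OF V] oV(1)[OF V]] sfuns_coord_deriv[OF oV(1)[OF V] F]])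
  then show "?D \<in> fields W" unfolding D by (simp add: restrict_PiE_iff Pi_iff)
  fix V assume V: "V \<in> opens L W"
  { fix F assume F: "F \<in> sfuns C n V"
   show "?D V (%p al I. x * F p al I) = (%p al I. x * ?D V F p al I)" for x
    unfolding ev[OF V F] ev[OF V sfuns_scale[OF F]] coord_deriv_sder
    using sder_linear[of i x "F _" "%al I. 0"] by (simp add: sz mult_ac)
   { fix b p assume b: "\<forall>p. homogeneous b (F p)"
    have "(b ~= odd_index i) = (odd_index i ~= b)" by auto
    then have "homogeneous (odd_index i ~= b) (sder i (F p))"
     using sder_homogeneous[where a = i, OF b[rule_format, of p] sfuns_support[OF F, of p]] by simp
    then show "homogeneous (odd_index i ~= b) (?D V F p)"
     unfolding ev[OF V F] coord_deriv_sder homogeneous_def by auto }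
   { fix W' assume W': "W' \<in> opens L V"
    have "W' \<in> opens L W" "W' <= V" "C = Formal \<or> open W'"
     using opens_trans[OF W' V] opensD[OF W'] by (auto simp: L openin_affine)
    note e = ev[OF this(1) sfuns_restr[OF F this(2,3)]]
    show "?D W' (%p. if p \<in> W' then F p else (%al I. 0)) = (%p. if p \<in> W' then ?D V F p else (%al I. 0))"
     unfolding ev[OF V F] e coord_deriv_sder by (auto simp: sz) }
   fix G assume G: "G \<in> sfuns C n V"
   show "?D V (%p al I. F p al I + G p al I) = (%p al I. ?D V F p al I + ?D V G p al I)"
    unfolding ev[OF V F] ev[OF V G] ev[OF V sfuns_add[OF F G]] coord_deriv_sder
    using sder_linear[of i 1 "F _" "G _"] by (simp add: distrib_left)
   fix b assume b: "\<forall>p. homogeneous b (F p)"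
   show "?D V (sfun_mult F G) = (%p al I. smul (?D V F p) (G p) al I +
     (if odd_index i \<and> b then - 1 else 1) * smul (F p) (?D V G p) al I)"
    unfolding ev[OF V F] ev[OF V G] ev[OF V sfuns_mult[OF F G]] coord_deriv_sder sfun_mult_smul
     sder_smul_homogeneous[OF b[rule_format]] smul_scale by (simp add: algebra_simps) }
 qed
qed

lemma affine_lin_comb_eval:
 assumes W: "C = Formal \<or> open W" and f: "!!i. i \<in> coords n ==> locally_constant L W (f i)"
  and V: "V \<in> opens L W" and F: "F \<in> sfuns C n V"
 shows "lin_comb L n W f (coord_field L W) V F = (%p al I. \<Sum>i\<in>coords n. f i p (%_. 0) {} * coord_deriv i F p al I)"
proof -
 have "lin_comb L n W f (coord_field L W) V F =
   (%p al I. \<Sum>i\<in>coords n. smult (tangent L W) (f i) (vrestr L W (coord_field L W i)) V F p al I)"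
  unfolding lin_comb_def
  by (rule affine_finsum_eval[OF V F finite_coords])
   (rule affine_derivation_tangent[OF constant_field_derivation(1)[OF W f]])
 also have "... = (%p al I. \<Sum>i\<in>coords n. f i p (%_. 0) {} * coord_deriv i F p al I)"
  by (intro ext sum.cong refl) (simp add: constant_field_derivation(2)[OF W f _ V F])
 finally show ?thesis .
qed

end

section \<open>The induced flat structure\<close>

lemma (in ringed_space) tangent_open_sub:
 assumes U: "opn U" and V: "V \<in> ops U"
 shows "tangent (open_sub X U) V = tangent X V"
proof -
 have o: "opens (open_sub X U) W = ops W" if "W <= U" for W
  using that unfolding opens_open_sub[OF U] by (simp add: Int_absorb2)
 have oV: "opens (open_sub X U) V = ops V" by (rule o[OF opensD(2)[OF V]])
 have oW: "opens (open_sub X U) W = ops W" if "W \<in> ops V" for W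
  by (rule o) (use opensD(2)[OF that] opensD(2)[OF V] in auto)
 have d: "derivation (open_sub X U) V a = ders V a" for a
  unfolding derivation_def oV open_sub_simps
  by (intro Collect_cong conj_cong refl ball_cong) (simp add: oW)
 have v: "vadd (open_sub X U) V = vadd X V"
  unfolding vadd_def oV open_sub_simps ..
 show ?thesis unfolding tangent_def d v oV open_sub_simps ..
qed

context flat_frame_map
begin

text \<open>Coordinate fields of the fiber correspond to the frame: by \<open>tay_step\<close> the
  series of \<open>s b\<close> applied to a pullback is the derivative of the series.\<close>

lemma local_fiber_map_lin_comb:
 assumes V: "V \<in> ops U" and i: "iso V W (local_fiber_map V)" and W': "opL W'" "W' <= W" and F: "F \<in> sfuns C n W'"
 defines "Q \<equiv> {q \<in> V. body_map q \<in> W'}"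
 shows "Q \<in> ops V"
  and "snd (local_fiber_map V) W' F \<in> fns Q"
  and "snd (local_fiber_map V) W' (%p al I. \<Sum>b\<in>coords n. x b * coord_deriv b F p al I) =
   comb n V (%b. scl V (x b)) s Q (snd (local_fiber_map V) W' F)"
proof -
 note \<rho> = local_fiber_map_eq[OF V]
 note m = mor_props[OF iso_mor[OF i] W', unfolded \<rho>(1), folded Q_def]
 have sub: "Q <= V" by (auto simp: Q_def)
 show QV: "Q \<in> ops V" by (rule opensI[OF m(1) sub])
 note QU = opens_trans[OF QV V] and oV = opensD(1)[OF V] and fs = flat_frame_family[OF s]
 show c: "snd (local_fiber_map V) W' F \<in> fns Q" by (rule m(2)[OF F])
 interpret ring "sec Q" by (rule ring_sections[OF m(1)])
 have "Q <= over W'" using opensD(2)[OF V] by (auto simp: Q_def)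
 note QO = opensI[OF m(1) this]
 have dF: "coord_deriv b F \<in> sfuns C n W'" for b by (rule sfuns_coord_deriv[OF W'(1) F])
 have der: "snd (local_fiber_map V) W' (coord_deriv b F) = s b Q (snd (local_fiber_map V) W' F)" if b: "b \<in> coords n" for b
 proof -
  have "compatible (over W') (s b (over W') (snd fiber_map W' F)) (coord_deriv b F)"
   unfolding compatible_def coord_deriv_sder
  proof (intro conjI ballI)
   show "s b (over W') (snd fiber_map W' F) \<in> fns (over W')"
    by (rule family_closed[OF fs b over_open[OF W'(1)] fiber_map_props(1)[OF W'(1) F]])
   fix p assume "p \<in> over W'"
   from tay_step[OF fs fiber_map_props(2)[OF W'(1) F this] b]
   show "tay s p (over W') (s b (over W') (snd fiber_map W' F)) (sder b (F (body_map p)))" .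
  qed
  then have "snd fiber_map W' (coord_deriv b F) = s b (over W') (snd fiber_map W' F)"
   by (rule fiber_map_eqI[OF W'(1)])
  then show ?thesis
   unfolding \<rho>(2) o_apply Q_def[symmetric]
   using derivationD(6)[OF family_der[OF fs b] over_open[OF W'(1)] QO fiber_map_props(1)[OF W'(1) F]] by simp
 qed
 have co: "coeffs n V (%b. scl V (x b))" by (simp add: coeffs_def scalar_closed[OF oV])
 have "snd (local_fiber_map V) W' (%p al I. \<Sum>b\<in>coords n. x b * coord_deriv b F p al I) =
   (\<Oplus>\<^bsub>sec Q\<^esub>b\<in>coords n. scl Q (x b) *[Q] snd (local_fiber_map V) W' (coord_deriv b F))"
  using mor_sum[OF iso_mor[OF i] W' finite_coords dF, of x] unfolding \<rho>(1) Q_def[symmetric] .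
 also have "... = (\<Oplus>\<^bsub>sec Q\<^esub>b\<in>coords n. rstr V Q (scl V (x b)) *[Q] s b Q (snd (local_fiber_map V) W' F))"
  by (intro finsum_cong' refl)
   (use der restr_props(3)[OF oV m(1) sub] scalar_closed[OF m(1)] family_closed[OF fs _ QU c] in auto)
 also have "... = comb n V (%b. scl V (x b)) s Q (snd (local_fiber_map V) W' F)"
  by (rule lin_comb_eval[OF fs V co QV c, symmetric])
 finally show "snd (local_fiber_map V) W' (%p al I. \<Sum>b\<in>coords n. x b * coord_deriv b F p al I) =
   comb n V (%b. scl V (x b)) s Q (snd (local_fiber_map V) W' F)" .
qed

text \<open>The relation \<open>related\<close> with the nested open subspaces unfolded; it can be
  applied to \<open>D\<close> before restriction.\<close>

definition matches :: "'p set => ('k^'m) set => ('p, 's) vfield => ('k^'m, ('k, 'm) sfun) vfield => bool" where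
 "matches V W D E \<longleftrightarrow> (\<forall>W'. opL W' \<and> W' <= W --> (\<forall>F\<in>sfuns C n W'.
  D {q \<in> V. body_map q \<in> W'} (snd (local_fiber_map V) W' F) = snd (local_fiber_map V) W' (E W' F)))"

lemma related_matches:
 assumes V: "V \<in> ops U" and i: "iso V W (local_fiber_map V)"
 shows "related (open_sub (open_sub X U) V) (open_sub L W) (local_fiber_map V) (vrestr (open_sub X U) V D) E
  \<longleftrightarrow> matches V W D E"
proof -
 have W: "opL W" using i by (simp add: iso_def)
 then have oW: "openin (points L) W" by (simp add: openin_L)
 have oV: "opens (open_sub X U) V = ops V"
  unfolding opens_open_sub[OF frame_open] using opensD(2)[OF V] by (simp add: Int_absorb2)
 have pr: "preim (open_sub (open_sub X U) V) (local_fiber_map V) W' = {q \<in> V. body_map q \<in> W'}" for W'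
  unfolding open_sub_open_sub[OF opensD(2)[OF V]] preim_open_sub[OF opensD(1)[OF V]] local_fiber_map_eq(1)[OF V] ..
 have op: "W' \<in> opens (open_sub L W) (whole (open_sub L W)) \<longleftrightarrow> opL W' \<and> W' <= W" for W'
  unfolding whole_open_sub[OF oW] opens_open_sub[OF oW] by (simp add: opens_def openin_L)
 have car: "carrier (sections L W') = sfuns C n W'" for W' by (simp add: L)
 have v: "vrestr (open_sub X U) V D {q \<in> V. body_map q \<in> W'} = D {q \<in> V. body_map q \<in> W'}"
  if W': "opL W'" "W' <= W" for W'
  using local_fiber_map_lin_comb(1)[OF V i W' sfuns_zero] by (simp add: vrestr_def oV)
 show ?thesis
  unfolding related_def matches_def Ball_def[of "opens _ _"] op pr
  unfolding open_sub_simps car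
  by (simp add: v cong: imp_cong)
qed

lemma mem_induced:
 assumes V: "V \<in> ops U"
 shows "D \<in> induced_flat (open_sub X U) L fiber_map S V \<longleftrightarrow> D \<in> vfs V \<and>
  (\<forall>p\<in>V. \<exists>V'\<in>ops V. p \<in> V' \<and> (\<exists>W. iso V' W (local_fiber_map V') \<and> (\<exists>E\<in>S W. matches V' W D E)))"
proof -
 have oV: "opens (open_sub X U) V = ops V"
  unfolding opens_open_sub[OF frame_open] using opensD(2)[OF V] by (simp add: Int_absorb2)
 have *: "(\<exists>W\<in>opens L (whole L). is_iso (open_sub (open_sub X U) V') (open_sub L W) (local_fiber_map V') \<and>
    (\<exists>E\<in>S W. related (open_sub (open_sub X U) V') (open_sub L W) (local_fiber_map V') (vrestr (open_sub X U) V' D) E)) \<longleftrightarrow>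
   (\<exists>W. iso V' W (local_fiber_map V') \<and> (\<exists>E\<in>S W. matches V' W D E))" if V': "V' \<in> ops V" for V'
 proof -
  note V'U = opens_trans[OF V' V]
  have i: "W \<in> opens L (whole L) \<and> is_iso (open_sub (open_sub X U) V') (open_sub L W) (local_fiber_map V') \<longleftrightarrow>
    iso V' W (local_fiber_map V')" for W
   unfolding open_sub_open_sub[OF opensD(2)[OF V'U]] iso_def opens_whole openin_L using opensD(1)[OF V'] by blast
  show ?thesis
   unfolding Bex_def[of "opens _ _"] conj_assoc[symmetric] i
   by (intro ex_cong1 conj_cong refl bex_cong) (rule related_matches[OF V'U])
 qed
 show ?thesis
  unfolding induced_flat_def mem_Collect_eq local_fiber_map_def[symmetric] tangent_open_sub[OF frame_open V] oV
  by (intro conj_cong refl ball_cong bex_cong) (rule *)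
qed

text \<open>The functions \<open>F\<close> live over a subset of \<open>W0\<close>, where the
  coefficients are the constants \<open>x\<close>; elsewhere the coefficients multiply zero
  expansions.\<close>

lemma constant_matches:
 assumes V: "V \<in> ops U" and i: "iso V W (local_fiber_map V)"
  and f: "!!i. i \<in> coords n ==> locally_constant L W (f i)"
  and W0: "opL W0" "W0 <= W" and x: "!!i q. i \<in> coords n ==> q \<in> W0 ==> f i q (%_. 0) {} = x i"
  and W': "opL W'" "W' <= W0" and F: "F \<in> sfuns C n W'"
 shows "snd (local_fiber_map V) W' (lin_comb L n W f (coord_field L W) W' F) =
  comb n V (%b. scl V (x b)) s {q \<in> V. body_map q \<in> W'} (snd (local_fiber_map V) W' F)"
proof -
 have W: "opL W" using i by (simp add: iso_def)
 have W'W: "W' <= W" "W' \<in> opens L W" using W' W0 by (auto intro!: opensI simp: openin_L)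
 have eq: "f i q (%_. 0) {} * coord_deriv i F q al I = x i * coord_deriv i F q al I" if i: "i \<in> coords n" for i q al I
 proof (cases "q \<in> W'")
  case True
  then show ?thesis using x[OF i, of q] W'(2) by auto
 next
  case False
  then show ?thesis using sfuns_outside[OF sfuns_coord_deriv[OF W'(1) F] False, of i] by simp
 qed
 have "lin_comb L n W f (coord_field L W) W' F = (%p al I. \<Sum>i\<in>coords n. f i p (%_. 0) {} * coord_deriv i F p al I)"
  by (rule affine_lin_comb_eval[OF L W f W'W(2) F])
 also have "... = (%p al I. \<Sum>i\<in>coords n. x i * coord_deriv i F p al I)"
  by (intro ext sum.cong refl) (rule eq)
 finally have "lin_comb L n W f (coord_field L W) W' F = (%p al I. \<Sum>i\<in>coords n. x i * coord_deriv i F p al I)" .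
 then show ?thesis using local_fiber_map_lin_comb(3)[OF V i W'(1) W'W(1) F, of x] by simp
qed

text \<open>Near each point the coefficients of \<open>D\<close> in the frame are scalars, and the
  same scalars define the corresponding constant field on the fiber.\<close>

lemma flat_subset_induced:
 assumes V: "V \<in> ops U"
 shows "T V <= induced_flat (open_sub X U) L fiber_map (tautological_flat L n) V"
proof
 fix D assume D: "D \<in> T V"
 note oV = opensD(1)[OF V] and fs = flat_frame_family[OF s]
 have Dt: "D \<in> vfs V" using flat_props(1)[OF oV] D by auto
 obtain f where f: "coeffs n V f" "D = comb n V f s" by (rule frame_coeffs[OF s V Dt]) (rule that)
 have lc: "locally_constant X V (f i)" if "i \<in> coords n" for i
  using frame_flat[OF s V f(1)] D f(2) that by simp
 show "D \<in> induced_flat (open_sub X U) L fiber_map (tautological_flat L n) V"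
  unfolding mem_induced[OF V]
 proof (intro conjI ballI Dt)
  fix p assume p: "p \<in> V"
  have "\<exists>V1\<in>ops V. p \<in> V1 \<and> (\<exists>x. \<forall>i\<in>coords n. rstr V V1 (f i) = scl V1 (x i))"
   by (rule locally_constant_finite[OF oV p finite_coords]) (rule lc)
  then obtain V1 x where V1: "V1 \<in> ops V" "p \<in> V1" and x: "\<forall>i\<in>coords n. rstr V V1 (f i) = scl V1 (x i)"
   by (elim bexE conjE exE) (rule that)
  obtain V' W where V': "V' \<in> ops V1" "p \<in> V'" and i: "iso V' W (local_fiber_map V')"
   by (rule fiber_map_local_iso[OF opens_trans[OF V1(1) V] V1(2)]) (rule that)
  have W: "opL W" using i by (simp add: iso_def)
  note V'V = opens_trans[OF V'(1) V1(1)]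
  note V'U = opens_trans[OF V'V V] and oV' = opensD(1)[OF V'(1)]
  let ?f = "%i :: 'm + nat. sfun_scalar W (x i)"
  let ?E = "lin_comb L n W ?f (coord_field L W)"
  have lcE: "locally_constant L W (?f i)" for i
   unfolding locally_constant_def
   by (intro conjI ballI bexI[of _ W] exI[of _ "x i"])
    (use W in \<open>auto simp: L sfun_scalar_in opens_affine sfun_scalar_def fun_eq_iff\<close>)
  have E: "?E \<in> tautological_flat L n W" unfolding tautological_flat_def using lcE by blast
  have co: "coeffs n V' (%i. scl V' (x i))" by (simp add: coeffs_def scalar_closed[OF oV'])
  have fx: "rstr V V' (f i) = scl V' (x i)" if i: "i \<in> coords n" for i
  proof -
   have "rstr V V' (f i) = rstr V1 V' (rstr V V1 (f i))"
    by (rule restr_props(4)[OF oV opensD[OF V1(1)] oV' opensD(2)[OF V'(1)], symmetric]) (use f(1) i in \<open>simp add: coeffs_def\<close>)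
   then show ?thesis using bspec[OF x i] restr_props(3)[OF opensD(1)[OF V1(1)] opensD[OF V'(1)]] by simp
  qed
  have vD: "vrst V' D = comb n V' (%i. scl V' (x i)) s"
   unfolding f(2) lin_comb_restr[OF fs V f(1) V'V] by (rule lin_comb_cong[OF fs V'U co fx])
  have "matches V' W D ?E"
   unfolding matches_def
  proof (intro allI impI ballI)
   fix W' F assume W': "opL W' \<and> W' <= W" and F: "F \<in> sfuns C n W'"
   note w = conjunct1[OF W'] conjunct2[OF W']
   note Q = local_fiber_map_lin_comb(1)[OF V'U i w F]
   have "D {q \<in> V'. body_map q \<in> W'} (snd (local_fiber_map V') W' F) =
     vrst V' D {q \<in> V'. body_map q \<in> W'} (snd (local_fiber_map V') W' F)" by (simp add: vrestr_eval[OF Q])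
   also have "... = snd (local_fiber_map V') W' (?E W' F)"
    unfolding vD
    by (rule constant_matches[OF V'U i lcE W order_refl _ w F, symmetric]) (simp add: sfun_scalar_def)
   finally show "D {q \<in> V'. body_map q \<in> W'} (snd (local_fiber_map V') W' F) = snd (local_fiber_map V') W' (?E W' F)" .
  qed
  then show "\<exists>V'\<in>ops V. p \<in> V' \<and> (\<exists>W. iso V' W (local_fiber_map V') \<and> (\<exists>E\<in>tautological_flat L n W. matches V' W D E))"
   using V'V V'(2) i E by blast
 qed
qed

lemma locally_constant_affine:
 assumes "opL W" and q: "q \<in> W" and S: "finite S"
 shows "(!!i. i \<in> S ==> locally_constant L W (f i)) ==>
  \<exists>W0. opL W0 \<and> W0 <= W \<and> q \<in> W0 \<and> (\<forall>i\<in>S. \<forall>q'\<in>W0. f i q' (%_. 0) {} = f i q (%_. 0) {})"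
 using S
proof (induction S)
 case empty
 then show ?case using assms by blast
next
 case (insert j S)
 have ls: "locally_constant L W (f i)" if "i \<in> S" for i by (rule insert.prems) (use that in simp)
 from insert.IH[OF ls] obtain W0 where W0: "opL W0" "W0 <= W" "q \<in> W0"
  "\<forall>i\<in>S. \<forall>q'\<in>W0. f i q' (%_. 0) {} = f i q (%_. 0) {}" by blast
 have "locally_constant L W (f j)" by (rule insert.prems) simp
 then obtain W1 z where W1: "W1 \<in> opens L W" "q \<in> W1" "restr L W W1 (f j) = scalar L W1 z"
  using q unfolding locally_constant_def by blast
 have o: "opL W1" using opensD(1)[OF W1(1)] by (simp add: openin_L)
 have "f j q' (%_. 0) {} = z" if "q' \<in> W1" for q'
  using fun_cong[OF fun_cong[OF fun_cong[OF W1(3), of q'], of "%_. 0"], of "{}"] that by (simp add: L sfun_scalar_def)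
 note fj = this
 show ?case
 proof (intro exI[of _ "W0 \<inter> W1"] conjI ballI)
  show "opL (W0 \<inter> W1)" using W0(1) o by auto
  show "W0 \<inter> W1 <= W" "q \<in> W0 \<inter> W1" using W0(2,3) W1(2) by blast+
  fix i q' assume i: "i \<in> insert j S" and q': "q' \<in> W0 \<inter> W1"
  show "f i q' (%_. 0) {} = f i q (%_. 0) {}"
  proof (cases "i = j")
   case True
   then show ?thesis using fj[of q'] fj[OF W1(2)] q' by simp
  next
   case False
   then show ?thesis using W0(4) i q' by simp
  qed
 qed
qed

text \<open>Over a smaller set the coefficients of \<open>E\<close> are constants \<open>x\<close>.
  As every section there is a pullback, \<open>D\<close> is the combination of the frame with
  coefficients \<open>x\<close>. This is flat, and flatness is local.\<close>

lemma induced_subset_flat: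
 assumes V: "V \<in> ops U"
 shows "induced_flat (open_sub X U) L fiber_map (tautological_flat L n) V <= T V"
proof
 fix D assume "D \<in> induced_flat (open_sub X U) L fiber_map (tautological_flat L n) V"
 note D = this[unfolded mem_induced[OF V]]
 note Dt = conjunct1[OF D] and oV = opensD(1)[OF V] and fs = flat_frame_family[OF s]
 show "D \<in> T V"
 proof (rule flat_props(3)[OF oV Dt], intro ballI)
  fix p assume p: "p \<in> V"
  from bspec[OF conjunct2[OF D] p] obtain V' W E where V': "V' \<in> ops V" "p \<in> V'"
   and i: "iso V' W (local_fiber_map V')" and E: "E \<in> tautological_flat L n W" and r: "matches V' W D E"
   by (elim bexE conjE exE) (rule that)
  note V'U = opens_trans[OF V'(1) V]
  have W: "opL W" using i by (simp add: iso_def)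
  obtain f where Ef: "E = lin_comb L n W f (coord_field L W)" and f: "\<forall>i\<in>coords n. locally_constant L W (f i)"
   using E unfolding tautological_flat_def mem_Collect_eq by (elim exE conjE) (rule that)
  note b = iso_props(1)[OF i, unfolded local_fiber_map_eq(1)[OF V'U]]
  have pW: "body_map p \<in> W" using b V'(2) by (auto simp: bij_betw_def)
  have "\<exists>W0. opL W0 \<and> W0 <= W \<and> body_map p \<in> W0 \<and>
    (\<forall>i\<in>coords n. \<forall>q'\<in>W0. f i q' (%_. 0) {} = f i (body_map p) (%_. 0) {})"
   by (rule locally_constant_affine[OF W pW finite_coords]) (rule bspec[OF f])
  then obtain W0 where W0: "opL W0" "W0 <= W" "body_map p \<in> W0"
   and x0: "\<forall>i\<in>coords n. \<forall>q'\<in>W0. f i q' (%_. 0) {} = f i (body_map p) (%_. 0) {}"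
   by (elim exE conjE) (rule that)
  define x where "x i = f i (body_map p) (%_. 0) {}" for i
  have x: "f i q (%_. 0) {} = x i" if "i \<in> coords n" "q \<in> W0" for i q
   using x0 that by (simp add: x_def)
  define V0 where "V0 = {q \<in> V'. body_map q \<in> W0}"
  have V0: "V0 \<in> ops V'" "p \<in> V0"
   using local_fiber_map_lin_comb(1)[OF V'U i W0(1,2) sfuns_zero] V'(2) W0(3) by (simp_all add: V0_def)
  note V0V = opens_trans[OF V0(1) V'(1)]
  note V0U = opens_trans[OF V0V V] and oV0 = opensD(1)[OF V0(1)] and oV' = opensD(1)[OF V'(1)]
  have co: "coeffs n Q (%i. scl Q (x i))" if "opn Q" for Q by (simp add: coeffs_def scalar_closed[OF that])
  let ?K = "comb n V0 (%i. scl V0 (x i)) s"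
  have K': "vrst V0 (comb n V' (%i. scl V' (x i)) s) = ?K"
   unfolding lin_comb_restr[OF fs V'U co[OF oV'] V0(1)]
   by (rule lin_comb_cong[OF fs V0U co[OF oV0]]) (rule restr_props(3)[OF oV' opensD[OF V0(1)]])
  have "vrst V0 D = ?K"
  proof (rule tangent_eqI[OF vrestr_tangent[OF Dt V0V] lin_comb_closed[OF fs V0U co[OF oV0]]])
   fix Q G assume Q: "Q \<in> ops V0" and G: "G \<in> fns Q"
   note QV' = opens_trans[OF Q V0(1)]
   \<comment> \<open>The local isomorphism identifies the arbitrary open set \<open>Q\<close> with
     this open set of the model, so that every section over \<open>Q\<close> is reached.\<close>
   define W' where "W' = body_map ` Q"
   have W': "opL W'" using iso_props(2)[OF i opensD[OF QV']] unfolding local_fiber_map_eq(1)[OF V'U] W'_def .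
   have W'0: "W' <= W0" using opensD(2)[OF Q] by (auto simp: W'_def V0_def)
   have W'W: "W' <= W" using W'0 W0(2) by auto
   have pQ: "{q \<in> V'. body_map q \<in> W'} = Q"
    using iso_props(4)[OF i opensD(2)[OF QV']] unfolding local_fiber_map_eq(1)[OF V'U] W'_def .
   obtain F where F: "F \<in> sfuns C n W'" "G = snd (local_fiber_map V') W' F"
    using iso_props(3)[OF i W' W'W] G unfolding local_fiber_map_eq(1)[OF V'U] pQ
    by (auto simp: bij_betw_def image_iff)
   have "vrst V0 D Q G = D Q G" by (simp add: vrestr_eval[OF Q])
   also have "... = snd (local_fiber_map V') W' (E W' F)"
    using r[unfolded matches_def, rule_format, OF conjI[OF W' W'W] F(1)] unfolding pQ F(2) .
   also have "... = comb n V' (%i. scl V' (x i)) s Q G"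
    unfolding Ef F(2) pQ[symmetric]
    by (rule constant_matches[OF V'U i _ W0(1,2) _ W' W'0 F(1)]) (rule bspec[OF f], assumption, rule x)
   also have "... = ?K Q G" unfolding K'[symmetric] by (simp add: vrestr_eval[OF Q])
   finally show "vrst V0 D Q G = ?K Q G" .
  qed
  moreover have "?K \<in> T V0"
   unfolding frame_flat[OF s V0U co[OF oV0]] locally_constant_def
  proof (intro ballI conjI scalar_closed[OF oV0])
   fix i :: "'m + nat" and q assume "q \<in> V0"
   then show "\<exists>W\<in>ops V0. q \<in> W \<and> (\<exists>z. rstr V0 W (scl V0 (x i)) = scl W z)"
    using restr_props(3)[OF oV0 oV0 order_refl] opens_refl[OF oV0] by blast
  qed
  ultimately show "\<exists>V'\<in>ops V. p \<in> V' \<and> vrst V' D \<in> T V'"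
   using V0V V0(2) by auto
 qed
qed

end

theorem proposition5p3p2:
  fixes C :: category and n :: nat
    and L :: "('k::{real_normed_field,banach}^'m::finite, ('k, 'm) sfun, 'k) superspace"
    and X :: "('p, 's, 'k) superspace"
    and T :: "'p set \<Rightarrow> ('p, 's) vfield set"
    and nabla :: "('p, 's) connection"
    and A e h :: "('p, 's) vfield"
    and B :: "('p, 's) endo"
  assumes "L = affine_superspace C n"
    and "supermanifold L X"
    and "affine_flat_structure L n X T"
    and "flat_connection X T nabla"
    and "oriented_associativity L n X T A"
    and "flat_identity L n X T A e"
    and "B = j_nabla X nabla A"
    and "h = e"
  shows "commutativity_solution X nabla B \<and>
    primitive_vector L n X T B h \<and>
    (\<forall>U s. flat_frame n X T U s \<longrightarrow>
      (\<exists>\<phi>. section_map L n X U s (B U (vrestr X U e)) \<phi> \<and>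
         local_iso (open_sub X U) L \<phi> \<and>
         (\<forall>V\<in>opens X U. T V = induced_flat (open_sub X U) L \<phi> (tautological_flat L n) V)))"
proof -
  have ringed: "ringed_superspace X" using assms(2) by (simp add: supermanifold_def)
  interpret flat_supermanifold X C n L T nabla
    by unfold_locales (fact ringed assms)+
  interpret potential_field X L n T nabla A
    by unfold_locales (use assms(5) in \<open>simp add: oriented_associativity_def\<close>)
  \<comment> \<open>This contains primitivity as well: the local isomorphism is obtained for every
    flat frame, that is, for every trivialization.\<close>
  have main: "\<exists>\<phi>. section_map L n X U s (B U (vrestr X U e)) \<phi> \<and> local_iso (open_sub X U) L \<phi> \<and>
      (\<forall>V\<in>opens X U. T V = induced_flat (open_sub X U) L \<phi> (tautological_flat L n) V)"
    if s: "flat_frame n X T U s" for U s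
  proof -
    obtain y where y: "j_nabla X nabla A U (vrestr X U e) = lin_comb X n U y s"
      "\<And>c. c \<in> coords n \<Longrightarrow> y c \<in> part X U (odd_index c)"
      "\<And>a c. a \<in> coords n \<Longrightarrow> c \<in> coords n \<Longrightarrow> s a U (y c) = scalar X U (if c = a then 1 else 0)"
      by (rule identity_coordinates[OF assms(6) s]) (rule that)
    interpret F: flat_frame_map X C n L T nabla U s y
      by unfold_locales (fact s y)+
    have "lin_comb X n U (\<lambda>c. snd F.fiber_map (whole L) (coord c)) s = lin_comb X n U y s"
      unfolding F.whole_L
      by (rule lin_comb_cong[OF flat_frame_family[OF s] opens_refl[OF F.frame_open]])
        (simp_all add: coeffs_def F.y_closed F.fiber_map_coord)
    then have "section_map L n X U s (B U (vrestr X U e)) F.fiber_map"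
      unfolding section_map_def assms(7) y(1) using F.fiber_map_morphism by simp
    moreover have "T V = induced_flat (open_sub X U) L F.fiber_map (tautological_flat L n) V" if "V \<in> opens X U" for V
      using F.flat_subset_induced[OF that] F.induced_subset_flat[OF that] by (rule subset_antisym)
    ultimately show ?thesis using F.fiber_map_is_local_iso by blast
  qed
  have "commutativity_solution X nabla B" unfolding assms(7) by (rule commutativity[OF assms(5)])
  moreover have "primitive_vector L n X T B h"
    unfolding primitive_vector_def assms(8)
    using main assms(6) unfolding flat_identity_def by blast
  ultimately show ?thesis using main by blast
qed

end
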